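(* Let $Z$ be a two-dimensional topological manifold (possibly with boundary) with countable base, and let $\Delta$ be a one-dimensional foliation on $Z$ such that each connected component of $\partial Z$ is a leaf of $\Delta$, and each leaf of $\Delta$ is homeomorphic to $\mathbb{R}$ and is a closed subset of $Z$. Then the following conditions are equivalent: (1) $(Z,\Delta)$ admits a striped atlas whose canonical foliation is $\Delta$; (2) the family of all singular leaves of $\Delta$ is locally finite.
   Context: A foliated homeomorphism between foliated surfaces is a homeomorphism sending each leaf onto a leaf. A leaf $\omega\subset \operatorname{Int} Z$ is regular if there is a saturated neighbourhood $U$ of $\omega$ (a union of leaves) such that the pair $(\overline{U},U)$ is foliated homeomorphic to $(\mathbb{R}\times[-1,1],\mathbb{R}\times(-1,1))$ (foliated by horizontal lines $\mathbb{R}\times\{t\}$) via a homeomorphism sending $\omega$ onto $\mathbb{R}\times 0$. A leaf $\omega\subset\partial Z$ is regular if there is a saturated neighbourhood $U$ of $\omega$ such that $(\overline{U},U)$ is foliated homeomorphic to $(\mathbb{R}\times[0,1],\mathbb{R}\times[0,1))$ via a homeomorphism sending $\omega$ onto $\mathbb{R}\times 0$. A leaf that is not regular is singular. A strip is a subset $S\subset\mathbb{R}^2$ such that for some $u<v$ one has $\mathbb{R}\times(u,v)\subset S\subset \mathbb{R}\times[u,v]$ and $S$ is open in $\mathbb{R}\times[u,v]$; put $\partial_-S=S\cap(\mathbb{R}\times\{u\})$, $\partial_+S=S\cap(\mathbb{R}\times\{v\})$, $\partial S=\partial_-S\cup\partial_+S$ (a disjoint union of at most countably many open intervals, called boundary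 intervals). The canonical foliation of $S$ consists of the lines $\mathbb{R}\times\{t\}$, $t\in(u,v)$, and the boundary intervals. A striped atlas on $Z$ is a map $q:\bigsqcup_{\lambda\in\Lambda}S_\lambda\to Z$ from a disjoint union of at most countably many strips such that: $q$ is a quotient map (continuous, surjective, and $A\subset Z$ is open iff $q^{-1}(A)\cap S_\lambda$ is open in $S_\lambda$ for all $\lambda$); and there are two disjoint families $\{X_\gamma\}_{\gamma\in\Gamma}$, $\{Y_\gamma\}_{\gamma\in\Gamma}$ of mutually distinct boundary intervals of the strips, indexed by the same set $\Gamma$, such that $q$ is injective on the complement of $\bigcup_\gamma (X_\gamma\cup Y_\gamma)$, $q(X_\gamma)=q(Y_\gamma)$ for each $\gamma$, and $q|_{X_\gamma}$, $q|_{Y_\gamma}$ are embeddings with closed images. The canonical foliation of the atlas is the foliation of $Z$ whose leaves are the images under $q$ of the leaves of the canonical foliations of the strips. *)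

theory Defs
  imports "HOL-Analysis.Analysis"
begin

definition half_plane :: "(real \<times> real) set" where
  "half_plane = {p. snd p \<ge> 0}"

definition surface_with_boundary :: "'a topology \<Rightarrow> bool" where
  "surface_with_boundary X \<longleftrightarrow>
     Hausdorff_space X \<and> second_countable X \<and>
     (\<forall>x\<in>topspace X. \<exists>U W. openin X U \<and> x \<in> U \<and>
        openin (subtopology euclidean half_plane) W \<and>
        subtopology X U homeomorphic_space subtopology euclidean W)"

definition mboundary :: "'a topology \<Rightarrow> 'a set" where
  "mboundary X = {x \<in> topspace X. \<not> (\<exists>U W. openin X U \<and> x \<in> U \<and> open (W :: (real \<times> real) set) \<and>
        subtopology X U homeomorphic_space subtopology euclidean W)}"

definition minterior :: "'a topology \<Rightarrow> 'a set" where
  "minterior X = topspace X - mboundary X"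

definition foliation_chart_domain :: "(real \<times> real) set \<Rightarrow> bool" where
  "foliation_chart_domain B \<longleftrightarrow>
     B = {-1<..<1} \<times> {-1<..<1} \<or> B = {-1<..<1} \<times> {0..<1}"

definition foliation1 :: "'a topology \<Rightarrow> 'a set set \<Rightarrow> bool" where
  "foliation1 X \<Delta> \<longleftrightarrow>
     \<Union>\<Delta> = topspace X \<and> {} \<notin> \<Delta> \<and>
     (\<forall>L\<in>\<Delta>. \<forall>L'\<in>\<Delta>. L \<noteq> L' \<longrightarrow> L \<inter> L' = {}) \<and>
     (\<forall>L\<in>\<Delta>. path_connectedin X L) \<and>
     (\<forall>x\<in>topspace X. \<exists>U B \<phi>. openin X U \<and> x \<in> U \<and> foliation_chart_domain B \<and>
        homeomorphic_map (subtopology X U) (subtopology euclidean B) \<phi> \<and>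
        (\<forall>L\<in>\<Delta>. \<forall>C\<in>path_components_of (subtopology X (L \<inter> U)).
            \<exists>t. \<phi> ` C = {-1<..<1} \<times> {t}))"

definition saturated :: "'a set set \<Rightarrow> 'a set \<Rightarrow> bool" where
  "saturated \<Delta> U \<longleftrightarrow> (\<forall>L\<in>\<Delta>. L \<inter> U \<noteq> {} \<longrightarrow> L \<subseteq> U)"

definition foliated_model_nbhd ::
  "'a topology \<Rightarrow> 'a set set \<Rightarrow> 'a set \<Rightarrow> 'a set \<Rightarrow> real set \<Rightarrow> real set \<Rightarrow> bool" where
  "foliated_model_nbhd X \<Delta> \<omega> U T T0 \<longleftrightarrow>
     U \<subseteq> topspace X \<and> saturated \<Delta> U \<and>
     (\<exists>V. openin X V \<and> \<omega> \<subseteq> V \<and> V \<subseteq> U) \<and>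
     (\<exists>h. homeomorphic_map (subtopology X (X closure_of U)) (subtopology euclidean ((UNIV::real set) \<times> T)) h \<and>
          h ` U = (UNIV::real set) \<times> T0 \<and> h ` \<omega> = UNIV \<times> {0} \<and>
          {h ` L | L. L \<in> \<Delta> \<and> L \<subseteq> X closure_of U} = {UNIV \<times> {t} | t. t \<in> T})"

definition regular_leaf :: "'a topology \<Rightarrow> 'a set set \<Rightarrow> 'a set \<Rightarrow> bool" where
  "regular_leaf X \<Delta> \<omega> \<longleftrightarrow>
     (\<omega> \<subseteq> minterior X \<and> (\<exists>U. foliated_model_nbhd X \<Delta> \<omega> U {-1..1} {-1<..<1})) \<or>
     (\<omega> \<subseteq> mboundary X \<and> (\<exists>U. foliated_model_nbhd X \<Delta> \<omega> U {0..1} {0..<1}))"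

definition singular_leaves :: "'a topology \<Rightarrow> 'a set set \<Rightarrow> 'a set set" where
  "singular_leaves X \<Delta> = {\<omega> \<in> \<Delta>. \<not> regular_leaf X \<Delta> \<omega>}"

definition is_strip :: "(real \<times> real) set \<Rightarrow> real \<Rightarrow> real \<Rightarrow> bool" where
  "is_strip S u v \<longleftrightarrow> u < v \<and> UNIV \<times> {u<..<v} \<subseteq> S \<and> S \<subseteq> UNIV \<times> {u..v} \<and>
     openin (subtopology euclidean (UNIV \<times> {u..v})) S"

definition strip_boundary :: "(real \<times> real) set \<Rightarrow> real \<Rightarrow> real \<Rightarrow> (real \<times> real) set" where
  "strip_boundary S u v = S \<inter> (UNIV \<times> {u, v})"

definition boundary_intervals :: "(real \<times> real) set \<Rightarrow> real \<Rightarrow> real \<Rightarrow> (real \<times> real) set set" where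
  "boundary_intervals S u v = connected_components_of (subtopology euclidean (strip_boundary S u v))"

definition strip_canonical_foliation :: "(real \<times> real) set \<Rightarrow> real \<Rightarrow> real \<Rightarrow> (real \<times> real) set set" where
  "strip_canonical_foliation S u v =
     {(UNIV::real set) \<times> {t} | t. t \<in> {u<..<v}} \<union> boundary_intervals S u v"

text \<open>Striped atlas.  Strips are indexed by \<open>\<Lambda> \<subseteq> nat\<close> (at most countably many);
  the disjoint union is \<open>Sigma \<Lambda> S\<close> and \<open>q\<close> is defined on it.  Boundary intervals of
  the disjoint union are pairs \<open>(\<lambda>, J)\<close>; the gluing families are indexed by \<open>\<Gamma> \<subseteq> nat\<close>.\<close>
definition is_bint :: "nat set \<Rightarrow> (nat \<Rightarrow> (real \<times> real) set) \<Rightarrow> (nat \<Rightarrow> real) \<Rightarrow> (nat \<Rightarrow> real)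
    \<Rightarrow> nat \<times> (real \<times> real) set \<Rightarrow> bool" where
  "is_bint \<Lambda> S u v I \<longleftrightarrow> fst I \<in> \<Lambda> \<and> snd I \<in> boundary_intervals (S (fst I)) (u (fst I)) (v (fst I))"

definition sheet :: "nat \<times> (real \<times> real) set \<Rightarrow> (nat \<times> (real \<times> real)) set" where
  "sheet I = {fst I} \<times> snd I"

definition striped_atlas ::
  "'a topology \<Rightarrow> nat set \<Rightarrow> (nat \<Rightarrow> (real \<times> real) set) \<Rightarrow> (nat \<Rightarrow> real) \<Rightarrow> (nat \<Rightarrow> real)
   \<Rightarrow> (nat \<times> (real \<times> real) \<Rightarrow> 'a) \<Rightarrow> nat set
   \<Rightarrow> (nat \<Rightarrow> nat \<times> (real \<times> real) set) \<Rightarrow> (nat \<Rightarrow> nat \<times> (real \<times> real) set) \<Rightarrow> bool" where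
  "striped_atlas X \<Lambda> S u v q \<Gamma> Xg Yg \<longleftrightarrow>
     (\<forall>l\<in>\<Lambda>. is_strip (S l) (u l) (v l)) \<and>
     \<comment> \<open>quotient map\<close>
     (\<forall>l\<in>\<Lambda>. continuous_map (subtopology euclidean (S l)) X (\<lambda>p. q (l, p))) \<and>
     q ` (Sigma \<Lambda> S) = topspace X \<and>
     (\<forall>A. A \<subseteq> topspace X \<longrightarrow>
        (openin X A \<longleftrightarrow> (\<forall>l\<in>\<Lambda>. openin (subtopology euclidean (S l)) {p \<in> S l. q (l, p) \<in> A}))) \<and>
     \<comment> \<open>gluing families\<close>
     (\<forall>\<gamma>\<in>\<Gamma>. is_bint \<Lambda> S u v (Xg \<gamma>) \<and> is_bint \<Lambda> S u v (Yg \<gamma>)) \<and>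
     inj_on Xg \<Gamma> \<and> inj_on Yg \<Gamma> \<and> Xg ` \<Gamma> \<inter> Yg ` \<Gamma> = {} \<and>
     inj_on q (Sigma \<Lambda> S - (\<Union>\<gamma>\<in>\<Gamma>. sheet (Xg \<gamma>) \<union> sheet (Yg \<gamma>))) \<and>
     (\<forall>\<gamma>\<in>\<Gamma>. q ` sheet (Xg \<gamma>) = q ` sheet (Yg \<gamma>) \<and>
        embedding_map (subtopology euclidean (snd (Xg \<gamma>))) X (\<lambda>p. q (fst (Xg \<gamma>), p)) \<and>
        embedding_map (subtopology euclidean (snd (Yg \<gamma>))) X (\<lambda>p. q (fst (Yg \<gamma>), p)) \<and>
        closedin X (q ` sheet (Xg \<gamma>)) \<and> closedin X (q ` sheet (Yg \<gamma>)))"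

definition atlas_canonical_foliation ::
  "nat set \<Rightarrow> (nat \<Rightarrow> (real \<times> real) set) \<Rightarrow> (nat \<Rightarrow> real) \<Rightarrow> (nat \<Rightarrow> real)
   \<Rightarrow> (nat \<times> (real \<times> real) \<Rightarrow> 'a) \<Rightarrow> 'a set set" where
  "atlas_canonical_foliation \<Lambda> S u v q =
     {q ` ({l} \<times> L) | l L. l \<in> \<Lambda> \<and> L \<in> strip_canonical_foliation (S l) (u l) (v l)}"

definition admits_striped_atlas :: "'a topology \<Rightarrow> 'a set set \<Rightarrow> bool" where
  "admits_striped_atlas X \<Delta> \<longleftrightarrow>
     (\<exists>\<Lambda> S u v q \<Gamma> Xg Yg. striped_atlas X \<Lambda> S u v q \<Gamma> Xg Yg \<and>
        atlas_canonical_foliation \<Lambda> S u v q = \<Delta>)"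

end

theory Submission
  imports Defs
begin

text \<open>From an atlas to local finiteness: the quotient map is injective on the open strips, hence open there by
invariance of domain, so every open line of a strip is a regular leaf. Near a glued boundary point the two adjacent half
boxes already form an open disc, again by invariance of domain, so no third boundary interval comes near it; hence the
images of the boundary intervals are locally finite.

Conversely, cut the surface along all leaves that do not have a product neighbourhood on both sides, together with one leaf
in every component. Every remaining leaf lies in a properly embedded strip. A union of a chain of strips is a strip, and two
maximal strips that meet coincide, because otherwise they would close up to an annulus without cut leaves. So the complement
of the cut leaves is a countable disjoint union of maximal strips. Each side of a cut leaf is the end of exactly one maximal
strip. Reparametrizing the lines of the strip by ln (L / R), where L and R are weighted measures of the part of the
charts at its ends that lies to the left and to the right of a point, makes every such end converge to an open interval on
the boundary of the model strip. Gluing these completed strips along the cut leaves recovers the surface.\<close>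

section \<open>Strips embedded in a surface\<close>

text \<open>A maximal strip has no preferred coordinate along its lines. Infinitely many cut leaves
  may lie at the same end of it, each with charts in which the strip coordinate may run off to
  infinity or oscillate. One reparametrization has to make all these ends converge at once, keep the
  order on each line and keep different ends apart. A sum of clamped chart positions with weights
  \<open>(1/2) ^ n\<close> does this: each summand is bounded and has a limit at every end, because
  a chart germ there is either inside the other chart, where the summand is explicit, or misses its
  compact core, where the summand is a constant multiple of a cutoff. The clamp at 1/2 is what
  provides the compact core. Orientations are never assumed: a strip may be turned over, and each
  side of a cut leaf carries its own sign. The effect of cutting one leaf in every component is
  expressed as the absence of nonempty open and closed sets made of uncut leaves; this excludes the
  Moebius band along with the annulus.\<close>

abbreviation band :: "real set => (real * real) set" where "band T \<equiv> UNIV \<times> T"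

section \<open>Invariance of domain for maps from the plane into a surface\<close>

text \<open>A chart takes values in the plane, so the planar theorem applies to the composition of
  the map with a chart. The image obtained is open in the plane, not merely in the half plane, and
  pulls back to an open set of the surface; boundary points need no separate treatment.\<close>

lemma surface_invariance_of_domain:
 fixes f :: "real \<times> real => 'a"
 assumes X: "surface_with_boundary X" and A: "open A"
  and f: "continuous_map (top_of_set A) X f" "inj_on f A"
 shows "openin X (f ` A)"
proof (subst openin_subopen, intro ballI)
 fix z assume "z : f ` A"
 then obtain a where a: "a : A" "z = f a" by blast
 have fX: "f ` A <= topspace X"
  using continuous_map_image_subset_topspace[OF f(1)] by simp
 with a have "z : topspace X" by blast
 then obtain U W where U: "openin X U" "z : U"
  and "subtopology X U homeomorphic_space top_of_set (W :: (real \<times> real) set)"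
  using X unfolding surface_with_boundary_def by blast
 then obtain psi where psi: "homeomorphic_map (subtopology X U) (top_of_set W) psi"
  using homeomorphic_space by blast
 define V where "V = {p : A. f p : U}"
 have "openin (top_of_set A) {p : topspace (top_of_set A). f p : U}"
  using f(1) U(1) by (rule openin_continuous_map_preimage)
 then have V: "open V"
  using A unfolding V_def by (simp add: openin_open_eq)
 have VA: "V <= A" by (auto simp: V_def)
 have fV: "continuous_map (top_of_set V) (subtopology X U) f"
  using continuous_map_from_subtopology_mono[OF f(1) VA]
  by (auto simp: continuous_map_in_subtopology V_def)
 have psic: "continuous_map (subtopology X U) (top_of_set W) psi"
  using psi by (rule homeomorphic_imp_continuous_map)
 have psii: "inj_on psi U"
  using homeomorphic_imp_injective_map[OF psi] openin_subset[OF U(1)]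
  by (metis inf.absorb2 topspace_subtopology)
 have "continuous_map (top_of_set V) (top_of_set W) (psi \<circ> f)"
  using continuous_map_compose[OF fV psic] .
 then have c: "continuous_on V (psi \<circ> f)" by (simp add: continuous_map_in_subtopology)
 have i: "inj_on (psi \<circ> f) V"
  using f(2) psii VA by (intro comp_inj_on) (auto simp: V_def inj_on_def)
 have o: "open ((psi \<circ> f) ` V)"
  using invariance_of_domain[OF c V i] .
 have "openin (subtopology X U) {y : topspace (subtopology X U). psi y : (psi \<circ> f) ` V}"
  using psic o by (intro openin_continuous_map_preimage[where Y = euclidean])
   (auto simp: continuous_map_in_subtopology)
 moreover have "{y : topspace (subtopology X U). psi y : (psi \<circ> f) ` V} = f ` V"
  using psii openin_subset[OF U(1)] by (auto simp: V_def inj_on_def)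
 ultimately have "openin X (f ` V)"
  using U(1) by (simp add: openin_open_subtopology)
 moreover have "z : f ` V" using a U by (auto simp: V_def)
 ultimately show "EX T. openin X T & z : T & T <= f ` A"
  using VA by blast
qed

lemma surface_open_embedding:
 fixes f :: "real \<times> real => 'a"
 assumes X: "surface_with_boundary X" and A: "open A"
  and f: "continuous_map (top_of_set A) X f" "inj_on f A"
 shows "homeomorphic_map (top_of_set A) (subtopology X (f ` A)) f"
proof (rule bijective_open_imp_homeomorphic_map)
 have fX: "f ` A <= topspace X"
  using continuous_map_image_subset_topspace[OF f(1)] by simp
 show "continuous_map (top_of_set A) (subtopology X (f ` A)) f"
  using f(1) by (simp add: continuous_map_in_subtopology)
 show "open_map (top_of_set A) (subtopology X (f ` A)) f"
  unfolding open_map_def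
 proof (intro allI impI)
  fix V assume V: "openin (top_of_set A) V"
  then have VA: "V <= A" and "open V"
   using A openin_subset openin_open_trans by fastforce+
  then have "openin X (f ` V)"
   using f X by (intro surface_invariance_of_domain)
    (auto intro: continuous_map_from_subtopology_mono inj_on_subset)
  then show "openin (subtopology X (f ` A)) (f ` V)"
   using VA by (intro openin_subtopology_Int2 openin_subtopology[THEN iffD2]) (auto simp: image_mono)
 qed
 show "f ` topspace (top_of_set A) = topspace (subtopology X (f ` A))"
  using fX by auto
qed (use f in auto)

lemma surface_open_embedding_inverse:
 fixes f :: "real \<times> real => 'a"
 assumes "surface_with_boundary X" "open A" "continuous_map (top_of_set A) X f" "inj_on f A"
 shows "continuous_map (subtopology X (f ` A)) (top_of_set A) (inv_into A f)"
proof -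
 obtain g where g: "homeomorphic_maps (top_of_set A) (subtopology X (f ` A)) f g"
  using surface_open_embedding[OF assms] homeomorphic_map_maps by blast
 have fX: "f ` A <= topspace X"
  using continuous_map_image_subset_topspace[OF assms(3)] by simp
 show ?thesis
 proof (rule continuous_map_eq)
  show "continuous_map (subtopology X (f ` A)) (top_of_set A) g"
   using g by (simp add: homeomorphic_maps_def)
  show "g z = inv_into A f z" if "z : topspace (subtopology X (f ` A))" for z
   using that g assms(4) fX by (auto simp: homeomorphic_maps_def)
 qed
qed

lemma continuous_map_top_of_set_o:
 fixes k :: "'b::topological_space => 'c::topological_space"
 assumes "continuous_map (top_of_set B) X h" "continuous_on A k" "k ` A <= B"
 shows "continuous_map (top_of_set A) X (%p. h (k p))"
proof -
 have "continuous_map (top_of_set A) (top_of_set B) k"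
  using assms(2,3) by (auto simp: continuous_map_in_subtopology)
 from continuous_map_compose[OF this assms(1)] show ?thesis by (simp add: o_def)
qed

section \<open>Proper strips and their changes of coordinates\<close>

text \<open>The last clause is properness: bands over compact sets of heights have closed images, so
  a curve that leaves the strip can do so only with heights that leave every compact part of the
  interval. In the main use \<open>\<L>\<close> is the family of uncut leaves.\<close>

definition proper_strip :: "'a topology => 'a set set => real => real => (real \<times> real => 'a) => bool" where
 "proper_strip X \<L> a b h \<longleftrightarrow> a < b &
   continuous_map (top_of_set (band {a<..<b})) X h & inj_on h (band {a<..<b}) &
   (ALL t:{a<..<b}. h ` (band {t}) : \<L>) &
   (ALL K. compact K & K <= {a<..<b} --> closedin X (h ` (band K)))"

lemma image_fibred:
 assumes "!!t. t : J ==> bij (%x. g x t)"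
 shows "(%(x, t). h (g x t, tau t)) ` (band J) = h ` (UNIV \<times> tau ` J)"
proof (intro set_eqI iffI)
 fix z assume "z : h ` (UNIV \<times> tau ` J)"
 then obtain y t where "t : J" "z = h (y, tau t)" by blast
 moreover obtain x where "y = g x t"
  using assms[OF \<open>t : J\<close>] by (meson bij_pointE)
 ultimately show "z : (%(x, t). h (g x t, tau t)) ` (band J)" by force
qed auto

text \<open>Every line is reparametrized bijectively, so the image of a band over a compact set is
  the image under \<open>h\<close> of the band over another compact set. Properness therefore
  survives without any control of \<open>g\<close> at infinity.\<close>

lemma proper_strip_reparametrize:
 assumes h: "proper_strip X \<L> a b h" and "a' < b'"
  and g: "continuous_on (band {a'<..<b'}) (%(x, t). g x t)"
   "!!t. t : {a'<..<b'} ==> bij (%x. g x t)"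
  and tau: "continuous_on {a'<..<b'} tau" "inj_on tau {a'<..<b'}" "tau ` {a'<..<b'} <= {a<..<b}"
 shows "proper_strip X \<L> a' b' (%(x, t). h (g x t, tau t))"
 unfolding proper_strip_def
proof (intro conjI allI impI ballI)
 let ?k = "%p. (g (fst p) (snd p), tau (snd p))"
 have c: "continuous_on (band {a'<..<b'}) ?k"
  using g(1) by (intro continuous_on_Pair continuous_on_compose2[OF tau(1)] continuous_intros)
   (auto simp: case_prod_beta)
 show "continuous_map (top_of_set (band {a'<..<b'})) X (%(x, t). h (g x t, tau t))"
  using continuous_map_top_of_set_o[OF _ c, of "band {a<..<b}" X h] h tau(3)
  by (force simp: proper_strip_def case_prod_unfold)
 show "inj_on (%(x, t). h (g x t, tau t)) (band {a'<..<b'})"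
 proof (rule inj_onI, clarify)
  fix x t x' t' assume t: "t : {a'<..<b'}" "t' : {a'<..<b'}"
   and eq: "h (g x t, tau t) = h (g x' t', tau t')"
  have "tau t : {a<..<b}" "tau t' : {a<..<b}" using t tau(3) by blast+
  then have "(g x t, tau t) = (g x' t', tau t')"
   using h eq unfolding proper_strip_def by (meson UNIV_I inj_on_def mem_Sigma_iff)
  then have "t = t'" using tau(2) t by (auto simp: inj_on_def)
  moreover have "x = x'"
   using g(2)[OF t(1)] \<open>(g x t, tau t) = (g x' t', tau t')\<close> \<open>t = t'\<close>
   by (auto simp: bij_def inj_def)
  ultimately show "x = x' & t = t'" by simp
 qed
 fix t assume "t : {a'<..<b'}"
 then show "(%(x, t). h (g x t, tau t)) ` (band {t}) : \<L>"
  using image_fibred[of "{t}" g h tau] g(2) tau(3) h by (force simp: proper_strip_def)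
next
 fix K assume K: "compact K & K <= {a'<..<b'}"
 then have "compact (tau ` K)" "tau ` K <= {a<..<b}"
  using tau(3) compact_continuous_image continuous_on_subset[OF tau(1)] by blast+
 then have "closedin X (h ` (UNIV \<times> tau ` K))"
  using h by (simp add: proper_strip_def)
 moreover have "(%(x, t). h (g x t, tau t)) ` (band K) = h ` (UNIV \<times> tau ` K)"
  using g(2) K by (intro image_fibred) blast
 ultimately show "closedin X ((%(x, t). h (g x t, tau t)) ` (band K))"
  by simp
qed fact

locale strip_family =
 fixes X :: "'a topology" and \<L> :: "'a set set"
 assumes surf: "surface_with_boundary X"
  and leaf_disjoint: "!!L L'. L : \<L> ==> L' : \<L> ==> L Int L' ~= {} ==> L = L'"
begin

abbreviation pstrip :: "real => real => (real \<times> real => 'a) => bool" where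
 "pstrip \<equiv> proper_strip X \<L>"

lemma strip_openin:
 assumes h: "pstrip a b h" and J: "open J" "J <= {a<..<b}"
 shows "openin X (h ` (band J))"
proof (rule surface_invariance_of_domain[OF surf])
 have sub: "UNIV \<times> J <= band {a<..<b}" using J by auto
 show "continuous_map (top_of_set (band J)) X h" "inj_on h (band J)"
  using h sub unfolding proper_strip_def
  by (blast intro: continuous_map_from_subtopology_mono inj_on_subset)+
qed (simp add: J open_Times)

text \<open>Lines are leaves, and leaves that meet coincide. One common point per line, tested at
  abscissa 0, forces whole lines to correspond, which gives the change of coordinates its triangular
  form. Its continuity comes from the continuous inverse of \<open>h\<close>.\<close>

lemma strip_transition:
 assumes h: "pstrip a b h" and e: "pstrip c d e" and J: "J <= {c<..<d}"
  and sub: "!!s. s : J ==> e (0, s) : h ` (band {a<..<b})"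
 obtains g T where "continuous_on (band J) (%(x, s). g x s)" "!!s. s : J ==> bij (%x. g x s)"
  "continuous_on J T" "inj_on T J" "T ` J <= {a<..<b}"
  "!!x s. s : J ==> e (x, s) = h (g x s, T s)"
  "!!s. s : J ==> e ` (band {s}) = h ` (band {T s})"
proof -
 let ?A = "band {a<..<b}"
 define k where "k = inv_into ?A h"
 define T where "T s = snd (k (e (0, s)))" for s
 define g where "g x s = fst (k (e (x, s)))" for x s
 have hi: "inj_on h ?A" and hL: "!!t. t : {a<..<b} ==> h ` (band {t}) : \<L>"
  using h by (auto simp: proper_strip_def)
 have ei: "inj_on e (band {c<..<d})" and eL: "!!t. t : {c<..<d} ==> e ` (band {t}) : \<L>"
  using e by (auto simp: proper_strip_def)
 have kh: "k (h p) = p" if "p : ?A" for p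
  unfolding k_def using hi that by (rule inv_into_f_f)
 have leaf: "T s : {a<..<b} & e ` (band {s}) = h ` (band {T s})" if s: "s : J" for s
 proof -
  obtain y t where t: "t : {a<..<b}" "e (0, s) = h (y, t)"
   using sub[OF s] by auto
  then have "T s = t" using kh by (simp add: T_def)
  moreover have "e (0, s) : e ` (band {s}) Int h ` (band {t})"
   using t(2) by (metis IntI SigmaI UNIV_I imageI singletonI)
  ultimately show ?thesis
   using leaf_disjoint[OF eL hL, of s t] J s t(1) by blast
 qed
 have eq: "e (x, s) = h (g x s, T s)" if s: "s : J" for x s
 proof -
  have "e (x, s) : h ` (band {T s})" using leaf[OF s] by blast
  then obtain y where y: "e (x, s) = h (y, T s)" by blast
  then show ?thesis using kh[of "(y, T s)"] leaf[OF s] by (simp add: g_def)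
 qed
 have bij: "bij (%x. g x s)" if s: "s : J" for s
  unfolding bij_def
 proof
  show "inj (%x. g x s)"
  proof (rule injI)
   fix x x' assume "g x s = g x' s"
   then have "e (x, s) = e (x', s)" using eq[OF s] by simp
   then show "x = x'" using ei s J by (auto dest!: inj_onD)
  qed
  have "EX x. y = g x s" for y
  proof -
   have "h (y, T s) : e ` (band {s})" using leaf[OF s] by blast
   then obtain x where "h (y, T s) = e (x, s)" by auto
   then have "h (y, T s) = h (g x s, T s)" using eq[OF s] by simp
   then show ?thesis using hi leaf[OF s] by (auto dest!: inj_onD)
  qed
  then show "surj (%x. g x s)" by (auto simp: surj_def)
 qed
 have injT: "inj_on T J"
 proof (rule inj_onI)
  fix s s' assume s: "s : J" "s' : J" "T s = T s'"
  then have "e (0, s) : e ` (band {s'})" using leaf by force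
  then obtain x where "e (0, s) = e (x, s')" by auto
  then show "s = s'" using ei s J by (auto dest!: inj_onD)
 qed
 have ce: "continuous_map (top_of_set (band J)) (subtopology X (h ` ?A)) e"
 proof -
  have "continuous_map (top_of_set (band J)) X e"
   using e J unfolding proper_strip_def
   by (meson Sigma_mono continuous_map_from_subtopology_mono subset_UNIV)
  moreover have "e (x, s) : h ` ?A" if "s : J" for x s
   using eq[OF that] leaf[OF that] by auto
  ultimately show ?thesis by (auto simp: continuous_map_in_subtopology)
 qed
 have ck: "continuous_map (subtopology X (h ` ?A)) (top_of_set ?A) k"
  unfolding k_def using h by (intro surface_open_embedding_inverse[OF surf])
   (auto simp: proper_strip_def open_Times)
 have c: "continuous_on (band J) (k \<circ> e)"
  using continuous_map_compose[OF ce ck] by (simp add: continuous_map_in_subtopology)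
 show thesis
 proof
  show "continuous_on (band J) (%(x, s). g x s)"
   using continuous_on_fst[OF c] by (simp add: g_def case_prod_unfold o_def)
  have "continuous_on J (%s. (k \<circ> e) (0, s))"
   by (intro continuous_on_compose2[OF c] continuous_intros) auto
  from continuous_on_snd[OF this] show "continuous_on J T" by (simp add: T_def[abs_def])
 qed (use eq bij injT leaf in auto)
qed

lemma pstrip_affine:
 assumes h: "pstrip a b h" and "a' < b'" and "m ~= 0" and
  im: "(%t. m * t + n) ` {a'<..<b'} = {a<..<b}"
 shows "pstrip a' b' (%(x, t). h (x, m * t + n))"
  and "(%(x, t). h (x, m * t + n)) ` (band {a'<..<b'}) = h ` (band {a<..<b})"
proof -
 show "pstrip a' b' (%(x, t). h (x, m * t + n))"
  using \<open>m ~= 0\<close> im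
  by (intro proper_strip_reparametrize[OF h \<open>a' < b'\<close>, where g = "%x t. x"])
   (auto intro!: continuous_intros simp: case_prod_unfold inj_on_def bij_def)
 show "(%(x, t). h (x, m * t + n)) ` (band {a'<..<b'}) = h ` (band {a<..<b})"
  using image_fibred[of "{a'<..<b'}" "%x t. x" h "%t. m * t + n"] im by (simp add: bij_def)
qed

lemma affine_image_greaterThanLessThan:
 fixes a b m n :: real
 shows "m > 0 ==> (%t. m * t + n) ` {a<..<b} = {m * a + n<..<m * b + n}"
  and "m < 0 ==> (%t. m * t + n) ` {a<..<b} = {m * b + n<..<m * a + n}"
proof -
 have *: "y = m * ((y - n) / m) + n" if "m ~= 0" for y using that by simp
 show "m > 0 ==> (%t. m * t + n) ` {a<..<b} = {m * a + n<..<m * b + n}"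
  using * by (auto simp: image_iff field_simps intro!: bexI[of _ "(_ - n) / m"])
 show "m < 0 ==> (%t. m * t + n) ` {a<..<b} = {m * b + n<..<m * a + n}"
  using * by (auto simp: image_iff field_simps intro!: bexI[of _ "(_ - n) / m"])
qed

text \<open>Only the underlying set is kept, so that strips can be ordered by inclusion;
  parametrizations are chosen anew whenever two strips are compared.\<close>

definition strip_arc :: "'a set => bool" where
 "strip_arc B \<longleftrightarrow> (EX h. pstrip 0 1 h & B = h ` (band {0<..<1}))"

lemma strip_arcI:
 assumes "pstrip a b h"
 shows "strip_arc (h ` (band {a<..<b}))"
proof -
 have "a < b" using assms by (simp add: proper_strip_def)
 then have im: "(%t. (b - a) * t + a) ` {0<..<1} = {a<..<b}"
  by (subst affine_image_greaterThanLessThan) auto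
 have "b - a ~= 0" using \<open>a < b\<close> by simp
 from pstrip_affine[OF assms zero_less_one this im] show ?thesis
  unfolding strip_arc_def by blast
qed

lemma pstrip_reflect:
 assumes "pstrip 0 1 h"
 shows "pstrip 0 1 (%(x, t). h (x, -1 * t + 1))"
  and "(%(x, t). h (x, -1 * t + 1)) ` (band {0<..<1}) = h ` (band {0<..<1})"
proof -
 have "(%t. -1 * t + 1) ` {0<..<1} = {0<..<1::real}"
  by (subst affine_image_greaterThanLessThan) auto
 from pstrip_affine[OF assms _ _ this]
 show "pstrip 0 1 (%(x, t). h (x, -1 * t + 1))"
  and "(%(x, t). h (x, -1 * t + 1)) ` (band {0<..<1}) = h ` (band {0<..<1})"
  by simp_all
qed

text \<open>The parametrization of the larger strip is changed so that it prolongs the one of the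
  smaller strip. Agreement is asked on a closed middle part only, because towards its own ends
  \<open>h\<close> need not converge inside the larger strip.\<close>

lemma strip_extend_mono:
 assumes e: "pstrip 0 1 e" and cd: "0 < c" "c < d" "d < 1"
  and g: "continuous_on (band {0<..<1}) (%(x, s). g x s)" "!!s. s : {0<..<1} ==> bij (%x. g x s)"
  and T: "continuous_on {0<..<1} T" "strict_mono_on {0<..<1} T" "T ` {0<..<1} <= {0<..<1}"
  and eq: "!!x s. s : {0<..<1} ==> h (x, s) = e (g x s, T s)"
 obtains h' where "pstrip 0 1 h'" "h' ` (band {0<..<1}) = e ` (band {0<..<1})"
  "!!x t. t : {c..d} ==> h' (x, t) = h (x, t)"
proof -
 define cl where "cl t = max c (min d t)" for t
 \<comment> \<open>Outside [c, d] the height continues affinely; the slopes are those that yield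
   \<open>tau 0 = 0\<close> and \<open>tau 1 = 1\<close>.\<close>
 define tau where "tau t = T (cl t) + T c / c * min (t - c) 0 + (1 - T d) / (1 - d) * max (t - d) 0" for t
 have cl: "cl t : {c..d}" "cl t : {0<..<1}" for t using cd by (auto simp: cl_def)
 have Tc: "0 < T c" "T c < T d" "T d < 1"
  using T(2,3) cd by (auto simp: strict_mono_on_def image_subset_iff)
 have slopes: "T c / c > 0" "(1 - T d) / (1 - d) > 0" using Tc cd by auto
 have mono: "tau s < tau t" if "s < t" for s t
 proof -
  have 1: "T (cl s) <= T (cl t)"
  proof (cases "cl s = cl t")
   case False
   then have "cl s < cl t" using that by (auto simp: cl_def)
   then show ?thesis using strict_mono_onD[OF T(2) cl(2) cl(2), of s t] by simp
  qed simp
  have 2: "T c / c * min (s - c) 0 <= T c / c * min (t - c) 0"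
   using slopes that by (intro mult_left_mono) auto
  have 3: "(1 - T d) / (1 - d) * max (s - d) 0 <= (1 - T d) / (1 - d) * max (t - d) 0"
   using slopes that by (intro mult_left_mono) auto
  consider "s < c" | "t > d" | "c <= s" "t <= d" by linarith
  then show ?thesis
  proof cases
   case 1
   then have "T c / c * min (s - c) 0 < T c / c * min (t - c) 0"
    using slopes that by (intro mult_strict_left_mono) auto
   then show ?thesis using \<open>T (cl s) <= T (cl t)\<close> 3 by (simp add: tau_def)
  next
   case 2
   then have "(1 - T d) / (1 - d) * max (s - d) 0 < (1 - T d) / (1 - d) * max (t - d) 0"
    using slopes that by (intro mult_strict_left_mono) auto
   then show ?thesis using \<open>T (cl s) <= T (cl t)\<close> \<open>T c / c * min (s - c) 0 <= T c / c * min (t - c) 0\<close>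
    by (simp add: tau_def)
  next
   case 3
   then have "cl s < cl t" using that by (auto simp: cl_def)
   then have "T (cl s) < T (cl t)"
    using strict_mono_onD[OF T(2) cl(2) cl(2), of s t] by simp
   then show ?thesis using 2 \<open>(1 - T d) / (1 - d) * max (s - d) 0 <= (1 - T d) / (1 - d) * max (t - d) 0\<close>
    by (simp add: tau_def)
  qed
 qed
 have cont_cl: "continuous_on S cl" for S unfolding cl_def by (intro continuous_intros)
 have cont: "continuous_on S tau" for S
  unfolding tau_def using cl
  by (intro continuous_intros continuous_on_compose2[OF T(1) cont_cl]) auto
 have ends: "tau 0 = 0" "tau 1 = 1" using cd by (auto simp: tau_def cl_def)
 have im: "tau ` {0<..<1} = {0<..<1}"
 proof
  show "tau ` {0<..<1} <= {0<..<1}" using mono ends by fastforce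
  show "{0<..<1} <= tau ` {0<..<1}"
  proof
   fix y :: real assume y: "y : {0<..<1}"
   obtain t where "0 <= t" "t <= 1" "tau t = y"
    using IVT'[of tau 0 y 1] y ends cont by auto
   moreover have "t ~= 0" "t ~= 1" using \<open>tau t = y\<close> y ends by auto
   ultimately show "y : tau ` {0<..<1}" by force
  qed
 qed
 let ?h = "%(x, t). e (g x (cl t), tau t)"
 have gc: "continuous_on (band {0<..<1}) (%(x, t). g x (cl t))"
 proof -
  have "continuous_on (band {0<..<1}) (%p. case (fst p, cl (snd p)) of (x, s) => g x s)"
   using cl by (intro continuous_on_compose2[OF g(1)] continuous_intros continuous_on_compose2[OF cont_cl]) auto
  then show ?thesis by (simp add: case_prod_unfold)
 qed
 show thesis
 proof
  have "inj_on tau {0<..<1}"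
   using mono by (intro linorder_inj_onI) (auto, metis less_irrefl)
  then show "pstrip 0 1 ?h"
   using g(2) cl im cont by (intro proper_strip_reparametrize[OF e _ gc]) auto
  show "?h ` (band {0<..<1}) = e ` (band {0<..<1})"
   using image_fibred[of "{0<..<1}" "%x t. g x (cl t)" e tau] g(2) cl im by auto
  show "?h (x, t) = h (x, t)" if "t : {c..d}" for x t
   using that eq[of t x] cd by (auto simp: tau_def cl_def)
 qed
qed

text \<open>A decreasing change of heights becomes increasing when the larger strip is turned upside
  down.\<close>

lemma strip_extend:
 assumes h: "pstrip 0 1 h" and e: "pstrip 0 1 e" and cd: "0 < c" "c < d" "d < 1"
  and sub: "h ` (band {0<..<1}) <= e ` (band {0<..<1})"
 obtains h' where "pstrip 0 1 h'" "h' ` (band {0<..<1}) = e ` (band {0<..<1})"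
  "!!x t. t : {c..d} ==> h' (x, t) = h (x, t)"
proof -
 obtain g T where g: "continuous_on (band {0<..<1}) (%(x, s). g x s)"
   "!!s. s : {0<..<1} ==> bij (%x. g x s)"
  and T: "continuous_on {0<..<1} T" "inj_on T {0<..<1}" "T ` {0<..<1} <= {0<..<1}"
  and eq: "!!x s. s : {0<..<1} ==> h (x, s) = e (g x s, T s)"
  by (rule strip_transition[OF e h order_refl]) (use sub in \<open>auto\<close>)
 have "strict_mono_on {0<..<1} T \<or> strict_antimono_on {0<..<1} T"
  using injective_eq_monotone_map[OF _ T(1)] T(2) is_interval_oo by blast
 then show thesis
 proof
  assume "strict_mono_on {0<..<1} T"
  from strip_extend_mono[OF e cd g T(1) this T(3) eq] that show thesis by blast
 next
  assume anti: "strict_antimono_on {0<..<1} T"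
  define e' where "e' = (%(x, t). e (x, -1 * t + 1))"
  have e': "pstrip 0 1 e'" "e' ` (band {0<..<1}) = e ` (band {0<..<1})"
   unfolding e'_def using pstrip_reflect[OF e] by auto
  have "strict_mono_on {0<..<1} (%s. 1 - T s)" "continuous_on {0<..<1} (%s. 1 - T s)"
   "(%s. 1 - T s) ` {0<..<1} <= {0<..<1}"
   using anti T by (auto simp: monotone_on_def intro!: continuous_intros)
  moreover have "h (x, s) = e' (g x s, 1 - T s)" if "s : {0<..<1}" for x s
   using eq[OF that] by (simp add: e'_def)
  ultimately show thesis
   using strip_extend_mono[OF e'(1) cd g, of "%s. 1 - T s" h] that e'(2) by metis
 qed
qed

text \<open>The heights of the given lines form a compact subset of (0, 1). The numbers
  \<open>c\<close> and \<open>d\<close> are added to it so that the new interval also contains them,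
  and halving the distances to 0 and 1 makes all inclusions strict.\<close>

lemma compact_part_in_strip:
 assumes h: "pstrip 0 1 h" and e: "pstrip a b e" and K: "compact K" "K <= {a<..<b}"
  and sub: "e ` (band K) <= h ` (band {0<..<1})" and cd: "0 < c" "c < 1" "0 < d" "d < 1"
 obtains c' d' where "0 < c'" "c' < c" "d < d'" "d' < 1" "e ` (band K) <= h ` (band {c'..d'})"
proof -
 obtain g T where T: "continuous_on K T" "T ` K <= {0<..<1}"
  and eq: "!!s. s : K ==> e ` (band {s}) = h ` (band {T s})"
  by (rule strip_transition[OF h e K(2)]) (use sub in auto)
 define M where "M = insert c (insert d (T ` K))"
 have M: "compact M" "M ~= {}" "M <= {0<..<1}"
  using compact_continuous_image[OF T(1) K(1)] T(2) cd by (auto simp: M_def)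
 obtain l where l: "l : M" "!!y. y : M ==> l <= y" using compact_attains_inf[OF M(1,2)] by blast
 obtain u where u: "u : M" "!!y. y : M ==> y <= u" using compact_attains_sup[OF M(1,2)] by blast
 have lu: "0 < l" "l <= c" "d <= u" "u < 1" using l u M(3) by (auto simp: M_def)
 have sub': "e ` (band K) <= h ` (band {l / 2..(u + 1) / 2})"
 proof -
  have "e (x, s) : h ` (band {l / 2..(u + 1) / 2})" if s: "s : K" for x s
  proof -
   have "e (x, s) : h ` (band {T s})" using eq[OF s] by blast
   moreover have "T s : {l / 2..(u + 1) / 2}"
    using l(2)[of "T s"] u(2)[of "T s"] s lu by (auto simp: M_def)
   ultimately show ?thesis by blast
  qed
  then show ?thesis by auto
 qed
 show thesis
  by (rule that[OF _ _ _ _ sub']) (use lu in auto)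
qed

end

context strip_family
begin

section \<open>Unions of chains of strips\<close>

lemma strip_arc_nonempty: "strip_arc B ==> B ~= {}"
 by (force simp: strip_arc_def)

lemma strip_arc_openin: "strip_arc B ==> openin X B"
 using strip_openin[of 0 1 _ "{0<..<1}"] by (auto simp: strip_arc_def)

text \<open>A direct limit: the k-th parametrization is frozen over [c k, d k], and these intervals
  grow strictly, so every compact set of heights in the limit interval lies inside one of them. Each
  clause of a strip concerns such a compact set, or at most two heights, and is inherited from a
  single \<open>h k\<close>.\<close>

lemma pstrip_limit:
 assumes h: "!!k. pstrip 0 1 (h k)" and cd: "!!k. 0 < c k" "!!k. c k < d k" "!!k. d k < 1"
  and step: "!!k. c (Suc k) < c k" "!!k. d k < d (Suc k)"
  and eq: "!!k x t. t : {c k..d k} ==> h (Suc k) (x, t) = h k (x, t)"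
 shows "strip_arc (\<Union>k. h k ` (band {c k..d k}))"
proof -
 have cm: "c j <= c k" "d k <= d j" if "k <= j" for k j
  using that step lift_Suc_antimono_le[of c] lift_Suc_mono_le[of d] by (simp_all add: less_imp_le)
 have eq': "h j (x, t) = h k (x, t)" if "k <= j" "t : {c k..d k}" for k j x t
  using that
 proof (induction j rule: dec_induct)
  case (step j)
  then have "t : {c j..d j}" using cm[of k j] by auto
  then show ?case using step eq[of t j x] by simp
 qed simp
 define a where "a = Inf (range c)"
 define b where "b = Sup (range d)"
 have bd: "bdd_below (range c)" "bdd_above (range d)"
  using cd by (auto intro!: bdd_belowI[of _ 0] bdd_aboveI[of _ 1] less_imp_le)
 have ab: "a < c k" "d k < b" for k
 proof -
  have "a <= c (Suc k)" "d (Suc k) <= b"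
   unfolding a_def b_def using bd by (auto intro: cInf_lower cSup_upper)
  then show "a < c k" "d k < b" using step[of k] by auto
 qed
 have cover: "EX k. K <= {c k<..<d k}" if K: "compact K" "K <= {a<..<b}" for K
 proof (cases "K = {}")
  case False
  obtain l where l: "l : K" "!!y. y : K ==> l <= y" using compact_attains_inf[OF K(1) False] by blast
  obtain u where u: "u : K" "!!y. y : K ==> y <= u" using compact_attains_sup[OF K(1) False] by blast
  have "a < l" "u < b" using l(1) u(1) K(2) by auto
  obtain i where i: "c i < l"
   using \<open>a < l\<close> cInf_lessD[of "range c" l] unfolding a_def by blast
  obtain j where j: "u < d j"
   using \<open>u < b\<close> less_cSupD[of "range d" u] unfolding b_def by blast
  have "K <= {c (max i j)<..<d (max i j)}"
   using l(2) u(2) i j cm(1)[of i "max i j"] cm(2)[of j "max i j"] by fastforce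
  then show ?thesis by blast
 qed auto
 have cover1: "EX k. t : {c k<..<d k}" if "t : {a<..<b}" for t
  using cover[of "{t}"] that by auto
 define H where "H p = h (LEAST k. snd p : {c k..d k}) p" for p
 have H: "H (x, t) = h k (x, t)" if t: "t : {c k..d k}" for x t k
 proof -
  let ?j = "LEAST k. t : {c k..d k}"
  have "t : {c ?j..d ?j}" using t by (rule LeastI)
  moreover have "?j <= k" using t by (rule Least_le)
  ultimately show ?thesis using eq'[of ?j k t x] by (simp add: H_def)
 qed
 have im: "H ` (band K) = h k ` (band K)" if "K <= {c k..d k}" for k K
  using that H by (intro image_cong) auto
 have sub01: "{a<..<b} <= {0<..<1}"
  using cover1 cd(1,3) by (force simp: subset_iff intro: less_trans)
 have "pstrip a b H"
  unfolding proper_strip_def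
 proof (intro conjI ballI allI impI)
  show "a < b" using ab[of 0] cd(2)[of 0] by linarith
  show "continuous_map (top_of_set (band {a<..<b})) X H"
  proof (rule pasting_lemma[where I = UNIV and T = "%k. band {c k<..<d k}" and f = h])
   fix k
   have "band {c k<..<d k} <= (band {a<..<b} :: (real \<times> real) set)"
    using ab[of k] by auto
   then show "openin (top_of_set (band {a<..<b})) (band {c k<..<d k} :: (real \<times> real) set)"
    by (simp add: open_Times openin_open_eq open_subset)
   have "band {a<..<b} Int band {c k<..<d k} <= (band {0<..<1} :: (real \<times> real) set)"
    using sub01 by auto
   then show "continuous_map (subtopology (top_of_set (band {a<..<b})) (band {c k<..<d k})) X (h k)"
    using h[of k] unfolding proper_strip_def subtopology_subtopology
    by (blast intro: continuous_map_from_subtopology_mono)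
  next
   fix j k and p :: "real \<times> real"
   assume "p : topspace (top_of_set (band {a<..<b})) Int band {c j<..<d j} Int band {c k<..<d k}"
   then show "h j p = h k p"
    using H[of "snd p" j "fst p"] H[of "snd p" k "fst p"] by (cases p) auto
  next
   fix p :: "real \<times> real" assume "p : topspace (top_of_set (band {a<..<b}))"
   then obtain k where "snd p : {c k<..<d k}" using cover1[of "snd p"] by (cases p) auto
   then show "EX k. k : UNIV & p : band {c k<..<d k} & H p = h k p"
    using H[of "snd p" k "fst p"] by (cases p) auto
  qed
  show "inj_on H (band {a<..<b})"
  proof (rule inj_onI, clarify)
   fix x t x' t' assume t: "t : {a<..<b}" "t' : {a<..<b}" "H (x, t) = H (x', t')"
   obtain k where "{t, t'} <= {c k<..<d k}" using cover[of "{t, t'}"] t by auto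
   then have "h k (x, t) = h k (x', t')" "t : {0<..<1}" "t' : {0<..<1}"
    using H[of t k x] H[of t' k x'] t sub01 by auto
   then show "x = x' & t = t'" using h[of k] by (auto simp: proper_strip_def dest!: inj_onD)
  qed
  show "H ` (band {t}) : \<L>" if t: "t : {a<..<b}" for t
  proof -
   obtain k where "t : {c k<..<d k}" using cover1[OF t] by blast
   then have "H ` (band {t}) = h k ` (band {t})" by (intro im) auto
   then show ?thesis using h[of k] t sub01 by (auto simp: proper_strip_def)
  qed
  show "closedin X (H ` (band K))" if K: "compact K & K <= {a<..<b}" for K
  proof -
   obtain k where "K <= {c k<..<d k}" using cover K by blast
   then have "H ` (band K) = h k ` (band K)" by (intro im) auto
   moreover have "K <= {0<..<1}" using K sub01 by blast
   ultimately show ?thesis using h[of k] K by (simp add: proper_strip_def)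
  qed
 qed
 moreover have "H ` (band {a<..<b}) = (\<Union>k. h k ` (band {c k..d k}))"
 proof (intro set_eqI iffI)
  fix z assume "z : H ` (band {a<..<b})"
  then obtain x t where xt: "t : {a<..<b}" "z = H (x, t)" by auto
  obtain k where "t : {c k<..<d k}" using cover1[OF xt(1)] by blast
  then have "z = h k (x, t)" "(x, t) : band {c k..d k}" using xt H[of t k x] by auto
  then show "z : (\<Union>k. h k ` (band {c k..d k}))" by blast
 next
  fix z assume "z : (\<Union>k. h k ` (band {c k..d k}))"
  then obtain k x t where xt: "t : {c k..d k}" "z = h k (x, t)" by auto
  then have "z = H (x, t)" "(x, t) : band {a<..<b}" using H[of t k x] ab[of k] by auto
  then show "z : H ` (band {a<..<b})" by blast
 qed
 ultimately show ?thesis using strip_arcI by metis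
qed

text \<open>Second countability replaces the chain by a countable family with the same union. The
  compact bands of its members are listed in one sequence, and the parametrization is extended step
  by step so that the k-th frozen band contains the k-th item of the list.\<close>

lemma strip_arc_Union_chain:
 assumes C: "C ~= {}" "subset.chain (Collect strip_arc) C"
 shows "strip_arc (\<Union>C)"
proof -
 have arc: "strip_arc B" if "B : C" for B using C(2) that by (auto simp: subset.chain_def)
 have tot: "B <= B' \<or> B' <= B" if "B : C" "B' : C" for B B'
  using C(2) that by (auto simp: subset.chain_def)
 have "second_countable (subtopology X (\<Union>C))"
  using surf by (simp add: surface_with_boundary_def second_countable_subtopology)
 then have "Lindelof_space (subtopology X (\<Union>C))" by (rule second_countable_imp_Lindelof_space)
 moreover have "openin (subtopology X (\<Union>C)) B" if "B : C" for B
  using strip_arc_openin[OF arc[OF that]] that by (auto simp: openin_subtopology)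
 moreover have "\<Union>C = topspace (subtopology X (\<Union>C))"
  using strip_arc_openin[OF arc] openin_subset by fastforce
 ultimately obtain \<V> where \<V>: "countable \<V>" "\<V> <= C" "\<Union>\<V> = \<Union>C"
  using Lindelof_spaceD[of "subtopology X (\<Union>C)" C] by metis
 have "\<V> ~= {}" using \<V>(3) C(1) arc strip_arc_nonempty by fastforce
 then obtain V :: "nat => 'a set" where V: "range V = \<V>"
  using range_from_nat_into[OF _ \<V>(1)] by metis
 have "ALL n. EX h. pstrip 0 1 h & V n = h ` (band {0<..<1})"
  using V \<V>(2) arc unfolding strip_arc_def by blast
 then obtain e where e: "!!n. pstrip 0 1 (e n)" "!!n. V n = e n ` (band {0<..<1})" by metis
 \<comment> \<open>The shift by 3 makes every interval contain [1/3, 2/3] and stay inside (0,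
   1).\<close>
 define K :: "nat => real set" where "K j = {1 / (real j + 3)..1 - 1 / (real j + 3)}" for j
 have K: "compact (K j)" "K j <= {0<..<1}" for j
 proof -
  have "0 < 1 / (real j + 3)" by simp
  then show "K j <= {0<..<1}" unfolding K_def by (smt (verit) atLeastAtMost_iff greaterThanLessThan_iff subsetI)
  show "compact (K j)" unfolding K_def by simp
 qed
 have Kcov: "EX j. t : K j" if t: "t : {0<..<1}" for t
 proof -
  obtain j where "1 / real (Suc j) < min t (1 - t)"
   using reals_Archimedean[of "min t (1 - t)"] t by (auto simp: inverse_eq_divide)
  moreover have "1 / (real j + 3) <= 1 / real (Suc j)" by (auto simp: field_simps)
  ultimately show ?thesis by (intro exI[of _ j]) (auto simp: K_def)
 qed
 define D where "D k = (case prod_decode k of (n, j) => e n ` (UNIV \<times> K j))" for k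
 let ?P = "%k (h, c, d). pstrip 0 1 h & h ` (band {0<..<1}) : C & 0 < c & c < d & d < 1 &
   D k <= h ` (band {c..d})"
 let ?Q = "%k (h, c, d) (h', c', d'). c' < c & d < d' & (ALL x. ALL t:{c..d}. h' (x, t) = h (x, t))"
 have nxt: "EX s'. ?P k s' & ?Q (k - 1) (h, c, d) s'"
  if h: "pstrip 0 1 h" "h ` (band {0<..<1}) : C" and cd: "0 < c" "c < d" "d < 1" for k h c d
 proof -
  obtain n j where nj: "prod_decode k = (n, j)" by fastforce
  let ?B = "h ` (band {0<..<1})"
  have "V n : C" using V \<V>(2) by blast
  then have "?B <= V n \<or> V n <= ?B" using tot h(2) by blast
  then have "EX h'. pstrip 0 1 h' & h' ` (band {0<..<1}) : C & V n <= h' ` (band {0<..<1}) &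
    (ALL x. ALL t:{c..d}. h' (x, t) = h (x, t))"
  proof
   assume "?B <= V n"
   then have "?B <= e n ` (band {0<..<1})" using e(2) by simp
   from strip_extend[OF h(1) e(1) cd this] obtain h' where
    "pstrip 0 1 h'" "h' ` (band {0<..<1}) = V n" "!!x t. t : {c..d} ==> h' (x, t) = h (x, t)"
    using e(2) by metis
   then show ?thesis using \<open>V n : C\<close> by auto
  qed (use h in blast)
  then obtain h' where h': "pstrip 0 1 h'" "h' ` (band {0<..<1}) : C" "V n <= h' ` (band {0<..<1})"
   "ALL x. ALL t:{c..d}. h' (x, t) = h (x, t)" by blast
  have "e n ` (UNIV \<times> K j) <= h' ` (band {0<..<1})"
  proof -
   have "e n ` (UNIV \<times> K j) <= e n ` (band {0<..<1})" using K(2)[of j] by (intro image_mono) auto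
   then show ?thesis using h'(3) e(2) by auto
  qed
  moreover have "c < 1" "0 < d" using cd by linarith+
  ultimately obtain c' d' where
   "0 < c'" "c' < c" "d < d'" "d' < 1" "e n ` (UNIV \<times> K j) <= h' ` (band {c'..d'})"
   using compact_part_in_strip[OF h'(1) e(1) K, where c = c and d = d] cd by metis
  then have "?P k (h', c', d') & ?Q (k - 1) (h, c, d) (h', c', d')"
   using h' cd nj by (auto simp: D_def)
  then show ?thesis by blast
 qed
 have "e 0 ` (band {0<..<1}) : C" using e(2)[of 0] V \<V>(2) by blast
 \<comment> \<open>The interval [1/3, 2/3] is arbitrary; it only serves to produce a first
   triple.\<close>
 then have "EX s. ?P 0 s & ?Q (0 - 1) (e 0, 1 / 3, 2 / 3) s"
  by (intro nxt e(1)) auto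
 then have base: "EX s. ?P 0 s"
  by (rule ex_forward) (rule conjunct1)
 have "EX f. ALL k. ?P k (f k) & ?Q k (f k) (f (Suc k))"
 proof (rule dependent_nat_choice)
  show "EX s. ?P 0 s" by (rule base)
  fix s k assume P: "?P k s"
  obtain h c d where s: "s = (h, c, d)" by (cases s)
  show "EX s'. ?P (Suc k) s' & ?Q k s s'"
   using nxt[of h c d "Suc k"] P unfolding s by simp
 qed
 then obtain f where f: "ALL k. ?P k (f k) & ?Q k (f k) (f (Suc k))" by (rule exE)
 define h where "h k = fst (f k)" for k
 define c where "c k = fst (snd (f k))" for k
 define d where "d k = snd (snd (f k))" for k
 have P: "pstrip 0 1 (h k)" "h k ` (band {0<..<1}) : C" "0 < c k" "c k < d k" "d k < 1"
   "D k <= h k ` (band {c k..d k})" for k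
  using f[THEN spec, of k] by (auto simp: h_def c_def d_def split: prod.splits)
 have Q: "c (Suc k) < c k" "d k < d (Suc k)" "!!x t. t : {c k..d k} ==> h (Suc k) (x, t) = h k (x, t)" for k
  using f[THEN spec, of k] by (auto simp: h_def c_def d_def split: prod.splits)
 have "strip_arc (\<Union>k. h k ` (band {c k..d k}))"
  by (rule pstrip_limit) (use P Q in auto)
 moreover have "(\<Union>k. h k ` (band {c k..d k})) = \<Union>C"
 proof
  have "h k ` (band {c k..d k}) <= h k ` (band {0<..<1})" for k
   using P(3,5)[of k] by (intro image_mono) auto
  then show "(\<Union>k. h k ` (band {c k..d k})) <= \<Union>C" using P(2) by blast
  show "\<Union>C <= (\<Union>k. h k ` (band {c k..d k}))"
  proof
   fix z assume "z : \<Union>C"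
   then obtain n where "z : V n" using \<V>(3) V by blast
   then obtain x t where xt: "t : {0<..<1}" "z = e n (x, t)" using e(2) by auto
   obtain j where "t : K j" using Kcov[OF xt(1)] by blast
   then have "z : D (prod_encode (n, j))" using xt by (auto simp: D_def)
   then show "z : (\<Union>k. h k ` (band {c k..d k}))" using P(6) by blast
  qed
 qed
 ultimately show ?thesis by simp
qed

definition maximal_arc :: "'a set => bool" where
 "maximal_arc B \<longleftrightarrow> strip_arc B & (ALL B'. strip_arc B' & B <= B' --> B' = B)"

lemma maximal_arc_exists:
 assumes "strip_arc B"
 obtains M where "maximal_arc M" "B <= M"
proof -
 let ?A = "{B'. strip_arc B' & B <= B'}"
 have "EX M:?A. ALL B':?A. M <= B' --> B' = M"
 proof (rule subset_Zorn_nonempty)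
  show "?A ~= {}" using assms by blast
  fix C assume C: "C ~= {}" "subset.chain ?A C"
  then have "subset.chain (Collect strip_arc) C" by (auto simp: subset.chain_def)
  then have "strip_arc (\<Union>C)" using C(1) by (rule strip_arc_Union_chain[rotated])
  moreover have "B <= \<Union>C" using C by (fastforce simp: subset.chain_def)
  ultimately show "\<Union>C : ?A" by simp
 qed
 then show thesis using that unfolding maximal_arc_def by fastforce
qed

end

section \<open>Maximal strips\<close>

text \<open>Near \<open>s0\<close> the function avoids 1/2, so by connectedness it stays on one side
  of 1/2. On that side it also avoids every interval between 1/2 and \<open>c\<close>, and only the
  approach to the end 0 or 1 remains.\<close>

lemma end_limit_left:
 fixes T :: "real => real"
 assumes s: "s1 < s0" and T: "continuous_on {s1..<s0} T"
  and esc: "!!c d. 0 < c ==> c <= d ==> d < 1 ==> EX s'<s0. ALL s:{s'<..<s0}. s1 <= s --> T s ~: {c..d}"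
 shows "(ALL c<1. EX s':{s1..<s0}. ALL s:{s'..<s0}. c < T s) \<or> (ALL c>0. EX s':{s1..<s0}. ALL s:{s'..<s0}. T s < c)"
proof -
 have esc': "EX m:{s1..<s0}. ALL s:{m..<s0}. T s ~: {c..d}" if cd: "0 < c" "c <= d" "d < 1" for c d
 proof -
  obtain s' where s': "s' < s0" "ALL s:{s'<..<s0}. s1 <= s --> T s ~: {c..d}" using esc[OF cd] by blast
  show ?thesis
   using s s' by (intro bexI[of _ "max s1 ((s' + s0) / 2)"]) auto
 qed
 obtain m where m: "m : {s1..<s0}" "!!s. s : {m..<s0} ==> T s ~= 1 / 2"
  using esc'[of "1/2" "1/2"] by force
 have cont: "continuous_on {m..s} T" if "s < s0" for s
  using m(1) that by (intro continuous_on_subset[OF T]) auto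
 have "(ALL s:{m..<s0}. 1 / 2 < T s) \<or> (ALL s:{m..<s0}. T s < 1 / 2)"
 proof (rule ccontr)
  assume "\<not> ?thesis"
  then obtain s s' where ss: "s : {m..<s0}" "s' : {m..<s0}" "T s < 1 / 2" "1 / 2 < T s'"
   using m(2) by (metis linorder_neqE_linordered_idom)
  have "connected (T ` {m..<s0})"
   using m(1) by (intro connected_continuous_image continuous_on_subset[OF T]) auto
  then have "1 / 2 : T ` {m..<s0}"
   by (rule connectedD_interval[of _ "T s" "T s'"]) (use ss in auto)
  then show False using m(2) by force
 qed
 then show ?thesis
 proof
  assume hi: "ALL s:{m..<s0}. 1 / 2 < T s"
  have "EX s':{s1..<s0}. ALL s:{s'..<s0}. c < T s" if c: "c < 1" for c
  proof -
   have "EX m:{s1..<s0}. ALL s:{m..<s0}. T s ~: {1/2..max c (1/2)}" by (rule esc') (use c in auto)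
   then obtain m' where m': "m' : {s1..<s0}" "!!s. s : {m'..<s0} ==> T s ~: {1/2..max c (1/2)}"
    by blast
   show ?thesis
    using m(1) m'(1)
   proof (intro bexI[of _ "max m m'"] ballI)
    fix s assume "s : {max m m'..<s0}"
    then have "1 / 2 < T s" "T s ~: {1/2..max c (1/2)}" using hi m'(2)[of s] by auto
    then show "c < T s" by auto
   qed auto
  qed
  then show ?thesis by blast
 next
  assume lo: "ALL s:{m..<s0}. T s < 1 / 2"
  have "EX s':{s1..<s0}. ALL s:{s'..<s0}. T s < c" if c: "c > 0" for c
  proof -
   have "EX m:{s1..<s0}. ALL s:{m..<s0}. T s ~: {min c (1/2)..1/2}" by (rule esc') (use c in auto)
   then obtain m' where m': "m' : {s1..<s0}" "!!s. s : {m'..<s0} ==> T s ~: {min c (1/2)..1/2}"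
    by blast
   show ?thesis
    using m(1) m'(1)
   proof (intro bexI[of _ "max m m'"] ballI)
    fix s assume "s : {max m m'..<s0}"
    then have "T s < 1 / 2" "T s ~: {min c (1/2)..1/2}" using lo m'(2)[of s] by auto
    then show "T s < c" by auto
   qed auto
  qed
  then show ?thesis by blast
 qed
qed

lemma end_limit_right:
 fixes T :: "real => real"
 assumes s: "s0 < s1" and T: "continuous_on {s0<..s1} T"
  and esc: "!!c d. 0 < c ==> c <= d ==> d < 1 ==> EX s'>s0. ALL s:{s0<..<s'}. s <= s1 --> T s ~: {c..d}"
 shows "(ALL c<1. EX s':{s0<..s1}. ALL s:{s0<..s'}. c < T s) \<or> (ALL c>0. EX s':{s0<..s1}. ALL s:{s0<..s'}. T s < c)"
proof -
 let ?S = "%s. T (- s)"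
 have refl: "(ALL c<1. EX s':{- s1..<- s0}. ALL s:{s'..<- s0}. c < ?S s) \<or> (ALL c>0. EX s':{- s1..<- s0}. ALL s:{s'..<- s0}. ?S s < c)"
 proof (rule end_limit_left)
  show "continuous_on {- s1..<- s0} ?S"
   by (intro continuous_on_compose2[OF T] continuous_intros) auto
  fix c d :: real assume "0 < c" "c <= d" "d < 1"
  from esc[OF this] obtain s' where "s' > s0" "ALL s:{s0<..<s'}. s <= s1 --> T s ~: {c..d}" by blast
  then show "EX s'<(- s0). ALL s:{s'<..<- s0}. - s1 <= s --> ?S s ~: {c..d}"
   by (intro exI[of _ "-s'"]) auto
 qed (use s in simp)
 have conv: "EX s':{s0<..s1}. ALL s:{s0<..s'}. P (T s)"
  if ex: "EX s':{- s1..<- s0}. ALL s:{s'..<- s0}. P (?S s)" for P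
 proof -
  obtain s' where s': "s' : {- s1..<- s0}" "ALL s:{s'..<- s0}. P (?S s)" using ex by blast
  have "P (T s)" if "s : {s0<..- s'}" for s using s'(2)[rule_format, of "- s"] that by auto
  then show ?thesis using s'(1) by (intro bexI[of _ "- s'"]) auto
 qed
 from refl show ?thesis
 proof
  assume hi: "ALL c<1. EX s':{- s1..<- s0}. ALL s:{s'..<- s0}. c < ?S s"
  have "EX s':{s0<..s1}. ALL s:{s0<..s'}. c < T s" if "c < 1" for c
   by (rule conv) (use hi that in blast)
  then show ?thesis by blast
 next
  assume lo: "ALL c>0. EX s':{- s1..<- s0}. ALL s:{s'..<- s0}. ?S s < c"
  have "EX s':{s0<..s1}. ALL s:{s0<..s'}. T s < c" if "c > 0" for c
   by (rule conv) (use lo that in blast)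
  then show ?thesis by blast
 qed
qed

context strip_family
begin

section \<open>Gluing two strips along a common leaf\<close>

text \<open>The lower part of one strip is continued by the upper part of another. Their
  parametrizations of the common leaf differ by a bijection \<open>g0\<close> of the line, which is
  applied to all later lines of \<open>e\<close>. The union is injective by \<open>disj\<close>,
  since leaves that meet coincide.\<close>

lemma strip_glue:
 assumes h: "pstrip 0 1 h" and e: "pstrip 0 1 e" and t1: "0 < t1" "t1 < 1"
  and s: "0 < s1" "s1 < s2" "s2 <= 1" and leaf: "h ` (band {t1}) = e ` (band {s1})"
  and disj: "!!s. s1 < s ==> s < s2 ==> e (0, s) ~: h ` (band {0<..t1})"
 shows "strip_arc (h ` (band {0<..t1}) Un e ` (band {s1..<s2}))"
proof -
 have hi: "inj_on h (band {0<..<1})" and hL: "!!t. t : {0<..<1} ==> h ` (band {t}) : \<L>"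
  and hc: "continuous_map (top_of_set (band {0<..<1})) X h"
  using h by (auto simp: proper_strip_def)
 have ei: "inj_on e (band {0<..<1})" and eL: "!!t. t : {0<..<1} ==> e ` (band {t}) : \<L>"
  and ec: "continuous_map (top_of_set (band {0<..<1})) X e"
  using e by (auto simp: proper_strip_def)
 have t1m: "{t1} <= {0<..<1}" using t1 by auto
 have "h (0, t1) : e ` (band {s1})" using leaf by blast
 then have sub: "h (0, t) : e ` (band {0<..<1})" if "t : {t1}" for t
  using that s by auto
 obtain g T where
  g: "continuous_on (band {t1}) (%(x, s). g x s)" "!!s. s : {t1} ==> bij (%x. g x s)"
  and T1: "T ` {t1} <= {0<..<1}" and eq': "!!x s. s : {t1} ==> h (x, s) = e (g x s, T s)"
  by (rule strip_transition[OF e h t1m]) (use sub in auto)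
 have T: "T t1 : {0<..<1}" and eq: "!!x. h (x, t1) = e (g x t1, T t1)" using T1 eq' by auto
 have "T t1 = s1"
 proof -
  have "h (0, t1) : e ` (band {s1})" using leaf by blast
  then obtain x where "h (0, t1) = e (x, s1)" by auto
  then have "e (g 0 t1, T t1) = e (x, s1)" using eq by simp
  then show ?thesis using ei T s by (auto dest!: inj_onD)
 qed
 define g0 where "g0 x = g x t1" for x
 have g0: "bij g0" "!!x. h (x, t1) = e (g0 x, s1)"
  using g(2) eq \<open>T t1 = s1\<close> by (auto simp: g0_def[abs_def])
 have cg0: "continuous_on UNIV g0"
 proof -
  have "continuous_on UNIV (%x. case (x, t1) of (x, s) => g x s)"
   by (intro continuous_on_compose2[OF g(1)] continuous_intros) auto
  then show ?thesis by (simp add: g0_def[abs_def])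
 qed
 define b where "b = t1 + (s2 - s1)"
 define H where "H = (%p. if snd p <= t1 then h p else e (g0 (fst p), s1 + (snd p - t1)))"
 have H2: "H (x, t) = e (g0 x, s1 + (t - t1))" if "t \<ge> t1" for x t
  using that g0(2)[of x] by (auto simp: H_def)
 have im1: "H ` (band K) = h ` (band K)" if "K <= {..t1}" for K
  using that by (intro image_cong) (auto simp: H_def)
 have im2: "H ` (band K) = e ` (UNIV \<times> (%t. s1 + (t - t1)) ` K)" if "K <= {t1..}" for K
 proof -
  have "H ` (band K) = (%(x, t). e (g0 x, s1 + (t - t1))) ` (band K)"
   using that H2 by (intro image_cong) auto
  also have "\<dots> = e ` (UNIV \<times> (%t. s1 + (t - t1)) ` K)"
   using image_fibred[of K "%x t. g0 x"] g0(1) by simp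
  finally show ?thesis .
 qed
 have "pstrip 0 b H"
  unfolding proper_strip_def
 proof (intro conjI ballI allI impI)
  show "0 < b" using t1 s by (simp add: b_def)
  show "continuous_map (top_of_set (band {0<..<b})) X H"
   unfolding H_def
  proof (rule continuous_map_cases_le)
   let ?Z = "subtopology (top_of_set (band {0<..<b}))"
   have 1: "band {0<..<b} Int {p : topspace (top_of_set (band {0<..<b})). snd p <= t1} <= (band {0<..<1} :: (real \<times> real) set)"
    using t1 by auto
   show "continuous_map (?Z {p : topspace (top_of_set (band {0<..<b})). snd p <= t1}) X h"
    unfolding subtopology_subtopology using continuous_map_from_subtopology_mono[OF hc 1] .
   show "continuous_map (?Z {p : topspace (top_of_set (band {0<..<b})). t1 <= snd p}) X
       (%p. e (g0 (fst p), s1 + (snd p - t1)))"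
    unfolding subtopology_subtopology
    by (intro continuous_map_top_of_set_o[OF ec] continuous_intros continuous_on_compose2[OF cg0])
     (use s in \<open>auto simp: b_def\<close>)
   show "h p = e (g0 (fst p), s1 + (snd p - t1))" if "snd p = t1" for p
    using g0(2)[of "fst p"] that by (cases p) auto
  qed (auto intro!: continuous_intros)
  show "inj_on H (band {0<..<b})"
  proof (rule inj_onI)
   have aux: "p = p'" if p: "p : band {0<..<b}" "p' : band {0<..<b}" "H p = H p'" "snd p <= snd p'" for p p'
   proof -
    consider "snd p' <= t1" | "t1 <= snd p" | "snd p < t1" "t1 < snd p'" by linarith
    then show ?thesis
    proof cases
     case 1
     then have "h p = h p'" using p by (auto simp: H_def)
     then show ?thesis using p 1 t1 by (intro inj_onD[OF hi]) auto
    next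
     case 2
     then have "e (g0 (fst p), s1 + (snd p - t1)) = e (g0 (fst p'), s1 + (snd p' - t1))"
      using p H2[of "snd p" "fst p"] H2[of "snd p'" "fst p'"] by auto
     then have "(g0 (fst p), s1 + (snd p - t1)) = (g0 (fst p'), s1 + (snd p' - t1))"
      using p 2 s by (intro inj_onD[OF ei]) (auto simp: b_def)
     then show ?thesis using g0(1) by (simp add: bij_def inj_eq prod_eq_iff)
    next
     case 3
     let ?s = "s1 + (snd p' - t1)"
     have s': "s1 < ?s" "?s < s2" using 3 p by (auto simp: b_def)
     have eqhe: "h p = e (g0 (fst p'), ?s)" using p 3 by (simp add: H_def)
     then have "h p : e ` (band {?s})" by blast
     moreover have "h p : h ` (band {snd p})" by (intro imageI) (auto simp: mem_Times_iff)
     ultimately have "h ` (band {snd p}) = e ` (band {?s})"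
      using p 3 t1 s s' by (intro leaf_disjoint hL eL) auto
     moreover have "e (0, ?s) : e ` (band {?s})" by blast
     moreover have "h ` (band {snd p}) <= h ` (band {0<..t1})"
      using p 3 by (intro image_mono) auto
     ultimately show ?thesis using disj[OF s'] by blast
    qed
   qed
   fix p p' assume p: "p : band {0<..<b}" "p' : band {0<..<b}" "H p = H p'"
   show "p = p'"
   proof (cases "snd p <= snd p'")
    case False
    then show ?thesis using aux[OF p(2,1) p(3)[symmetric]] by simp
   qed (rule aux[OF p])
  qed
  show "H ` (band {t}) : \<L>" if "t : {0<..<b}" for t
  proof (cases "t <= t1")
   case True
   then show ?thesis using im1[of "{t}"] hL[of t] that t1 by auto
  next
   case False
   then show ?thesis using im2[of "{t}"] eL[of "s1 + (t - t1)"] that s by (auto simp: b_def)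
  qed
  show "closedin X (H ` (band K))" if K: "compact K & K <= {0<..<b}" for K
  proof -
   let ?K1 = "K Int {..t1}" and ?K2 = "K Int {t1..}"
   let ?K3 = "(%t. s1 + (t - t1)) ` ?K2"
   have "compact ?K1" "?K1 <= {0<..<1}" using K t1 by (auto simp: compact_Int_closed)
   then have 1: "closedin X (h ` (UNIV \<times> ?K1))" using h by (simp add: proper_strip_def)
   have "compact ?K3"
    using K by (intro compact_continuous_image continuous_intros) (auto simp: compact_Int_closed)
   moreover have "?K3 <= {0<..<1}" using K s by (force simp: b_def)
   ultimately have 2: "closedin X (e ` (UNIV \<times> ?K3))" using e by (simp add: proper_strip_def)
   have "H ` (band K) = H ` (UNIV \<times> ?K1) Un H ` (UNIV \<times> ?K2)"
    unfolding image_Un[symmetric] by (intro arg_cong[of _ _ "image H"]) auto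
   then show ?thesis using 1 2 im1[of ?K1] im2[of ?K2] by auto
  qed
 qed
 from strip_arcI[OF this] have "strip_arc (H ` (band {0<..<b}))" .
 moreover have "H ` (band {0<..<b}) = h ` (band {0<..t1}) Un e ` (band {s1..<s2})"
 proof -
  have "{0<..<b} = {0<..t1} Un {t1..<b}" using t1 s by (auto simp: b_def)
  then have "H ` (band {0<..<b}) = H ` (band {0<..t1}) Un H ` (band {t1..<b})"
   unfolding image_Un[symmetric] by (intro arg_cong[of _ _ "image H"]) auto
  moreover have ims: "(%t. s1 + (t - t1)) ` {t1..<b} = {s1..<s2}"
  proof (intro set_eqI iffI)
   fix y assume "y : {s1..<s2}"
   then show "y : (%t. s1 + (t - t1)) ` {t1..<b}"
    by (intro image_eqI[of _ _ "y - s1 + t1"]) (auto simp: b_def)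
  qed (auto simp: b_def)
  moreover have "H ` (band {0<..t1}) = h ` (band {0<..t1})" by (rule im1) auto
  moreover have "H ` (band {t1..<b}) = e ` (band {s1..<s2})"
   unfolding ims[symmetric] by (rule im2) auto
  ultimately show ?thesis by simp
 qed
 ultimately show ?thesis by simp
qed

end

context strip_family
begin

section \<open>How a transversal meets a maximal strip\<close>

lemma strip_arc_leaf:
 assumes "strip_arc B" "z : B"
 obtains L where "L : \<L>" "z : L" "L <= B"
proof -
 obtain h where h: "pstrip 0 1 h" "B = h ` (band {0<..<1})" using assms(1) by (auto simp: strip_arc_def)
 obtain x t where t: "t : {0<..<1}" "z = h (x, t)" using assms(2) h(2) by auto
 have "h ` (band {t}) : \<L>" using h(1) t(1) by (simp add: proper_strip_def)
 moreover have "z : h ` (band {t})" "h ` (band {t}) <= B" using t h(2) by auto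
 ultimately show thesis by (rule that)
qed

lemma strip_arc_subset: "strip_arc B ==> B <= \<Union>\<L>"
 using strip_arc_leaf by blast

lemma strip_arc_saturated:
 assumes "strip_arc B" "L : \<L>" "L Int B ~= {}"
 shows "L <= B"
proof -
 obtain z where z: "z : L" "z : B" using assms(3) by blast
 obtain L' where "L' : \<L>" "z : L'" "L' <= B" using strip_arc_leaf[OF assms(1) z(2)] .
 then show ?thesis using leaf_disjoint[of L L'] assms(2) z by blast
qed

lemma strip_transversal_continuous:
 assumes "pstrip 0 1 e"
 shows "continuous_map (top_of_set {0<..<1}) X (%s. e (x, s))"
proof (rule continuous_map_top_of_set_o)
 show "continuous_map (top_of_set (band {0<..<1})) X e" using assms by (simp add: proper_strip_def)
 show "continuous_on {0<..<1} (%s. (x, s))" by (intro continuous_intros)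
qed auto

text \<open>Properness enters here: the image of the band over a compact set is closed, so a
  transversal avoids it near each of its points outside the strip.\<close>

lemma strip_avoids_compact:
 assumes h: "pstrip 0 1 h" and e: "pstrip 0 1 e" and s0: "s0 : {0<..<1}"
  and out: "e (0, s0) ~: h ` (band {0<..<1})" and K: "compact K" "K <= {0<..<1}"
 obtains delta where "delta > 0" "!!s. \<bar>s - s0\<bar> < delta ==> s : {0<..<1} & e (0, s) ~: h ` (band K)"
proof -
 have cl: "closedin X (h ` (band K))" using h K by (simp add: proper_strip_def)
 let ?O = "{s : {0<..<1}. e (0, s) : topspace X - h ` (band K)}"
 have "openin (top_of_set {0<..<1}) ?O"
  using openin_continuous_map_preimage[OF strip_transversal_continuous[OF e, of 0], of "topspace X - h ` (band K)"] cl
  by (auto simp: closedin_def)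
 then have "open ?O" by (simp add: openin_open_eq)
 moreover have "s0 : ?O"
 proof -
  have "e (0, s0) : topspace X"
   using continuous_map_image_subset_topspace[OF strip_transversal_continuous[OF e, of 0]] s0 by auto
  moreover have "h ` (band K) <= h ` (band {0<..<1})" using K by (intro image_mono) auto
  ultimately show ?thesis using s0 out by blast
 qed
 ultimately obtain delta where "delta > 0" "ball s0 delta <= ?O" using open_contains_ball by blast
 then show thesis
  by (intro that[of delta]) (auto simp: subset_iff dist_real_def abs_minus_commute)
qed

lemma strip_trace_open:
 assumes e: "pstrip 0 1 e" and B: "strip_arc B"
 shows "open {s : {0<..<1}. e (0, s) : B}"
 using openin_continuous_map_preimage[OF strip_transversal_continuous[OF e, of 0] strip_arc_openin[OF B]]
 by (auto simp: openin_open_eq)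

text \<open>At both ends of the segment the height in \<open>B\<close> leaves every compact set;
  being monotone, it tends to different ends and takes all values in (0, 1). Hence \<open>B\<close>
  lies in the strip of \<open>e\<close>, and maximality gives equality, although the transversal of
  \<open>e\<close> passes through points outside \<open>B\<close>.\<close>

lemma maximal_arc_no_component:
 assumes M: "maximal_arc B" and h: "pstrip 0 1 h" "B = h ` (band {0<..<1})" and e: "pstrip 0 1 e"
  and ab: "alpha < beta" "alpha : {0<..<1}" "beta : {0<..<1}" and out: "e (0, alpha) ~: B" "e (0, beta) ~: B"
  and sub: "!!s. s : {alpha<..<beta} ==> e (0, s) : B"
 shows False
proof -
 have J: "{alpha<..<beta} <= {0<..<1}" using ab by auto
 obtain g T where T: "continuous_on {alpha<..<beta} T" "inj_on T {alpha<..<beta}" "T ` {alpha<..<beta} <= {0<..<1}"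
  and eq: "!!s. s : {alpha<..<beta} ==> e ` (band {s}) = h ` (band {T s})"
  by (rule strip_transition[OF h(1) e J]) (use sub h(2) in auto)
 have Tin: "e (0, s) : h ` (band {T s})" if "s : {alpha<..<beta}" for s
  using eq[OF that] by blast
 have esc: "EX delta>0. ALL s:{alpha<..<beta}. \<bar>s - s0\<bar> < delta --> T s ~: {c..d}"
  if cd: "0 < c" "c <= d" "d < 1" and s0: "s0 : {alpha, beta}" for c d s0
 proof -
  have "{c..d} <= {0<..<1}" "e (0, s0) ~: h ` (band {0<..<1})" "s0 : {0<..<1}"
   using cd s0 ab out h(2) by auto
  then obtain delta where delta: "delta > 0" "!!s. \<bar>s - s0\<bar> < delta ==> e (0, s) ~: h ` (band {c..d})"
   using strip_avoids_compact[OF h(1) e, of s0 "{c..d}"] by (metis compact_Icc)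
  have "T s ~: {c..d}" if "s : {alpha<..<beta}" "\<bar>s - s0\<bar> < delta" for s
   using Tin[OF that(1)] delta(2)[OF that(2)] by auto
  then show ?thesis using delta(1) by blast
 qed
 define m where "m = (alpha + beta) / 2"
 have m: "m : {alpha<..<beta}" using ab by (auto simp: m_def)
 have L: "(ALL c<1. EX s':{m..<beta}. ALL s:{s'..<beta}. c < T s) \<or> (ALL c>0. EX s':{m..<beta}. ALL s:{s'..<beta}. T s < c)"
 proof (rule end_limit_left)
  show "continuous_on {m..<beta} T" using m by (intro continuous_on_subset[OF T(1)]) auto
  fix c d :: real assume "0 < c" "c <= d" "d < 1"
  from esc[OF this, of beta] obtain delta where "delta > 0" "ALL s:{alpha<..<beta}. \<bar>s - beta\<bar> < delta --> T s ~: {c..d}" by auto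
  then show "EX s'<beta. ALL s:{s'<..<beta}. m <= s --> T s ~: {c..d}"
   using m by (intro exI[of _ "beta - delta"]) auto
 qed (use m in auto)
 have R: "(ALL c<1. EX s':{alpha<..m}. ALL s:{alpha<..s'}. c < T s) \<or> (ALL c>0. EX s':{alpha<..m}. ALL s:{alpha<..s'}. T s < c)"
 proof (rule end_limit_right)
  show "continuous_on {alpha<..m} T" using m by (intro continuous_on_subset[OF T(1)]) auto
  fix c d :: real assume "0 < c" "c <= d" "d < 1"
  from esc[OF this, of alpha] obtain delta where "delta > 0" "ALL s:{alpha<..<beta}. \<bar>s - alpha\<bar> < delta --> T s ~: {c..d}" by auto
  then show "EX s'>alpha. ALL s:{alpha<..<s'}. s <= m --> T s ~: {c..d}"
   using m by (intro exI[of _ "alpha + delta"]) auto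
 qed (use m in auto)
 have "T m : {0<..<1}" using T(3) m by blast
 then have Tm: "0 < T m" "T m < 1" by auto
 have "strict_mono_on {alpha<..<beta} T \<or> strict_antimono_on {alpha<..<beta} T"
  using injective_eq_monotone_map[OF _ T(1)] T(2) is_interval_oo by blast
 then have ends: "(ALL c<1. EX s:{alpha<..<beta}. c < T s) & (ALL c>0. EX s:{alpha<..<beta}. T s < c)"
 proof
  assume mono: "strict_mono_on {alpha<..<beta} T"
  have mono': "T s < T s'" if "alpha < s" "s < s'" "s' < beta" for s s'
   using mono that by (auto simp: monotone_on_def)
  have "EX s':{m..<beta}. T m < T s'" using ab m mono'[of m "(m + beta) / 2"] by (intro bexI[of _ "(m + beta) / 2"]) auto
  have n1: "\<not> (ALL c>0. EX s':{m..<beta}. ALL s:{s'..<beta}. T s < c)"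
  proof
   assume "ALL c>0. EX s':{m..<beta}. ALL s:{s'..<beta}. T s < c"
   then obtain s' where s': "s' : {m..<beta}" "T s' < T m" using Tm by (metis atLeastLessThan_iff order_refl)
   then show False using mono'[of m s'] m by (cases "s' = m") auto
  qed
  have n2: "\<not> (ALL c<1. EX s':{alpha<..m}. ALL s:{alpha<..s'}. c < T s)"
  proof
   assume "ALL c<1. EX s':{alpha<..m}. ALL s:{alpha<..s'}. c < T s"
   then obtain s' where s': "s' : {alpha<..m}" "T m < T s'" using Tm by (metis greaterThanAtMost_iff order_refl)
   then show False using mono'[of s' m] m by (cases "s' = m") auto
  qed
  have "ALL c<1. EX s:{alpha<..<beta}. c < T s" using L n1 m by (meson atLeastLessThan_iff greaterThanLessThan_iff less_le_trans order_refl)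
  moreover have "ALL c>0. EX s:{alpha<..<beta}. T s < c" using R n2 m by (meson greaterThanAtMost_iff greaterThanLessThan_iff le_less_trans order_refl)
  ultimately show ?thesis by blast
 next
  assume mono: "strict_antimono_on {alpha<..<beta} T"
  have mono': "T s' < T s" if "alpha < s" "s < s'" "s' < beta" for s s'
   using mono that by (auto simp: monotone_on_def)
  have n1: "\<not> (ALL c<1. EX s':{m..<beta}. ALL s:{s'..<beta}. c < T s)"
  proof
   assume "ALL c<1. EX s':{m..<beta}. ALL s:{s'..<beta}. c < T s"
   then obtain s' where s': "s' : {m..<beta}" "T m < T s'" using Tm by (metis atLeastLessThan_iff order_refl)
   then show False using mono'[of m s'] m by (cases "s' = m") auto
  qed
  have n2: "\<not> (ALL c>0. EX s':{alpha<..m}. ALL s:{alpha<..s'}. T s < c)"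
  proof
   assume "ALL c>0. EX s':{alpha<..m}. ALL s:{alpha<..s'}. T s < c"
   then obtain s' where s': "s' : {alpha<..m}" "T s' < T m" using Tm by (metis greaterThanAtMost_iff order_refl)
   then show False using mono'[of s' m] m by (cases "s' = m") auto
  qed
  have "ALL c>0. EX s:{alpha<..<beta}. T s < c" using L n1 m by (meson atLeastLessThan_iff greaterThanLessThan_iff less_le_trans order_refl)
  moreover have "ALL c<1. EX s:{alpha<..<beta}. c < T s" using R n2 m by (meson greaterThanAtMost_iff greaterThanLessThan_iff le_less_trans order_refl)
  ultimately show ?thesis by blast
 qed
 have "B <= e ` (band {0<..<1})"
 proof
  fix z assume "z : B"
  then obtain x y where y: "y : {0<..<1}" "z = h (x, y)" using h(2) by auto
  obtain s s' where "s : {alpha<..<beta}" "T s < y" "s' : {alpha<..<beta}" "y < T s'"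
   using ends y(1) by (metis greaterThanLessThan_iff)
  moreover have "connected (T ` {alpha<..<beta})" by (intro connected_continuous_image T(1)) auto
  ultimately have "y : T ` {alpha<..<beta}"
   by (meson connectedD_interval imageI less_imp_le)
  then obtain r where r: "r : {alpha<..<beta}" "y = T r" by blast
  have "z : e ` (band {r})" using eq[OF r(1)] y(2) r(2) by blast
  then show "z : e ` (band {0<..<1})" using r(1) J by blast
 qed
 then have "e ` (band {0<..<1}) = B"
  using M strip_arcI[OF e] unfolding maximal_arc_def by blast
 then show False using out(1) ab(2) by blast
qed

text \<open>If points outside \<open>B\<close> and points of \<open>B\<close> alternated to the left
  of \<open>s0\<close>, some component of the trace of \<open>B\<close> would have both its ends
  outside \<open>B\<close>, which has just been excluded.\<close>

lemma maximal_arc_left_interval: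
 assumes M: "maximal_arc B" and e: "pstrip 0 1 e"
  and s0: "s0 : {0<..<1}" "e (0, s0) ~: B"
  and freq: "!!eta. eta < s0 ==> EX s. eta < s & s < s0 & s : {0<..<1} & e (0, s) : B"
 obtains s1 where "0 < s1" "s1 < s0" "!!s. s : {s1..<s0} ==> e (0, s) : B"
proof (rule ccontr)
 assume notthesis: "\<not> thesis"
 obtain h where h: "pstrip 0 1 h" "B = h ` (band {0<..<1})"
  using M by (auto simp: maximal_arc_def strip_arc_def)
 let ?O = "{s : {0<..<1}. e (0, s) : B}"
 have O: "open ?O" using strip_trace_open[OF e] M by (simp add: maximal_arc_def)
 have "\<not> (ALL s:{s0 / 2..<s0}. e (0, s) : B)"
 proof
  assume "ALL s:{s0 / 2..<s0}. e (0, s) : B"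
  then have thesis by (intro that[of "s0 / 2"]) (use s0(1) in auto)
  with notthesis show False ..
 qed
 then obtain s' where "s' : {s0 / 2..<s0}" "e (0, s') ~: B" by blast
 then have s': "0 < s'" "s' < s0" "e (0, s') ~: B" using s0(1) by auto
 obtain s2 where s2: "s' < s2" "s2 < s0" "e (0, s2) : B" using freq[OF s'(2)] by blast
 have cp: "compact ({l..u} - ?O)" for l u using O by (intro compact_diff) auto
 have "s' : {s'..s2} - ?O" "s0 : {s2..s0} - ?O" using s' s2 s0 by auto
 then have ne: "{s'..s2} - ?O ~= {}" "{s2..s0} - ?O ~= {}" by blast+
 obtain alpha where alpha: "alpha : {s'..s2} - ?O" "!!s. s : {s'..s2} - ?O ==> s <= alpha"
  using compact_attains_sup[OF cp ne(1)] by blast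
 obtain beta where beta: "beta : {s2..s0} - ?O" "!!s. s : {s2..s0} - ?O ==> beta <= s"
  using compact_attains_inf[OF cp ne(2)] by blast
 have ab: "alpha < s2" "s2 < beta" "e (0, alpha) ~: B" "e (0, beta) ~: B"
 proof -
  show "e (0, alpha) ~: B" "e (0, beta) ~: B" using alpha(1) beta(1) s' s0(1) s2 by auto
  then show "alpha < s2" "s2 < beta" using s2(3) alpha(1) beta(1) by (auto simp: less_le)
 qed
 have "e (0, s) : B" if s: "s : {alpha<..<beta}" for s
 proof (rule ccontr)
  assume "e (0, s) ~: B"
  then show False using alpha(2)[of s] beta(2)[of s] s alpha(1) beta(1) by (cases "s <= s2") auto
 qed
 then show False
  using maximal_arc_no_component[OF M h e _ _ _ ab(3,4)] ab alpha(1) beta(1) s' s0(1) by auto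
qed

end

section \<open>Disjointness of maximal strips\<close>

text \<open>The assumption \<open>no_clopen\<close> excludes an annulus or Moebius band formed by
  uncut leaves. In an annulus the complement of any single line is a maximal strip, so maximal
  strips would overlap without being equal.\<close>

locale cut_strip_family = strip_family +
 assumes no_clopen: "!!C. openin X C ==> closedin X C ==> C <= \<Union>\<L> ==> C = {}"
begin

text \<open>If the transversal stays outside \<open>B\<close> just after \<open>s0\<close>, gluing
  prolongs \<open>B\<close> across the leaf at \<open>s0\<close>, against maximality. Otherwise it
  enters \<open>B\<close> again, and it must do so at the opposite end, since the heights near 1
  have already been taken before \<open>s0\<close>. Then the strip closes up to a set that is both
  open and closed.\<close>

lemma maximal_arc_left_accumulation_aux:
 assumes M: "maximal_arc B" and h: "pstrip 0 1 h" "B = h ` (band {0<..<1})" and e: "pstrip 0 1 e"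
  and s0: "s0 : {0<..<1}" "e (0, s0) ~: B"
  and s1: "0 < s1" "s1 < s0" "!!s. s : {s1..<s0} ==> e (0, s) : B"
  and lim: "!!c. c < 1 ==> EX s':{s1..<s0}. ALL s:{s'..<s0}. e (0, s) : h ` (UNIV \<times> ({c<..<1} Int {0<..<1}))"
 shows False
proof -
 have arc: "strip_arc B" using M by (simp add: maximal_arc_def)
 define Q where "Q = {s : {0<..<1}. e (0, s) : B}"
 have Qsub: "Q <= {0<..<1}" by (auto simp: Q_def)
 have sub: "e (0, s) : h ` (band {0<..<1})" if "s : Q" for s
  using that h(2) by (simp add: Q_def)
 obtain g :: "real => real => real" and T where T: "continuous_on Q T" "inj_on T Q" "T ` Q <= {0<..<1}"
  and eq: "!!s. s : Q ==> e ` (band {s}) = h ` (band {T s})"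
  by (rule strip_transition[OF h(1) e Qsub sub]) blast+
 have T01: "0 < T s" "T s < 1" if "s : Q" for s
 proof -
  have "T s : {0<..<1}" using T(3) that by blast
  then show "0 < T s" "T s < 1" by auto
 qed
 have Tin: "T s : A" if s: "s : Q" and A: "e (0, s) : h ` (UNIV \<times> A)" "A <= {0<..<1}" for s A
 proof -
  have "e (0, s) : h ` (band {T s})" using eq[OF s] by blast
  then obtain y where y: "e (0, s) = h (y, T s)" by auto
  obtain y' a where a: "e (0, s) = h (y', a)" "a : A" using A(1) by auto
  have "(y, T s) = (y', a)"
   by (rule inj_onD[of h "band {0<..<1}"])
    (use h(1) y a A(2) T01[OF s] in \<open>auto simp: proper_strip_def\<close>)
  then show ?thesis using a(2) by simp
 qed
 have O1: "{s1..<s0} <= Q" using s1 s0(1) by (auto simp: Q_def)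
 have O0: "s0 ~: Q" using s0 by (simp add: Q_def)
 define t1 where "t1 = T s1"
 have s1O: "s1 : Q" using O1 s1 by auto
 have t1: "0 < t1" "t1 < 1" using T01[OF s1O] by (auto simp: t1_def)
 have limT: "EX s':{s1..<s0}. ALL s:{s'..<s0}. c < T s" if c: "c < 1" for c
 proof -
  obtain s' where s': "s' : {s1..<s0}" "ALL s:{s'..<s0}. e (0, s) : h ` (UNIV \<times> ({c<..<1} Int {0<..<1}))"
   using lim[OF c] by blast
  have "c < T s" if s: "s : {s'..<s0}" for s
  proof -
   have "T s : {c<..<1} Int {0<..<1}"
    by (rule Tin) (use s s' O1 in auto)
   then show ?thesis by auto
  qed
  then show ?thesis using s'(1) by blast
 qed
 have cov1: "EX s:{s1..<s0}. T s = y" if y: "t1 <= y" "y < 1" for y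
 proof -
  obtain s where s: "s : {s1..<s0}" "y < T s" using limT[OF y(2)] by force
  have "continuous_on {s1..s} T" using O1 s by (intro continuous_on_subset[OF T(1)]) auto
  then obtain r where "s1 <= r" "r <= s" "T r = y"
   using IVT'[of T s1 y s] s y by (auto simp: t1_def)
  then show ?thesis using s by auto
 qed
 \<comment> \<open>The height tends to 1; had it dropped to \<open>t1\<close> or below after
   \<open>s1\<close>, it would have to pass through \<open>t1\<close> a second time.\<close>
 have above: "t1 < T s" if s: "s1 < s" "s < s0" for s
 proof (rule ccontr)
  assume "\<not> t1 < T s"
  obtain s' where s': "s' : {s1..<s0}" "ALL r:{s'..<s0}. t1 < T r" using limT[OF t1(2)] by blast
  let ?r = "max s s'"
  have r: "?r : {s..<s0}" "t1 < T ?r" using s s' by auto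
  have sr: "{s..?r} <= {s1..<s0}" using s r(1) unfolding atLeastLessThan_iff by fastforce
  then have "continuous_on {s..?r} T" using O1 by (intro continuous_on_subset[OF T(1)]) blast
  then obtain q where q: "s <= q" "q <= ?r" "T q = t1"
   using IVT'[of T s t1 ?r] r \<open>\<not> t1 < T s\<close> by auto
  then have "q : Q" using sr O1 by fastforce
  then have "q = s1" using inj_onD[OF T(2), of q s1] s1O q(3) by (simp add: t1_def)
  then show False using q s by auto
 qed
 have leaf_s1: "h ` (band {t1}) = e ` (band {s1})" using eq[OF s1O] by (simp add: t1_def)
 have upper: "h (x, y) : e ` (band {s1..<s0})" if y: "t1 <= y" "y < 1" for x y
 proof -
  obtain s where s: "s : {s1..<s0}" "T s = y" using cov1[OF y] by blast
  have "e ` (band {s}) = h ` (band {y})" using eq[of s] s O1 by blast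
  then have "h (x, y) : e ` (band {s})" by blast
  then show ?thesis using s(1) by blast
 qed
 show False
 proof (cases "EX s2. s0 < s2 & s2 <= 1 & (ALL s:{s0..<s2}. s ~: Q)")
  case True
  then obtain s2 where s2: "s0 < s2" "s2 <= 1" "!!s. s : {s0..<s2} ==> s ~: Q" by blast
  let ?A = "h ` (band {0<..t1}) Un e ` (band {s1..<s2})"
  have "strip_arc ?A"
  proof (rule strip_glue[OF h(1) e t1 s1(1) _ s2(2) leaf_s1])
   show "s1 < s2" using s1 s2 by simp
   fix s assume s: "s1 < s" "s < s2"
   show "e (0, s) ~: h ` (band {0<..t1})"
   proof
    assume a: "e (0, s) : h ` (band {0<..t1})"
    show False
    proof (cases "s < s0")
     case True
     then have "T s : {0<..t1}" using s O1 a t1 by (intro Tin) auto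
     then show False using above[OF s(1) True] by auto
    next
     case False
     then have "e (0, s) ~: B" using s2 s s1 by (auto simp: Q_def)
     moreover have "h ` (band {0<..t1}) <= B" unfolding h(2) using t1 by (intro image_mono) auto
     ultimately show False using a by blast
    qed
   qed
  qed
  moreover have "B <= ?A"
  proof
   fix z assume "z : B"
   then obtain x y where y: "y : {0<..<1}" "z = h (x, y)" using h(2) by auto
   show "z : ?A"
   proof (cases "y <= t1")
    case False
    then have "z : e ` (band {s1..<s0})" using upper[of y x] y by auto
    moreover have "e ` (band {s1..<s0}) <= e ` (band {s1..<s2})" using s2 by (intro image_mono) auto
    ultimately show ?thesis by blast
   qed (use y in auto)
  qed
  ultimately have "?A = B" using M by (auto simp: maximal_arc_def)
  moreover have "e (0, s0) : ?A" using s1 s2 by auto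
  ultimately show False using s0(2) by blast
 next
  case False
  \<comment> \<open>Accumulation from the right is accumulation from the left for the reversed
    transversal.\<close>
  define e' where "e' = (%(x, t). e (x, -1 * t + 1))"
  have e': "pstrip 0 1 e'" unfolding e'_def by (rule pstrip_reflect(1)[OF e])
  have e'e: "e' (x, t) = e (x, 1 - t)" for x t by (simp add: e'_def)
  have freq: "EX s. eta < s & s < 1 - s0 & s : {0<..<1} & e' (0, s) : B" if eta: "eta < 1 - s0" for eta
  proof -
   have "s0 < min 1 (1 - eta)" "min 1 (1 - eta) <= 1" using eta s0(1) by auto
   then obtain s where s: "s : {s0..<min 1 (1 - eta)}" "s : Q" using False by blast
   then have "s ~= s0" using O0 by auto
   then show ?thesis using s by (intro exI[of _ "1 - s"]) (auto simp: e'e Q_def)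
  qed
  have "1 - s0 : {0<..<1}" "e' (0, 1 - s0) ~: B" using s0 by (auto simp: e'e)
  from maximal_arc_left_interval[OF M e' this freq] obtain s1' where
   s1': "0 < s1'" "s1' < 1 - s0" "!!s. s : {s1'..<1 - s0} ==> e' (0, s) : B" by blast
  define s2 where "s2 = 1 - s1'"
  have s2: "s0 < s2" "s2 < 1" using s1' by (auto simp: s2_def)
  have O2: "{s0<..s2} <= Q"
  proof
   fix s assume s: "s : {s0<..s2}"
   then have "e' (0, 1 - s) : B" by (intro s1'(3)) (auto simp: s2_def)
   then show "s : Q" using s s0(1) s2 by (auto simp: e'e Q_def)
  qed
  have "(ALL c<1. EX s':{s0<..s2}. ALL s:{s0<..s'}. c < T s) \<or> (ALL c>0. EX s':{s0<..s2}. ALL s:{s0<..s'}. T s < c)"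
  proof (rule end_limit_right[OF s2(1)])
   show "continuous_on {s0<..s2} T" by (rule continuous_on_subset[OF T(1) O2])
   fix c d :: real assume cd: "0 < c" "c <= d" "d < 1"
   then have "compact {c..d}" "{c..d} <= {0<..<1}" "e (0, s0) ~: h ` (band {0<..<1})"
    using s0(2) h(2) by auto
   from strip_avoids_compact[OF h(1) e s0(1) this(3) this(1,2)] obtain delta where
    delta: "delta > 0" "!!s. \<bar>s - s0\<bar> < delta ==> s : {0<..<1} & e (0, s) ~: h ` (band {c..d})" by blast
   have "T s ~: {c..d}" if s: "s : {s0<..<s0 + delta}" "s <= s2" for s
   proof
    assume Ts: "T s : {c..d}"
    have "s : Q" using O2 s by (simp add: subset_iff)
    then have "e (0, s) : h ` (band {T s})" using eq[of s] by blast
    moreover have "h ` (band {T s}) <= h ` (band {c..d})" using Ts by (intro image_mono) auto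
    ultimately show False using delta(2)[of s] s by auto
   qed
   then show "EX s'>s0. ALL s:{s0<..<s'}. s <= s2 --> T s ~: {c..d}"
    using delta(1) by (intro exI[of _ "s0 + delta"]) auto
  qed
  then show False
  proof
   assume "ALL c<1. EX s':{s0<..s2}. ALL s:{s0<..s'}. c < T s"
   then obtain s' where s': "s' : {s0<..s2}" "t1 < T s'" using t1(2) by fastforce
   have s'O: "s' : Q" using s' O2 by auto
   obtain r where r: "r : {s1..<s0}" "T r = T s'" using cov1[of "T s'"] s'(2) T01[OF s'O] by auto
   then have "r = s'" using inj_onD[OF T(2) r(2)] O1 s'O by auto
   then show False using r s' by auto
  next
   assume lo: "ALL c>0. EX s':{s0<..s2}. ALL s:{s0<..s'}. T s < c"
   then obtain s3 where s3: "s3 : {s0<..s2}" "!!s. s : {s0<..s3} ==> T s < t1" using t1(1) by blast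
   define t2 where "t2 = T s3"
   have s3O: "s3 : Q" using s3 O2 by auto
   have t2: "0 < t2" "t2 < t1" using T01[OF s3O] s3 by (auto simp: t2_def)
   have lower: "h (x, y) : e ` (band {s0<..s3})" if y: "0 < y" "y <= t2" for x y
   proof -
    obtain s' where s': "s' : {s0<..s2}" "ALL s:{s0<..s'}. T s < y" using lo y(1) by blast
    let ?r = "min s' s3"
    have "{?r..s3} <= {s0<..s2}" using s3(1) s'(1) by auto
    then have "continuous_on {?r..s3} T" using O2 by (intro continuous_on_subset[OF T(1)]) blast
    moreover have "T ?r <= y" using s' s3(1) by (auto intro!: less_imp_le)
    ultimately obtain q where q: "?r <= q" "q <= s3" "T q = y"
     using IVT'[of T ?r y s3] y by (auto simp: t2_def)
    then have qs: "q : {s0<..s3}" using s' s3(1) by auto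
    then have "q : Q" using O2 s3(1) by (simp add: subset_iff)
    then have "e ` (band {q}) = h ` (band {y})" using eq[of q] q(3) by simp
    then have "h (x, y) : e ` (band {q})" by blast
    then show ?thesis using qs by blast
   qed
   \<comment> \<open>This representation by two bands over compact intervals shows that the set is
     closed; its second representation, by \<open>B\<close> and an open band of \<open>e\<close>,
     shows that it is open.\<close>
   let ?C = "e ` (band {s1..s3}) Un h ` (band {t2..t1})"
   have C: "?C = B Un e ` (band {s1<..<s3})"
   proof
    have ce: "e (x, s) : B Un e ` (band {s1<..<s3})" if s: "s : {s1..s3}" for x s
    proof (cases "s : {s1, s3}")
     case True
     then have "s : Q" using s1O s3O by auto
     then have "e (x, s) : h ` (band {T s})" "T s : {0<..<1}" using eq[of s] T01[of s] by auto
     then show ?thesis unfolding h(2) by blast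
    qed (use s in force)
    have "e ` (band {s1..s3}) <= B Un e ` (band {s1<..<s3})"
     by (rule image_subsetI, erule SigmaE, simp only:, rule ce)
    moreover have "h ` (band {t2..t1}) <= B" unfolding h(2) using t1 t2 by (intro image_mono) auto
    ultimately show "?C <= B Un e ` (band {s1<..<s3})" by blast
    have ch: "h (x, y) : ?C" if y: "y : {0<..<1}" for x y
    proof -
     have a: "e ` (band {s1..<s0}) <= e ` (band {s1..s3})" "e ` (band {s0<..s3}) <= e ` (band {s1..s3})"
      using s1 s3(1) by (intro image_mono; auto)+
     consider "y <= t2" | "t1 <= y" | "y : {t2..t1}" by fastforce
     then show ?thesis
     proof cases
      case 1 then show ?thesis using lower[of y x] y a by auto
     next
      case 2 then show ?thesis using upper[of y x] y a by auto
     qed blast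
    qed
    have "B <= ?C"
     unfolding h(2) by (rule image_subsetI, erule SigmaE, simp only:, rule ch)
    moreover have "e ` (band {s1<..<s3}) <= e ` (band {s1..s3})" by (intro image_mono) auto
    ultimately show "B Un e ` (band {s1<..<s3}) <= ?C" by blast
   qed
   have "closedin X ?C"
   proof (intro closedin_Un)
    have "{s1..s3} <= {0<..<1}" "{t2..t1} <= {0<..<1}" using s1 s3(1) s2 t1 t2 by auto
    then show "closedin X (e ` (band {s1..s3}))" "closedin X (h ` (band {t2..t1}))"
     using e h(1) by (auto simp: proper_strip_def)
   qed
   moreover have s13: "{s1<..<s3} <= {0<..<1}" using s1 s3(1) s2 by auto
   then have "openin X ?C"
    unfolding C using strip_arc_openin[OF arc] strip_openin[OF e _ s13] by (intro openin_Un) auto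
   moreover have "?C <= \<Union>\<L>"
   proof -
    have "e ` (band {s1<..<s3}) <= e ` (band {0<..<1})" using s13 by (intro image_mono) auto
    then show ?thesis unfolding C
     using strip_arc_subset[OF arc] strip_arc_subset[OF strip_arcI[OF e]] by blast
   qed
   ultimately have "?C = {}" using no_clopen by blast
   then show False using s1 s3(1) by auto
  qed
 qed
qed

text \<open>By properness the height tends to an end of \<open>B\<close>; if this end is 0, turning
  \<open>B\<close> upside down makes it 1.\<close>

lemma maximal_arc_left_accumulation:
 assumes M: "maximal_arc B" and e: "pstrip 0 1 e"
  and s0: "s0 : {0<..<1}" "e (0, s0) ~: B"
  and freq: "!!eta. eta < s0 ==> EX s. eta < s & s < s0 & s : {0<..<1} & e (0, s) : B"
 shows False
proof -
 obtain h where h: "pstrip 0 1 h" "B = h ` (band {0<..<1})"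
  using M by (auto simp: maximal_arc_def strip_arc_def)
 obtain s1 where s1: "0 < s1" "s1 < s0" "!!s. s : {s1..<s0} ==> e (0, s) : B"
  using maximal_arc_left_interval[OF M e s0 freq] by blast
 have J: "{s1..<s0} <= {0<..<1}" using s1 s0(1) by auto
 have sub: "e (0, s) : h ` (band {0<..<1})" if "s : {s1..<s0}" for s
  using s1(3)[OF that] h(2) by simp
 obtain g :: "real => real => real" and T where T: "continuous_on {s1..<s0} T" "T ` {s1..<s0} <= {0<..<1}"
  and eq: "!!s. s : {s1..<s0} ==> e ` (band {s}) = h ` (band {T s})"
  by (rule strip_transition[OF h(1) e J sub]) blast+
 have Tin: "e (0, s) : h ` (band {T s})" if "s : {s1..<s0}" for s using eq[OF that] by blast
 have T01: "0 < T s" "T s < 1" if "s : {s1..<s0}" for s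
 proof -
  have "T s : {0<..<1}" using T(2) that by blast
  then show "0 < T s" "T s < 1" by auto
 qed
 have "(ALL c<1. EX s':{s1..<s0}. ALL s:{s'..<s0}. c < T s) \<or> (ALL c>0. EX s':{s1..<s0}. ALL s:{s'..<s0}. T s < c)"
 proof (rule end_limit_left[OF s1(2) T(1)])
  fix c d :: real assume cd: "0 < c" "c <= d" "d < 1"
  then have "compact {c..d}" "{c..d} <= {0<..<1}" "e (0, s0) ~: h ` (band {0<..<1})"
   using s0(2) h(2) by auto
  from strip_avoids_compact[OF h(1) e s0(1) this(3) this(1,2)] obtain delta where
   delta: "delta > 0" "!!s. \<bar>s - s0\<bar> < delta ==> s : {0<..<1} & e (0, s) ~: h ` (band {c..d})" by blast
  have "T s ~: {c..d}" if s: "s : {s0 - delta<..<s0}" "s1 <= s" for s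
  proof
   assume Ts: "T s : {c..d}"
   have "e (0, s) : h ` (band {T s})" using Tin[of s] s by auto
   moreover have "h ` (band {T s}) <= h ` (band {c..d})" using Ts by (intro image_mono) auto
   ultimately show False using delta(2)[of s] s by auto
  qed
  then show "EX s'<s0. ALL s:{s'<..<s0}. s1 <= s --> T s ~: {c..d}"
   using delta(1) by (intro exI[of _ "s0 - delta"]) auto
 qed
 then show False
 proof
  assume hi: "ALL c<1. EX s':{s1..<s0}. ALL s:{s'..<s0}. c < T s"
  show False
  proof (rule maximal_arc_left_accumulation_aux[OF M h e s0 s1])
   fix c :: real assume "c < 1"
   then obtain s' where s': "s' : {s1..<s0}" "ALL s:{s'..<s0}. c < T s" using hi by blast
   have "e (0, s) : h ` (UNIV \<times> ({c<..<1} Int {0<..<1}))" if s: "s : {s'..<s0}" for s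
   proof -
    have "s : {s1..<s0}" "c < T s" using s s' by auto
    then have "T s : {c<..<1} Int {0<..<1}" using T01[of s] by auto
    then show ?thesis using Tin[OF \<open>s : {s1..<s0}\<close>] by blast
   qed
   then show "EX s':{s1..<s0}. ALL s:{s'..<s0}. e (0, s) : h ` (UNIV \<times> ({c<..<1} Int {0<..<1}))"
    using s'(1) by blast
  qed
 next
  assume lo: "ALL c>0. EX s':{s1..<s0}. ALL s:{s'..<s0}. T s < c"
  define h' where "h' = (%(x, t). h (x, -1 * t + 1))"
  have h': "pstrip 0 1 h'" "B = h' ` (band {0<..<1})"
   unfolding h'_def h(2) using pstrip_reflect[OF h(1)] by auto
  show False
  proof (rule maximal_arc_left_accumulation_aux[OF M h' e s0 s1])
   fix c :: real assume "c < 1"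
   then have "0 < 1 - c" by simp
   then obtain s' where s': "s' : {s1..<s0}" "ALL s:{s'..<s0}. T s < 1 - c" using lo by blast
   have "e (0, s) : h' ` (UNIV \<times> ({c<..<1} Int {0<..<1}))" if s: "s : {s'..<s0}" for s
   proof -
    have "s : {s1..<s0}" "T s < 1 - c" using s s' by auto
    then have "1 - T s : {c<..<1} Int {0<..<1}" using T01[of s] by auto
    moreover have "e (0, s) : h' ` (band {1 - T s})"
    proof -
     obtain y where "e (0, s) = h (y, T s)" using Tin[OF \<open>s : {s1..<s0}\<close>] by auto
     then have "e (0, s) = h' (y, 1 - T s)" by (simp add: h'_def)
     then show ?thesis by blast
    qed
    ultimately show ?thesis by blast
   qed
   then show "EX s':{s1..<s0}. ALL s:{s'..<s0}. e (0, s) : h' ` (UNIV \<times> ({c<..<1} Int {0<..<1}))"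
    using s'(1) by blast
  qed
 qed
qed

lemma maximal_arc_trace_closed:
 assumes M: "maximal_arc B" and e: "pstrip 0 1 e" and s0: "s0 : {0<..<1}" "e (0, s0) ~: B"
 obtains eta where "eta > 0" "!!s. s : {0<..<1} ==> \<bar>s - s0\<bar> < eta ==> e (0, s) ~: B"
proof -
 define e' where "e' = (%(x, t). e (x, -1 * t + 1))"
 have e': "pstrip 0 1 e'" unfolding e'_def by (rule pstrip_reflect(1)[OF e])
 have e'e: "e' (x, t) = e (x, 1 - t)" for x t by (simp add: e'_def)
 obtain l where l: "l < s0" "!!s. l < s ==> s < s0 ==> s : {0<..<1} ==> e (0, s) ~: B"
  using maximal_arc_left_accumulation[OF M e s0] by blast
 have "1 - s0 : {0<..<1}" "e' (0, 1 - s0) ~: B" using s0 by (auto simp: e'e)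
 then obtain r where r: "r < 1 - s0" "!!s. r < s ==> s < 1 - s0 ==> s : {0<..<1} ==> e' (0, s) ~: B"
  using maximal_arc_left_accumulation[OF M e', of "1 - s0"] by blast
 show thesis
 proof (rule that[of "min (s0 - l) (1 - s0 - r)"])
  fix s assume s: "s : {0<..<1}" "\<bar>s - s0\<bar> < min (s0 - l) (1 - s0 - r)"
  consider "s < s0" | "s = s0" | "s > s0" by linarith
  then show "e (0, s) ~: B"
  proof cases
   case 3
   then show ?thesis using r(2)[of "1 - s"] s by (auto simp: e'e)
  qed (use l(2)[of s] s s0 in auto)
 qed (use l r in auto)
qed

text \<open>The trace of \<open>B\<close> on the transversal is open because \<open>B\<close> is
  open, and closed because it does not accumulate at points outside \<open>B\<close>; the interval
  of heights is connected.\<close>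

lemma strip_in_or_out_maximal_arc:
 assumes M: "maximal_arc B" and e: "pstrip 0 1 e" and meet: "e ` (band {0<..<1}) Int B ~= {}"
 shows "e ` (band {0<..<1}) <= B"
proof -
 have arc: "strip_arc B" using M by (simp add: maximal_arc_def)
 have leaf: "e ` (band {s}) : \<L>" if "s : {0<..<1}" for s using e that by (simp add: proper_strip_def)
 let ?O = "{s : {0<..<1}. e (0, s) : B}"
 obtain x s where s: "s : {0<..<1}" "e (x, s) : B" using meet by blast
 have "e ` (band {s}) <= B" using s by (intro strip_arc_saturated[OF arc leaf]) auto
 then have "?O ~= {}" using s(1) by blast
 moreover have "openin (top_of_set {0<..<1}) ?O"
  using strip_trace_open[OF e arc] by (intro open_subset) auto
 moreover have "open ({0<..<1} - ?O)"
  unfolding open_dist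
 proof
  fix s0 assume "s0 : {0<..<1} - ?O"
  then have s0: "s0 : {0<..<1}" "e (0, s0) ~: B" by auto
  obtain eta where eta: "eta > 0" "!!s. s : {0<..<1} ==> \<bar>s - s0\<bar> < eta ==> e (0, s) ~: B"
   using maximal_arc_trace_closed[OF M e s0] by blast
  show "EX eta>0. ALL s. dist s s0 < eta --> s : {0<..<1} - ?O"
   using eta s0(1) by (intro exI[of _ "min eta (min s0 (1 - s0))"]) (auto simp: dist_real_def)
 qed
 then have "closedin (top_of_set {0<..<1}) ?O"
  by (auto simp: closedin_def openin_open_eq)
 ultimately have O: "?O = {0<..<1}"
  using connected_clopen[of "{0<..<1::real}"] by auto
 show ?thesis
 proof clarify
  fix x s :: real assume s: "s : {0<..<1}"
  then have "e (0, s) : B" using O by blast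
  then have "e ` (band {s}) <= B" using s by (intro strip_arc_saturated[OF arc leaf]) auto
  then show "e (x, s) : B" by blast
 qed
qed

lemma maximal_arc_disjoint:
 assumes "maximal_arc B" "maximal_arc B'" "B Int B' ~= {}"
 shows "B = B'"
proof -
 have sub: "B <= B'" if B: "maximal_arc B" "maximal_arc B'" "B Int B' ~= {}" for B B'
 proof -
  obtain h where "pstrip 0 1 h" "B = h ` (band {0<..<1})"
   using B(1) by (auto simp: maximal_arc_def strip_arc_def)
  then show ?thesis using strip_in_or_out_maximal_arc[OF B(2)] B(3) by blast
 qed
 show ?thesis using sub[OF assms] sub[OF assms(2,1)] assms(3) by blast
qed

end

section \<open>Straightening the ends of a strip\<close>

text \<open>For increasing \<open>f\<close> this is the inverse of its restriction to [-1/2, 1/2],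
  continued by the constants -1/2 and 1/2 to all real numbers. The inserted -1/2 is the value for
  \<open>y\<close> below the range, where the set itself would be empty.\<close>

definition clamped_inverse :: "(real => real) => real => real" where
 "clamped_inverse f y = Sup (insert (-1/2) {x : {-1/2..1/2}. f x <= y})"

context
 fixes f :: "real => real"
 assumes cont: "continuous_on {-1/2..1/2} f"
  and mono: "!!x x'. -1/2 <= x ==> x < x' ==> x' <= 1/2 ==> f x < f x'"
begin

lemma clamped_inverse_bdd: "bdd_above (insert (-1/2) {x : {-1/2..1/2}. f x <= y})"
 by (rule bdd_aboveI[of _ "1/2"]) auto

lemma clamped_inverse_bounds: "clamped_inverse f y : {-1/2..1/2}"
proof -
 have "- 1 / 2 <= clamped_inverse f y"
  unfolding clamped_inverse_def using clamped_inverse_bdd by (intro cSup_upper) auto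
 moreover have "clamped_inverse f y <= 1/2"
  unfolding clamped_inverse_def by (intro cSup_least) auto
 ultimately show ?thesis by simp
qed

text \<open>This equivalence and its mirror image translate inequalities for the inverse into
  inequalities for \<open>f\<close>; the continuity of the inverse in a parameter is later read off
  from them.\<close>

lemma clamped_inverse_greater:
 assumes x: "-1/2 <= x" "x < 1/2"
 shows "x < clamped_inverse f y \<longleftrightarrow> f x < y"
proof
 assume "f x < y"
 have "continuous (at x within {-1/2..1/2}) f" using cont x by (simp add: continuous_on_eq_continuous_within)
 then obtain d where d: "d > 0" "ALL x':{-1/2..1/2}. dist x' x < d --> dist (f x') (f x) < y - f x"
  using \<open>f x < y\<close> unfolding continuous_within_eps_delta by (metis diff_gt_0_iff_gt)
 define x' where "x' = min (1/2) (x + d/2)"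
 have x': "x < x'" "x' : {-1/2..1/2}" "dist x' x < d" using x d(1) by (auto simp: x'_def dist_real_def min_def)
 then have "f x' <= y" using d(2) by (force simp: dist_real_def)
 then have "x' <= clamped_inverse f y"
  unfolding clamped_inverse_def using clamped_inverse_bdd x' by (intro cSup_upper) auto
 then show "x < clamped_inverse f y" using x' by simp
next
 assume a: "x < clamped_inverse f y"
 show "f x < y"
 proof (rule ccontr)
  assume "\<not> f x < y"
  have "clamped_inverse f y <= x"
   unfolding clamped_inverse_def
  proof (rule cSup_least)
   fix x' assume "x' : insert (-1/2) {x : {-1/2..1/2}. f x <= y}"
   then show "x' <= x" using x mono[of x x'] \<open>\<not> f x < y\<close> by (cases "x' = -1/2"; cases "x < x'") auto
  qed simp
  with a show False by simp
 qed
qed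

lemma clamped_inverse_less:
 assumes x: "-1/2 < x" "x <= 1/2"
 shows "clamped_inverse f y < x \<longleftrightarrow> y < f x"
proof
 assume a: "clamped_inverse f y < x"
 show "y < f x"
 proof (rule ccontr)
  assume "\<not> y < f x"
  then have "x <= clamped_inverse f y"
   unfolding clamped_inverse_def using clamped_inverse_bdd x by (intro cSup_upper) auto
  with a show False by simp
 qed
next
 assume "y < f x"
 have "continuous (at x within {-1/2..1/2}) f" using cont x by (simp add: continuous_on_eq_continuous_within)
 then obtain d where d: "d > 0" "ALL x':{-1/2..1/2}. dist x' x < d --> dist (f x') (f x) < f x - y"
  using \<open>y < f x\<close> unfolding continuous_within_eps_delta by (metis diff_gt_0_iff_gt)
 define x' where "x' = max (-1/2) (x - d/2)"
 have x': "x' < x" "x' : {-1/2..1/2}" "dist x' x < d" using x d(1) by (auto simp: x'_def dist_real_def max_def)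
 then have fx': "y < f x'" using d(2) by (force simp: dist_real_def)
 have "clamped_inverse f y <= x'"
  unfolding clamped_inverse_def
 proof (rule cSup_least)
  fix x'' assume "x'' : insert (-1/2) {x : {-1/2..1/2}. f x <= y}"
  then show "x'' <= x'" using x' mono[of x' x''] fx' by (cases "x'' = -1/2"; cases "x' < x''") auto
 qed simp
 then show "clamped_inverse f y < x" using x' by simp
qed

lemma clamped_inverse_inverse:
 assumes "x : {-1/2..1/2}"
 shows "clamped_inverse f (f x) = x"
 using clamped_inverse_greater[of x "f x"] clamped_inverse_less[of x "f x"] clamped_inverse_bounds[of "f x"] assms
 by (cases "x = 1/2"; cases "x = -1/2") (auto simp: not_less intro: antisym)

lemma clamped_inverse_interior:
 assumes "-1/2 < clamped_inverse f y" "clamped_inverse f y < 1/2"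
 shows "f (clamped_inverse f y) = y"
 using clamped_inverse_greater[of "clamped_inverse f y" y] clamped_inverse_less[of "clamped_inverse f y" y] assms
 by auto

lemma clamped_inverse_mono:
 assumes "y <= y'"
 shows "clamped_inverse f y <= clamped_inverse f y'"
 unfolding clamped_inverse_def using clamped_inverse_bdd assms by (intro cSup_subset_mono) auto

end

lemma clamped_inverse_clamp:
 fixes f :: "real => real"
 assumes cont: "continuous_on {-1/2..1/2} f" and mono: "!!x x'. -1 < x ==> x < x' ==> x' < 1 ==> f x < f x'"
  and x: "x : {-1<..<1}"
 shows "clamped_inverse f (f x) = max (-1/2) (min (1/2) x)"
proof -
 have mono': "f x < f x'" if "-1/2 <= x" "x < x'" "x' <= 1/2" for x x' using mono that by auto
 note facts = clamped_inverse_bounds[of f, OF cont mono'] clamped_inverse_inverse[of f, OF cont mono']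
  clamped_inverse_greater[of f, OF cont mono'] clamped_inverse_less[of f, OF cont mono']
 consider "x < -1/2" | "x > 1/2" | "x : {-1/2..1/2}" by force
 then show ?thesis
 proof cases
  case 1
  then have "f x < f (-1/2)" using mono[of x "-1/2"] x by auto
  then have "\<not> - 1 / 2 < clamped_inverse f (f x)" using facts(3)[of "-1/2" "f x"] by auto
  then show ?thesis using facts(1)[of "f x"] 1 by auto
 next
  case 2
  then have "f (1/2) < f x" using mono[of "1/2" x] x by auto
  then have "\<not> clamped_inverse f (f x) < 1 / 2" using facts(4)[of "1/2" "f x"] by auto
  then show ?thesis using facts(1)[of "f x"] 2 by auto
 next
  case 3
  then show ?thesis using facts(2)[of x] by auto
 qed
qed

section \<open>Half boxes at a base point\<close>

definition hbox :: "real => real => (real \<times> real) set" where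
 "hbox x delta = {x - delta<..<x + delta} \<times> {0..<delta}"

definition hbox_pos :: "real => real => (real \<times> real) set" where
 "hbox_pos x delta = {x - delta<..<x + delta} \<times> {0<..<delta}"

abbreviation half_square :: "(real \<times> real) set" where "half_square \<equiv> {-1<..<1} \<times> {0..<1}"
abbreviation half_square_pos :: "(real \<times> real) set" where "half_square_pos \<equiv> {-1<..<1} \<times> {0<..<1}"

lemma hbox_mono: "delta <= delta' ==> hbox x delta <= hbox x delta'" "delta <= delta' ==> hbox_pos x delta <= hbox_pos x delta'"
 by (auto simp: hbox_def hbox_pos_def)

lemma hbox_pos_subset: "hbox_pos x delta <= hbox x delta"
 by (auto simp: hbox_def hbox_pos_def)

lemma hbox_pos_in_half_square:
 assumes "hbox x delta <= half_square"
 shows "hbox_pos x delta <= half_square_pos"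
proof
 fix p assume p: "p : hbox_pos x delta"
 then have "p : half_square" using assms hbox_pos_subset by blast
 moreover have "snd p > 0" using p by (auto simp: hbox_pos_def)
 ultimately show "p : half_square_pos" by (cases p) auto
qed

lemma hbox_center: "delta > 0 ==> (x, 0) : hbox x delta"
 by (auto simp: hbox_def)

lemma connected_hbox_pos: "connected (hbox_pos x delta)"
 unfolding hbox_pos_def by (intro connected_Times) auto

lemma hbox_in_open:
 assumes T: "open T" "(x, 0) : T" and x: "x : {-1<..<1}"
 obtains delta where "delta > 0" "hbox x delta <= half_square" "hbox x delta <= T"
proof -
 obtain r where r: "r > 0" "ball (x, 0) r <= T" using T open_contains_ball by blast
 define delta where "delta = min (r / 2) (1 - \<bar>x\<bar>)"
 have "delta > 0" using r(1) x by (auto simp: delta_def)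
 moreover have "delta <= r / 2" unfolding delta_def by (rule min.cobounded1)
 moreover have "delta <= 1 - \<bar>x\<bar>" unfolding delta_def by (rule min.cobounded2)
 ultimately have delta: "delta > 0" "delta <= r / 2" "delta <= 1 - \<bar>x\<bar>" by blast+
 have "p : T" if p: "p : hbox x delta" for p
 proof -
  obtain y s where ys: "p = (y, s)" "\<bar>y - x\<bar> < delta" "0 <= s" "s < delta"
   using p by (auto simp: hbox_def abs_less_iff)
  have "dist (x, 0) (y, s) <= \<bar>x - y\<bar> + \<bar>0 - s\<bar>"
   unfolding dist_Pair_Pair dist_real_def by (rule sqrt_sum_squares_le_sum) auto
  also have "\<dots> < r" using ys delta by linarith
  finally show ?thesis using r(2) ys(1) by auto
 qed
 moreover have "hbox x delta <= half_square" using delta by (auto simp: hbox_def)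
 ultimately show thesis using that delta(1) by blast
qed

lemma hbox_in_preimage:
 assumes b: "continuous_map (top_of_set half_square) X b" and V: "openin X V" "b (x, 0) : V"
  and x: "x : {-1<..<1}"
 obtains delta where "delta > 0" "hbox x delta <= half_square" "b ` hbox x delta <= V"
proof -
 have "openin (top_of_set half_square) {p : half_square. b p : V}"
  using openin_continuous_map_preimage[OF b V(1)] by simp
 then obtain T where T: "open T" "{p : half_square. b p : V} = half_square Int T"
  by (auto simp: openin_open)
 then have "(x, 0) : T" using V x by auto
 from hbox_in_open[OF T(1) this x] obtain delta where delta: "delta > 0" "hbox x delta <= half_square" "hbox x delta <= T" .
 then show thesis using T(2) by (intro that[of delta]) auto
qed

section \<open>All charts at the ends of one strip\<close>

text \<open>One strip \<open>h\<close> together with all half charts \<open>b j\<close> whose open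
  halves lie in it; \<open>W\<close> is the union of the cut leaves, which carry the bases. The
  chart is attached at the end \<open>e j\<close> of the strip, reaches up to distance
  \<open>eps j\<close> from it, and \<open>1 - 2 * e j\<close> is the inward direction. Heights are
  linear in \<open>s\<close>, so charts at the same end are compared at equal heights by rescaling
  \<open>s\<close>.\<close>

locale arc_ends =
 fixes X :: "'a topology" and W :: "'a set" and h :: "real \<times> real => 'a" and I :: "nat set"
  and b :: "nat => real \<times> real => 'a" and U :: "nat => 'a set"
  and xi :: "nat => real => real => real" and e eps :: "nat => real"
 assumes hausdorff: "Hausdorff_space X"
  and h_inj: "inj_on h (band {0<..<1})"
  and b_homeo: "!!j. j : I ==> homeomorphic_map (top_of_set half_square) (subtopology X (b j ` half_square)) (b j)"
  and b_cont: "!!j. j : I ==> continuous_map (top_of_set half_square) X (b j)"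
  and U_open: "!!j. j : I ==> openin X (U j)"
  and b_U: "!!j. j : I ==> b j ` half_square <= U j"
  and U_W: "!!j. j : I ==> U j Int W = b j ` ({-1<..<1} \<times> {0})"
  and b_W: "!!j. j : I ==> b j ` half_square_pos Int W = {}"
  and b_open: "!!j. j : I ==> openin X (b j ` half_square_pos)"
  and rest_open: "!!j. j : I ==> openin X (U j - W - b j ` half_square_pos)"
  and xi_cont: "!!j. j : I ==> continuous_on half_square_pos (%(x, s). xi j x s)"
  and xi_mono: "!!j x x' s. j : I ==> s : {0<..<1} ==> -1 < x ==> x < x' ==> x' < 1 ==> xi j x s < xi j x' s"
  and e01: "!!j. j : I ==> e j = 0 \<or> e j = 1"
  and eps01: "!!j. j : I ==> 0 < eps j" "!!j. j : I ==> eps j <= 1"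
  and coords: "!!j x s. j : I ==> x : {-1<..<1} ==> s : {0<..<1} ==>
    b j (x, s) = h (xi j x s, e j + (1 - 2 * e j) * eps j * s)"
begin

definition tau :: "nat => real => real" where "tau j s = e j + (1 - 2 * e j) * eps j * s"

lemma tau_01: "j : I ==> s : {0<..<1} ==> tau j s : {0<..<1}"
proof -
 assume j: "j : I" and s: "s : {0<..<1}"
 have "0 < eps j * s" "eps j * s < 1"
  using eps01[OF j] s mult_le_less_imp_less[of "eps j" 1 s 1] by auto
 then show ?thesis using e01[OF j] by (auto simp: tau_def)
qed

lemma tau_0: "tau j 0 = e j" by (simp add: tau_def)

lemma tau_dist: "j : I ==> 0 <= s ==> \<bar>tau j s - e j\<bar> = eps j * s"
 using e01[of j] eps01[of j] by (auto simp: tau_def abs_mult)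

lemma b_eq: "j : I ==> (x, s) : half_square_pos ==> b j (x, s) = h (xi j x s, tau j s)"
 using coords by (simp add: tau_def)

lemma b_inj: "j : I ==> inj_on (b j) half_square"
 using homeomorphic_imp_injective_map[OF b_homeo] by auto

lemma b_coords_eq:
 assumes "j : I" "k : I" "(x, s) : half_square_pos" "(x', s') : half_square_pos" "b j (x, s) = b k (x', s')"
 shows "xi j x s = xi k x' s'" "tau j s = tau k s'"
proof -
 have "(xi j x s, tau j s) = (xi k x' s', tau k s')"
  by (rule inj_onD[OF h_inj]) (use assms b_eq tau_01 in auto)
 then show "xi j x s = xi k x' s'" "tau j s = tau k s'" by auto
qed

text \<open>A small half box without its base is connected and lies in \<open>U n\<close> minus
  \<open>W\<close>, which is covered by two disjoint open sets: the open half chart and the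
  remainder.\<close>

lemma germ_in_or_out:
 assumes j: "j : I" and n: "n : I" and x: "x : {-1<..<1}" and in_U: "b j (x, 0) : U n"
 obtains delta where "delta > 0" "hbox x delta <= half_square" "b j ` hbox x delta <= U n"
  "b j ` hbox_pos x delta <= b n ` half_square_pos \<or> b j ` hbox_pos x delta Int b n ` half_square_pos = {}"
proof -
 obtain delta where delta: "delta > 0" "hbox x delta <= half_square" "b j ` hbox x delta <= U n"
  using hbox_in_preimage[OF b_cont[OF j] U_open[OF n] in_U x] .
 have sub: "hbox_pos x delta <= half_square_pos" using delta(2) by (rule hbox_pos_in_half_square)
 have "connectedin (top_of_set half_square) (hbox_pos x delta)"
  using connected_hbox_pos[of x delta] delta(2) hbox_pos_subset[of x delta] by (auto simp: connectedin_subtopology)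
 then have c: "connectedin X (b j ` hbox_pos x delta)"
  by (rule connectedin_continuous_map_image[OF b_cont[OF j]])
 have "b j ` hbox_pos x delta <= U n - W"
  using delta(3) hbox_pos_subset[of x delta] b_W[OF j] sub by blast
 then have "b j ` hbox_pos x delta <= b n ` half_square_pos Un (U n - W - b n ` half_square_pos)" by blast
 then have "b j ` hbox_pos x delta <= b n ` half_square_pos \<or> b j ` hbox_pos x delta Int b n ` half_square_pos = {}"
  using connectedinD[OF c b_open[OF n] rest_open[OF n]] by blast
 then show thesis using that delta by blast
qed

definition same_germ :: "nat => real => nat => real => bool" where
 "same_germ k x j x' \<longleftrightarrow> b k (x, 0) = b j (x', 0) & (EX delta>0. hbox x' delta <= half_square & b j ` hbox_pos x' delta <= b k ` half_square_pos)"

text \<open>Distinct base points are separated by the Hausdorff property. At a common base point a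
  germ that is not inside the other half chart is disjoint from it.\<close>

lemma germ_dichotomy:
 assumes k: "k : I" and j: "j : I" and x: "x : {-1<..<1}" and x': "x' : {-1<..<1}" and ns: "\<not> same_germ k x j x'"
 obtains delta where "delta > 0" "hbox x delta <= half_square" "hbox x' delta <= half_square"
  "b k ` hbox_pos x delta Int b j ` hbox_pos x' delta = {}"
proof (cases "b k (x, 0) = b j (x', 0)")
 case True
 have "b j (x', 0) : U k" using b_U[OF k] x True by force
 from germ_in_or_out[OF j k x' this] obtain delta where delta: "delta > 0" "hbox x' delta <= half_square"
  "b j ` hbox_pos x' delta <= b k ` half_square_pos \<or> b j ` hbox_pos x' delta Int b k ` half_square_pos = {}" .
 then have disj: "b j ` hbox_pos x' delta Int b k ` half_square_pos = {}"
  using ns True unfolding same_germ_def by blast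
 obtain delta' where delta': "delta' > 0" "hbox x delta' <= half_square" using hbox_in_open[OF open_UNIV _ x] by blast
 let ?d = "min delta delta'"
 have sub: "hbox_pos x ?d <= half_square_pos"
  using delta'(2) hbox_mono(1)[of ?d delta' x] by (intro hbox_pos_in_half_square) auto
 show thesis
 proof (rule that[of ?d])
  show "hbox x ?d <= half_square" "hbox x' ?d <= half_square"
   using delta(2) delta'(2) hbox_mono(1)[of ?d delta x'] hbox_mono(1)[of ?d delta' x] by auto
  show "b k ` hbox_pos x ?d Int b j ` hbox_pos x' ?d = {}"
   using disj sub hbox_mono(2)[of ?d delta x'] by auto
 qed (use delta delta' in auto)
next
 case False
 have "b k (x, 0) : topspace X" "b j (x', 0) : topspace X"
  using continuous_map_image_subset_topspace[OF b_cont[OF k]] continuous_map_image_subset_topspace[OF b_cont[OF j]] x x'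
  by force+
 then obtain V V' where V: "openin X V" "openin X V'" "b k (x, 0) : V" "b j (x', 0) : V'" "disjnt V V'"
  using hausdorff False unfolding Hausdorff_space_def by metis
 obtain delta where delta: "delta > 0" "hbox x delta <= half_square" "b k ` hbox x delta <= V"
  using hbox_in_preimage[OF b_cont[OF k] V(1,3) x] .
 obtain delta' where delta': "delta' > 0" "hbox x' delta' <= half_square" "b j ` hbox x' delta' <= V'"
  using hbox_in_preimage[OF b_cont[OF j] V(2,4) x'] .
 let ?d = "min delta delta'"
 have sub: "hbox_pos x ?d <= hbox x delta" "hbox_pos x' ?d <= hbox x' delta'"
  using hbox_pos_subset[of x ?d] hbox_pos_subset[of x' ?d] hbox_mono(1)[of ?d delta x] hbox_mono(1)[of ?d delta' x'] by auto
 show thesis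
 proof (rule that[of ?d])
  show "hbox x ?d <= half_square" "hbox x' ?d <= half_square"
   using delta(2) delta'(2) hbox_mono(1)[of ?d delta' x'] hbox_mono(1)[of ?d delta x] by auto
  show "b k ` hbox_pos x ?d Int b j ` hbox_pos x' ?d = {}"
  proof -
   have "b k ` hbox_pos x ?d <= V" "b j ` hbox_pos x' ?d <= V'" using sub delta(3) delta'(3) by blast+
   then show ?thesis using V(5) by (auto simp: disjnt_def)
  qed
 qed (use delta delta' in auto)
qed

end

lemma eventually_hbox_pos:
 assumes "delta > 0"
 shows "eventually (%p. p : hbox_pos x delta) (at (x, 0) within half_square_pos)"
 unfolding eventually_at_topological
proof (intro exI conjI ballI impI)
 show "open ({x - delta<..<x + delta} \<times> {-delta<..<delta})" by (intro open_Times) auto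
qed (use assms in \<open>auto simp: hbox_pos_def\<close>)

lemma at_half_square_nontrivial:
 fixes x :: real
 assumes "x : {-1<..<1}"
 shows "at (x, 0) within half_square_pos ~= bot"
proof -
 have "half_square_pos - {(x, 0)} = half_square_pos" by auto
 moreover have "(x, 0) : closure half_square_pos"
  using assms by (simp add: closure_Times)
 ultimately show ?thesis by (simp add: at_within_eq_bot_iff)
qed

text \<open>The limits are taken through all points of the open half square, not only vertically. A
  base value is therefore a limit of interior values near it, and an estimate around one base point
  passes to the neighbouring base points.\<close>

lemma continuous_extension_to_base:
 fixes F :: "real \<times> real => real" and g :: "real => real"
 assumes F: "continuous_on ({-a<..<a} \<times> {0<..<1}) F" and a: "a <= 1"
  and lim: "!!x. x : {-a<..<a} ==> (F \<longlongrightarrow> g x) (at (x, 0) within half_square_pos)"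
 shows "continuous_on ({-a<..<a} \<times> {0..<1}) (%p. if snd p > 0 then F p else g (fst p))" (is "continuous_on _ ?G")
 unfolding continuous_on_iff
proof (intro ballI allI impI)
 fix p :: "real \<times> real" and r :: real assume p: "p : {-a<..<a} \<times> {0..<1}" and r: "r > 0"
 obtain x s where xs: "p = (x, s)" "x : {-a<..<a}" "s : {0..<1}" using p by (cases p) auto
 show "EX d>0. ALL p':{-a<..<a} \<times> {0..<1}. dist p' p < d --> dist (?G p') (?G p) < r"
 proof (cases "s = 0")
  case False
  then have sp: "s > 0" using xs by auto
  then obtain d where d: "d > 0" "ALL p':{-a<..<a} \<times> {0<..<1}. dist p' p < d --> dist (F p') (F p) < r"
   using F r xs unfolding continuous_on_iff by (metis SigmaI atLeastLessThan_iff greaterThanLessThan_iff)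
  show ?thesis
  proof (intro exI[of _ "min d s"] conjI ballI impI)
   fix p' assume p': "p' : {-a<..<a} \<times> {0..<1}" "dist p' p < min d s"
   have "dist (snd p') (snd p) <= dist p' p" by (rule dist_snd_le)
   then have "snd p' > 0" using p'(2) xs by (auto simp: dist_real_def)
   then show "dist (?G p') (?G p) < r" using d(2)[rule_format, of p'] p' xs sp by auto
  qed (use d sp in auto)
 next
  case True
  have "eventually (%q. dist (F q) (g x) < r / 2) (at (x, 0) within half_square_pos)"
   using lim[OF xs(2)] r by (intro tendstoD) auto
  then obtain d where d: "d > 0" "!!q. q : half_square_pos ==> q ~= (x, 0) ==> dist q (x, 0) < d ==> dist (F q) (g x) < r / 2"
   unfolding eventually_at by blast
  show ?thesis
  proof (intro exI[of _ d] conjI ballI impI)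
   fix p' assume p': "p' : {-a<..<a} \<times> {0..<1}" "dist p' p < d"
   show "dist (?G p') (?G p) < r"
   proof (cases "snd p' > 0")
    case True
    then have "p' : half_square_pos" "p' ~= (x, 0)" using p'(1) a by (cases p', auto)+
    then have "dist (F p') (g x) < r / 2" using d(2) p'(2) xs \<open>s = 0\<close> by blast
    then show ?thesis using True xs \<open>s = 0\<close> r by simp
   next
    case False
    then obtain x' where x': "p' = (x', 0)" "x' : {-a<..<a}" using p'(1) by (cases p') auto
    have "dist (g x') (g x) <= r / 2"
    proof (rule tendsto_le)
     show "at (x', 0) within half_square_pos ~= bot" using x' a by (intro at_half_square_nontrivial) auto
     show "((%q. dist (F q) (g x)) \<longlongrightarrow> dist (g x') (g x)) (at (x', 0) within half_square_pos)"
      by (intro tendsto_intros lim x'(2))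
     show "((%q. r / 2) \<longlongrightarrow> r / 2) (at (x', 0) within half_square_pos)" by simp
     have "eventually (%q. q : ball (x, 0) d) (at (x', 0) within half_square_pos)"
      using p' x' xs \<open>s = 0\<close> by (intro eventually_at_topological[THEN iffD2] exI[of _ "ball (x, 0) d"])
       (auto simp: dist_commute)
     moreover have "eventually (%q. q : half_square_pos) (at (x', 0) within half_square_pos)"
      by (simp add: eventually_at_filter)
     ultimately show "eventually (%q. dist (F q) (g x) <= r / 2) (at (x', 0) within half_square_pos)"
     proof eventually_elim
      case (elim q)
      then have "q ~= (x, 0)" "dist q (x, 0) < d" by (auto simp: dist_commute)
      then show ?case using d(2)[of q] elim by auto
     qed
    qed
    then show ?thesis using x' xs \<open>s = 0\<close> r by simp
   qed
  qed (use d in auto)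
 qed
qed

lemma tendsto_geometric_suminf:
 fixes a :: "nat => 'b => real"
 assumes "F ~= bot" and lim: "!!n. (a n \<longlongrightarrow> v n) F" and bound: "eventually (%p. ALL n. \<bar>a n p\<bar> <= 1) F"
 shows "((%p. \<Sum>n. (1/2) ^ n * a n p) \<longlongrightarrow> (\<Sum>n. (1/2) ^ n * v n)) F"
proof -
 have "((%p. \<Sum>n. (1/2) ^ n * a n p) \<longlongrightarrow> (\<Sum>n. (1/2) ^ n * v n)) F"
 proof (rule tannerys_theorem[THEN conjunct2, THEN conjunct2])
  show "((%p. (1/2) ^ n * a n p) \<longlongrightarrow> (1/2) ^ n * v n) F" for n
   by (intro tendsto_intros lim)
  have *: "norm ((1/2) ^ n * a n p) <= (1/2) ^ n" if "\<bar>a n p\<bar> <= 1" for n p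
   using mult_left_mono[OF that, of "(1/2) ^ n"] by (simp add: abs_mult)
  show "\<forall>\<^sub>F (k, n) in at_top \<times>\<^sub>F F. norm ((1 / 2) ^ k * a k n) <= (1 / 2) ^ k"
   by (rule eventually_mono[OF eventually_prodI[OF always_eventually bound]]) (use * in \<open>auto simp: case_prod_unfold\<close>)
  show "summable (%n. (1/2) ^ n :: real)" by (intro summable_geometric) auto
 qed fact
 then show ?thesis .
qed

lemma summable_geometric_bounded:
 fixes a :: "nat => real"
 assumes "!!n. \<bar>a n\<bar> <= 1"
 shows "summable (%n. (1/2) ^ n * a n)"
proof (rule summable_comparison_test')
 show "summable (%n. (1/2) ^ n :: real)" by (intro summable_geometric) auto
 show "norm ((1/2) ^ n * a n) <= (1/2) ^ n" if "n \<ge> 0" for n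
  using mult_left_mono[OF assms[of n], of "(1/2) ^ n"] by (simp add: abs_mult)
qed

text \<open>All terms of the difference are nonnegative, so a single one bounds it from below. This
  is how the contribution of one chart survives in the limit at an end.\<close>

lemma suminf_geometric_diff_ge:
 fixes a a' :: "nat => real"
 assumes "!!n. \<bar>a n\<bar> <= 1" "!!n. \<bar>a' n\<bar> <= 1" "!!n. a n <= a' n"
 shows "(1/2) ^ j * (a' j - a j) <= (\<Sum>n. (1/2) ^ n * a' n) - (\<Sum>n. (1/2) ^ n * a n)"
proof -
 have s: "summable (%n. (1/2) ^ n * a n)" "summable (%n. (1/2) ^ n * a' n)"
  using assms by (intro summable_geometric_bounded; simp)+
 have "(1/2) ^ j * a' j - (1/2) ^ j * a j <= (\<Sum>n. (1/2) ^ n * a' n - (1/2) ^ n * a n)"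
  using sum_le_suminf[OF summable_diff[OF s(2,1)], of "{j}"] assms(3)
  by (simp add: mult_left_mono)
 then show ?thesis using suminf_diff[OF s(2,1)] by (simp add: right_diff_distrib)
qed

context arc_ends
begin

section \<open>The mass of a line inside the charts\<close>

definition cinv :: "nat => real => real => real" where
 "cinv n y s = clamped_inverse (%x. xi n x s) y"

text \<open>A cutoff in the height: 1/2 at the end \<open>e n\<close>, falling linearly to 0 halfway
  up the chart. It vanishes before the chart stops, so that masses can be continued by 0 beyond
  it.\<close>

definition theta :: "nat => real => real" where
 "theta n t = (if n : I then max 0 (1/2 - \<bar>t - e n\<bar> / eps n) else 0)"

text \<open>The part of the core of chart n to the left of \<open>y\<close> on the line at height
  \<open>t\<close>, measured in the chart coordinate and weighted by the cutoff. The shift by 1/2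
  makes it start at 0. For heights in (0, 1) the guard keeps the level passed to \<open>cinv\<close>
  inside (0, 1).\<close>

definition box_mass :: "nat => real => real => real" where
 "box_mass n y t = (if n : I & \<bar>t - e n\<bar> < eps n then theta n t * (cinv n y (\<bar>t - e n\<bar> / eps n) + 1/2) else 0)"

lemma xi_cont_fst: "n : I ==> s : {0<..<1} ==> continuous_on {-1<..<1} (%x. xi n x s)"
proof -
 assume n: "n : I" and s: "s : {0<..<1}"
 have "continuous_on {-1<..<1} (%x. case (x, s) of (x, s) => xi n x s)"
  by (rule continuous_on_compose2[OF xi_cont[OF n]]) (use s in \<open>auto intro!: continuous_on_Pair continuous_on_id continuous_on_const\<close>)
 then show ?thesis by simp
qed

lemma xi_cont_snd: "n : I ==> x : {-1<..<1} ==> continuous_on {0<..<1} (%s. xi n x s)"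
proof -
 assume n: "n : I" and x: "x : {-1<..<1}"
 have "continuous_on {0<..<1} (%s. case (x, s) of (x, s) => xi n x s)"
  by (rule continuous_on_compose2[OF xi_cont[OF n]]) (use x in \<open>auto intro!: continuous_on_Pair continuous_on_id continuous_on_const\<close>)
 then show ?thesis by simp
qed

lemma xi_core:
 assumes "n : I" "s : {0<..<1}"
 shows "continuous_on {-1/2..1/2} (%x. xi n x s)"
  and "!!x x'. -1/2 <= x ==> x < x' ==> x' <= 1/2 ==> xi n x s < xi n x' s"
proof -
 show "continuous_on {-1/2..1/2} (%x. xi n x s)"
  by (rule continuous_on_subset[OF xi_cont_fst[OF assms]]) auto
 show "!!x x'. -1/2 <= x ==> x < x' ==> x' <= 1/2 ==> xi n x s < xi n x' s"
  by (rule xi_mono[OF assms]) auto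
qed

lemma cinv_bounds:
 assumes "n : I" "s : {0<..<1}"
 shows "-1/2 <= cinv n y s" "cinv n y s <= 1/2"
 using clamped_inverse_bounds[of "%x. xi n x s" y, OF xi_core[OF assms]] unfolding cinv_def by auto

text \<open>A bound for the inverse inside [-1/2, 1/2] amounts to a strict inequality between
  continuous functions of the parameters and is therefore stable; bounds outside this interval hold
  everywhere.\<close>

lemma cinv_continuous:
 assumes n: "n : I"
 shows "continuous_on (band {0<..<1}) (%(y, s). cinv n y s)"
 unfolding continuous_on_def
proof
 fix p :: "real \<times> real" assume p: "p : band {0<..<1}"
 let ?F = "at p within band {0<..<1}"
 have inS: "eventually (%q. snd q : {0<..<1}) ?F"
  unfolding eventually_at_filter by (rule always_eventually) auto
 have s: "snd p : {0<..<1}" using p by auto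
 have lim: "((%q. fst q - xi n a (snd q)) \<longlongrightarrow> fst p - xi n a (snd p)) ?F" if "a : {-1<..<1}" for a
 proof -
  have "continuous_on (band {0<..<1}) (%q. fst q - xi n a (snd q))"
   by (intro continuous_intros continuous_on_compose2[OF xi_cont_snd[OF n that]]) auto
  then show ?thesis using p unfolding continuous_on_def by blast
 qed
 have "((%q. cinv n (fst q) (snd q)) \<longlongrightarrow> cinv n (fst p) (snd p)) ?F"
 proof (rule order_tendstoI)
  fix a assume a: "a < cinv n (fst p) (snd p)"
  show "eventually (%q. a < cinv n (fst q) (snd q)) ?F"
  proof (cases "a < -1/2")
   case True
   show ?thesis using inS
   proof eventually_elim
    case (elim q)
    then show ?case using cinv_bounds(1)[OF n elim, of "fst q"] True by linarith
   qed
  next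
   case False
   then have a2: "-1/2 <= a" "a < 1/2" using a cinv_bounds(2)[OF n s, of "fst p"] by auto
   then have "0 < fst p - xi n a (snd p)"
    using clamped_inverse_greater[of "%x. xi n x (snd p)" a "fst p", OF xi_core[OF n s]] a by (simp add: cinv_def)
   moreover have "a : {-1<..<1}" using a2 by auto
   ultimately have "eventually (%q. 0 < fst q - xi n a (snd q)) ?F"
    using lim order_tendstoD(1) by blast
   with inS show ?thesis
   proof eventually_elim
    case (elim q)
    then show ?case
     using clamped_inverse_greater[of "%x. xi n x (snd q)" a "fst q", OF xi_core[OF n elim(1)]] a2
     by (simp add: cinv_def)
   qed
  qed
 next
  fix a assume a: "cinv n (fst p) (snd p) < a"
  show "eventually (%q. cinv n (fst q) (snd q) < a) ?F"
  proof (cases "a > 1/2")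
   case True
   show ?thesis using inS
   proof eventually_elim
    case (elim q)
    then show ?case using cinv_bounds(2)[OF n elim, of "fst q"] True by linarith
   qed
  next
   case False
   then have a2: "-1/2 < a" "a <= 1/2" using a cinv_bounds(1)[OF n s, of "fst p"] by auto
   then have "fst p - xi n a (snd p) < 0"
    using clamped_inverse_less[of "%x. xi n x (snd p)" a "fst p", OF xi_core[OF n s]] a by (simp add: cinv_def)
   moreover have "a : {-1<..<1}" using a2 by auto
   ultimately have "eventually (%q. fst q - xi n a (snd q) < 0) ?F"
    using lim order_tendstoD(2) by blast
   with inS show ?thesis
   proof eventually_elim
    case (elim q)
    then show ?case
     using clamped_inverse_less[of "%x. xi n x (snd q)" a "fst q", OF xi_core[OF n elim(1)]] a2
     by (simp add: cinv_def)
   qed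
  qed
 qed
 then show "((%(y, s). cinv n y s) \<longlongrightarrow> (case p of (y, s) => cinv n y s)) ?F"
  by (simp add: case_prod_unfold)
qed

lemma theta_bounds: "0 <= theta n t" "theta n t <= 1/2"
 using eps01[of n] divide_nonneg_pos[of "\<bar>t - e n\<bar>" "eps n"] by (auto simp: theta_def max_def)

lemma theta_continuous: "continuous_on S (theta n)"
 unfolding theta_def using eps01[of n] by (cases "n : I") (auto intro!: continuous_intros)

lemma level_01:
 assumes "n : I" "t : {0<..<1}" "\<bar>t - e n\<bar> < eps n"
 shows "\<bar>t - e n\<bar> / eps n : {0<..<1}"
 using assms e01[of n] eps01[of n] by auto

lemma box_mass_bounds:
 assumes "t : {0<..<1}"
 shows "0 <= box_mass n y t" "box_mass n y t <= theta n t"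
proof -
 have "0 <= box_mass n y t & box_mass n y t <= theta n t"
 proof (cases "n : I & \<bar>t - e n\<bar> < eps n")
  case True
  then have "cinv n y (\<bar>t - e n\<bar> / eps n) + 1/2 : {0..1}"
   using cinv_bounds[of n "\<bar>t - e n\<bar> / eps n" y] level_01[of n t] assms by auto
  then show ?thesis using True theta_bounds[of n t] mult_left_le[of _ "theta n t"] by (auto simp: box_mass_def)
 qed (use theta_bounds in \<open>auto simp: box_mass_def\<close>)
 then show "0 <= box_mass n y t" "box_mass n y t <= theta n t" by auto
qed

lemma box_mass_abs: "t : {0<..<1} ==> \<bar>box_mass n y t\<bar> <= 1"
 using box_mass_bounds[of t n y] theta_bounds[of n t] by auto

lemma box_mass_mono:
 assumes "t : {0<..<1}" "y <= y'"
 shows "box_mass n y t <= box_mass n y' t"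
proof (cases "n : I & \<bar>t - e n\<bar> < eps n")
 case True
 then have "cinv n y (\<bar>t - e n\<bar> / eps n) <= cinv n y' (\<bar>t - e n\<bar> / eps n)"
  unfolding cinv_def using level_01[of n t] assms
  by (intro clamped_inverse_mono xi_core) auto
 then show ?thesis using True theta_bounds[of n t] by (auto simp: box_mass_def intro!: mult_left_mono)
qed (auto simp: box_mass_def)

text \<open>The formula is continuous below the top of the chart, and the value is 0 above half its
  height; these two relatively open regions overlap and cover all heights in (0, 1).\<close>

lemma box_mass_continuous: "continuous_on (band {0<..<1}) (%(y, t). box_mass n y t)"
proof (cases "n : I")
 case n: True
 let ?A = "UNIV \<times> ({0<..<1} Int {t. \<bar>t - e n\<bar> < eps n}) :: (real \<times> real) set"
 let ?B = "UNIV \<times> ({0<..<1} Int {t. eps n / 2 < \<bar>t - e n\<bar>}) :: (real \<times> real) set"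
 have o: "open {t. \<bar>t - e n\<bar> < eps n}" "open {t. eps n / 2 < \<bar>t - e n\<bar>}"
  by (intro open_Collect_less continuous_intros)+
 have cA: "continuous_on ?A (%p. theta n (snd p) * (cinv n (fst p) (\<bar>snd p - e n\<bar> / eps n) + 1/2))"
 proof -
  have "continuous_on ?A (%p. case (fst p, \<bar>snd p - e n\<bar> / eps n) of (y, s) => cinv n y s)"
   using level_01[OF n] eps01[OF n]
   by (intro continuous_on_compose2[OF cinv_continuous[OF n]] continuous_intros) auto
  then show ?thesis
   by (intro continuous_intros continuous_on_compose2[OF theta_continuous[of UNIV]]) (auto simp: case_prod_unfold)
 qed
 have "continuous_on ?A (%(y, t). box_mass n y t)"
  by (rule continuous_on_eq[OF cA]) (use n in \<open>auto simp: box_mass_def\<close>)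
 moreover have "continuous_on ?B (%(y, t). box_mass n y t)"
 proof (rule continuous_on_eq[of _ "%_. 0"])
  fix p assume "p : ?B"
  then have "theta n (snd p) = 0" using eps01[OF n] n by (auto simp: theta_def max_def field_simps)
  then show "0 = (case p of (y, t) => box_mass n y t)" by (auto simp: box_mass_def case_prod_unfold)
 qed simp
 ultimately have "continuous_on (?A Un ?B) (%(y, t). box_mass n y t)"
  using o by (intro continuous_on_open_Un open_Times open_Int) auto
 moreover have "?A Un ?B = band {0<..<1}" using eps01[OF n] by auto
 ultimately show ?thesis by simp
qed (simp add: box_mass_def)

text \<open>In the chart's own coordinates the strip coordinate cancels. The right-hand side is
  continuous up to \<open>s = 0\<close>, however \<open>xi\<close> behaves there.\<close>

lemma box_mass_own:
 assumes j: "j : I" and p: "(x, s) : half_square_pos"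
 shows "box_mass j (xi j x s) (tau j s) = max 0 (1/2 - s) * (max (-1/2) (min (1/2) x) + 1/2)"
proof -
 have s: "s : {0<..<1}" "x : {-1<..<1}" using p by auto
 have d: "\<bar>tau j s - e j\<bar> / eps j = s" using tau_dist[OF j, of s] s eps01[OF j] by simp
 have "\<bar>tau j s - e j\<bar> < eps j" using tau_dist[OF j, of s] s eps01[OF j] by simp
 moreover have "cinv j (xi j x s) s = max (-1/2) (min (1/2) x)"
  unfolding cinv_def by (rule clamped_inverse_clamp) (use xi_core[OF j s(1)] xi_mono[OF j s(1)] s in auto)
 ultimately show ?thesis using j d by (simp add: box_mass_def theta_def)
qed

lemma box_mass_limits:
 assumes t: "t : {0<..<1}"
 shows "((%y. box_mass n y t) \<longlongrightarrow> 0) at_bot" and "((%y. box_mass n y t) \<longlongrightarrow> theta n t) at_top"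
proof -
 have "((%y. box_mass n y t) \<longlongrightarrow> 0) at_bot & ((%y. box_mass n y t) \<longlongrightarrow> theta n t) at_top"
 proof (cases "n : I & \<bar>t - e n\<bar> < eps n")
  case True
  let ?s = "\<bar>t - e n\<bar> / eps n"
  have s: "?s : {0<..<1}" using level_01 True t by auto
  have n: "n : I" using True by simp
  have lo: "cinv n y ?s = -1/2" if "y <= xi n (-1/2) ?s" for y
   using clamped_inverse_greater[of "%x. xi n x ?s" "-1/2" y, OF xi_core[OF n s]] cinv_bounds[OF n s, of y] that
   by (auto simp: cinv_def)
  have hi: "cinv n y ?s = 1/2" if "y \<ge> xi n (1/2) ?s" for y
   using clamped_inverse_less[of "%x. xi n x ?s" "1/2" y, OF xi_core[OF n s]] cinv_bounds[OF n s, of y] that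
   by (auto simp: cinv_def)
  have "eventually (%y. 0 = box_mass n y t) at_bot"
   using eventually_le_at_bot[of "xi n (-1/2) ?s"]
  proof eventually_elim
   case (elim y)
   show ?case using True lo[OF elim] by (simp add: box_mass_def)
  qed
  moreover have "eventually (%y. theta n t = box_mass n y t) at_top"
   using eventually_ge_at_top[of "xi n (1/2) ?s"]
  proof eventually_elim
   case (elim y)
   have "box_mass n y t = theta n t * (1/2 + 1/2)" using True hi[OF elim] unfolding box_mass_def by presburger
   then show ?case by simp
  qed
  ultimately show ?thesis by (intro conjI Lim_transform_eventually[OF tendsto_const])
 next
  case False
  then have "theta n t = 0" using eps01[of n] by (auto simp: theta_def max_def field_simps)
  moreover have "box_mass n y t = 0" for y using False by (auto simp: box_mass_def)
  ultimately show ?thesis by simp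
 qed
 then show "((%y. box_mass n y t) \<longlongrightarrow> 0) at_bot" "((%y. box_mass n y t) \<longlongrightarrow> theta n t) at_top" by auto
qed

end

lemma at_half_square_eq_hbox:
 assumes "delta > 0" "hbox x delta <= half_square"
 shows "at (x, 0) within half_square_pos = at (x, 0) within hbox_pos x delta"
proof (rule at_within_nhd)
 show "open ({x - delta<..<x + delta} \<times> {-delta<..<delta})" by (intro open_Times) auto
 show "half_square_pos Int ({x - delta<..<x + delta} \<times> {-delta<..<delta}) - {(x, 0)} =
  hbox_pos x delta Int ({x - delta<..<x + delta} \<times> {-delta<..<delta}) - {(x, 0)}"
  using hbox_pos_in_half_square[OF assms(2)] by (auto simp: hbox_pos_def)
qed (use assms in auto)

context arc_ends
begin

lemma tau_tendsto: "((%p. tau j (snd p)) \<longlongrightarrow> e j) (at (x, 0) within half_square_pos)"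
proof -
 have "((%p. tau j (snd p)) \<longlongrightarrow> tau j (snd (x, 0))) (at (x, 0) within half_square_pos)"
  unfolding tau_def by (intro tendsto_intros)
 then show ?thesis by (simp add: tau_def)
qed

text \<open>A germ that misses the core of chart n has clamped position -1/2 or 1/2. By continuity
  this position is constant on a connected half box, so the mass is a constant times the cutoff,
  which has a limit.\<close>

lemma box_mass_end_limit_outside:
 assumes n: "n : I" and j: "j : I" and same: "e n = e j"
  and delta: "delta > 0" "hbox x delta <= half_square"
  and out: "b j ` hbox_pos x delta Int b n ` ({-1/2..1/2} \<times> {0<..1/2}) = {}"
 shows "EX v. ((%p. box_mass n (xi j (fst p) (snd p)) (tau j (snd p))) \<longlongrightarrow> v) (at (x, 0) within half_square_pos)"
proof -
 \<comment> \<open>The second bound keeps the levels \<open>eps j * s / eps n\<close> in chart n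
   below 1/2, the height of the core that is avoided.\<close>
 define delta' where "delta' = min delta (eps n / (2 * eps j))"
 have delta': "delta' > 0" "delta' <= delta" using delta eps01[OF n] eps01[OF j] by (auto simp: delta'_def)
 have pos: "hbox_pos x delta' <= half_square_pos"
  using hbox_mono(2)[OF delta'(2), of x] hbox_pos_in_half_square[OF delta(2)] by blast
 let ?c = "%p. cinv n (xi j (fst p) (snd p)) (eps j * snd p / eps n)"
 have level: "eps j * s / eps n : {0<..<1/2}" if "0 < s" "s < delta'" for s
 proof -
  have "s < eps n / (2 * eps j)" using that by (simp add: delta'_def)
  then have "eps j * s < eps n / 2" using eps01[OF j] by (simp add: field_simps)
  then show ?thesis using that eps01[OF n] eps01[OF j] by (simp add: field_simps)
 qed
 have two: "?c p : {-1/2, 1/2}" if p: "p : hbox_pos x delta'" for p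
 proof (rule ccontr)
  assume neq: "?c p ~: {-1/2, 1/2}"
  obtain y s where "p = (y, s)" by fastforce
  moreover have "p : half_square_pos" using p pos by blast
  ultimately have ys: "p = (y, s)" "0 < s" "s < delta'" "(y, s) : half_square_pos"
   using p by (auto simp: hbox_pos_def)
  let ?s = "eps j * s / eps n" and ?x = "?c p"
  have lv: "0 < ?s" "?s < 1/2" using level[OF ys(2,3)] unfolding greaterThanLessThan_iff by blast+
  then have s: "?s : {0<..<1}" "?s <= 1/2" unfolding greaterThanLessThan_iff by linarith+
  have x: "-1/2 < ?x" "?x < 1/2"
   using neq cinv_bounds[OF n s(1), of "xi j y s"] unfolding ys(1) fst_conv snd_conv insert_iff by linarith+
  then have "xi n ?x ?s = xi j y s"
   using clamped_inverse_interior[of "%x. xi n x ?s" "xi j y s", OF xi_core[OF n s(1)]] ys(1)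
   by (simp add: cinv_def)
  moreover have "tau n ?s = tau j s" using same eps01[OF n] by (simp add: tau_def)
  moreover have "(?x, ?s) : half_square_pos"
   unfolding mem_Times_iff fst_conv snd_conv greaterThanLessThan_iff using x lv by linarith
  ultimately have "b n (?x, ?s) = b j (y, s)" using b_eq[OF n] b_eq[OF j ys(4)] by simp
  moreover have "(?x, ?s) : {-1/2..1/2} \<times> {0<..1/2}"
   unfolding mem_Times_iff fst_conv snd_conv greaterThanAtMost_iff atLeastAtMost_iff using x lv by linarith
  moreover have "(y, s) : hbox_pos x delta" using p ys(1) hbox_mono(2)[OF delta'(2)] by blast
  ultimately show False using out by (metis IntI emptyE imageI)
 qed
 have c: "continuous_on (hbox_pos x delta') ?c"
 proof -
  have "continuous_on (hbox_pos x delta') (%p. xi j (fst p) (snd p))"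
   using continuous_on_subset[OF xi_cont[OF j] pos] by (simp add: case_prod_unfold)
  then have "continuous_on (hbox_pos x delta') (%p. (xi j (fst p) (snd p), eps j * snd p / eps n))"
   using eps01[OF n] by (intro continuous_on_Pair continuous_intros) auto
  moreover have "(%p. (xi j (fst p) (snd p), eps j * snd p / eps n)) ` hbox_pos x delta' <= band {0<..<1}"
  proof (rule image_subsetI)
   fix p assume "p : hbox_pos x delta'"
   then have "0 < snd p" "snd p < delta'" by (auto simp: hbox_pos_def)
   from level[OF this] show "(xi j (fst p) (snd p), eps j * snd p / eps n) : band {0<..<1}"
    unfolding mem_Times_iff fst_conv snd_conv greaterThanLessThan_iff by (intro conjI UNIV_I) linarith+
  qed
  ultimately have "continuous_on (hbox_pos x delta') (%p. case (xi j (fst p) (snd p), eps j * snd p / eps n) of (y, s) => cinv n y s)"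
   by (rule continuous_on_compose2[OF cinv_continuous[OF n]])
  then show ?thesis by simp
 qed
 have "?c constant_on hbox_pos x delta'"
 proof (rule continuous_finite_range_constant[OF connected_hbox_pos c])
  have "?c ` hbox_pos x delta' <= {-1/2, 1/2}" using two by blast
  then show "finite (?c ` hbox_pos x delta')" by (rule finite_subset) auto
 qed
 then obtain c0 where c0: "!!p. p : hbox_pos x delta' ==> ?c p = c0" by (auto simp: constant_on_def)
 have "((%p. theta n (tau j (snd p)) * (c0 + 1/2)) \<longlongrightarrow> theta n (e j) * (c0 + 1/2)) (at (x, 0) within half_square_pos)"
 proof -
  have "isCont (theta n) (e j)" using theta_continuous[of UNIV n] by (simp add: continuous_on_eq_continuous_at)
  then have "((%p. theta n (tau j (snd p))) \<longlongrightarrow> theta n (e j)) (at (x, 0) within half_square_pos)"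
   using tau_tendsto isCont_tendsto_compose by blast
  then show ?thesis by (intro tendsto_intros)
 qed
 moreover have "eventually (%p. theta n (tau j (snd p)) * (c0 + 1/2) = box_mass n (xi j (fst p) (snd p)) (tau j (snd p)))
   (at (x, 0) within half_square_pos)"
  using eventually_hbox_pos[OF delta'(1), of x]
 proof eventually_elim
  case (elim p)
  then have s: "0 < snd p" "snd p < delta'" by (auto simp: hbox_pos_def)
  have "\<bar>tau j (snd p) - e n\<bar> = eps j * snd p" using tau_dist[OF j] s same by simp
  moreover have "eps j * snd p < eps n" using level[OF s] eps01[OF n] by (auto simp: field_simps)
  ultimately show ?case using c0[OF elim] n by (simp add: box_mass_def)
 qed
 ultimately show ?thesis by - (rule exI, rule Lim_transform_eventually, assumption+)
qed

lemma b_base_W: "j : I ==> x : {-1<..<1} ==> b j (x, 0) : W"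
 using U_W[of j] by blast

text \<open>The base of the germ lies in \<open>U n\<close> and in \<open>W\<close>, hence on the
  base of chart n. Together with the open part this makes the transition map \<open>P\<close>
  continuous up to the base, and boundary values can be carried from one chart to another.\<close>

lemma germ_transfer:
 assumes n: "n : I" and j: "j : I" and delta: "delta > 0" "hbox x delta <= half_square"
  and U: "b j ` hbox x delta <= U n" and sub: "b j ` hbox_pos x delta <= b n ` half_square_pos"
 obtains P where "continuous_on (hbox x delta) P" "!!p. p : hbox x delta ==> P p : half_square & b n (P p) = b j p"
  "!!p. p : hbox_pos x delta ==> P p : half_square_pos"
  "!!p. p : hbox_pos x delta ==> xi j (fst p) (snd p) = xi n (fst (P p)) (snd (P p)) & tau j (snd p) = tau n (snd (P p))"
proof -
 obtain g where g: "homeomorphic_maps (top_of_set half_square) (subtopology X (b n ` half_square)) (b n) g"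
  using b_homeo[OF n] homeomorphic_map_maps by blast
 have inQ: "b j p : b n ` half_square" if p: "p : hbox x delta" for p
 proof (cases "snd p = 0")
  case True
  then obtain y where y: "p = (y, 0)" "y : {-1<..<1}" using p delta(2) by (cases p) auto
  then have "b j p : U n Int W" using p U b_base_W[OF j] by blast
  then show ?thesis unfolding U_W[OF n] by auto
 next
  case False
  then have "p : hbox_pos x delta" using p by (auto simp: hbox_def hbox_pos_def)
  then have "b j p : b n ` half_square_pos" using sub by blast
  then show ?thesis by (auto intro: rev_image_eqI)
 qed
 have bt: "b n ` half_square <= topspace X"
  using continuous_map_image_subset_topspace[OF b_cont[OF n]] by simp
 have bj: "continuous_map (top_of_set (hbox x delta)) (subtopology X (b n ` half_square)) (b j)"
  using continuous_map_from_subtopology_mono[OF b_cont[OF j] delta(2)] inQ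
  by (auto simp: continuous_map_in_subtopology)
 have gc: "continuous_map (subtopology X (b n ` half_square)) (top_of_set half_square) g"
  using g by (simp add: homeomorphic_maps_def)
 have bg: "b n (g z) = z" "g z : half_square" if "z : b n ` half_square" for z
 proof -
  have z: "z : topspace (subtopology X (b n ` half_square))" using that bt by auto
  then show "b n (g z) = z" using g by (simp add: homeomorphic_maps_def)
  show "g z : half_square" using continuous_map_image_subset_topspace[OF gc] z by auto
 qed
 have cP: "continuous_on (hbox x delta) (g \<circ> b j)"
  using continuous_map_compose[OF bj gc] by (simp add: continuous_map_in_subtopology)
 have P: "(g \<circ> b j) p : half_square & b n ((g \<circ> b j) p) = b j p" if "p : hbox x delta" for p
  using bg[OF inQ[OF that]] by simp
 have Pp: "(g \<circ> b j) p : half_square_pos" if p: "p : hbox_pos x delta" for p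
 proof -
  have ph: "p : hbox x delta" "p : half_square_pos" using p hbox_pos_subset hbox_pos_in_half_square[OF delta(2)] by auto
  obtain y s where ys: "(g \<circ> b j) p = (y, s)" by fastforce
  then have ysQ: "(y, s) : half_square" "b n (y, s) = b j p" using P[OF ph(1)] by auto
  have "b j p ~: W" using b_W[OF j] ph(2) by blast
  then have "s ~= 0" using ysQ b_base_W[OF n, of y] by auto
  then show ?thesis using ysQ ys by auto
 qed
 show thesis
 proof
  fix p assume p: "p : hbox_pos x delta"
  have ph: "p : hbox x delta" "p : half_square_pos" using p hbox_pos_subset hbox_pos_in_half_square[OF delta(2)] by auto
  show "xi j (fst p) (snd p) = xi n (fst ((g \<circ> b j) p)) (snd ((g \<circ> b j) p)) & tau j (snd p) = tau n (snd ((g \<circ> b j) p))"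
   using b_coords_eq[OF j n, of "fst p" "snd p" "fst ((g \<circ> b j) p)" "snd ((g \<circ> b j) p)"] ph Pp[OF p] P[OF ph(1)]
   by (simp only: prod.collapse)
 qed (use cP P Pp in auto)
qed

text \<open>At the same end there are only two situations. Either the germ lies in half chart n, and
  the explicit formula applies through the transition map, or it misses the core of n, and the mass
  is a constant times the cutoff. A germ whose base point is outside \<open>U n\<close> is of the
  second kind because the core is compact.\<close>

lemma box_mass_end_limit:
 assumes j: "j : I" and x: "x : {-1<..<1}"
 shows "EX v. ((%p. box_mass n (xi j (fst p) (snd p)) (tau j (snd p))) \<longlongrightarrow> v) (at (x, 0) within half_square_pos)"
proof (cases "n : I")
 case False
 then show ?thesis by (auto simp: box_mass_def intro!: exI[of _ 0])
next
 case n: True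
 show ?thesis
 proof (cases "e n = e j")
  case False
  \<comment> \<open>At the opposite end the cutoff vanishes: for \<open>s\<close> below 1/2 the
    height has distance at least 1/2 from \<open>e n\<close>, and \<open>eps n\<close> is at most
    1.\<close>
  have "eventually (%p. 0 = box_mass n (xi j (fst p) (snd p)) (tau j (snd p))) (at (x, 0) within half_square_pos)"
   using eventually_hbox_pos[of "1/2" x, OF half_gt_zero[OF zero_less_one]]
  proof eventually_elim
   case (elim p)
   then have s: "0 < snd p" "snd p < 1/2" by (auto simp: hbox_pos_def)
   have "eps j * snd p < 1/2" using mult_le_less_imp_less[of "eps j" 1 "snd p" "1/2"] eps01[OF j] s by auto
   then have "1/2 <= \<bar>tau j (snd p) - e n\<bar>" using e01[OF n] e01[OF j] False by (auto simp: tau_def)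
   then have "1/2 <= \<bar>tau j (snd p) - e n\<bar> / eps n"
    using eps01[OF n] by (simp add: le_divide_eq)
   then have "theta n (tau j (snd p)) = 0" by (simp add: theta_def)
   then show ?case by (simp add: box_mass_def)
  qed
  then show ?thesis by - (rule exI, rule Lim_transform_eventually[OF tendsto_const], assumption)
 next
  case same: True
  show ?thesis
  proof (cases "b j (x, 0) : U n")
   case True
   from germ_in_or_out[OF j n x True] obtain delta where delta: "delta > 0" "hbox x delta <= half_square" "b j ` hbox x delta <= U n"
    "b j ` hbox_pos x delta <= b n ` half_square_pos \<or> b j ` hbox_pos x delta Int b n ` half_square_pos = {}" .
   from delta(4) show ?thesis
   proof
    assume "b j ` hbox_pos x delta <= b n ` half_square_pos"
    from germ_transfer[OF n j delta(1-3) this] obtain P where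
     P: "continuous_on (hbox x delta) P" "!!p. p : hbox_pos x delta ==> P p : half_square_pos"
      "!!p. p : hbox_pos x delta ==> xi j (fst p) (snd p) = xi n (fst (P p)) (snd (P p)) & tau j (snd p) = tau n (snd (P p))"
     by metis
    let ?v = "%p. max 0 (1/2 - snd (P p)) * (max (-1/2) (min (1/2) (fst (P p))) + 1/2)"
    have "continuous_on (hbox x delta) ?v" by (intro continuous_intros P(1))
    then have "(?v \<longlongrightarrow> ?v (x, 0)) (at (x, 0) within hbox x delta)"
     using hbox_center[OF delta(1)] unfolding continuous_on_def by blast
    then have lim: "(?v \<longlongrightarrow> ?v (x, 0)) (at (x, 0) within half_square_pos)"
     unfolding at_half_square_eq_hbox[OF delta(1,2)] by (rule tendsto_within_subset) (rule hbox_pos_subset)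
    have "eventually (%p. ?v p = box_mass n (xi j (fst p) (snd p)) (tau j (snd p))) (at (x, 0) within half_square_pos)"
     using eventually_hbox_pos[OF delta(1), of x]
    proof eventually_elim
     case (elim p)
     then show ?case
      using P(3)[OF elim] box_mass_own[OF n, of "fst (P p)" "snd (P p)"] P(2)[OF elim] by simp
    qed
    with lim show ?thesis by - (rule exI, rule Lim_transform_eventually, assumption+)
   next
    assume a: "b j ` hbox_pos x delta Int b n ` half_square_pos = {}"
    have "b n ` ({-1/2..1/2} \<times> {0<..1/2}) <= b n ` half_square_pos" by (intro image_mono) auto
    with a have "b j ` hbox_pos x delta Int b n ` ({-1/2..1/2} \<times> {0<..1/2}) = {}" by blast
    then show ?thesis by (rule box_mass_end_limit_outside[OF n j same delta(1,2)])
   qed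
  next
   case False
   \<comment> \<open>The core with its base is compact, hence closed in a Hausdorff space; the image
     of the whole half square need not be closed.\<close>
   let ?K = "b n ` ({-1/2..1/2} \<times> {0..1/2})"
   have "compactin (top_of_set half_square) ({-1/2..1/2} \<times> {0..1/2})"
    unfolding compactin_subtopology by (auto intro!: compact_Times)
   then have "compactin X ?K" by (rule image_compactin[OF _ b_cont[OF n]])
   then have "closedin X ?K" using hausdorff compactin_imp_closedin by blast
   then have o: "openin X (topspace X - ?K)" by blast
   have "?K <= U n" using b_U[OF n] by (force)
   moreover have "b j (x, 0) : topspace X"
    using continuous_map_image_subset_topspace[OF b_cont[OF j]] x by (auto simp: image_subset_iff)
   ultimately have "b j (x, 0) : topspace X - ?K" using False by blast
   from hbox_in_preimage[OF b_cont[OF j] o this x] obtain delta where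
    delta: "delta > 0" "hbox x delta <= half_square" "b j ` hbox x delta <= topspace X - ?K" .
   have "b j ` hbox_pos x delta <= b j ` hbox x delta" by (intro image_mono hbox_pos_subset)
   moreover have "b n ` ({-1/2..1/2} \<times> {0<..1/2}) <= ?K" by (intro image_mono) auto
   ultimately have "b j ` hbox_pos x delta Int b n ` ({-1/2..1/2} \<times> {0<..1/2}) = {}" using delta(3) by blast
   then show ?thesis by (rule box_mass_end_limit_outside[OF n j same delta(1,2)])
  qed
 qed
qed

end

definition kappa :: "real => real" where "kappa y = 1/2 + arctan y / pi"

lemma kappa_01: "0 < kappa y" "kappa y < 1"
proof -
 have "- (1 / 2) < arctan y / pi" using arctan_lbound[of y] by (simp add: less_divide_eq)
 then show "0 < kappa y" unfolding kappa_def by linarith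
 have "arctan y / pi < 1 / 2" using arctan_ubound[of y] by (simp add: divide_less_eq)
 then show "kappa y < 1" unfolding kappa_def by linarith
qed

lemma kappa_mono: "y < y' ==> kappa y < kappa y'"
 by (simp add: kappa_def divide_strict_right_mono arctan_monotone)

lemma kappa_continuous: "continuous_on S kappa"
 unfolding kappa_def by (intro continuous_intros) auto

lemma kappa_limits: "(kappa \<longlongrightarrow> 0) at_bot" "(kappa \<longlongrightarrow> 1) at_top"
proof -
 have "((%y. 1/2 + arctan y / pi) \<longlongrightarrow> 1/2 + (- (pi / 2)) / pi) at_bot"
  by (intro tendsto_intros tendsto_arctan_at_bot) auto
 then show "(kappa \<longlongrightarrow> 0) at_bot" by (simp add: kappa_def[abs_def])
 have "((%y. 1/2 + arctan y / pi) \<longlongrightarrow> 1/2 + (pi / 2) / pi) at_top"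
  by (intro tendsto_intros tendsto_arctan_at_top) auto
 then show "(kappa \<longlongrightarrow> 1) at_top" by (simp add: kappa_def[abs_def])
qed

context arc_ends
begin

section \<open>Left mass, right mass and the straightening coordinate\<close>

definition total_mass :: "real => real" where
 "total_mass t = t * (1 - t) + (\<Sum>n. (1/2) ^ n * theta n t)"

text \<open>The summand with \<open>kappa\<close> makes the mass positive and strictly increasing
  also on lines that meet no chart. Its factor \<open>t * (1 - t)\<close> makes it disappear at both
  ends of the strip, where \<open>kappa\<close> may oscillate.\<close>

definition left_mass :: "real => real => real" where
 "left_mass y t = t * (1 - t) * kappa y + (\<Sum>n. (1/2) ^ n * box_mass n y t)"

lemma theta_abs: "\<bar>theta n t\<bar> <= 1"
 using theta_bounds[of n t] by auto

lemma total_mass_continuous: "continuous_on UNIV total_mass"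
 unfolding continuous_on_def
proof
 fix t :: real
 have "(theta n \<longlongrightarrow> theta n t) (at t)" for n
  using theta_continuous[of UNIV n] by (simp add: continuous_on_def)
 then have "((%u. \<Sum>n. (1/2) ^ n * theta n u) \<longlongrightarrow> (\<Sum>n. (1/2) ^ n * theta n t)) (at t)"
  using theta_abs by (intro tendsto_geometric_suminf) auto
 then show "(total_mass \<longlongrightarrow> total_mass t) (at t within UNIV)"
  unfolding total_mass_def by (intro tendsto_intros)
qed

lemma left_mass_continuous: "continuous_on (band {0<..<1}) (%(y, t). left_mass y t)"
 unfolding continuous_on_def
proof
 fix p :: "real \<times> real" assume p: "p : band {0<..<1}"
 let ?F = "at p within band {0<..<1}"
 have "open (band {0<..<1} :: (real \<times> real) set)" by (intro open_Times) auto
 from at_within_open[OF p this] have nb: "?F ~= bot" by (simp only: at_neq_bot not_False_eq_True)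
 have inS: "eventually (%q. snd q : {0<..<1}) ?F"
  unfolding eventually_at_filter by (rule always_eventually) auto
 have "((%q. box_mass n (fst q) (snd q)) \<longlongrightarrow> box_mass n (fst p) (snd p)) ?F" for n
  using box_mass_continuous[of n] p unfolding continuous_on_def case_prod_unfold by (rule bspec)
 moreover have "eventually (%q. ALL n. \<bar>box_mass n (fst q) (snd q)\<bar> <= 1) ?F"
  using inS by eventually_elim (use box_mass_abs in blast)
 ultimately have 1: "((%q. \<Sum>n. (1/2) ^ n * box_mass n (fst q) (snd q)) \<longlongrightarrow> (\<Sum>n. (1/2) ^ n * box_mass n (fst p) (snd p))) ?F"
  by (intro tendsto_geometric_suminf nb)
 have "continuous_on UNIV (%q::real \<times> real. snd q * (1 - snd q) * kappa (fst q))"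
  by (intro continuous_intros continuous_on_compose2[OF kappa_continuous[of UNIV]]) auto
 then have "((%q. snd q * (1 - snd q) * kappa (fst q)) \<longlongrightarrow> snd p * (1 - snd p) * kappa (fst p)) (at p)"
  unfolding continuous_on_def by blast
 then have "((%q. snd q * (1 - snd q) * kappa (fst q)) \<longlongrightarrow> snd p * (1 - snd p) * kappa (fst p)) ?F"
  by (rule tendsto_within_subset) simp
 from tendsto_add[OF this 1]
 show "((%(y, t). left_mass y t) \<longlongrightarrow> (case p of (y, t) => left_mass y t)) ?F"
  by (simp add: left_mass_def case_prod_unfold)
qed

lemma left_mass_diff:
 assumes t: "t : {0<..<1}" and y: "y <= y'"
 shows "(1/2) ^ j * (box_mass j y' t - box_mass j y t) <= left_mass y' t - left_mass y t"
proof -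
 have "(1/2) ^ j * (box_mass j y' t - box_mass j y t) <=
   (\<Sum>n. (1/2) ^ n * box_mass n y' t) - (\<Sum>n. (1/2) ^ n * box_mass n y t)"
  using box_mass_abs[OF t] box_mass_mono[OF t y] by (intro suminf_geometric_diff_ge) auto
 moreover have "t * (1 - t) * kappa y <= t * (1 - t) * kappa y'"
  using t y kappa_mono[of y y'] by (intro mult_left_mono) (auto simp: le_less)
 ultimately show ?thesis by (simp add: left_mass_def)
qed

lemma left_mass_strict_mono:
 assumes t: "t : {0<..<1}" and y: "y < y'"
 shows "left_mass y t < left_mass y' t"
proof -
 have "(1/2) ^ 0 * (box_mass 0 y' t - box_mass 0 y t) <=
   (\<Sum>n. (1/2) ^ n * box_mass n y' t) - (\<Sum>n. (1/2) ^ n * box_mass n y t)"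
  using box_mass_abs[OF t] box_mass_mono[OF t] y by (intro suminf_geometric_diff_ge) auto
 then have "0 <= (\<Sum>n. (1/2) ^ n * box_mass n y' t) - (\<Sum>n. (1/2) ^ n * box_mass n y t)"
  using box_mass_mono[OF t, of y y' 0] y by auto
 moreover have "t * (1 - t) * kappa y < t * (1 - t) * kappa y'"
  using t y kappa_mono[of y y'] by (intro mult_strict_left_mono) auto
 ultimately show ?thesis by (simp add: left_mass_def)
qed

lemma left_mass_lower:
 assumes t: "t : {0<..<1}"
 shows "(1/2) ^ j * box_mass j y t <= left_mass y t" "0 < left_mass y t"
proof -
 have le: "(1/2) ^ j * (box_mass j y t - 0) <= (\<Sum>n. (1/2) ^ n * box_mass n y t) - (\<Sum>n. (1/2) ^ n * (0::real))" for j
  using box_mass_abs[OF t] box_mass_bounds[OF t] by (intro suminf_geometric_diff_ge) auto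
 have pos: "0 < t * (1 - t) * kappa y" using t kappa_01[of y] by auto
 show "(1/2) ^ j * box_mass j y t <= left_mass y t" using le[of j] pos by (simp add: left_mass_def)
 show "0 < left_mass y t" using le[of 0] pos box_mass_bounds(1)[OF t, of 0 y] by (simp add: left_mass_def)
qed

lemma right_mass_lower:
 assumes t: "t : {0<..<1}"
 shows "(1/2) ^ j * (theta j t - box_mass j y t) <= total_mass t - left_mass y t" "left_mass y t < total_mass t"
proof -
 have le: "(1/2) ^ j * (theta j t - box_mass j y t) <= (\<Sum>n. (1/2) ^ n * theta n t) - (\<Sum>n. (1/2) ^ n * box_mass n y t)" for j
  using box_mass_abs[OF t] box_mass_bounds[OF t] theta_abs by (intro suminf_geometric_diff_ge) auto
 have pos: "0 < t * (1 - t) - t * (1 - t) * kappa y"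
  using t kappa_01[of y] mult_strict_left_mono[of "kappa y" 1 "t * (1 - t)"] by auto
 show "(1/2) ^ j * (theta j t - box_mass j y t) <= total_mass t - left_mass y t"
  using le[of j] pos by (simp add: left_mass_def total_mass_def)
 show "left_mass y t < total_mass t"
  using le[of 0] pos box_mass_bounds(2)[OF t, of 0 y] by (simp add: left_mass_def total_mass_def)
qed

lemma left_mass_limits:
 assumes t: "t : {0<..<1}"
 shows "((%y. left_mass y t) \<longlongrightarrow> 0) at_bot" "((%y. left_mass y t) \<longlongrightarrow> total_mass t) at_top"
proof -
 have "((%y. \<Sum>n. (1/2) ^ n * box_mass n y t) \<longlongrightarrow> (\<Sum>n. (1/2) ^ n * (0::real))) at_bot"
  using box_mass_abs[OF t] box_mass_limits(1)[OF t] by (intro tendsto_geometric_suminf) auto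
 then have "((%y. t * (1 - t) * kappa y + (\<Sum>n. (1/2) ^ n * box_mass n y t)) \<longlongrightarrow> t * (1 - t) * 0 + (\<Sum>n. (1/2) ^ n * (0::real))) at_bot"
  by (intro tendsto_intros kappa_limits)
 then show "((%y. left_mass y t) \<longlongrightarrow> 0) at_bot" by (simp add: left_mass_def)
 have "((%y. \<Sum>n. (1/2) ^ n * box_mass n y t) \<longlongrightarrow> (\<Sum>n. (1/2) ^ n * theta n t)) at_top"
  using box_mass_abs[OF t] box_mass_limits(2)[OF t] by (intro tendsto_geometric_suminf) auto
 then have "((%y. t * (1 - t) * kappa y + (\<Sum>n. (1/2) ^ n * box_mass n y t)) \<longlongrightarrow> t * (1 - t) * 1 + (\<Sum>n. (1/2) ^ n * theta n t)) at_top"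
  by (intro tendsto_intros kappa_limits)
 then show "((%y. left_mass y t) \<longlongrightarrow> total_mass t) at_top" by (simp add: left_mass_def total_mass_def)
qed

text \<open>This is the logit of the share of mass to the left. It carries each line onto the whole
  real line, and it stays finite at an end where the limiting share is strictly between 0 and
  1.\<close>

definition straight :: "real => real => real" where
 "straight y t = ln (left_mass y t) - ln (total_mass t - left_mass y t)"

lemma straight_continuous: "continuous_on (band {0<..<1}) (%(y, t). straight y t)"
proof -
 have "continuous_on (band {0<..<1}) (%p::real \<times> real. total_mass (snd p))"
  by (intro continuous_on_compose2[OF total_mass_continuous] continuous_intros) auto
 moreover have "continuous_on (band {0<..<1}) (%p. left_mass (fst p) (snd p))"
  using left_mass_continuous by (simp add: case_prod_unfold)
 ultimately have "continuous_on (band {0<..<1}) (%p. ln (left_mass (fst p) (snd p)) - ln (total_mass (snd p) - left_mass (fst p) (snd p)))"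
  using left_mass_lower(2) right_mass_lower(2)
  by (intro continuous_intros) (auto, (metis greaterThanLessThan_iff less_irrefl)+)
 then show ?thesis by (simp add: straight_def case_prod_unfold)
qed

lemma straight_strict_mono:
 assumes t: "t : {0<..<1}" and y: "y < y'"
 shows "straight y t < straight y' t"
proof -
 note * = left_mass_strict_mono[OF t y] left_mass_lower(2)[OF t] right_mass_lower(2)[OF t]
 have "ln (left_mass y t) < ln (left_mass y' t)" using * by (subst ln_less_cancel_iff) auto
 moreover have "ln (total_mass t - left_mass y' t) < ln (total_mass t - left_mass y t)"
  using *(1) *(3)[of y] *(3)[of y'] by (subst ln_less_cancel_iff) auto
 ultimately show ?thesis by (simp add: straight_def)
qed

lemma straight_surj:
 assumes t: "t : {0<..<1}"
 shows "EX y. straight y t = v"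
proof -
 \<comment> \<open>The logistic function inverts the logit and thus prescribes the share of mass
   needed for the value \<open>v\<close>.\<close>
 define w where "w = exp v / (1 + exp v)"
 have w: "0 < w" "w < 1" by (auto simp: w_def divide_less_eq_1 add_pos_pos)
 have M: "0 < total_mass t" using left_mass_lower(2)[OF t, of 0] right_mass_lower(2)[OF t, of 0] by simp
 have "w * total_mass t < total_mass t" "0 < w * total_mass t" using w M by (auto simp: mult_less_cancel_right1)
 then obtain y1 y2 where "left_mass y1 t < w * total_mass t" "w * total_mass t < left_mass y2 t"
  using order_tendstoD(2)[OF left_mass_limits(1)[OF t], of "w * total_mass t"]
   order_tendstoD(1)[OF left_mass_limits(2)[OF t], of "w * total_mass t"]
  unfolding eventually_at_bot_linorder eventually_at_top_linorder by blast
 moreover have "connected ((%y. left_mass y t) ` UNIV)"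
 proof (rule connected_continuous_image)
  have "continuous_on UNIV (%y. case (y, t) of (y, t) => left_mass y t)"
   by (rule continuous_on_compose2[OF left_mass_continuous]) (use t in \<open>auto intro!: continuous_intros\<close>)
  then show "continuous_on UNIV (%y. left_mass y t)" by simp
 qed auto
 ultimately have "w * total_mass t : range (%y. left_mass y t)"
  by (meson connectedD_interval less_imp_le rangeI)
 then obtain y where y: "left_mass y t = w * total_mass t" by auto
 have "straight y t = ln (w * total_mass t) - ln ((1 - w) * total_mass t)"
  by (simp add: straight_def y algebra_simps)
 also have "\<dots> = ln w - ln (1 - w)" using w M by (simp add: ln_mult)
 also have "\<dots> = v"
 proof -
  have pos: "1 + exp v > 0" by (intro add_pos_pos) auto
  then have "1 - w = 1 / (1 + exp v)" by (simp add: w_def field_simps)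
  then show ?thesis using pos by (simp add: w_def ln_div)
 qed
 finally show ?thesis by blast
qed

definition Straight :: "real \<times> real => real \<times> real" where
 "Straight p = (straight (fst p) (snd p), snd p)"

lemma Straight_bij: "bij_betw Straight (band {0<..<1}) (band {0<..<1})"
proof (rule bij_betw_imageI)
 show "inj_on Straight (band {0<..<1})"
 proof (rule inj_onI, clarify)
  fix y t y' t' assume t: "t : {0<..<1}" "t' : {0<..<1}" "Straight (y, t) = Straight (y', t')"
  then show "y = y' & t = t'"
   using straight_strict_mono[OF t(1), of y y'] straight_strict_mono[OF t(1), of y' y]
   by (cases y y' rule: linorder_cases) (auto simp: Straight_def)
 qed
 show "Straight ` (band {0<..<1}) = band {0<..<1}"
 proof (intro equalityI subsetI)
  fix p :: "real \<times> real" assume "p : band {0<..<1}"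
  then obtain v t where p: "p = (v, t)" "t : {0<..<1}" by auto
  then obtain y where "straight y t = v" using straight_surj by blast
  then show "p : Straight ` (band {0<..<1})"
   using p by (intro image_eqI[of _ _ "(y, t)"]) (auto simp: Straight_def)
 qed (auto simp: Straight_def)
qed

lemma Straight_continuous: "continuous_on (band {0<..<1}) Straight"
 unfolding Straight_def using straight_continuous
 by (intro continuous_on_Pair continuous_intros) (simp add: case_prod_unfold)

text \<open>The limits of the single charts pass through the dominated series. The remaining summand
  tends to 0 because \<open>kappa\<close> is bounded, whether or not \<open>xi\<close>
  converges.\<close>

lemma left_mass_end_limit:
 assumes j: "j : I" and x: "x : {-1<..<1}"
 shows "EX v. ((%p. left_mass (xi j (fst p) (snd p)) (tau j (snd p))) \<longlongrightarrow> v) (at (x, 0) within half_square_pos)"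
proof -
 let ?F = "at (x, 0) within half_square_pos"
 have inS: "eventually (%p. p : half_square_pos) ?F" by (simp add: eventually_at_filter)
 have "ALL n. EX v. ((%p. box_mass n (xi j (fst p) (snd p)) (tau j (snd p))) \<longlongrightarrow> v) ?F"
  using box_mass_end_limit[OF j x] by blast
 from choice[OF this] obtain v where
  v': "ALL n. ((%p. box_mass n (xi j (fst p) (snd p)) (tau j (snd p))) \<longlongrightarrow> v n) ?F" by (rule exE)
 note v = v'[THEN spec]
 have "eventually (%p. ALL n. \<bar>box_mass n (xi j (fst p) (snd p)) (tau j (snd p))\<bar> <= 1) ?F"
  using inS
 proof eventually_elim
  case (elim p)
  then have "tau j (snd p) : {0<..<1}" by (intro tau_01[OF j]) auto
  then show ?case using box_mass_abs by blast
 qed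
 then have 1: "((%p. \<Sum>n. (1/2) ^ n * box_mass n (xi j (fst p) (snd p)) (tau j (snd p))) \<longlongrightarrow> (\<Sum>n. (1/2) ^ n * v n)) ?F"
  by (intro tendsto_geometric_suminf v at_half_square_nontrivial x)
 have "((%p. tau j (snd p) * (1 - tau j (snd p))) \<longlongrightarrow> e j * (1 - e j)) ?F"
  by (intro tendsto_intros tau_tendsto)
 then have 0: "((%p. tau j (snd p) * (1 - tau j (snd p))) \<longlongrightarrow> 0) ?F" using e01[OF j] by auto
 have "((%p. tau j (snd p) * (1 - tau j (snd p)) * kappa (xi j (fst p) (snd p))) \<longlongrightarrow> 0) ?F"
 proof (rule Lim_null_comparison[OF _ 0])
  show "eventually (%p. norm (tau j (snd p) * (1 - tau j (snd p)) * kappa (xi j (fst p) (snd p))) <= tau j (snd p) * (1 - tau j (snd p))) ?F"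
   using inS
  proof eventually_elim
   case (elim p)
   then have "tau j (snd p) : {0<..<1}" by (intro tau_01[OF j]) auto
   then have t: "0 <= tau j (snd p) * (1 - tau j (snd p))" by auto
   have k: "0 < kappa (xi j (fst p) (snd p))" "kappa (xi j (fst p) (snd p)) < 1" by (rule kappa_01)+
   show ?case
    using mult_left_mono[OF less_imp_le[OF k(2)] t] abs_of_nonneg[OF mult_nonneg_nonneg[OF t less_imp_le[OF k(1)]]]
    by simp
  qed
 qed
 from tendsto_add[OF this 1] show ?thesis unfolding left_mass_def by blast
qed

end

lemma filterlim_vertical:
 assumes "x : {-1<..<1}"
 shows "filterlim (%s. (x, s)) (at (x, 0) within half_square_pos) (at_right (0::real))"
 unfolding filterlim_at
proof
 have "eventually (%s. s : {0<..<1}) (at_right (0::real))" by (rule eventually_at_right_real) simp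
 then show "eventually (%s. (x, s) : half_square_pos & (x, s) ~= (x, 0)) (at_right 0)"
  by eventually_elim (use assms in auto)
 show "((%s. (x, s)) \<longlongrightarrow> (x, 0)) (at_right 0)" by (intro tendsto_intros)
qed

context arc_ends
begin

section \<open>Boundary values of the straightening coordinate\<close>

definition left_end :: "nat => real => real" where
 "left_end j x = Lim (at (x, 0) within half_square_pos) (%p. left_mass (xi j (fst p) (snd p)) (tau j (snd p)))"

lemma left_end_tendsto:
 assumes "j : I" "x : {-1<..<1}"
 shows "((%p. left_mass (xi j (fst p) (snd p)) (tau j (snd p))) \<longlongrightarrow> left_end j x) (at (x, 0) within half_square_pos)"
proof -
 obtain v where v: "((%p. left_mass (xi j (fst p) (snd p)) (tau j (snd p))) \<longlongrightarrow> v) (at (x, 0) within half_square_pos)"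
  using left_mass_end_limit[OF assms] by blast
 then have "left_end j x = v"
  unfolding left_end_def using at_half_square_nontrivial[OF assms(2)] by (intro tendsto_Lim)
 then show ?thesis using v by simp
qed

lemma left_end_vertical:
 assumes "j : I" "x : {-1<..<1}"
 shows "((%s. left_mass (xi j x s) (tau j s)) \<longlongrightarrow> left_end j x) (at_right 0)"
 using filterlim_compose[OF left_end_tendsto[OF assms] filterlim_vertical[OF assms(2)]] by simp

lemma eventually_at_right_unit: "eventually (%s. s : {0<..<1}) (at_right (0::real))"
 by (rule eventually_at_right_real) simp

lemma box_mass_own_vertical:
 assumes j: "j : I" and x: "x : {-1/2<..<1/2}"
 shows "((%s. box_mass j (xi j x s) (tau j s)) \<longlongrightarrow> (1/2) * (x + 1/2)) (at_right 0)"
proof -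
 have "((%s. max 0 (1/2 - s) * (x + 1/2)) \<longlongrightarrow> max 0 (1/2 - 0) * (x + 1/2)) (at_right 0)"
  by (intro tendsto_intros)
 then have 1: "((%s. max 0 (1/2 - s) * (x + 1/2)) \<longlongrightarrow> (1/2) * (x + 1/2)) (at_right 0)" by simp
 show ?thesis
 proof (rule Lim_transform_eventually[OF 1])
  show "eventually (%s. max 0 (1/2 - s) * (x + 1/2) = box_mass j (xi j x s) (tau j s)) (at_right 0)"
   using eventually_at_right_unit
  proof eventually_elim
   case (elim s)
   have "max (-1/2) (min (1/2) x) = x" using x by auto
   then show ?case using box_mass_own[OF j, of x s] elim x by auto
  qed
 qed
qed

lemma tau_vertical: "((%s. tau j s) \<longlongrightarrow> e j) (at_right 0)"
proof -
 have "((%s. tau j s) \<longlongrightarrow> tau j 0) (at_right 0)" unfolding tau_def by (intro tendsto_intros)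
 then show ?thesis by (simp add: tau_0)
qed

text \<open>Chart j itself contributes \<open>(1/2) * (x' - x)\<close> between the two points in the
  limit, and with its weight \<open>(1/2) ^ j\<close> this bounds the difference from below. Only
  the core is measured, hence the restriction to (-1/2, 1/2).\<close>

lemma left_end_strict_mono:
 assumes j: "j : I" and x: "-1/2 < x" "x < x'" "x' < 1/2"
 shows "left_end j x < left_end j x'"
proof -
 have x2: "x : {-1<..<1}" "x' : {-1<..<1}" "x : {-1/2<..<1/2}" "x' : {-1/2<..<1/2}" using x by auto
 have "(1/2) ^ j * ((1/2) * (x' + 1/2) - (1/2) * (x + 1/2)) <= left_end j x' - left_end j x"
 proof (rule tendsto_le)
  show "at_right (0::real) ~= bot" by simp
  show "((%s. left_mass (xi j x' s) (tau j s) - left_mass (xi j x s) (tau j s)) \<longlongrightarrow> left_end j x' - left_end j x) (at_right 0)"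
   by (intro tendsto_intros left_end_vertical j x2)
  show "((%s. (1/2) ^ j * (box_mass j (xi j x' s) (tau j s) - box_mass j (xi j x s) (tau j s))) \<longlongrightarrow>
    (1/2) ^ j * ((1/2) * (x' + 1/2) - (1/2) * (x + 1/2))) (at_right 0)"
   by (intro tendsto_intros box_mass_own_vertical j x2)
  show "eventually (%s. (1/2) ^ j * (box_mass j (xi j x' s) (tau j s) - box_mass j (xi j x s) (tau j s))
    <= left_mass (xi j x' s) (tau j s) - left_mass (xi j x s) (tau j s)) (at_right 0)"
   using eventually_at_right_unit
  proof eventually_elim
   case (elim s)
   show ?case using xi_mono[OF j elim, of x x'] x by (intro left_mass_diff tau_01[OF j elim]) auto
  qed
 qed
 moreover have "0 < (1/2) ^ j * ((1/2) * (x' + 1/2) - (1/2) * (x + 1/2))" using x by simp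
 ultimately show ?thesis by linarith
qed

text \<open>Chart j has positive mass on both sides of each point of its core, so neither the left
  nor the right mass vanishes in the limit and both logarithms remain finite.\<close>

lemma left_end_bounds:
 assumes j: "j : I" and x: "x : {-1/2<..<1/2}"
 shows "0 < left_end j x" "left_end j x < total_mass (e j)"
proof -
 have x2: "x : {-1<..<1}" using x by auto
 have "(1/2) ^ j * ((1/2) * (x + 1/2)) <= left_end j x"
 proof (rule tendsto_le)
  show "at_right (0::real) ~= bot" by simp
  show "((%s. left_mass (xi j x s) (tau j s)) \<longlongrightarrow> left_end j x) (at_right 0)" by (rule left_end_vertical[OF j x2])
  show "((%s. (1/2) ^ j * box_mass j (xi j x s) (tau j s)) \<longlongrightarrow> (1/2) ^ j * ((1/2) * (x + 1/2))) (at_right 0)"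
   by (intro tendsto_intros box_mass_own_vertical[OF j x])
  show "eventually (%s. (1/2) ^ j * box_mass j (xi j x s) (tau j s) <= left_mass (xi j x s) (tau j s)) (at_right 0)"
   using eventually_at_right_unit by eventually_elim (rule left_mass_lower(1)[OF tau_01[OF j]])
 qed
 moreover have "0 < (1/2) ^ j * ((1/2) * (x + 1/2))" using x by simp
 ultimately show "0 < left_end j x" by linarith
 have th: "theta j (e j) = 1/2" using j by (simp add: theta_def)
 have "(1/2) ^ j * (theta j (e j) - (1/2) * (x + 1/2)) <= total_mass (e j) - left_end j x"
 proof (rule tendsto_le)
  show "at_right (0::real) ~= bot" by simp
  have "isCont total_mass (e j)" using total_mass_continuous by (simp add: continuous_on_eq_continuous_at)
  then have "((%s. total_mass (tau j s)) \<longlongrightarrow> total_mass (e j)) (at_right 0)"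
   using tau_vertical by (rule isCont_tendsto_compose)
  then show "((%s. total_mass (tau j s) - left_mass (xi j x s) (tau j s)) \<longlongrightarrow> total_mass (e j) - left_end j x) (at_right 0)"
   by (intro tendsto_intros left_end_vertical[OF j x2])
  have "isCont (theta j) (e j)" using theta_continuous[of UNIV j] by (simp add: continuous_on_eq_continuous_at)
  then have "((%s. theta j (tau j s)) \<longlongrightarrow> theta j (e j)) (at_right 0)"
   using tau_vertical by (rule isCont_tendsto_compose)
  then show "((%s. (1/2) ^ j * (theta j (tau j s) - box_mass j (xi j x s) (tau j s))) \<longlongrightarrow> (1/2) ^ j * (theta j (e j) - (1/2) * (x + 1/2))) (at_right 0)"
   by (intro tendsto_intros box_mass_own_vertical[OF j x])
  show "eventually (%s. (1/2) ^ j * (theta j (tau j s) - box_mass j (xi j x s) (tau j s)) <= total_mass (tau j s) - left_mass (xi j x s) (tau j s)) (at_right 0)"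
   using eventually_at_right_unit by eventually_elim (rule right_mass_lower(1)[OF tau_01[OF j]])
 qed
 moreover have "0 < (1/2) ^ j * (theta j (e j) - (1/2) * (x + 1/2))" using x th by simp
 ultimately show "left_end j x < total_mass (e j)" by linarith
qed

definition end_coord :: "nat => real \<times> real => real" where
 "end_coord j p = (if snd p > 0 then straight (xi j (fst p) (snd p)) (tau j (snd p))
   else ln (left_end j (fst p)) - ln (total_mass (e j) - left_end j (fst p)))"

lemma end_coord_tendsto:
 assumes j: "j : I" and x: "x : {-1/2<..<1/2}"
 shows "((%p. straight (xi j (fst p) (snd p)) (tau j (snd p))) \<longlongrightarrow> end_coord j (x, 0)) (at (x, 0) within half_square_pos)"
proof -
 let ?F = "at (x, 0) within half_square_pos"
 have x2: "x : {-1<..<1}" using x by auto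
 note L = left_end_tendsto[OF j x2] and B = left_end_bounds[OF j x]
 have "isCont total_mass (e j)" using total_mass_continuous by (simp add: continuous_on_eq_continuous_at)
 then have M: "((%p. total_mass (tau j (snd p))) \<longlongrightarrow> total_mass (e j)) ?F"
  using tau_tendsto by (rule isCont_tendsto_compose)
 have "((%p. ln (left_mass (xi j (fst p) (snd p)) (tau j (snd p))) -
   ln (total_mass (tau j (snd p)) - left_mass (xi j (fst p) (snd p)) (tau j (snd p)))) \<longlongrightarrow>
   ln (left_end j x) - ln (total_mass (e j) - left_end j x)) ?F"
  using B by (intro tendsto_intros L M) auto
 then show ?thesis by (simp add: end_coord_def straight_def)
qed

lemma end_coord_vertical:
 assumes j: "j : I" and x: "x : {-1/2<..<1/2}"
 shows "((%s. end_coord j (x, s)) \<longlongrightarrow> end_coord j (x, 0)) (at_right 0)"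
proof (rule Lim_transform_eventually)
 have "x : {-1<..<1}" using x by auto
 from filterlim_compose[OF end_coord_tendsto[OF j x] filterlim_vertical[OF this]]
 show "((%s. straight (xi j x s) (tau j s)) \<longlongrightarrow> end_coord j (x, 0)) (at_right 0)" by simp
 show "eventually (%s. straight (xi j x s) (tau j s) = end_coord j (x, s)) (at_right 0)"
  using eventually_at_right_unit by eventually_elim (simp add: end_coord_def)
qed

lemma end_coord_continuous:
 assumes j: "j : I"
 shows "continuous_on ({-1/2<..<1/2} \<times> {0..<1}) (end_coord j)"
proof -
 let ?F = "%p. straight (xi j (fst p) (snd p)) (tau j (snd p))"
 have c: "continuous_on ({-(1/2)<..<1/2} \<times> {0<..<1}) ?F"
 proof -
  have xi: "continuous_on ({-(1/2)<..<1/2} \<times> {0<..<1}) (%p. xi j (fst p) (snd p))"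
  proof -
   have "{-(1/2)<..<1/2} \<times> {0<..<1} <= half_square_pos" by auto
   from continuous_on_subset[OF xi_cont[OF j] this] show ?thesis by (simp add: case_prod_unfold)
  qed
  have "continuous_on ({-(1/2)<..<1/2} \<times> {0<..<1}) (%p. case (xi j (fst p) (snd p), tau j (snd p)) of (y, t) => straight y t)"
  proof (rule continuous_on_compose2[OF straight_continuous])
   show "continuous_on ({-(1/2)<..<1/2} \<times> {0<..<1}) (%p. (xi j (fst p) (snd p), tau j (snd p)))"
    unfolding tau_def by (intro continuous_on_Pair xi continuous_intros)
   show "(%p. (xi j (fst p) (snd p), tau j (snd p))) ` ({-(1/2)<..<1/2} \<times> {0<..<1}) <= band {0<..<1}"
    using tau_01[OF j] by fastforce
  qed
  then show ?thesis by simp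
 qed
 have "continuous_on ({-(1/2)<..<1/2} \<times> {0..<1}) (%p. if snd p > 0 then ?F p else end_coord j (fst p, 0))"
  using end_coord_tendsto[OF j] by (intro continuous_extension_to_base[OF c]) auto
 moreover have eq: "(%p. if snd p > 0 then ?F p else end_coord j (fst p, 0)) = end_coord j"
  by (rule ext) (auto simp: end_coord_def)
 ultimately have "continuous_on ({-(1/2)<..<1/2} \<times> {0..<1}) (end_coord j)" by (simp only:)
 then show ?thesis by simp
qed

lemma end_coord_strict_mono:
 assumes j: "j : I" and x: "-1/2 < x" "x < x'" "x' < 1/2" and s: "s : {0..<1}"
 shows "end_coord j (x, s) < end_coord j (x', s)"
proof (cases "s = 0")
 case True
 have B: "0 < left_end j x" "left_end j x' < total_mass (e j)"
  using left_end_bounds[OF j] x by auto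
 have lt: "left_end j x < left_end j x'" by (rule left_end_strict_mono[OF j x])
 have "ln (left_end j x) < ln (left_end j x')" using B lt by (subst ln_less_cancel_iff) auto
 moreover have "ln (total_mass (e j) - left_end j x') < ln (total_mass (e j) - left_end j x)"
  using B lt by (subst ln_less_cancel_iff) auto
 ultimately show ?thesis using True by (simp add: end_coord_def)
next
 case False
 then have s': "s : {0<..<1}" using s by auto
 then show ?thesis using xi_mono[OF j s', of x x'] x tau_01[OF j s']
  by (auto simp: end_coord_def intro!: straight_strict_mono)
qed

text \<open>The transition map turns the vertical approach in chart j into an approach to the base
  point of chart k along which heights and straightening coordinates agree; limits are
  unique.\<close>

lemma end_coord_germ:
 assumes k: "k : I" and j: "j : I" and x: "x : {-1/2<..<1/2}" and x': "x' : {-1/2<..<1/2}"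
  and same: "same_germ k x j x'"
 shows "e k = e j" "end_coord k (x, 0) = end_coord j (x', 0)"
proof -
 have x2: "x : {-1<..<1}" "x' : {-1<..<1}" using x x' by auto
 obtain delta1 where delta1: "delta1 > 0" "hbox x' delta1 <= half_square" "b j ` hbox_pos x' delta1 <= b k ` half_square_pos"
  and eq: "b k (x, 0) = b j (x', 0)" using same unfolding same_germ_def by blast
 have "b j (x', 0) : U k" using b_U[OF k] x2 eq by force
 from hbox_in_preimage[OF b_cont[OF j] U_open[OF k] this x2(2)] obtain delta2 where
  delta2: "delta2 > 0" "hbox x' delta2 <= half_square" "b j ` hbox x' delta2 <= U k" .
 define delta where "delta = min delta1 delta2"
 have delta: "delta > 0" "hbox x' delta <= half_square" "b j ` hbox x' delta <= U k" "b j ` hbox_pos x' delta <= b k ` half_square_pos"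
 proof -
  have le: "delta <= delta1" "delta <= delta2" by (auto simp: delta_def)
  show "delta > 0" using delta1(1) delta2(1) by (simp add: delta_def)
  show "hbox x' delta <= half_square" "b j ` hbox x' delta <= U k" using hbox_mono(1)[OF le(2), of x'] delta2 by blast+
  show "b j ` hbox_pos x' delta <= b k ` half_square_pos" using hbox_mono(2)[OF le(1), of x'] delta1(3) by blast
 qed
 obtain P where P: "continuous_on (hbox x' delta) P" "!!p. p : hbox x' delta ==> P p : half_square & b k (P p) = b j p"
  "!!p. p : hbox_pos x' delta ==> P p : half_square_pos"
  "!!p. p : hbox_pos x' delta ==> xi j (fst p) (snd p) = xi k (fst (P p)) (snd (P p)) & tau j (snd p) = tau k (snd (P p))"
  by (rule germ_transfer[OF k j delta]) blast
 have "P (x', 0) : half_square" "b k (P (x', 0)) = b k (x, 0)"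
  using P(2)[OF hbox_center[OF delta(1)]] eq by auto
 then have P0: "P (x', 0) = (x, 0)" using inj_onD[OF b_inj[OF k]] x2 by auto
 have ev: "eventually (%s. (x', s) : hbox_pos x' delta) (at_right 0)"
  using eventually_at_right_real[OF delta(1)] by eventually_elim (use delta(1) in \<open>auto simp: hbox_pos_def\<close>)
 have Plim: "((%s. P (x', s)) \<longlongrightarrow> (x, 0)) (at_right 0)"
 proof -
  have "(P \<longlongrightarrow> (x, 0)) (at (x', 0) within hbox x' delta)"
   using P(1) hbox_center[OF delta(1)] P0 unfolding continuous_on_def by metis
  then have "(P \<longlongrightarrow> (x, 0)) (at (x', 0) within half_square_pos)"
   unfolding at_half_square_eq_hbox[OF delta(1,2)] by (rule tendsto_within_subset) (rule hbox_pos_subset)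
  from filterlim_compose[OF this filterlim_vertical[OF x2(2)]] show ?thesis .
 qed
 have Pat: "filterlim (%s. P (x', s)) (at (x, 0) within half_square_pos) (at_right 0)"
  unfolding filterlim_at
 proof
  show "eventually (%s. P (x', s) : half_square_pos & P (x', s) ~= (x, 0)) (at_right 0)"
   using ev by eventually_elim (use P(3) in fastforce)
 qed (rule Plim)
 have "((%s. tau k (snd (P (x', s)))) \<longlongrightarrow> e k) (at_right 0)"
  using filterlim_compose[OF tau_tendsto Pat] by simp
 moreover have "eventually (%s. tau k (snd (P (x', s))) = tau j s) (at_right 0)"
  using ev by eventually_elim (use P(4) in fastforce)
 ultimately have A: "((%s. tau j s) \<longlongrightarrow> e k) (at_right 0)" by (rule Lim_transform_eventually)
 have nb: "at_right (0::real) ~= bot" by simp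
 show "e k = e j" by (rule tendsto_unique[OF nb A tau_vertical])
 have "((%s. straight (xi k (fst (P (x', s))) (snd (P (x', s)))) (tau k (snd (P (x', s))))) \<longlongrightarrow> end_coord k (x, 0)) (at_right 0)"
  using filterlim_compose[OF end_coord_tendsto[OF k x] Pat] by simp
 moreover have "eventually (%s. straight (xi k (fst (P (x', s))) (snd (P (x', s)))) (tau k (snd (P (x', s)))) = end_coord j (x', s)) (at_right 0)"
  using ev
 proof eventually_elim
  case (elim s)
  then have "0 < s" by (auto simp: hbox_pos_def)
  then show ?case using P(4)[OF elim] by (simp add: end_coord_def)
 qed
 ultimately have B: "((%s. end_coord j (x', s)) \<longlongrightarrow> end_coord k (x, 0)) (at_right 0)" by (rule Lim_transform_eventually)
 show "end_coord k (x, 0) = end_coord j (x', 0)" by (rule tendsto_unique[OF nb B end_coord_vertical[OF j x']])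
qed

text \<open>Different germs have disjoint small half boxes. At equal heights these cut disjoint
  intervals out of one line, so one interval lies to the left of the other. In the limit a weak
  inequality between the facing edges remains, and strict monotonicity inside each chart separates
  the centres.\<close>

lemma end_coord_separated:
 assumes k: "k : I" and j: "j : I" and x: "x : {-1/2<..<1/2}" and x': "x' : {-1/2<..<1/2}"
  and ns: "\<not> same_germ k x j x'" and ee: "e k = e j"
 shows "end_coord k (x, 0) ~= end_coord j (x', 0)"
proof -
 have x2: "x : {-1<..<1}" "x' : {-1<..<1}" using x x' by auto
 obtain delta where delta: "delta > 0" "hbox x delta <= half_square" "hbox x' delta <= half_square"
  "b k ` hbox_pos x delta Int b j ` hbox_pos x' delta = {}" using germ_dichotomy[OF k j x2 ns] .
 \<comment> \<open>Small enough for the intervals to stay both in the disjoint half boxes and in the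
   cores.\<close>
 define eta where "eta = Min {delta / 2, (1/2 - \<bar>x\<bar>) / 2, (1/2 - \<bar>x'\<bar>) / 2}"
 have "0 < eta" unfolding eta_def using delta(1) x x' by (subst Min_gr_iff) auto
 moreover have "eta <= delta / 2" "eta <= (1/2 - \<bar>x\<bar>) / 2" "eta <= (1/2 - \<bar>x'\<bar>) / 2"
  unfolding eta_def by (rule Min_le; simp)+
 ultimately have eta: "0 < eta" "eta <= delta / 2" "eta <= (1/2 - \<bar>x\<bar>) / 2" "eta <= (1/2 - \<bar>x'\<bar>) / 2" by blast+
 have core: "x - eta : {-1/2<..<1/2}" "x + eta : {-1/2<..<1/2}" "x' - eta : {-1/2<..<1/2}" "x' + eta : {-1/2<..<1/2}"
  using eta by (auto simp: abs_if split: if_splits)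
 \<comment> \<open>The level in chart j that has the same height as level \<open>s\<close> in chart
   k.\<close>
 let ?r = "%s. eps k * s / eps j"
 have eps: "0 < eps k" "0 < eps j" using eps01 k j by auto
 have rlim: "filterlim ?r (at_right 0) (at_right 0)"
 proof (rule filterlim_at[THEN iffD2], rule conjI)
  show "eventually (%s. ?r s : {0<..} & ?r s ~= 0) (at_right 0)"
   using eventually_at_right_unit by eventually_elim (use eps in auto)
  have "(?r \<longlongrightarrow> eps k * 0 / eps j) (at_right 0)" using eps by (intro tendsto_intros) auto
  then show "(?r \<longlongrightarrow> 0) (at_right 0)" by simp
 qed
 let ?A = "%s. end_coord k (x + eta, s) - end_coord j (x' - eta, ?r s)"
 let ?B = "%s. end_coord j (x' + eta, ?r s) - end_coord k (x - eta, s)"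
 \<comment> \<open>Which interval is the left one might change with the height; the minimum of both
   differences passes to the limit without deciding this.\<close>
 have "min (end_coord k (x + eta, 0) - end_coord j (x' - eta, 0)) (end_coord j (x' + eta, 0) - end_coord k (x - eta, 0)) <= 0"
 proof (rule tendsto_upperbound)
  show "((%s. min (?A s) (?B s)) \<longlongrightarrow> min (end_coord k (x + eta, 0) - end_coord j (x' - eta, 0)) (end_coord j (x' + eta, 0) - end_coord k (x - eta, 0))) (at_right 0)"
   by (intro tendsto_intros end_coord_vertical k j core filterlim_compose[OF end_coord_vertical rlim])
  define m where "m = min 1 delta"
  have m: "0 < m" "m <= 1" "m <= delta" using delta(1) by (auto simp: m_def)
  have "0 < min m (m * eps j / eps k)" using m eps by auto
  from eventually_at_right_real[OF this]
  show "eventually (%s. min (?A s) (?B s) <= 0) (at_right 0)"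
  proof eventually_elim
   case (elim s)
   then have s: "0 < s" "s < 1" "s < delta" "s < m * eps j / eps k" using m by auto
   have "eps k * s < m * eps j" using s(4) eps by (simp add: pos_less_divide_eq mult.commute)
   then have "?r s < m" using eps by (simp add: pos_divide_less_eq)
   moreover have "0 < ?r s" using s eps by simp
   ultimately have r: "0 < ?r s" "?r s < 1" "?r s < delta" using m by linarith+
   have taueq: "tau k s = tau j (?r s)" using ee eps by (simp add: tau_def)
   have t01: "tau k s : {0<..<1}" using tau_01[OF k] s by auto
   have "xi k (x + eta) s <= xi j (x' - eta) (?r s) \<or> xi j (x' + eta) (?r s) <= xi k (x - eta) s"
   proof (rule ccontr)
    assume "\<not> ?thesis"
    then have o: "xi j (x' - eta) (?r s) < xi k (x + eta) s" "xi k (x - eta) s < xi j (x' + eta) (?r s)" by auto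
    define y where "y = max (xi k (x - eta) s) (xi j (x' - eta) (?r s))"
    have m: "xi k (x - eta) s < xi k (x + eta) s" "xi j (x' - eta) (?r s) < xi j (x' + eta) (?r s)"
     using s r eta(1) core by (intro xi_mono k j; simp)+
    have "continuous_on {x - eta..x + eta} (%u. xi k u s)"
     by (rule continuous_on_subset[OF xi_cont_fst[OF k]]) (use s core in auto)
    then obtain u where u: "x - eta <= u" "u <= x + eta" "xi k u s = y"
     using IVT'[of "%u. xi k u s" "x - eta" y "x + eta"] o m eta(1) by (auto simp: y_def)
    have "continuous_on {x' - eta..x' + eta} (%u. xi j u (?r s))"
     by (rule continuous_on_subset[OF xi_cont_fst[OF j]]) (use r core in auto)
    then obtain u' where u': "x' - eta <= u'" "u' <= x' + eta" "xi j u' (?r s) = y"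
     using IVT'[of "%u. xi j u (?r s)" "x' - eta" y "x' + eta"] o m eta(1) by (auto simp: y_def)
    have "(u, s) : hbox_pos x delta" "(u', ?r s) : hbox_pos x' delta"
     using u u' s r eta delta(1) by (auto simp: hbox_pos_def)
    moreover have "(u, s) : half_square_pos" "(u', ?r s) : half_square_pos"
     using u u' s r core by auto
    then have "b k (u, s) = b j (u', ?r s)" using b_eq[OF k] b_eq[OF j] u(3) u'(3) taueq by simp
    ultimately show False using delta(4) by (metis IntI emptyE imageI)
   qed
   then have "?A s <= 0 \<or> ?B s <= 0"
    using straight_strict_mono[OF t01] s r taueq by (auto simp: end_coord_def le_less)
   then show ?case by linarith
  qed
 qed simp
 then consider "end_coord k (x + eta, 0) <= end_coord j (x' - eta, 0)" | "end_coord j (x' + eta, 0) <= end_coord k (x - eta, 0)"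
  by linarith
 then show ?thesis
 proof cases
  case 1
  moreover have "end_coord k (x, 0) < end_coord k (x + eta, 0)" "end_coord j (x' - eta, 0) < end_coord j (x', 0)"
   using core x x' eta(1) by (intro end_coord_strict_mono k j; simp)+
  ultimately show ?thesis by linarith
 next
  case 2
  moreover have "end_coord k (x - eta, 0) < end_coord k (x, 0)" "end_coord j (x', 0) < end_coord j (x' + eta, 0)"
   using core x x' eta(1) by (intro end_coord_strict_mono k j; simp)+
  ultimately show ?thesis by linarith
 qed
qed

end

section \<open>Completing and gluing strips\<close>

abbreviation core_square :: "(real \<times> real) set" where "core_square \<equiv> {-1/2<..<1/2} \<times> {0..<1}"

context arc_ends
begin

section \<open>The completed strip\<close>

definition End :: "nat => real \<times> real => real \<times> real" where
 "End j p = (end_coord j p, tau j (snd p))"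

definition strip_set :: "(real \<times> real) set" where
 "strip_set = band {0<..<1} Un (\<Union>j\<in>I. End j ` core_square)"

text \<open>A boundary point may be described by several charts. The choice does not depend on the
  chart, because equal end points belong to equal germs and thus to equal base points.\<close>

definition strip_map :: "real \<times> real => 'a" where
 "strip_map p = (if snd p : {0<..<1} then h (inv_into (band {0<..<1}) Straight p)
   else (SOME z. EX j:I. EX x:{-1/2<..<1/2}. p = End j (x, 0) & z = b j (x, 0)))"

lemma End_pos:
 assumes "j : I" "s : {0<..<1}"
 shows "End j (x, s) = Straight (xi j x s, tau j s)" "snd (End j (x, s)) : {0<..<1}"
 using assms tau_01[of j s] by (auto simp: End_def end_coord_def Straight_def)

lemma End_base: "End j (x, 0) = (end_coord j (x, 0), e j)"
 by (simp add: End_def tau_0)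

lemma tau_unit: "j : I ==> s : {0..<1} ==> tau j s : {0..1}"
 using tau_01[of j s] tau_0[of j] e01[of j] by (cases "s = 0") auto

lemma tau_eq_iff: "j : I ==> tau j s = tau j s' \<longleftrightarrow> s = s'"
 using e01[of j] eps01[of j] by (auto simp: tau_def)

lemma End_continuous: "j : I ==> continuous_on core_square (End j)"
 unfolding End_def tau_def by (intro continuous_on_Pair end_coord_continuous continuous_intros)

text \<open>Invariance of domain asks for an open set of the plane, so the chart is doubled across
  its base: the coordinate along the line is reflected, while the height continues linearly beyond
  the end of the strip.\<close>

lemma End_openin:
 assumes j: "j : I" and V: "openin (top_of_set core_square) V"
 shows "openin (top_of_set (band {0..1})) (End j ` V)"
proof -
 obtain T where T: "open T" "V = core_square Int T" using V by (auto simp: openin_open)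
 let ?C = "{-1/2<..<1/2} \<times> {-1<..<1} :: (real \<times> real) set"
 let ?R = "%p. (end_coord j (fst p, \<bar>snd p\<bar>), tau j (snd p))"
 define V2 where "V2 = ?C Int {p. (fst p, \<bar>snd p\<bar>) : T}"
 have "open {p :: real \<times> real. (fst p, \<bar>snd p\<bar>) : T}"
 proof -
  have "continuous_on UNIV (%p::real \<times> real. (fst p, \<bar>snd p\<bar>))"
   by (intro continuous_on_Pair continuous_on_fst continuous_on_rabs continuous_on_snd continuous_on_id)
  from open_vimage[OF T(1) this] show ?thesis by (simp add: vimage_def)
 qed
 then have o: "open V2" unfolding V2_def by (intro open_Int open_Times) auto
 have "continuous_on ?C ?R"
  unfolding tau_def
  by (intro continuous_on_Pair continuous_on_compose2[OF end_coord_continuous[OF j]] continuous_intros) auto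
 then have c: "continuous_on V2 ?R" by (rule continuous_on_subset) (auto simp: V2_def)
 have i: "inj_on ?R V2"
 proof (rule inj_onI)
  fix p p' assume p: "p : V2" "p' : V2" "?R p = ?R p'"
  then have s: "snd p = snd p'" using tau_eq_iff[OF j] by simp
  have "\<bar>snd p\<bar> : {0..<1}" using p(1) by (auto simp: V2_def)
  then have "fst p = fst p'"
   using p s end_coord_strict_mono[OF j, of "fst p" "fst p'" "\<bar>snd p\<bar>"] end_coord_strict_mono[OF j, of "fst p'" "fst p" "\<bar>snd p\<bar>"]
   by (cases "fst p" "fst p'" rule: linorder_cases) (auto simp: V2_def)
  then show "p = p'" using s by (simp add: prod_eq_iff)
 qed
 have "open (?R ` V2)" by (rule invariance_of_domain[OF c o i])
 moreover have "End j ` V = (band {0..1}) Int ?R ` V2"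
 proof (intro equalityI subsetI)
  fix z assume "z : End j ` V"
  then obtain p where p: "p : V" "z = End j p" by blast
  then have R: "z = ?R p" "p : V2" "snd p : {0..<1}" using T(2) by (auto simp: V2_def End_def)
  then have "z : ?R ` V2" by blast
  moreover have "z : band {0..1}" using tau_unit[OF j R(3)] p(2) by (simp add: End_def)
  ultimately show "z : (band {0..1}) Int ?R ` V2" by blast
 next
  fix z assume z: "z : (band {0..1}) Int ?R ` V2"
  then obtain p where p: "p : V2" "z = ?R p" by blast
  have "tau j (snd p) : {0..1}" using z p by auto
  then have "snd p \<ge> 0" using e01[OF j] eps01[OF j] by (auto simp: tau_def mult_less_0_iff zero_le_mult_iff)
  then have "p : V" "z = End j p" using p T(2) by (auto simp: V2_def End_def)
  then show "z : End j ` V" by blast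
 qed
 ultimately show ?thesis by (auto simp: openin_open)
qed

lemma strip_set_openin: "openin (top_of_set (band {0..1})) strip_set"
proof -
 have "openin (top_of_set (band {0..1})) (band {0<..<1} :: (real \<times> real) set)"
  by (intro open_subset open_Times) auto
 moreover have "openin (top_of_set (band {0..1})) (End j ` core_square)" if "j : I" for j
  using End_openin[OF that openin_subtopology_self] by simp
 ultimately show ?thesis unfolding strip_set_def by (intro openin_Un openin_Union) auto
qed

lemma strip_set_is_strip: "is_strip strip_set 0 1"
 unfolding is_strip_def
 using strip_set_openin openin_subset[OF strip_set_openin] by (auto simp: strip_set_def)

lemma End_in_strip: "j : I ==> p : core_square ==> End j p : strip_set"
 by (auto simp: strip_set_def)

lemma same_germ_of_End_eq:
 assumes "k : I" "j : I" "x : {-1/2<..<1/2}" "x' : {-1/2<..<1/2}" "End k (x, 0) = End j (x', 0)"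
 shows "same_germ k x j x'"
 using assms end_coord_separated[OF assms(1-4)] by (auto simp: End_base)

lemma strip_map_End:
 assumes j: "j : I" and p: "p : core_square"
 shows "strip_map (End j p) = b j p"
proof (cases "snd p = 0")
 case True
 then obtain x where x: "p = (x, 0)" "x : {-1/2<..<1/2}" using p by (cases p) auto
 have ni: "snd (End j p) ~: {0<..<1}" using e01[OF j] x by (auto simp: End_base)
 have "(SOME z. EX k:I. EX y:{-1/2<..<1/2}. End j p = End k (y, 0) & z = b k (y, 0)) = b j p"
 proof (rule some_equality)
  show "EX k:I. EX y:{-1/2<..<1/2}. End j p = End k (y, 0) & b j p = b k (y, 0)" using j x by blast
  fix z assume "EX k:I. EX y:{-1/2<..<1/2}. End j p = End k (y, 0) & z = b k (y, 0)"
  then obtain k y where k: "k : I" "y : {-1/2<..<1/2}" "End j p = End k (y, 0)" "z = b k (y, 0)" by blast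
  then have "same_germ k y j x" using x j by (intro same_germ_of_End_eq) auto
  then show "z = b j p" using k x by (simp add: same_germ_def)
 qed
 then show ?thesis by (simp only: strip_map_def if_not_P[OF ni])
next
 case False
 then obtain x s where x: "p = (x, s)" "x : {-1/2<..<1/2}" "s : {0<..<1}" using p by (cases p) auto
 have "(xi j x s, tau j s) : band {0<..<1}" using tau_01[OF j x(3)] by simp
 then have "inv_into (band {0<..<1}) Straight (End j p) = (xi j x s, tau j s)"
  using End_pos(1)[OF j x(3), of x] x(1) Straight_bij by (simp add: bij_betw_def inv_into_f_f)
 moreover have "snd (End j p) : {0<..<1}" using End_pos(2)[OF j x(3)] x(1) by simp
 moreover have "b j p = h (xi j x s, tau j s)" unfolding x(1) by (rule b_eq[OF j]) (use x in auto)
 ultimately show ?thesis by (simp add: strip_map_def)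
qed

lemma strip_boundary_cases:
 assumes "p : strip_set" "snd p ~: {0<..<1}"
 obtains j x where "j : I" "x : {-1/2<..<1/2}" "p = End j (x, 0)"
proof -
 have "p ~: band {0<..<1}" using assms(2) by auto
 then obtain j y where j: "j : I" "y : core_square" "p = End j y" using assms(1) by (auto simp: strip_set_def)
 obtain u s where us: "y = (u, s)" "u : {-1/2<..<1/2}" "s : {0..<1}" using j(2) by (cases y) auto
 have "s = 0"
 proof (rule ccontr)
  assume "s ~= 0"
  then have "s : {0<..<1}" using us(3) by auto
  from End_pos(2)[OF j(1) this, of u] show False using assms(2) j(3) us(1) by simp
 qed
 then show thesis using j us by (intro that[of j u]) auto
qed

lemma strip_boundary_eq: "strip_boundary strip_set 0 1 = (\<Union>j\<in>I. End j ` ({-1/2<..<1/2} \<times> {0}))"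
proof (intro equalityI subsetI)
 fix p assume "p : strip_boundary strip_set 0 1"
 then have "p : strip_set" "snd p ~: {0<..<1}" by (auto simp: strip_boundary_def)
 then obtain j x where "j : I" "x : {-1/2<..<1/2}" "p = End j (x, 0)" by (rule strip_boundary_cases)
 then show "p : (\<Union>j\<in>I. End j ` ({-1/2<..<1/2} \<times> {0}))" by blast
next
 fix p assume "p : (\<Union>j\<in>I. End j ` ({-1/2<..<1/2} \<times> {0}))"
 then obtain j x where "j : I" "x : {-1/2<..<1/2}" "p = End j (x, 0)" by auto
 then show "p : strip_boundary strip_set 0 1"
  using End_in_strip[of j "(x, 0)"] e01[of j] by (auto simp: strip_boundary_def End_base)
qed

lemma strip_map_interior:
 assumes "y : band {0<..<1}"
 shows "strip_map (Straight y) = h y"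
proof -
 have "snd (Straight y) : {0<..<1}" using assms by (auto simp: Straight_def)
 moreover have "inv_into (band {0<..<1}) Straight (Straight y) = y"
  using Straight_bij assms by (simp add: bij_betw_def inv_into_f_f)
 ultimately show ?thesis by (simp add: strip_map_def)
qed

lemma Straight_line: "t : {0<..<1} ==> Straight ` (band {t}) = band {t}"
proof (intro equalityI subsetI)
 fix p :: "real \<times> real" assume t: "t : {0<..<1}" and "p : band {t}"
 then obtain v where "p = (v, t)" by auto
 then show "p : Straight ` (band {t})"
  using straight_surj[OF t, of v] by (force simp: Straight_def)
qed (auto simp: Straight_def)

lemma strip_map_line:
 assumes "t : {0<..<1}"
 shows "strip_map ` (band {t}) = h ` (band {t})"
proof -
 have "strip_map ` (band {t}) = strip_map ` Straight ` (band {t})" using Straight_line[OF assms] by simp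
 also have "\<dots> = h ` (band {t})"
  unfolding image_image using assms by (intro image_cong strip_map_interior) auto
 finally show ?thesis .
qed

lemma strip_map_interior_eq:
 assumes "p : band {0<..<1}"
 obtains y where "y : band {0<..<1}" "p = Straight y" "strip_map p = h y"
proof -
 have "p : Straight ` (band {0<..<1})" using Straight_bij assms by (simp add: bij_betw_def)
 then obtain y where "y : band {0<..<1}" "p = Straight y" by blast
 then show thesis using that strip_map_interior by blast
qed

lemma strip_map_inj_interior: "inj_on strip_map (band {0<..<1})"
proof (rule inj_onI)
 fix p p' assume p: "p : band {0<..<1}" "p' : band {0<..<1}" "strip_map p = strip_map p'"
 obtain y where y: "y : band {0<..<1}" "p = Straight y" "strip_map p = h y" using strip_map_interior_eq[OF p(1)] .
 obtain y' where y': "y' : band {0<..<1}" "p' = Straight y'" "strip_map p' = h y'" using strip_map_interior_eq[OF p(2)] .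
 have "y = y'" using inj_onD[OF h_inj _ y(1) y'(1)] p(3) y(3) y'(3) by simp
 then show "p = p'" using y y' by simp
qed

text \<open>At boundary points the neighbourhoods come from the charts, whose images under
  \<open>End\<close> are open in the completed strip.\<close>

lemma strip_map_continuous:
 assumes h: "continuous_map (top_of_set (band {0<..<1})) X h"
 shows "continuous_map (top_of_set strip_set) X strip_map"
proof -
 have ci: "continuous_map (top_of_set (band {0<..<1})) X strip_map"
 proof -
  have "homeomorphism (band {0<..<1}) (Straight ` (band {0<..<1})) Straight (inv_into (band {0<..<1}) Straight)"
  proof -
   obtain g where g: "homeomorphism (band {0<..<1}) (Straight ` (band {0<..<1})) Straight g"
    using invariance_of_domain_homeomorphism[of "band {0<..<1}" Straight] Straight_continuous Straight_bij
    by (auto simp: open_Times bij_betw_def)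
   show ?thesis
   proof (rule homeomorphism_cong[OF g])
    show "inv_into (band {0<..<1}) Straight y = g y" if y: "y : Straight ` (band {0<..<1})" for y
    proof -
     obtain w where w: "w : band {0<..<1}" "y = Straight w" using y by blast
     have "inv_into (band {0<..<1}) Straight y = w"
      unfolding w(2) using Straight_bij w(1) by (intro inv_into_f_f) (auto simp: bij_betw_def)
     moreover have "g y = w" using g w by (simp only: homeomorphism_def)
     ultimately show ?thesis by simp
    qed
   qed auto
  qed
  then have "continuous_on (band {0<..<1}) (inv_into (band {0<..<1}) Straight)"
   "inv_into (band {0<..<1}) Straight ` (band {0<..<1}) <= band {0<..<1}"
   using Straight_bij by (auto simp: homeomorphism_def bij_betw_def)
  from continuous_map_top_of_set_o[OF h this] show ?thesis
   by (rule continuous_map_eq) (auto simp: strip_map_def)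
 qed
 have subX: "strip_map p : topspace X" if p: "p : strip_set" for p
 proof (cases "snd p : {0<..<1}")
  case True
  then have "p : band {0<..<1}" by (simp add: mem_Times_iff)
  then show ?thesis using continuous_map_image_subset_topspace[OF ci] by auto
 next
  case False
  obtain j x where jx: "j : I" "x : {-1/2<..<1/2}" "p = End j (x, 0)" using strip_boundary_cases[OF p False] .
  then have "strip_map p = b j (x, 0)" using strip_map_End[of j "(x, 0)"] by auto
  moreover have "(x, 0) : half_square" using jx by auto
  ultimately show ?thesis using continuous_map_image_subset_topspace[OF b_cont[OF jx(1)]] by auto
 qed
 show ?thesis
  unfolding continuous_map_def
 proof (intro conjI allI impI)
  show "strip_map : topspace (top_of_set strip_set) \<rightarrow> topspace X" using subX by auto
  fix V assume V: "openin X V"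
  show "openin (top_of_set strip_set) {p : topspace (top_of_set strip_set). strip_map p : V}"
  proof (subst openin_subopen, intro ballI)
   fix p assume "p : {p : topspace (top_of_set strip_set). strip_map p : V}"
   then have p: "p : strip_set" "strip_map p : V" by auto
   show "EX T. openin (top_of_set strip_set) T & p : T & T <= {p : topspace (top_of_set strip_set). strip_map p : V}"
   proof (cases "snd p : {0<..<1}")
    case True
    let ?T = "{p : band {0<..<1}. strip_map p : V}"
    have "openin (top_of_set (band {0<..<1})) ?T"
     using openin_continuous_map_preimage[OF ci V] by simp
    then have "open ?T" using openin_open_trans open_Times[OF open_UNIV open_greaterThanLessThan] by blast
    then have "openin (top_of_set strip_set) ?T" by (intro open_subset) (auto simp: strip_set_def)
    then show ?thesis using True p by (intro exI[of _ ?T]) (auto simp: strip_set_def mem_Times_iff)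
   next
    case False
    obtain j x where jx: "j : I" "x : {-1/2<..<1/2}" "p = End j (x, 0)" using strip_boundary_cases[OF p(1) False] .
    let ?T = "{y : core_square. b j y : V}"
    have "core_square <= half_square" by auto
    then have "continuous_map (top_of_set core_square) X (b j)"
     by (rule continuous_map_from_subtopology_mono[OF b_cont[OF jx(1)]])
    from openin_continuous_map_preimage[OF this V] have "openin (top_of_set core_square) ?T" by simp
    then have oT: "openin (top_of_set (band {0..1})) (End j ` ?T)" by (rule End_openin[OF jx(1)])
    have sub: "End j ` ?T <= strip_set" using End_in_strip[OF jx(1)] by blast
    have "strip_set <= band {0..1}" using strip_set_is_strip by (simp add: is_strip_def)
    from openin_subset_trans[OF oT sub this] have "openin (top_of_set strip_set) (End j ` ?T)" .
    moreover have "p : End j ` ?T" using jx p(2) strip_map_End[OF jx(1), of "(x, 0)"] by auto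
    moreover have "End j ` ?T <= {p : topspace (top_of_set strip_set). strip_map p : V}"
     using sub strip_map_End[OF jx(1)] by auto
    ultimately show ?thesis by blast
   qed
  qed
 qed
qed

text \<open>Openness in the completed strip is pulled back to the original half chart. This is one
  side's share of the quotient property at a cut leaf.\<close>

lemma strip_map_hbox:
 assumes j: "j : I" and x: "x : {-1/2<..<1/2}"
  and A: "openin (top_of_set strip_set) {p : strip_set. strip_map p : A}" and z: "b j (x, 0) : A"
 obtains delta where "delta > 0" "hbox x delta <= half_square" "b j ` hbox x delta <= A"
proof -
 have "openin (top_of_set core_square) (core_square Int End j -` {p : strip_set. strip_map p : A})"
  using continuous_openin_preimage[OF End_continuous[OF j] _ A] End_in_strip[OF j] by blast
 then obtain T where T: "open T" "core_square Int End j -` {p : strip_set. strip_map p : A} = core_square Int T"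
  by (auto simp: openin_open)
 have core: "(x, 0) : core_square" using x by auto
 then have "(x, 0) : core_square Int T"
  unfolding T(2)[symmetric] using End_in_strip[OF j core] strip_map_End[OF j core] z by simp
 moreover have "open (T Int {-1/2<..<1/2} \<times> UNIV)" using T(1) by (intro open_Int open_Times) auto
 moreover have "x : {-1<..<1}" using x by auto
 ultimately obtain delta where delta: "delta > 0" "hbox x delta <= half_square" "hbox x delta <= T Int {-1/2<..<1/2} \<times> UNIV"
  using hbox_in_open[of "T Int {-1/2<..<1/2} \<times> UNIV" x] by auto
 have "b j p : A" if p: "p : hbox x delta" for p
 proof -
  have "p : half_square" "p : T Int {-1/2<..<1/2} \<times> UNIV" using p delta(2,3) by blast+
  then have pc: "p : core_square" "p : T" by (cases p; auto)+
  then have "p : core_square Int End j -` {p : strip_set. strip_map p : A}" using T(2) by blast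
  then show ?thesis using strip_map_End[OF j pc(1)] by auto
 qed
 then show thesis using that delta by blast
qed

end

definition germ_inside :: "(real \<times> real => 'a) => (real \<times> real => 'a) => real => bool" where
 "germ_inside c d x \<longleftrightarrow> (EX delta>0. hbox x delta <= half_square & d ` hbox_pos x delta <= c ` half_square_pos)"

abbreviation core :: "real set" where "core \<equiv> {-1/2<..<1/2}"

text \<open>The interface between straightening and gluing, in which the masses are no longer
  visible. Boundary points coincide exactly when base points and germs do, so that the two sides of
  a leaf stay distinct even if both belong to the same strip. The last clause provides the half
  boxes for the quotient topology.\<close>

definition strip_completion ::
 "'a topology => (real \<times> real => 'a) => nat set => (nat => real \<times> real => 'a)
  => (real \<times> real) set => (real \<times> real => 'a) => (nat => real => real \<times> real) => bool" where
 "strip_completion X h I b S q En \<longleftrightarrow>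
   is_strip S 0 1 & continuous_map (top_of_set S) X q & inj_on q (band {0<..<1}) &
   (ALL t:{0<..<1}. q ` (band {t}) = h ` (band {t})) &
   strip_boundary S 0 1 = (\<Union>j\<in>I. En j ` core) &
   (ALL j:I. ALL x:core. q (En j x) = b j (x, 0)) &
   (ALL j:I. continuous_on core (En j) & inj_on (%x. fst (En j x)) core) &
   (ALL j:I. ALL k:I. ALL x:core. ALL x':core.
    En k x = En j x' \<longleftrightarrow> b k (x, 0) = b j (x', 0) & germ_inside (b k) (b j) x') &
   (ALL A. openin (top_of_set S) {p : S. q p : A} -->
    (ALL j:I. ALL x:core. b j (x, 0) : A --> (EX delta>0. hbox x delta <= half_square & b j ` hbox x delta <= A)))"

context arc_ends
begin

lemma strip_completion_exists:
 assumes h: "continuous_map (top_of_set (band {0<..<1})) X h"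
 shows "strip_completion X h I b strip_set strip_map (%j x. End j (x, 0))"
 unfolding strip_completion_def
proof (intro conjI ballI allI impI iffI)
 show "is_strip strip_set 0 1" by (rule strip_set_is_strip)
 show "continuous_map (top_of_set strip_set) X strip_map" by (rule strip_map_continuous[OF h])
 show "inj_on strip_map (band {0<..<1})" by (rule strip_map_inj_interior)
 show "strip_map ` (band {t}) = h ` (band {t})" if "t : {0<..<1}" for t by (rule strip_map_line[OF that])
 show "strip_boundary strip_set 0 1 = (\<Union>j\<in>I. (%x. End j (x, 0)) ` core)"
  unfolding strip_boundary_eq by force
 show "strip_map (End j (x, 0)) = b j (x, 0)" if "j : I" "x : core" for j x
  using that by (intro strip_map_End) auto
 show "continuous_on core (%x. End j (x, 0))" if "j : I" for j
  by (rule continuous_on_compose2[OF End_continuous[OF that]]) (auto intro!: continuous_intros)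
 show "inj_on (%x. fst (End j (x, 0))) core" if "j : I" for j
 proof (rule linorder_inj_onI)
  fix x y :: real assume "x < y" "x : core" "y : core"
  then show "fst (End j (x, 0)) ~= fst (End j (y, 0))"
   using end_coord_strict_mono[OF that, of x y 0] by (simp add: End_base)
 qed auto
next
 fix j k x x' assume *: "j : I" "k : I" "x : core" "x' : core" "End k (x, 0) = End j (x', 0)"
 from same_germ_of_End_eq[OF *(2,1,3,4,5)]
 show "b k (x, 0) = b j (x', 0)" "germ_inside (b k) (b j) x'" by (auto simp: same_germ_def germ_inside_def)
next
 fix j k x x' assume *: "j : I" "k : I" "x : core" "x' : core"
  "b k (x, 0) = b j (x', 0) & germ_inside (b k) (b j) x'"
 then have "same_germ k x j x'" by (auto simp: same_germ_def germ_inside_def)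
 from end_coord_germ[OF *(2,1,3,4) this] show "End k (x, 0) = End j (x', 0)" by (simp add: End_base)
next
 fix A j x assume *: "openin (top_of_set strip_set) {p : strip_set. strip_map p : A}" "j : I" "x : core" "b j (x, 0) : A"
 obtain delta where "delta > 0" "hbox x delta <= half_square" "b j ` hbox x delta <= A"
  using strip_map_hbox[OF *(2,3,1,4)] .
 then show "EX delta>0. hbox x delta <= half_square & b j ` hbox x delta <= A" by blast
qed

end

text \<open>Equal values at two points would force an extremum strictly between them or a constant
  function there; strict monotonicity near each point excludes both.\<close>

lemma locally_injective_imp_injective:
 fixes phi :: "real => real"
 assumes Y: "is_interval Y" and c: "continuous_on Y phi"
  and loc: "!!y. y : Y ==> EX N. open N & y : N & N <= Y & inj_on phi N"
 shows "inj_on phi Y"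
proof (rule linorder_inj_onI)
 fix y1 y2 assume y: "y1 < y2" "y1 : Y" "y2 : Y"
 show "phi y1 ~= phi y2"
 proof
  assume eq: "phi y1 = phi y2"
  have sub: "{y1..y2} <= Y"
  proof
   fix z assume "z : {y1..y2}"
   then have "y1 <= z" "z <= y2" by auto
   then show "z : Y" using Y y(2,3) unfolding is_interval_1 by blast
  qed
  have ext: False if m: "m : {y1<..<y2}" and ex: "(ALL z:{y1..y2}. phi z <= phi m) \<or> (ALL z:{y1..y2}. phi m <= phi z)" for m
  proof -
   have "m : Y" using m sub by auto
   then obtain N where N: "open N" "m : N" "N <= Y" "inj_on phi N" using loc by blast
   have "open (N Int {y1<..<y2})" "m : N Int {y1<..<y2}" using N m by auto
   then obtain d where d: "d > 0" "ball m d <= N Int {y1<..<y2}" using open_contains_ball by blast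
   define u where "u = m - d/2"
   define v where "v = m + d/2"
   have uv: "u < m" "m < v" "{u..v} <= N Int {y1<..<y2}"
   proof -
    show "u < m" "m < v" using d(1) by (auto simp: u_def v_def)
    have "{u..v} <= ball m d" using d(1) by (auto simp: u_def v_def dist_real_def)
    then show "{u..v} <= N Int {y1<..<y2}" using d(2) by blast
   qed
   have "{u..v} <= N" "{u..v} <= Y" using uv(3) N(3) by blast+
   then have "continuous_on {u..v} phi" "inj_on phi {u..v}"
    using N(4) by (blast intro: continuous_on_subset[OF c] inj_on_subset)+
   from continuous_inj_imp_mono[OF uv(1,2) this]
   have "(phi u < phi m & phi m < phi v) \<or> (phi v < phi m & phi m < phi u)" .
   moreover have "u : {u..v}" "v : {u..v}" using uv(1,2) by auto
   then have "u : {y1<..<y2}" "v : {y1<..<y2}" using uv(3) by blast+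
   then have "u : {y1..y2}" "v : {y1..y2}" by auto
   then have "(phi u <= phi m & phi v <= phi m) \<or> (phi m <= phi u & phi m <= phi v)" using ex by blast
   ultimately show False by linarith
  qed
  have cc: "compact {y1..y2}" "{y1..y2} ~= {}" "continuous_on {y1..y2} phi"
   using y(1) continuous_on_subset[OF c sub] by auto
  obtain m where m: "m : {y1..y2}" "ALL z:{y1..y2}. phi z <= phi m" using continuous_attains_sup[OF cc] by blast
  obtain n where n: "n : {y1..y2}" "ALL z:{y1..y2}. phi n <= phi z" using continuous_attains_inf[OF cc] by blast
  have "m = y1 \<or> m = y2"
  proof (rule ccontr)
   assume "\<not> (m = y1 \<or> m = y2)"
   then have "m : {y1<..<y2}" using m(1) by auto
   then show False using ext[of m] m(2) by blast
  qed
  moreover have "n = y1 \<or> n = y2"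
  proof (rule ccontr)
   assume "\<not> (n = y1 \<or> n = y2)"
   then have "n : {y1<..<y2}" using n(1) by auto
   then show False using ext[of n] n(2) by blast
  qed
  ultimately have mn: "phi m = phi y1" "phi n = phi y1" using eq by auto
  have const: "phi z = phi y1" if z: "z : {y1..y2}" for z
   using m(2)[rule_format, OF z] n(2)[rule_format, OF z] mn by linarith
  let ?m = "(y1 + y2) / 2"
  have "?m : {y1<..<y2}" using y(1) by (auto simp: field_simps)
  moreover have "ALL z:{y1..y2}. phi z <= phi ?m"
  proof
   fix z assume z: "z : {y1..y2}"
   have "?m : {y1..y2}" using y(1) by (auto simp: field_simps)
   then show "phi z <= phi ?m" using const[OF z] const[of ?m] by simp
  qed
  ultimately show False using ext[of ?m] by blast
 qed
qed auto

section \<open>Gluing the completed strips along the cut leaves\<close>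

text \<open>Chart n on a cut leaf has the half charts \<open>2 * n\<close> and
  \<open>2 * n + 1\<close>, the second only if \<open>full n\<close>, that is, if the chart has two
  sides. \<open>I\<close> collects the existing half charts and \<open>a k\<close> is the strip on
  side k. The sides may run through the base in opposite directions, which the sign
  \<open>r n\<close> records. The cores of the bases cover all cut leaves.\<close>

locale strip_gluing =
 fixes X :: "'a topology" and \<Delta> Sg :: "'a set set" and \<Lambda> :: "nat set" and h :: "nat => real \<times> real => 'a"
  and full :: "nat => bool" and U :: "nat => 'a set" and a :: "nat => nat"
  and b :: "nat => real \<times> real => 'a" and r :: "nat => real"
  and S :: "nat => (real \<times> real) set" and q :: "nat => real \<times> real => 'a"
  and En :: "nat => nat => real => real \<times> real"
 fixes I W defines I_def: "I \<equiv> {k. even k \<or> full (k div 2)}" and W_def: "W \<equiv> \<Union>Sg"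
 assumes surf: "surface_with_boundary X"
  and leaf_disjoint: "!!L L'. L : \<Delta> ==> L' : \<Delta> ==> L Int L' ~= {} ==> L = L'"
  and leaf_nonempty: "{} ~: \<Delta>"
  and leaves_cover: "\<Union>\<Delta> = topspace X"
  and leaf_closed: "!!L. L : \<Delta> ==> closedin X L"
  and leaf_line: "!!L. L : \<Delta> ==> subtopology X L homeomorphic_space euclideanreal"
  and Sg: "Sg <= \<Delta>" and Sg_locally_finite: "locally_finite_in X Sg"
  and completion: "!!l. l : \<Lambda> ==> strip_completion X (h l) {k : I. a k = l} b (S l) (q l) (En l)"
  and h_leaf: "!!l t. l : \<Lambda> ==> t : {0<..<1} ==> h l ` (band {t}) : \<Delta> - Sg"
  and h_disjoint: "!!l l'. l : \<Lambda> ==> l' : \<Lambda> ==> h l ` (band {0<..<1}) Int h l' ` (band {0<..<1}) ~= {} ==> l = l'"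
  and h_cover: "(\<Union>l\<in>\<Lambda>. h l ` (band {0<..<1})) = topspace X - W"
  and a_in: "!!k. k : I ==> a k : \<Lambda>"
  and b_cont: "!!k. k : I ==> continuous_map (top_of_set half_square) X (b k)"
  and b_inj: "!!k. k : I ==> inj_on (b k) half_square"
  and b_arc: "!!k. k : I ==> b k ` half_square_pos <= h (a k) ` (band {0<..<1})"
  and b_open: "!!k. k : I ==> openin X (b k ` half_square_pos)"
  and U_open: "!!n. openin X (U n)"
  and b_U: "!!k. k : I ==> b k ` half_square <= U (k div 2)"
  and base_cover: "!!z. z : W ==> EX n. EX x:core. z = b (2 * n) (x, 0)"
  and base_leaf: "!!n. EX L:Sg. b (2 * n) ` ({-1<..<1} \<times> {0}) <= L"
  and r_sign: "!!n. r n = 1 \<or> r n = -1"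
  and base_odd: "!!n x. full n ==> x : {-1<..<1} ==> b (2 * n + 1) (x, 0) = b (2 * n) (r n * x, 0)"
  and sides: "!!n. U n - W <= b (2 * n) ` half_square_pos Un (if full n then b (2 * n + 1) ` half_square_pos else {})"
  and sides_disjoint: "!!n. full n ==> b (2 * n) ` half_square_pos Int b (2 * n + 1) ` half_square_pos = {}"
  and nbhd: "!!n x delta. x : core ==> delta > 0 ==> EX V. openin X V & b (2 * n) (x, 0) : V &
    V <= b (2 * n) ` (hbox x delta Int half_square) Un (if full n then b (2 * n + 1) ` (hbox (r n * x) delta Int half_square) else {})"
begin

definition K :: "nat => nat set" where "K n = {k : I. k div 2 = n}"

text \<open>Refers the direction of side k to that of the even side of its chart.\<close>

definition rho :: "nat => real" where "rho k = (if even k then 1 else r (k div 2))"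

abbreviation base :: "nat => real => 'a" where "base n x \<equiv> b (2 * n) (x, 0)"

lemma K_cases: "K n = (if full n then {2 * n, 2 * n + 1} else {2 * n})"
proof -
 have "k div 2 = n \<longleftrightarrow> k = 2 * n \<or> k = 2 * n + 1" for k by presburger
 then show ?thesis by (auto simp: K_def I_def)
qed

lemma even_in_I: "2 * n : I" by (simp add: I_def)

lemma rho_sign: "rho k = 1 \<or> rho k = -1" using r_sign by (auto simp: rho_def)

lemma rho_mult: "rho k * (rho k * x) = x" using rho_sign[of k] by auto

lemma rho_core: "rho k * x : core \<longleftrightarrow> x : core" using rho_sign[of k] by auto

lemma b_base:
 assumes "k : I" "x : {-1<..<1}"
 shows "b k (x, 0) = base (k div 2) (rho k * x)"
proof (cases "even k")
 case True
 then have "2 * (k div 2) = k" by simp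
 then show ?thesis using True by (simp add: rho_def)
next
 case False
 then have "2 * (k div 2) + 1 = k" "full (k div 2)" using assms(1) by (auto simp: I_def)
 then show ?thesis using base_odd[of "k div 2" x] assms(2) False by (simp add: rho_def)
qed

lemma base_b:
 assumes "k : K n" "x : core"
 shows "b k (rho k * x, 0) = base n x"
proof -
 have "rho k * x : {-1<..<1}" using rho_core[of k x] assms(2) by auto
 then show ?thesis using b_base[of k "rho k * x"] assms(1) rho_mult by (simp add: K_def)
qed

lemma base_in_W: "x : {-1<..<1} ==> base n x : W"
 using base_leaf[of n] unfolding W_def by blast

lemma q_facts:
 assumes "l : \<Lambda>"
 shows "is_strip (S l) 0 1" "continuous_map (top_of_set (S l)) X (q l)" "inj_on (q l) (band {0<..<1})"
  "!!t. t : {0<..<1} ==> q l ` (band {t}) = h l ` (band {t})"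
  "strip_boundary (S l) 0 1 = (\<Union>j\<in>{k : I. a k = l}. En l j ` core)"
 using completion[OF assms] unfolding strip_completion_def by auto

lemma En_facts:
 assumes "k : I"
 shows "!!x. x : core ==> q (a k) (En (a k) k x) = b k (x, 0)"
  "continuous_on core (En (a k) k)" "inj_on (%x. fst (En (a k) k x)) core"
 using completion[OF a_in[OF assms]] assms unfolding strip_completion_def by auto

lemma En_eq_iff:
 assumes "j : I" "k : I" "a j = a k" "x : core" "x' : core"
 shows "En (a k) k x = En (a k) j x' \<longleftrightarrow> b k (x, 0) = b j (x', 0) & germ_inside (b k) (b j) x'"
 using completion[OF a_in[OF assms(2)]] assms unfolding strip_completion_def by auto

lemma q_hbox:
 assumes "k : I" "x : core" "b k (x, 0) : A" "openin (top_of_set (S (a k))) {p : S (a k). q (a k) p : A}"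
 shows "EX delta>0. hbox x delta <= half_square & b k ` hbox x delta <= A"
 using completion[OF a_in[OF assms(1)]] assms unfolding strip_completion_def by auto

abbreviation bd :: "nat => (real \<times> real) set" where "bd l \<equiv> strip_boundary (S l) 0 1"

lemma q_interior_image:
 assumes "l : \<Lambda>"
 shows "q l ` (band {0<..<1}) = h l ` (band {0<..<1})"
proof -
 have "f ` (band {0<..<1}) = (\<Union>t\<in>{0<..<1}. f ` (band {t}))" for f :: "real \<times> real => 'a" by auto
 then show ?thesis using q_facts(4)[OF assms] by simp
qed

lemma q_interior_not_W: "l : \<Lambda> ==> p : band {0<..<1} ==> q l p ~: W"
 using q_interior_image[of l] h_cover by blast

lemma bd_cases:
 assumes "l : \<Lambda>" "p : bd l"
 obtains k x where "k : I" "a k = l" "x : core" "p = En (a k) k x" "q l p = b k (x, 0)"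
proof -
 obtain k x where "k : I" "a k = l" "x : core" "p = En l k x" using q_facts(5)[OF assms(1)] assms(2) by auto
 then show thesis using that En_facts(1)[of k x] by metis
qed

lemma S_cases:
 assumes "l : \<Lambda>" "p : S l"
 shows "p : band {0<..<1} \<or> p : bd l"
 using q_facts(1)[OF assms(1)] assms(2) by (cases p) (auto simp: is_strip_def strip_boundary_def)

lemma bd_in_S: "bd l <= S l" by (auto simp: strip_boundary_def)

lemma bd_in_W:
 assumes "l : \<Lambda>" "p : bd l"
 shows "q l p : W"
proof -
 obtain k x where k: "k : I" "x : core" "q l p = b k (x, 0)" using bd_cases[OF assms] by metis
 then have "x : {-1<..<1}" "rho k * x : {-1<..<1}" using rho_core[of k x] by auto
 then show ?thesis using b_base[OF k(1)] base_in_W k(3) by simp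
qed

lemma b_pos_not_W: "k : I ==> b k ` half_square_pos Int W = {}"
 using b_arc[of k] a_in[of k] h_cover by blast

text \<open>The open germ at such a boundary point lies in \<open>U n\<close> off the cut leaves and
  is connected, so it lies in one side of chart n. This puts both into the same strip, and equal
  germs over equal base points give equal boundary points.\<close>

lemma bd_preimage:
 assumes l: "l : \<Lambda>" and p: "p : bd l" and x: "x : core" and eq: "q l p = base n x"
 obtains k where "k : K n" "a k = l" "p = En (a k) k (rho k * x)"
proof -
 obtain j x' where j: "j : I" "a j = l" "x' : core" "p = En (a j) j x'" "q l p = b j (x', 0)"
  using bd_cases[OF l p] .
 have "(x, 0) : half_square" using x by auto
 then have "base n x : U n" using b_U[OF even_in_I[of n]] by auto
 then have inU: "b j (x', 0) : U n" using j(5) eq by simp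
 have x2: "x' : {-1<..<1}" using j(3) by auto
 obtain delta where delta: "delta > 0" "hbox x' delta <= half_square" "b j ` hbox x' delta <= U n"
  using hbox_in_preimage[OF b_cont[OF j(1)] U_open inU x2] .
 have pos: "hbox_pos x' delta <= half_square_pos" using delta(2) by (rule hbox_pos_in_half_square)
 have "connectedin (top_of_set half_square) (hbox_pos x' delta)"
  using connected_hbox_pos[of x' delta] delta(2) hbox_pos_subset[of x' delta] by (auto simp: connectedin_subtopology)
 then have con: "connectedin X (b j ` hbox_pos x' delta)"
  by (rule connectedin_continuous_map_image[OF b_cont[OF j(1)]])
 have "b j ` hbox_pos x' delta <= U n - W"
  using delta(3) hbox_pos_subset[of x' delta] b_pos_not_W[OF j(1)] pos by blast
 then have cov: "b j ` hbox_pos x' delta <= b (2 * n) ` half_square_pos Un (if full n then b (2 * n + 1) ` half_square_pos else {})"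
  using sides[of n] by blast
 have "EX k:K n. b j ` hbox_pos x' delta <= b k ` half_square_pos"
 proof (cases "full n")
  case True
  then have odd: "2 * n + 1 : I" by (simp add: I_def)
  have "b j ` hbox_pos x' delta <= b (2 * n) ` half_square_pos \<or> b j ` hbox_pos x' delta <= b (2 * n + 1) ` half_square_pos"
  proof (rule ccontr)
   have cov2: "b j ` hbox_pos x' delta <= b (2 * n) ` half_square_pos Un b (2 * n + 1) ` half_square_pos"
    using cov True by simp
   assume "\<not> ?thesis"
   then have "b (2 * n + 1) ` half_square_pos Int b j ` hbox_pos x' delta ~= {}" "b (2 * n) ` half_square_pos Int b j ` hbox_pos x' delta ~= {}"
    using cov2 by blast+
   moreover have "b (2 * n) ` half_square_pos Int b (2 * n + 1) ` half_square_pos Int b j ` hbox_pos x' delta = {}"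
    using sides_disjoint[OF True] by blast
   ultimately show False
    using connectedinD[OF con b_open[OF even_in_I[of n]] b_open[OF odd] cov2] by blast
  qed
  then show ?thesis using True by (auto simp: K_cases)
 next
  case False
  then show ?thesis using cov by (auto simp: K_cases)
 qed
 then obtain k where k: "k : K n" "b j ` hbox_pos x' delta <= b k ` half_square_pos" by blast
 then have kI: "k : I" by (simp add: K_def)
 have ne: "(x', delta/2) : hbox_pos x' delta" using delta(1) by (auto simp: hbox_pos_def)
 have "b j (x', delta/2) : h (a j) ` (band {0<..<1})" using b_arc[OF j(1)] pos ne by blast
 moreover have "b j (x', delta/2) : h (a k) ` (band {0<..<1})" using b_arc[OF kI] k(2) ne by blast
 ultimately have ak: "a j = a k" using h_disjoint[OF a_in[OF j(1)] a_in[OF kI]] by blast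
 have "b k (rho k * x, 0) = b j (x', 0)" using base_b[OF k(1) x] eq j(5) by simp
 moreover have "germ_inside (b k) (b j) x'" using delta(1,2) k(2) by (auto simp: germ_inside_def)
 ultimately have "En (a k) k (rho k * x) = En (a k) j x'"
  using En_eq_iff[OF j(1) kI ak _ j(3), of "rho k * x"] rho_core[of k x] x by blast
 then show thesis using that[OF k(1)] ak j by simp
qed

text \<open>A common boundary point would place a germ of one side inside the other side, but the
  two sides are disjoint.\<close>

lemma En_sides_distinct:
 assumes "full n" "a (2 * n) = a (2 * n + 1)" "x : core" "x' : core"
 shows "En (a (2 * n)) (2 * n) x ~= En (a (2 * n)) (2 * n + 1) x'"
proof
 assume eq: "En (a (2 * n)) (2 * n) x = En (a (2 * n)) (2 * n + 1) x'"
 have odd: "2 * n + 1 : I" using assms(1) by (simp add: I_def)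
 have "germ_inside (b (2 * n)) (b (2 * n + 1)) x'"
  using En_eq_iff[OF odd even_in_I[of n] assms(2)[symmetric] assms(3,4)] eq by blast
 then obtain delta where delta: "delta > 0" "hbox x' delta <= half_square" "b (2 * n + 1) ` hbox_pos x' delta <= b (2 * n) ` half_square_pos"
  by (auto simp: germ_inside_def)
 have "(x', delta/2) : hbox_pos x' delta" using delta(1) by (auto simp: hbox_pos_def)
 then show False using delta(3) hbox_pos_in_half_square[OF delta(2)] sides_disjoint[OF assms(1)] by blast
qed

section \<open>Boundary intervals over the cut leaves\<close>

text \<open>A boundary interval is addressed through a half chart on it; many half charts along the
  same side of a leaf name the same interval.\<close>

definition comp :: "nat => (real \<times> real) set" where
 "comp k = connected_component_of_set (top_of_set (bd (a k))) (En (a k) k 0)"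

lemma En_in_bd: "k : I ==> x : core ==> En (a k) k x : bd (a k)"
 using q_facts(5)[OF a_in[of k]] by blast

lemma zero_core: "0 : core" by simp

lemma comp_in: "k : I ==> comp k : boundary_intervals (S (a k)) 0 1"
 unfolding comp_def boundary_intervals_def
 using En_in_bd[OF _ zero_core] by (simp add: connected_component_in_connected_components_of)

lemma sheet_connected:
 assumes "k : I"
 shows "connectedin (top_of_set (bd (a k))) (En (a k) k ` core)"
 using connected_continuous_image[OF En_facts(2)[OF assms]] En_in_bd[OF assms]
 by (auto simp: connectedin_subtopology)

lemma sheet_in_comp:
 assumes "k : I"
 shows "En (a k) k ` core <= comp k"
 unfolding comp_def by (rule connected_component_of_maximal[OF sheet_connected[OF assms]]) (use zero_core in blast)

lemma sheet_in_interval: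
 assumes "k : I" "J : boundary_intervals (S (a k)) 0 1" "x : core" "En (a k) k x : J"
 shows "En (a k) k ` core <= J" "J = comp k"
proof -
 show sub: "En (a k) k ` core <= J"
  using assms(2,3,4) unfolding boundary_intervals_def
  by (intro connected_components_of_maximal[OF _ sheet_connected[OF assms(1)]]) (auto simp: disjnt_def)
 have "En (a k) k 0 : J Int comp k" using sub sheet_in_comp[OF assms(1)] zero_core by blast
 then show "J = comp k"
  using connected_components_of_overlap[of J "top_of_set (bd (a k))" "comp k"] assms(2) comp_in[OF assms(1)]
  unfolding boundary_intervals_def by blast
qed

lemma interval_subset_bd: "J : boundary_intervals (S l) 0 1 ==> J <= bd l"
 unfolding boundary_intervals_def using connected_components_of_subset by fastforce

lemma interval_is_comp:
 assumes "l : \<Lambda>" "J : boundary_intervals (S l) 0 1"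
 obtains k where "k : I" "a k = l" "J = comp k"
proof -
 have "J ~= {}" using assms(2) nonempty_connected_components_of unfolding boundary_intervals_def by blast
 then obtain p where p: "p : J" "p : bd l" using interval_subset_bd[OF assms(2)] by blast
 obtain k x where "k : I" "a k = l" "x : core" "p = En (a k) k x" using bd_cases[OF assms(1) p(2)] by metis
 then show thesis using that[of k] sheet_in_interval(2)[of k J x] p(1) assms(2) by auto
qed

end

context strip_gluing
begin

definition leaf_of :: "nat => 'a set" where
 "leaf_of n = (SOME L. L : Sg & b (2 * n) ` ({-1<..<1} \<times> {0}) <= L)"

lemma leaf_of: "leaf_of n : Sg" "x : {-1<..<1} ==> base n x : leaf_of n"
proof -
 have "EX L. L : Sg & b (2 * n) ` ({-1<..<1} \<times> {0}) <= L" using base_leaf[of n] by blast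
 from someI_ex[OF this] have *: "leaf_of n : Sg & b (2 * n) ` ({-1<..<1} \<times> {0}) <= leaf_of n"
  unfolding leaf_of_def .
 then show "leaf_of n : Sg" by blast
 show "base n x : leaf_of n" if "x : {-1<..<1}" using * that by blast
qed

lemma leaf_of_eq:
 assumes "L : Sg" "base n x : L" "x : {-1<..<1}"
 shows "leaf_of n = L"
proof (rule leaf_disjoint)
 show "leaf_of n : \<Delta>" "L : \<Delta>" using subsetD[OF Sg] leaf_of(1)[of n] assms(1) by auto
 show "leaf_of n Int L ~= {}" using leaf_of(2)[OF assms(3), of n] assms(2) by blast
qed

lemma leaf_of_surj:
 assumes "L : Sg"
 obtains n where "leaf_of n = L"
proof -
 have "L ~= {}" using assms Sg leaf_nonempty by blast
 then obtain z where z: "z : L" by blast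
 then have "z : W" using assms unfolding W_def by blast
 then obtain n x where "x : core" "z = base n x" using base_cover by blast
 then show thesis using that[of n] leaf_of_eq[OF assms, of n x] z by auto
qed

lemma b_in_leaf: "k : I ==> x : core ==> b k (x, 0) : leaf_of (k div 2)"
proof -
 assume k: "k : I" and x: "x : core"
 then have "x : {-1<..<1}" "rho k * x : {-1<..<1}" using rho_core[of k x] by auto
 then show ?thesis using b_base[OF k] leaf_of(2) by simp
qed

lemma comp_subset_bd: "k : I ==> comp k <= bd (a k)"
 using interval_subset_bd comp_in by blast

lemma comp_connected: "k : I ==> connected (comp k)"
 using connectedin_connected_components_of[of "comp k" "top_of_set (bd (a k))"] comp_in[of k]
 unfolding boundary_intervals_def by (simp add: connectedin_subtopology)

text \<open>The image is connected and contained in \<open>W\<close>. By local finiteness the union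
  of the other cut leaves is closed, so the leaf and this union separate \<open>W\<close>.\<close>

lemma comp_image_subset:
 assumes k: "k : I"
 shows "q (a k) ` comp k <= leaf_of (k div 2)"
proof -
 let ?l = "a k" and ?L = "leaf_of (k div 2)"
 have l: "?l : \<Lambda>" using a_in[OF k] .
 have "connectedin (top_of_set (S ?l)) (comp k)"
  using comp_connected[OF k] comp_subset_bd[OF k] bd_in_S[of ?l] by (auto simp: connectedin_subtopology)
 then have con: "connectedin X (q ?l ` comp k)"
  by (rule connectedin_continuous_map_image[OF q_facts(2)[OF l]])
 have inW: "q ?l ` comp k <= W" using bd_in_W[OF l] comp_subset_bd[OF k] by blast
 have Ld: "?L : \<Delta>" using leaf_of(1) Sg by blast
 have "closedin X (\<Union>(Sg - {?L}))"
  using leaf_closed Sg by (intro closedin_locally_finite_Union locally_finite_in_subset[OF Sg_locally_finite]) auto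
 then have o1: "openin X (topspace X - \<Union>(Sg - {?L}))" by blast
 have o2: "openin X (topspace X - ?L)" using leaf_closed[OF Ld] by blast
 have dis: "\<Union>(Sg - {?L}) Int ?L = {}"
 proof -
  have "L' Int ?L = {}" if "L' : Sg" "L' ~= ?L" for L' using leaf_disjoint[OF subsetD[OF Sg that(1)] Ld] that(2) by blast
  then show ?thesis by blast
 qed
 have top: "q ?l ` comp k <= topspace X" using con connectedin_subset_topspace by blast
 have c1: "q ?l ` comp k <= (topspace X - \<Union>(Sg - {?L})) Un (topspace X - ?L)" using top dis by blast
 have c2: "(topspace X - \<Union>(Sg - {?L})) Int (topspace X - ?L) Int q ?l ` comp k = {}" using inW unfolding W_def by blast
 have "q ?l (En ?l k 0) : q ?l ` comp k" using sheet_in_comp[OF k] zero_core by blast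
 moreover have "q ?l (En ?l k 0) : ?L" using En_facts(1)[OF k zero_core] b_in_leaf[OF k zero_core] by simp
 ultimately have "(topspace X - \<Union>(Sg - {?L})) Int q ?l ` comp k ~= {}" using dis top by blast
 then have "(topspace X - ?L) Int q ?l ` comp k = {}" using connectedinD[OF con o1 o2 c1 c2] by blast
 then show ?thesis using top by blast
qed

text \<open>Points of a chart off its base lie in open half charts, which avoid \<open>W\<close>.
  The size \<open>1/2 - \<bar>x\<bar>\<close> keeps the half boxes over the core.\<close>

lemma base_local:
 assumes x: "x : core"
 shows "EX V. openin X V & base n x : V & V Int W <= base n ` core"
proof -
 let ?d = "1/2 - \<bar>x\<bar>"
 have d: "?d > 0" using x by auto
 obtain V where V: "openin X V" "base n x : V"
  "V <= b (2 * n) ` (hbox x ?d Int half_square) Un (if full n then b (2 * n + 1) ` (hbox (r n * x) ?d Int half_square) else {})"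
  using nbhd[OF x d] by blast
 have "v : base n ` core" if v: "v : V" "v : W" for v
 proof -
  have "EX k:K n. EX p:hbox (rho k * x) ?d Int half_square. v = b k p"
   using V(3) v(1) by (auto simp: K_cases rho_def split: if_splits)
  then obtain k y s where k: "k : K n" "(y, s) : hbox (rho k * x) ?d" "(y, s) : half_square" "v = b k (y, s)" by auto
  then have kI: "k : I" "k div 2 = n" by (auto simp: K_def)
  have "s = 0"
  proof (rule ccontr)
   assume "s ~= 0"
   then have "(y, s) : half_square_pos" using k(3) by auto
   then show False using b_pos_not_W[OF kI(1)] k(4) v(2) by blast
  qed
  moreover have y: "y : core" using k(2) rho_sign[of k] by (auto simp: hbox_def abs_if split: if_splits)
  ultimately have "v = base n (rho k * y)" using b_base[OF kI(1), of y] kI(2) k(4) by auto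
  then show ?thesis using rho_core[of k y] y by blast
 qed
 then show ?thesis using V by blast
qed

text \<open>An interval over one point of the core of a base contains a boundary sheet of that
  chart, and this sheet covers the whole core.\<close>

lemma comp_absorbs:
 assumes k: "k : I" and x: "x : core" and z: "base n x : q (a k) ` comp k"
 shows "EX k':K n. a k' = a k & comp k = comp k'" "base n ` core <= q (a k) ` comp k"
proof -
 obtain p where p: "p : comp k" "q (a k) p = base n x" using z by auto
 have "p : bd (a k)" using p(1) comp_subset_bd[OF k] by blast
 from bd_preimage[OF a_in[OF k] this x p(2)] obtain k' where
  k': "k' : K n" "a k' = a k" "p = En (a k') k' (rho k' * x)" .
 have kI: "k' : I" using k'(1) by (simp add: K_def)
 have J: "comp k : boundary_intervals (S (a k')) 0 1" using comp_in[OF k] k'(2) by simp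
 have xc: "rho k' * x : core" using rho_core x by blast
 have inJ: "En (a k') k' (rho k' * x) : comp k" using p(1) k'(3) by simp
 show "EX k':K n. a k' = a k & comp k = comp k'" using sheet_in_interval(2)[OF kI J xc inJ] k' by blast
 show "base n ` core <= q (a k) ` comp k"
 proof
  fix z assume "z : base n ` core"
  then obtain y where y: "y : core" "z = base n y" by blast
  have yc: "rho k' * y : core" using rho_core y(1) by blast
  have "z = q (a k) (En (a k') k' (rho k' * y))"
   using base_b[OF k'(1) y(1)] En_facts(1)[OF kI yc] y(2) k'(2) by simp
  moreover have "En (a k') k' (rho k' * y) : comp k" using sheet_in_interval(1)[OF kI J xc inJ] yc by blast
  ultimately show "z : q (a k) ` comp k" by blast
 qed
qed

lemma leaf_connectedin:
 assumes "L : \<Delta>"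
 shows "connectedin X L"
proof -
 have "connected_space euclideanreal"
  using connectedin_topspace[of euclideanreal] connected_UNIV[where 'a = real] by simp
 then have "connected_space (subtopology X L)" using homeomorphic_connected_space[OF leaf_line[OF assms]] by blast
 then show ?thesis using leaves_cover assms by (auto simp: connectedin_def)
qed

text \<open>By absorption the covered part of the leaf and its complement are both relatively open,
  and the leaf is connected.\<close>

lemma comp_image:
 assumes k: "k : I"
 shows "q (a k) ` comp k = leaf_of (k div 2)"
proof (rule antisym[OF comp_image_subset[OF k]])
 let ?T = "q (a k) ` comp k" and ?L = "leaf_of (k div 2)"
 have Ld: "?L : \<Delta>" using leaf_of(1) Sg by blast
 have LW: "?L <= W" using leaf_of(1) unfolding W_def by blast
 define O1 where "O1 = \<Union>{V. openin X V & V Int W <= ?T}"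
 define O2 where "O2 = \<Union>{V. openin X V & V Int W Int ?T = {}}"
 have cov: "?L <= O1 Un O2"
 proof
  fix z assume "z : ?L"
  then obtain n x where x: "x : core" "z = base n x" using base_cover LW by blast
  obtain V where V: "openin X V" "z : V" "V Int W <= base n ` core" using base_local[OF x(1)] x(2) by blast
  show "z : O1 Un O2"
  proof (cases "base n ` core Int ?T = {}")
   case True
   then have "V Int W Int ?T = {}" using V(3) by blast
   then show ?thesis using V unfolding O2_def by blast
  next
   case False
   then obtain y where "y : core" "base n y : ?T" by blast
   then have "V Int W <= ?T" using comp_absorbs(2)[OF k] V(3) by blast
   then show ?thesis using V unfolding O1_def by blast
  qed
 qed
 have o: "openin X O1" "openin X O2" unfolding O1_def O2_def by (rule openin_Union, blast)+
 have dis: "O1 Int O2 Int ?L = {}" using LW unfolding O1_def O2_def by blast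
 have "?T ~= {}" using sheet_in_comp[OF k] zero_core by blast
 then obtain z where z: "z : ?T" "z : ?L" using comp_image_subset[OF k] by blast
 then have "z ~: O2" using LW unfolding O2_def by blast
 then have "O1 Int ?L ~= {}" using cov z by blast
 then have "O2 Int ?L = {}" using connectedinD[OF leaf_connectedin[OF Ld] o cov dis] by blast
 then have "?L <= O1" using cov by blast
 then show "?L <= ?T" using LW unfolding O1_def by blast
qed

text \<open>Read through a homeomorphism of the leaf with the real line, the restriction of
  \<open>q\<close> is a continuous real function on an interval. It is locally injective by the
  charts, hence injective, hence open by invariance of domain.\<close>

lemma comp_homeomorphic:
 assumes k: "k : I"
 shows "homeomorphic_map (top_of_set (comp k)) (subtopology X (leaf_of (k div 2))) (q (a k))"
proof -
 let ?l = "a k" and ?L = "leaf_of (k div 2)" and ?J = "comp k"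
 have l: "?l : \<Lambda>" using a_in[OF k] .
 have Ld: "?L : \<Delta>" using leaf_of(1) Sg by blast
 have Ltop: "?L <= topspace X" using leaves_cover Ld by blast
 obtain kappa where kappa: "homeomorphic_map (subtopology X ?L) euclideanreal kappa"
  using leaf_line[OF Ld] homeomorphic_space by blast
 have kappac: "continuous_map (subtopology X ?L) euclideanreal kappa" using homeomorphic_imp_continuous_map[OF kappa] .
 have kappai: "inj_on kappa ?L"
  using homeomorphic_imp_injective_map[OF kappa] Ltop by (metis inf.absorb2 topspace_subtopology)
 have "?J <= band {0, 1}" using comp_subset_bd[OF k] by (auto simp: strip_boundary_def)
 then have "snd ` ?J <= {0, 1}" by auto
 then have "finite (snd ` ?J)" by (rule finite_subset) simp
 then have "snd constant_on ?J"
  by (intro continuous_finite_range_constant comp_connected[OF k] continuous_on_snd continuous_on_id)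
 then obtain e0 where e0: "!!p. p : ?J ==> snd p = e0" by (auto simp: constant_on_def)
 define Y where "Y = fst ` ?J"
 have YJ: "(y, e0) : ?J \<longleftrightarrow> y : Y" for y
 proof
  assume "y : Y"
  then obtain p where "p : ?J" "y = fst p" by (auto simp: Y_def)
  then show "(y, e0) : ?J" using e0[of p] by (cases p) auto
 qed (auto simp: Y_def intro: rev_image_eqI)
 have "connected Y" unfolding Y_def by (intro connected_continuous_image comp_connected[OF k] continuous_on_fst continuous_on_id)
 then have Yint: "is_interval Y" by (simp add: is_interval_connected_1)
 have qJ: "continuous_map (top_of_set ?J) (subtopology X ?L) (q ?l)"
  using continuous_map_from_subtopology_mono[OF q_facts(2)[OF l]] comp_subset_bd[OF k] bd_in_S[of ?l] comp_image_subset[OF k]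
  by (auto simp: continuous_map_in_subtopology)
 define phi where "phi y = kappa (q ?l (y, e0))" for y
 have "continuous_map (top_of_set Y) (subtopology X ?L) (%y. q ?l (y, e0))"
  by (rule continuous_map_top_of_set_o[OF qJ]) (use YJ in \<open>auto intro!: continuous_intros\<close>)
 from continuous_map_compose[OF this kappac] have phic: "continuous_on Y phi" by (simp add: phi_def[abs_def] o_def)
 have loc: "EX N. open N & y : N & N <= Y & inj_on phi N" if y: "y : Y" for y
 proof -
  have yJ: "(y, e0) : ?J" using YJ y by blast
  then have "(y, e0) : bd ?l" using comp_subset_bd[OF k] by blast
  from bd_cases[OF l this] obtain k' x where k': "k' : I" "a k' = ?l" "x : core" "(y, e0) = En (a k') k' x" by metis
  have J: "?J : boundary_intervals (S (a k')) 0 1" using comp_in[OF k] k'(2) by simp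
  have sub: "En ?l k' ` core <= ?J" using sheet_in_interval(1)[OF k'(1) J k'(3)] yJ k'(2,4) by simp
  let ?N = "(%x. fst (En ?l k' x)) ` core"
  have En: "En ?l k' x = (fst (En ?l k' x), e0)" if "x : core" for x
  proof -
   have "En ?l k' x : ?J" using sub that by blast
   then show ?thesis using e0[of "En ?l k' x"] by (simp add: prod_eq_iff)
  qed
  have "open ?N"
  proof (rule invariance_of_domain)
   show "continuous_on core (%x. fst (En ?l k' x))"
    using continuous_on_fst[OF En_facts(2)[OF k'(1)]] k'(2) by simp
   show "inj_on (%x. fst (En ?l k' x)) core" using En_facts(3)[OF k'(1)] k'(2) by simp
  qed simp
  moreover have "y : ?N" using k'(2,3,4) by (intro image_eqI[of _ _ x]) (auto simp: prod_eq_iff)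
  moreover have "?N <= Y" unfolding Y_def using sub by blast
  moreover have "inj_on phi ?N"
  proof (rule inj_onI)
   fix y1 y2 assume "y1 : ?N" "y2 : ?N" and eq: "phi y1 = phi y2"
   then obtain x1 x2 where x12: "x1 : core" "x2 : core" "y1 = fst (En ?l k' x1)" "y2 = fst (En ?l k' x2)" by blast
   have q12: "q ?l (y1, e0) = b k' (x1, 0)" "q ?l (y2, e0) = b k' (x2, 0)"
    using En_facts(1)[OF k'(1)] k'(2) x12 En by metis+
   have "(y1, e0) : ?J" "(y2, e0) : ?J" using sub x12 En by (metis imageI subsetD)+
   then have "q ?l (y1, e0) : ?L" "q ?l (y2, e0) : ?L" using comp_image_subset[OF k] by blast+
   then have "b k' (x1, 0) = b k' (x2, 0)" using inj_onD[OF kappai] eq q12 unfolding phi_def by metis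
   then have "(x1, 0) = (x2, 0::real)"
    by (rule inj_onD[OF b_inj[OF k'(1)]]) (use x12 in auto)
   then show "y1 = y2" using x12 by simp
  qed
  ultimately show ?thesis by blast
 qed
 have phii: "inj_on phi Y" by (rule locally_injective_imp_injective[OF Yint phic loc])
 have Yo: "open Y"
  unfolding open_subopen[of Y]
 proof
  fix y assume "y : Y"
  then show "EX T. open T & y : T & T <= Y" using loc by blast
 qed
 have inJ: "EX y. y : Y & p = (y, e0)" if "p : ?J" for p
 proof -
  have "p = (fst p, e0)" using e0[OF that] by (simp add: prod_eq_iff)
  moreover have "fst p : Y" using that by (simp add: Y_def)
  ultimately show ?thesis by blast
 qed
 show ?thesis
 proof (rule bijective_open_imp_homeomorphic_map[OF qJ])
  show "q ?l ` topspace (top_of_set ?J) = topspace (subtopology X ?L)"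
   using comp_image[OF k] Ltop by auto
  show "inj_on (q ?l) (topspace (top_of_set ?J))"
  proof (rule inj_onI)
   fix p p' assume p: "p : topspace (top_of_set ?J)" "p' : topspace (top_of_set ?J)" "q ?l p = q ?l p'"
   then have "p : ?J" "p' : ?J" by auto
   then obtain y y' where y: "y : Y" "p = (y, e0)" "y' : Y" "p' = (y', e0)" using inJ by meson
   then have "phi y = phi y'" using p(3) by (simp add: phi_def)
   then show "p = p'" using inj_onD[OF phii] y by blast
  qed
  show "open_map (top_of_set ?J) (subtopology X ?L) (q ?l)"
   unfolding open_map_def
  proof (intro allI impI)
   fix V assume "openin (top_of_set ?J) V"
   then obtain T where T: "open T" "V = ?J Int T" by (auto simp: openin_open)
   define V' where "V' = Y Int (%y. (y, e0)) -` T"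
   have "open V'" unfolding V'_def using Yo T(1)
    by (intro open_Int open_vimage) (auto intro!: continuous_intros)
   moreover have V'Y: "V' <= Y" by (auto simp: V'_def)
   ultimately have "open (phi ` V')"
    using phic phii by (intro invariance_of_domain) (auto intro: continuous_on_subset inj_on_subset)
   then have "openin (subtopology X ?L) {z : topspace (subtopology X ?L). kappa z : phi ` V'}"
    using openin_continuous_map_preimage[OF kappac] by simp
   moreover have "{z : topspace (subtopology X ?L). kappa z : phi ` V'} = q ?l ` V"
   proof (intro equalityI subsetI)
    fix z assume "z : {z : topspace (subtopology X ?L). kappa z : phi ` V'}"
    then obtain y where z: "z : ?L" "y : V'" "kappa z = phi y" by auto
    have "(y, e0) : ?J" using z(2) V'Y YJ by blast
    then have "q ?l (y, e0) : ?L" using comp_image_subset[OF k] by blast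
    then have "z = q ?l (y, e0)" using inj_onD[OF kappai] z by (simp add: phi_def)
    moreover have "(y, e0) : V" using z(2) \<open>(y, e0) : ?J\<close> T(2) by (auto simp: V'_def)
    ultimately show "z : q ?l ` V" by blast
   next
    fix z assume "z : q ?l ` V"
    then obtain p where p: "p : ?J" "p : T" "z = q ?l p" using T(2) by auto
    then obtain y where y: "y : Y" "p = (y, e0)" using inJ by blast
    have "z : ?L" using p(1,3) comp_image_subset[OF k] by blast
    moreover have "kappa z = phi y" "y : V'" using p y by (auto simp: phi_def V'_def)
    ultimately show "z : {z : topspace (subtopology X ?L). kappa z : phi ` V'}" using Ltop by auto
   qed
   ultimately show "openin (subtopology X ?L) (q ?l ` V)" by simp
  qed
 qed
qed

lemma comp_inj: "k : I ==> inj_on (q (a k)) (comp k)"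
 using homeomorphic_imp_injective_map[OF comp_homeomorphic] by simp

text \<open>The interval covers the whole leaf, in particular the centre of chart m, and so contains
  one of the sides of that chart.\<close>

lemma comp_over_same_leaf:
 assumes k: "k : I" and m: "leaf_of m = leaf_of (k div 2)"
 shows "EX k':K m. a k' = a k & comp k = comp k'"
proof (rule comp_absorbs(1)[OF k zero_core])
 have "base m 0 : leaf_of m" by (rule leaf_of(2)) simp
 then show "base m 0 : q (a k) ` comp k" using comp_image[OF k] m by simp
qed

end

context strip_gluing
begin

section \<open>The striped atlas\<close>

text \<open>A leaf carries many charts. Its least chart represents it, so that the sides of a leaf
  are glued only once.\<close>

definition \<Gamma> :: "nat set" where "\<Gamma> = {n. full n & (ALL m<n. leaf_of m ~= leaf_of n)}"

definition Q :: "nat \<times> (real \<times> real) => 'a" where "Q = (%(l, p). q l p)"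

definition side :: "nat => nat \<times> (real \<times> real) set" where "side k = (a k, comp k)"

lemma Q_image: "Q ` ({l} \<times> A) = q l ` A" by (force simp: Q_def)

lemma Q_side: "k : I ==> Q ` sheet (side k) = leaf_of (k div 2)"
 by (simp add: sheet_def side_def Q_image comp_image)

lemma least_index:
 obtains m where "leaf_of m = leaf_of n" "!!m'. m' < m ==> leaf_of m' ~= leaf_of m"
proof -
 let ?m = "LEAST m. leaf_of m = leaf_of n"
 have "leaf_of ?m = leaf_of n" by (rule LeastI[of _ n]) simp
 moreover have "leaf_of m' ~= leaf_of ?m" if "m' < ?m" for m'
  using not_less_Least[OF that] calculation by simp
 ultimately show thesis by (rule that)
qed

lemma \<Gamma>_unique: "n : \<Gamma> ==> m : \<Gamma> ==> leaf_of n = leaf_of m ==> n = m"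
 unfolding \<Gamma>_def by (metis (mono_tags, lifting) linorder_neqE_nat mem_Collect_eq)

lemma \<Gamma>_in_I: "n : \<Gamma> ==> 2 * n + 1 : I" by (simp add: \<Gamma>_def I_def)

text \<open>If both sides gave the same interval, injectivity of \<open>q\<close> on it would
  identify the two sheets over a common base point, which the disjointness of the sides
  forbids.\<close>

lemma sides_differ:
 assumes n: "n : \<Gamma>"
 shows "side (2 * n) ~= side (2 * n + 1)"
proof
 assume eq: "side (2 * n) = side (2 * n + 1)"
 then have a: "a (2 * n) = a (2 * n + 1)" "comp (2 * n) = comp (2 * n + 1)" by (auto simp: side_def)
 have odd: "2 * n + 1 : I" and f: "full n" using n \<Gamma>_in_I by (auto simp: \<Gamma>_def)
 have "q (a (2 * n)) (En (a (2 * n)) (2 * n) 0) = base n 0" by (rule En_facts(1)[OF even_in_I zero_core])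
 moreover have "q (a (2 * n)) (En (a (2 * n)) (2 * n + 1) 0) = b (2 * n + 1) (0, 0)"
  using En_facts(1)[OF odd zero_core] a(1) by simp
 moreover have "b (2 * n + 1) (0, 0) = base n 0" using base_odd[OF f, of 0] by simp
 ultimately have "q (a (2 * n)) (En (a (2 * n)) (2 * n) 0) = q (a (2 * n)) (En (a (2 * n)) (2 * n + 1) 0)" by simp
 moreover have "En (a (2 * n)) (2 * n) 0 : comp (2 * n)" using sheet_in_comp[OF even_in_I] zero_core by blast
 moreover have "En (a (2 * n)) (2 * n + 1) 0 : comp (2 * n)"
 proof -
  have "En (a (2 * n + 1)) (2 * n + 1) 0 : comp (2 * n + 1)" using sheet_in_comp[OF odd] zero_core by blast
  then show ?thesis using a by simp
 qed
 ultimately have "En (a (2 * n)) (2 * n) 0 = En (a (2 * n)) (2 * n + 1) 0"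
  by (rule inj_onD[OF comp_inj[OF even_in_I]])
 then show False using En_sides_distinct[OF f a(1) zero_core zero_core] by contradiction
qed

text \<open>Off the cut leaves the open strips are embedded as open sets. At a cut leaf the half
  boxes obtained on each existing side fit together to a neighbourhood.\<close>

lemma quotient_open:
 assumes A: "A <= topspace X" and op: "!!l. l : \<Lambda> ==> openin (top_of_set (S l)) {p : S l. q l p : A}"
 shows "openin X A"
proof (subst openin_subopen, intro ballI)
 fix z assume z: "z : A"
 show "EX T. openin X T & z : T & T <= A"
 proof (cases "z : W")
  case False
  then have "z : (\<Union>l\<in>\<Lambda>. h l ` (band {0<..<1}))" using A z unfolding h_cover by blast
  then obtain l where l: "l : \<Lambda>" "z : q l ` (band {0<..<1})" using q_interior_image by blast
  let ?V = "{p : band {0<..<1}. q l p : A}"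
  have sub: "band {0<..<1} <= S l" using q_facts(1)[OF l(1)] by (simp add: is_strip_def)
  obtain T where T: "open T" "{p : S l. q l p : A} = S l Int T" using op[OF l(1)] by (auto simp: openin_open)
  have "?V = (band {0<..<1}) Int T" using T(2) sub by blast
  then have oV: "open ?V" using T(1) by (simp add: open_Int open_Times)
  have VS: "?V <= S l" using sub by blast
  have "continuous_map (top_of_set ?V) X (q l)"
   using q_facts(2)[OF l(1)] VS by (rule continuous_map_from_subtopology_mono)
  moreover have "inj_on (q l) ?V" using q_facts(3)[OF l(1)] by (rule inj_on_subset) blast
  ultimately have "openin X (q l ` ?V)" using surface_invariance_of_domain[OF surf oV] by blast
  moreover have "z : q l ` ?V" using l(2) z by blast
  ultimately show ?thesis by blast
 next
  case True
  then obtain n x where x: "x : core" "z = base n x" using base_cover by blast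
  have ex: "EX delta>0. b k ` hbox (rho k * x) delta <= A" if k: "k : K n" for k
  proof -
   have kI: "k : I" using k by (simp add: K_def)
   have "rho k * x : core" using rho_core x(1) by blast
   moreover have "b k (rho k * x, 0) : A" using base_b[OF k x(1)] x(2) z by simp
   ultimately show ?thesis using q_hbox[OF kI _ _ op[OF a_in[OF kI]]] by blast
  qed
  have "2 * n : K n" by (simp add: K_cases)
  from ex[OF this] obtain delta1 where delta1: "delta1 > 0" "b (2 * n) ` hbox x delta1 <= A" by (auto simp: rho_def)
  have "EX delta2>0. full n --> b (2 * n + 1) ` hbox (r n * x) delta2 <= A"
  proof (cases "full n")
   case True
   then have "2 * n + 1 : K n" by (simp add: K_cases)
   moreover have "rho (2 * n + 1) = r n" by (simp add: rho_def)
   ultimately show ?thesis using ex[of "2 * n + 1"] by metis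
  next
   case False
   then show ?thesis by (intro exI[of _ 1]) simp
  qed
  then obtain delta2 where delta2: "delta2 > 0" "full n --> b (2 * n + 1) ` hbox (r n * x) delta2 <= A" by blast
  define delta where "delta = min delta1 delta2"
  have delta: "delta > 0" "delta <= delta1" "delta <= delta2" using delta1 delta2 by (auto simp: delta_def)
  obtain V where V: "openin X V" "base n x : V"
   "V <= b (2 * n) ` (hbox x delta Int half_square) Un (if full n then b (2 * n + 1) ` (hbox (r n * x) delta Int half_square) else {})"
   using nbhd[OF x(1) delta(1)] by blast
  have "b (2 * n) ` (hbox x delta Int half_square) <= A" using delta1(2) hbox_mono(1)[OF delta(2)] by blast
  moreover have "b (2 * n + 1) ` (hbox (r n * x) delta Int half_square) <= A" if "full n"
   using delta2(2) that hbox_mono(1)[OF delta(3)] by blast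
  ultimately have "b (2 * n) ` (hbox x delta Int half_square) Un (if full n then b (2 * n + 1) ` (hbox (r n * x) delta Int half_square) else {}) <= A"
   by (cases "full n") simp_all
  with V(3) have "V <= A" by (rule order_trans)
  then show ?thesis using V x(2) by blast
 qed
qed

lemma Q_surj: "Q ` (Sigma \<Lambda> S) = topspace X"
proof
 show "Q ` (Sigma \<Lambda> S) <= topspace X"
  using continuous_map_image_subset_topspace[OF q_facts(2)] by (auto simp: Q_def)
 show "topspace X <= Q ` (Sigma \<Lambda> S)"
 proof
  fix z assume z: "z : topspace X"
  have mem: "q l p : Q ` (Sigma \<Lambda> S)" if "l : \<Lambda>" "p : S l" for l p
   using that by (intro image_eqI[of _ _ "(l, p)"]) (auto simp: Q_def)
  show "z : Q ` (Sigma \<Lambda> S)"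
  proof (cases "z : W")
   case False
   then have "z : (\<Union>l\<in>\<Lambda>. h l ` (band {0<..<1}))" using z unfolding h_cover by blast
   then obtain l p where l: "l : \<Lambda>" "p : band {0<..<1}" "z = q l p" using q_interior_image by blast
   then have "p : S l" using q_facts(1)[OF l(1)] by (auto simp: is_strip_def)
   then show ?thesis using mem l by simp
  next
   case True
   then obtain n x where x: "x : core" "z = base n x" using base_cover by blast
   have "En (a (2 * n)) (2 * n) x : S (a (2 * n))" using En_in_bd[OF even_in_I x(1)] bd_in_S by blast
   moreover have "q (a (2 * n)) (En (a (2 * n)) (2 * n) x) = z" using En_facts(1)[OF even_in_I x(1)] x(2) by simp
   ultimately show ?thesis using mem[OF a_in[OF even_in_I]] by metis
  qed
 qed
qed

text \<open>Unglued boundary points with the same image lie over the same leaf. Its least chart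
  cannot have two sides, for these would be glued; so there is only one boundary interval over the
  leaf, and \<open>q\<close> is injective on it.\<close>

lemma Q_inj: "inj_on Q (Sigma \<Lambda> S - (\<Union>n\<in>\<Gamma>. sheet (side (2 * n)) Un sheet (side (2 * n + 1))))"
proof (rule inj_onI)
 let ?D = "Sigma \<Lambda> S - (\<Union>n\<in>\<Gamma>. sheet (side (2 * n)) Un sheet (side (2 * n + 1)))"
 fix y y' assume y: "y : ?D" "y' : ?D" "Q y = Q y'"
 obtain l p where lp: "y = (l, p)" "l : \<Lambda>" "p : S l" using y(1) by auto
 obtain l' p' where lp': "y' = (l', p')" "l' : \<Lambda>" "p' : S l'" using y(2) by auto
 have eq: "q l p = q l' p'" using y(3) lp lp' by (simp add: Q_def)
 have unglued: "EX k. k : I & a k = l & p : comp k & (ALL n:\<Gamma>. side k ~= side (2 * n) & side k ~= side (2 * n + 1))"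
  if y: "(l, p) : ?D" and p: "p : bd l" for l p
 proof -
  have l: "l : \<Lambda>" using y by auto
  obtain k x where k: "k : I" "a k = l" "x : core" "p = En (a k) k x" using bd_cases[OF l p] by metis
  then have pk: "p : comp k" using sheet_in_comp[OF k(1)] by blast
  have lp: "(l, p) : sheet (side k)" using k(2) pk by (simp add: sheet_def side_def)
  have "side k ~= side (2 * n) & side k ~= side (2 * n + 1)" if n: "n : \<Gamma>" for n
  proof -
   have "(l, p) ~: sheet (side (2 * n))" "(l, p) ~: sheet (side (2 * n + 1))" using y n by blast+
   then show ?thesis using lp by metis
  qed
  then show ?thesis using k(1,2) pk by (intro exI[of _ k] conjI ballI) auto
 qed
 consider "p : band {0<..<1}" "p' : band {0<..<1}" | "p : band {0<..<1}" "p' : bd l'"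
  | "p : bd l" "p' : band {0<..<1}" | "p : bd l" "p' : bd l'"
  using S_cases[OF lp(2,3)] S_cases[OF lp'(2,3)] by blast
 then show "y = y'"
 proof cases
  case 1
  then have "q l p : h l ` (band {0<..<1})" "q l' p' : h l' ` (band {0<..<1})"
   using q_interior_image[OF lp(2)] q_interior_image[OF lp'(2)] by blast+
  then have "l = l'" using h_disjoint[OF lp(2) lp'(2)] eq by (metis IntI empty_iff)
  then show ?thesis using inj_onD[OF q_facts(3)[OF lp(2)]] 1 eq lp lp' by blast
 next
  case 2
  then show ?thesis using q_interior_not_W[OF lp(2)] bd_in_W[OF lp'(2)] eq by metis
 next
  case 3
  then show ?thesis using q_interior_not_W[OF lp'(2)] bd_in_W[OF lp(2)] eq by metis
 next
  case 4
  obtain k where k: "k : I" "a k = l" "p : comp k" "ALL n:\<Gamma>. side k ~= side (2 * n) & side k ~= side (2 * n + 1)"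
   using unglued[of l p] y(1) lp(1) 4(1) by blast
  obtain k' where k': "k' : I" "a k' = l'" "p' : comp k'" "ALL n:\<Gamma>. side k' ~= side (2 * n) & side k' ~= side (2 * n + 1)"
   using unglued[of l' p'] y(2) lp'(1) 4(2) by blast
  have "q l p : leaf_of (k div 2)" using comp_image_subset[OF k(1)] k(2,3) by blast
  moreover have "q l' p' : leaf_of (k' div 2)" using comp_image_subset[OF k'(1)] k'(2,3) by blast
  ultimately have leaf: "leaf_of (k' div 2) = leaf_of (k div 2)"
   using leaf_disjoint[of "leaf_of (k' div 2)" "leaf_of (k div 2)"] subsetD[OF Sg leaf_of(1)] eq by (metis IntI empty_iff)
  obtain m where m: "leaf_of m = leaf_of (k div 2)" "!!m'. m' < m ==> leaf_of m' ~= leaf_of m"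
   using least_index[of "k div 2"] by blast
  obtain j where j: "j : K m" "a j = a k" "comp k = comp j" using comp_over_same_leaf[OF k(1) m(1)] by blast
  obtain j' where j': "j' : K m" "a j' = a k'" "comp k' = comp j'"
   using comp_over_same_leaf[OF k'(1)] m(1) leaf by metis
  have nf: "\<not> full m"
  proof
   assume "full m"
   then have mG: "m : \<Gamma>" using m(2) by (simp add: \<Gamma>_def)
   have "j = 2 * m \<or> j = 2 * m + 1" using j(1) by (auto simp: K_cases split: if_splits)
   moreover have "side k = side j" using j(2,3) by (simp add: side_def)
   ultimately show False using k(4) mG by auto
  qed
  then have "j = j'" using j(1) j'(1) by (auto simp: K_cases)
  then have same: "l' = l" "comp k' = comp k" using j j' k(2) k'(2) by auto
  then have "p' : comp k" using k'(3) by simp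
  then have "p = p'" using inj_onD[OF comp_inj[OF k(1)]] k(2,3) eq same by simp
  then show ?thesis using lp lp' same by simp
 qed
qed

lemma side_embedding:
 assumes "k : I"
 shows "embedding_map (top_of_set (snd (side k))) X (%p. Q (fst (side k), p))"
 unfolding embedding_map_def
 using comp_homeomorphic[OF assms] comp_image[OF assms] by (simp add: side_def Q_def)

lemma side_bint: "k : I ==> is_bint \<Lambda> S (%_. 0) (%_. 1) (side k)"
 using a_in comp_in by (simp add: is_bint_def side_def)

lemma side_leaf_eq:
 assumes "k : I" "k' : I" "side k = side k'"
 shows "leaf_of (k div 2) = leaf_of (k' div 2)"
 using Q_side[OF assms(1)] Q_side[OF assms(2)] assms(3) by simp

theorem gluing_atlas: "striped_atlas X \<Lambda> S (%_. 0) (%_. 1) Q \<Gamma> (%n. side (2 * n)) (%n. side (2 * n + 1))"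
 unfolding striped_atlas_def
proof (intro conjI ballI allI impI)
 fix l assume l: "l : \<Lambda>"
 show "is_strip (S l) 0 1" using q_facts(1)[OF l] .
 show "continuous_map (top_of_set (S l)) X (%p. Q (l, p))" using q_facts(2)[OF l] by (simp add: Q_def)
next
 show "Q ` (Sigma \<Lambda> S) = topspace X" by (rule Q_surj)
 fix A assume A: "A <= topspace X"
 show "openin X A \<longleftrightarrow> (ALL l:\<Lambda>. openin (top_of_set (S l)) {p : S l. Q (l, p) : A})"
 proof
  assume o: "openin X A"
  show "ALL l:\<Lambda>. openin (top_of_set (S l)) {p : S l. Q (l, p) : A}"
  proof
   fix l assume "l : \<Lambda>"
   from openin_continuous_map_preimage[OF q_facts(2)[OF this] o]
   show "openin (top_of_set (S l)) {p : S l. Q (l, p) : A}" by (simp add: Q_def)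
  qed
 next
  assume "ALL l:\<Lambda>. openin (top_of_set (S l)) {p : S l. Q (l, p) : A}"
  then show "openin X A" by (intro quotient_open[OF A]) (simp add: Q_def)
 qed
next
 fix n assume n: "n : \<Gamma>"
 show "is_bint \<Lambda> S (%_. 0) (%_. 1) (side (2 * n))" by (rule side_bint[OF even_in_I])
 show "is_bint \<Lambda> S (%_. 0) (%_. 1) (side (2 * n + 1))" by (rule side_bint[OF \<Gamma>_in_I[OF n]])
next
 show "inj_on (%n. side (2 * n)) \<Gamma>"
 proof (rule inj_onI)
  fix n m assume nm: "n : \<Gamma>" "m : \<Gamma>" and eq: "side (2 * n) = side (2 * m)"
  have "leaf_of n = leaf_of m" using side_leaf_eq[OF even_in_I even_in_I eq] by simp
  then show "n = m" by (rule \<Gamma>_unique[OF nm])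
 qed
 show "inj_on (%n. side (2 * n + 1)) \<Gamma>"
 proof (rule inj_onI)
  fix n m assume nm: "n : \<Gamma>" "m : \<Gamma>" and eq: "side (2 * n + 1) = side (2 * m + 1)"
  have "leaf_of n = leaf_of m" using side_leaf_eq[OF \<Gamma>_in_I \<Gamma>_in_I eq] nm by simp
  then show "n = m" by (rule \<Gamma>_unique[OF nm])
 qed
 show "(%n. side (2 * n)) ` \<Gamma> Int (%n. side (2 * n + 1)) ` \<Gamma> = {}"
 proof (rule ccontr)
  assume "(%n. side (2 * n)) ` \<Gamma> Int (%n. side (2 * n + 1)) ` \<Gamma> ~= {}"
  then obtain n m where nm: "n : \<Gamma>" "m : \<Gamma>" "side (2 * n) = side (2 * m + 1)" by blast
  have "leaf_of n = leaf_of m" using side_leaf_eq[OF even_in_I \<Gamma>_in_I[OF nm(2)] nm(3)] by simp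
  then have "n = m" by (rule \<Gamma>_unique[OF nm(1,2)])
  then show False using nm sides_differ by simp
 qed
 show "inj_on Q (Sigma \<Lambda> S - (\<Union>n\<in>\<Gamma>. sheet (side (2 * n)) Un sheet (side (2 * n + 1))))" by (rule Q_inj)
next
 fix n assume n: "n : \<Gamma>"
 have L: "Q ` sheet (side (2 * n)) = leaf_of n" "Q ` sheet (side (2 * n + 1)) = leaf_of n"
  using Q_side[OF even_in_I[of n]] Q_side[OF \<Gamma>_in_I[OF n]] by auto
 then show "Q ` sheet (side (2 * n)) = Q ` sheet (side (2 * n + 1))" by simp
 show "embedding_map (top_of_set (snd (side (2 * n)))) X (%p. Q (fst (side (2 * n)), p))"
  by (rule side_embedding[OF even_in_I])
 show "embedding_map (top_of_set (snd (side (2 * n + 1)))) X (%p. Q (fst (side (2 * n + 1)), p))"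
  by (rule side_embedding[OF \<Gamma>_in_I[OF n]])
 have "closedin X (leaf_of n)" using leaf_closed subsetD[OF Sg leaf_of(1)] by blast
 then show "closedin X (Q ` sheet (side (2 * n)))" "closedin X (Q ` sheet (side (2 * n + 1)))" using L by simp_all
qed

theorem gluing_foliation: "atlas_canonical_foliation \<Lambda> S (%_. 0) (%_. 1) Q = \<Delta>"
proof (intro equalityI subsetI)
 fix L assume "L : atlas_canonical_foliation \<Lambda> S (%_. 0) (%_. 1) Q"
 then obtain l J where l: "l : \<Lambda>" "J : strip_canonical_foliation (S l) 0 1" "L = q l ` J"
  unfolding atlas_canonical_foliation_def Q_image by blast
 then consider t where "t : {0<..<1}" "J = band {t}" | "J : boundary_intervals (S l) 0 1"
  unfolding strip_canonical_foliation_def by blast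
 then show "L : \<Delta>"
 proof cases
  case 1
  then show ?thesis using q_facts(4)[OF l(1)] h_leaf[OF l(1)] l(3) by auto
 next
  case 2
  then obtain k where "k : I" "a k = l" "J = comp k" using interval_is_comp[OF l(1)] by blast
  then have "L = leaf_of (k div 2)" using comp_image l(3) by auto
  then show ?thesis using leaf_of(1) Sg by blast
 qed
next
 fix L assume L: "L : \<Delta>"
 have mem: "q l ` J : atlas_canonical_foliation \<Lambda> S (%_. 0) (%_. 1) Q"
  if "l : \<Lambda>" "J : strip_canonical_foliation (S l) 0 1" for l J
  unfolding atlas_canonical_foliation_def Q_image using that by blast
 show "L : atlas_canonical_foliation \<Lambda> S (%_. 0) (%_. 1) Q"
 proof (cases "L : Sg")
  case True
  then obtain n where n: "leaf_of n = L" using leaf_of_surj by blast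
  have "L = q (a (2 * n)) ` comp (2 * n)" using comp_image[OF even_in_I[of n]] n by simp
  moreover have "comp (2 * n) : strip_canonical_foliation (S (a (2 * n))) 0 1"
   using comp_in[OF even_in_I] by (simp add: strip_canonical_foliation_def)
  ultimately show ?thesis using mem[OF a_in[OF even_in_I]] by simp
 next
  case False
  have "L ~= {}" using L leaf_nonempty by blast
  then obtain z where z: "z : L" by blast
  have "z ~: W"
  proof
   assume "z : W"
   then obtain L' where L': "L' : Sg" "z : L'" unfolding W_def by blast
   have "L = L'" by (rule leaf_disjoint[OF L subsetD[OF Sg L'(1)]]) (use z L' in blast)
   then show False using False L' by simp
  qed
  moreover have "z : topspace X" using z L leaves_cover by blast
  ultimately have "z : (\<Union>l\<in>\<Lambda>. h l ` (band {0<..<1}))" unfolding h_cover by blast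
  then obtain l x t where t: "l : \<Lambda>" "t : {0<..<1}" "z = h l (x, t)" by auto
  have "h l ` (band {t}) : \<Delta>" using h_leaf[OF t(1,2)] by blast
  moreover have "z : h l ` (band {t})" using t(3) by blast
  ultimately have "L = h l ` (band {t})" using leaf_disjoint[OF L] z by blast
  then have "L = q l ` (band {t})" using q_facts(4)[OF t(1,2)] by simp
  moreover have "band {t} : strip_canonical_foliation (S l) 0 1"
   using t(2) by (auto simp: strip_canonical_foliation_def)
  ultimately show ?thesis using mem[OF t(1)] by simp
 qed
qed

theorem gluing_admits_striped_atlas: "admits_striped_atlas X \<Delta>"
 unfolding admits_striped_atlas_def using gluing_atlas gluing_foliation by blast

end

section \<open>Charts at the cut leaves\<close>

text \<open>An open map has no interior extremum. With equal values at two points both extrema would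
  sit at the ends of the interval between them, and the map would be constant there.\<close>

lemma open_map_imp_inj:
 fixes T :: "real => real"
 assumes c: "continuous_on {a<..<b} T" and o: "!!V. open V ==> V <= {a<..<b} ==> open (T ` V)"
 shows "inj_on T {a<..<b}"
proof (rule linorder_inj_onI)
 fix y1 y2 assume y: "y1 < y2" "y1 : {a<..<b}" "y2 : {a<..<b}"
 show "T y1 ~= T y2"
 proof
  assume eq: "T y1 = T y2"
  have sub: "{y1..y2} <= {a<..<b}" using y by auto
  then have op: "open (T ` {y1<..<y2})" by (intro o) auto
  have cc: "compact {y1..y2}" "{y1..y2} ~= {}" "continuous_on {y1..y2} T"
   using y(1) continuous_on_subset[OF c sub] by auto
  obtain m where m: "m : {y1..y2}" "ALL z:{y1..y2}. T z <= T m" using continuous_attains_sup[OF cc] by blast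
  obtain n where n: "n : {y1..y2}" "ALL z:{y1..y2}. T n <= T z" using continuous_attains_inf[OF cc] by blast
  have "m = y1 \<or> m = y2"
  proof (rule ccontr)
   assume "\<not> (m = y1 \<or> m = y2)"
   then have "T m : T ` {y1<..<y2}" using m(1) by auto
   then obtain d where d: "d > 0" "ball (T m) d <= T ` {y1<..<y2}" using op open_contains_ball by blast
   have "T m + d/2 : ball (T m) d" using d(1) by (simp add: dist_real_def)
   then obtain z where "z : {y1<..<y2}" "T z = T m + d/2" using d(2) by (metis imageE subsetD)
   then show False using m(2)[rule_format, of z] d(1) by auto
  qed
  moreover have "n = y1 \<or> n = y2"
  proof (rule ccontr)
   assume "\<not> (n = y1 \<or> n = y2)"
   then have "T n : T ` {y1<..<y2}" using n(1) by auto
   then obtain d where d: "d > 0" "ball (T n) d <= T ` {y1<..<y2}" using op open_contains_ball by blast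
   have "T n - d/2 : ball (T n) d" using d(1) by (simp add: dist_real_def)
   then obtain z where "z : {y1<..<y2}" "T z = T n - d/2" using d(2) by (metis imageE subsetD)
   then show False using n(2)[rule_format, of z] d(1) by auto
  qed
  ultimately have mn: "T m = T y1" "T n = T y1" using eq by auto
  have const: "T z = T y1" if z: "z : {y1..y2}" for z
   using m(2)[rule_format, OF z] n(2)[rule_format, OF z] mn by linarith
  have "T ` {y1<..<y2} = {T y1}"
  proof (intro equalityI subsetI)
   fix v assume "v : {T y1}"
   moreover have "(y1 + y2) / 2 : {y1<..<y2}" using y(1) by (auto simp: field_simps)
   moreover have "T ((y1 + y2) / 2) = T y1" using y(1) by (intro const) (auto simp: field_simps)
   ultimately show "v : T ` {y1<..<y2}" by (metis imageI singletonD)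
  next
   fix v assume "v : T ` {y1<..<y2}"
   then obtain z where z: "z : {y1<..<y2}" "v = T z" by blast
   then have "z : {y1..y2}" by auto
   then show "v : {T y1}" using const[of z] z(2) by simp
  qed
  then show False using op not_open_singleton[of "T y1"] by simp
 qed
qed auto

text \<open>A continuous injective height that tends to 0 is increasing, so its inverse makes it the
  linear function \<open>eps * s\<close>. The value 0 at 0 is assigned to \<open>\<sigma>\<close>
  and \<open>iota\<close> by hand and agrees with their limits, so both are continuous on [0,
  1).\<close>

lemma end_reparametrization:
 fixes T :: "real => real"
 assumes c: "continuous_on {0<..<1} T" and i: "inj_on T {0<..<1}" and im: "T ` {0<..<1} <= {0<..<1}"
  and lim: "!!c. c > 0 ==> EX s':{0<..<1}. ALL s:{0<..s'}. T s < c"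
 obtains eps \<sigma> iota where "0 < eps" "eps <= 1" "!!s. s : {0<..<1} ==> \<sigma> s : {0<..<1} & T (\<sigma> s) = eps * s" "\<sigma> 0 = 0"
  "continuous_on {0..<1} \<sigma>" "continuous_on {0..<1} iota" "iota 0 = 0"
  "!!s. s : {0<..<1} ==> iota s : {0<..<1}" "!!s. s : {0..<1} ==> iota (\<sigma> s) = s" "!!s. s : {0..<1} ==> \<sigma> (iota s) = s"
proof -
 have T01: "0 < T s" "T s < 1" if "s : {0<..<1}" for s
 proof -
  have "T s : {0<..<1}" using im that by blast
  then show "0 < T s" "T s < 1" by auto
 qed
 have "strict_mono_on {0<..<1} T \<or> strict_antimono_on {0<..<1} T"
  using injective_eq_monotone_map[OF _ c] i is_interval_oo by blast
 moreover have "\<not> strict_antimono_on {0<..<1} T"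
 proof
  assume anti: "strict_antimono_on {0<..<1} T"
  have "0 < T (1/2)" by (rule T01) simp
  then obtain s' where s': "s' : {0<..<1}" "ALL s:{0<..s'}. T s < T (1/2)" using lim by blast
  let ?s = "min s' (1/4)"
  have "?s : {0<..s'}" "?s : {0<..<1}" "?s < 1/2" using s'(1) by auto
  then have "T ?s < T (1/2)" "T (1/2) < T ?s" using s'(2) anti by (auto simp: monotone_on_def)
  then show False by simp
 qed
 ultimately have mono: "T s < T s'" if "0 < s" "s < s'" "s' < 1" for s s'
  using that by (auto simp: monotone_on_def)
 \<comment> \<open>The supremum is not attained, so the range of \<open>T\<close> is exactly (0,
   eps).\<close>
 define eps where "eps = Sup (T ` {0<..<1})"
 have bdd: "bdd_above (T ` {0<..<1})" using T01 by (intro bdd_aboveI[of _ 1]) (auto intro: less_imp_le)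
 have half: "(1/2::real) : {0<..<1}" by simp
 have ne: "T ` {0<..<1} ~= {}" using half by blast
 have Teps: "T s < eps" if s: "s : {0<..<1}" for s
 proof -
  have "T s < T ((s + 1) / 2)" by (rule mono) (use s in auto)
  also have "\<dots> <= eps" unfolding eps_def using bdd s by (intro cSup_upper) auto
  finally show ?thesis .
 qed
 have epspos: "0 < eps" using T01(1)[OF half] Teps[OF half] by simp
 have epsle: "eps <= 1" unfolding eps_def using ne T01 by (intro cSup_least) (auto intro: less_imp_le)
 have surj: "EX s:{0<..<1}. T s = v" if v: "0 < v" "v < eps" for v
 proof -
  obtain s1 where s1: "s1 : {0<..<1}" "T s1 < v" using lim[OF v(1)] by force
  obtain s2 where s2: "s2 : {0<..<1}" "v < T s2" using less_cSupD[OF ne, of v] v(2) unfolding eps_def by blast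
  have "connected (T ` {0<..<1})" by (intro connected_continuous_image c) auto
  then have "v : T ` {0<..<1}" by (rule connectedD_interval[of _ "T s1" "T s2"]) (use s1 s2 in auto)
  then show ?thesis by blast
 qed
 define \<sigma> where "\<sigma> s = (if s = 0 then 0 else (THE u. u : {0<..<1} & T u = eps * s))" for s
 define iota where "iota s = (if s = 0 then 0 else T s / eps)" for s
 have \<sigma>: "\<sigma> s : {0<..<1} & T (\<sigma> s) = eps * s" if s: "s : {0<..<1}" for s
 proof -
  have "0 < eps * s" "eps * s < eps" using s epspos by auto
  then obtain u where u: "u : {0<..<1}" "T u = eps * s" using surj by blast
  have "(THE u. u : {0<..<1} & T u = eps * s) = u"
   using u inj_onD[OF i] by (intro the_equality) auto
  then show ?thesis using u s by (simp add: \<sigma>_def)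
 qed
 have \<sigma>0: "\<sigma> 0 = 0" "iota 0 = 0" by (auto simp: \<sigma>_def iota_def)
 have iota: "iota s : {0<..<1}" if s: "s : {0<..<1}" for s
  using s T01[OF s] Teps[OF s] epspos by (auto simp: iota_def)
 have iota\<sigma>: "iota (\<sigma> s) = s" if s: "s : {0..<1}" for s
  using \<sigma>[of s] s epspos by (cases "s = 0") (auto simp: \<sigma>0, auto simp: iota_def)
 have \<sigma>iota: "\<sigma> (iota s) = s" if s: "s : {0..<1}" for s
 proof (cases "s = 0")
  case False
  then have s': "s : {0<..<1}" using s by auto
  have "T (\<sigma> (iota s)) = eps * iota s" "\<sigma> (iota s) : {0<..<1}" using \<sigma>[OF iota[OF s']] by auto
  moreover have "eps * iota s = T s" using s' epspos by (simp add: iota_def)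
  ultimately show ?thesis using inj_onD[OF i, of "\<sigma> (iota s)" s] s' by simp
 qed (simp add: \<sigma>0)
 have iotamono: "iota s < iota s'" if "0 <= s" "s < s'" "s' < 1" for s s'
  using that mono[of s s'] T01[of s'] epspos by (cases "s = 0") (auto simp: iota_def divide_strict_right_mono)
 have \<sigma>01: "\<sigma> s : {0..<1}" if "s : {0..<1}" for s using \<sigma>[of s] \<sigma>0 that by (cases "s = 0") auto
 have less_iff: "u < \<sigma> s \<longleftrightarrow> iota u < s" "\<sigma> s < u \<longleftrightarrow> s < iota u" if u: "u : {0..<1}" and s: "s : {0..<1}" for u s
  using iotamono[of u "\<sigma> s"] iotamono[of "\<sigma> s" u] iota\<sigma>[OF s] u \<sigma>01[OF s]
  by (cases u "\<sigma> s" rule: linorder_cases; auto)+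
 have "continuous_on {0..<1} \<sigma>"
  unfolding continuous_on_def
 proof
  fix s assume s: "s : {0..<1::real}"
  have inS: "eventually (%x. x : {0..<1}) (at s within {0..<1})" by (simp add: eventually_at_filter)
  have id: "((%x. x) \<longlongrightarrow> s) (at s within {0..<1})" by (rule tendsto_ident_at)
  show "(\<sigma> \<longlongrightarrow> \<sigma> s) (at s within {0..<1})"
  proof (rule order_tendstoI)
   fix u assume u: "u < \<sigma> s"
   show "eventually (%x. u < \<sigma> x) (at s within {0..<1})"
   proof (cases "u < 0")
    case True
    show ?thesis using inS
    proof eventually_elim
     case (elim x)
     then show ?case using \<sigma>01[OF elim] True by auto
    qed
   next
    case False
    then have u1: "u : {0..<1}" using u \<sigma>01[OF s] by auto
    have "iota u < s" using less_iff(1)[OF u1 s] u by simp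
    with order_tendstoD(1)[OF id] have "eventually (%x. iota u < x) (at s within {0..<1})" by blast
    with inS show ?thesis by eventually_elim (use less_iff(1)[OF u1] in blast)
   qed
  next
   fix u assume u: "\<sigma> s < u"
   show "eventually (%x. \<sigma> x < u) (at s within {0..<1})"
   proof (cases "u \<ge> 1")
    case True
    show ?thesis using inS
    proof eventually_elim
     case (elim x)
     then show ?case using \<sigma>01[OF elim] True by auto
    qed
   next
    case False
    then have u1: "u : {0..<1}" using u \<sigma>01[OF s] by auto
    have "s < iota u" using less_iff(2)[OF u1 s] u by simp
    with order_tendstoD(2)[OF id] have "eventually (%x. x < iota u) (at s within {0..<1})" by blast
    with inS show ?thesis by eventually_elim (use less_iff(2)[OF u1] in blast)
   qed
  qed
 qed
 moreover have "continuous_on {0..<1} iota"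
  unfolding continuous_on_def
 proof
  fix s assume s: "s : {0..<1::real}"
  show "(iota \<longlongrightarrow> iota s) (at s within {0..<1})"
  proof (cases "s = 0")
   case True
   have "(iota \<longlongrightarrow> 0) (at 0 within {0..<1})"
    unfolding tendsto_iff eventually_at
   proof (intro allI impI)
    fix r :: real assume r: "r > 0"
    then have "eps * r > 0" using epspos by simp
    then obtain s' where s': "s' : {0<..<1}" "ALL s:{0<..s'}. T s < eps * r" using lim by blast
    have "dist (iota x) 0 < r" if x: "x : {0..<1}" "x ~= 0" "dist x 0 < s'" for x
    proof -
     have x2: "x : {0<..s'}" "x : {0<..<1}" using x by (auto simp: dist_real_def)
     then have "T x < eps * r" "0 < T x" using s'(2) T01 by auto
     then show ?thesis using epspos x(2) by (simp add: iota_def dist_real_def divide_less_eq mult.commute)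
    qed
    then show "EX d>0. ALL x:{0..<1}. x ~= 0 & dist x 0 < d --> dist (iota x) 0 < r" using s'(1) by auto
   qed
   then show ?thesis using True \<sigma>0 by simp
  next
   case False
   then have s': "s : {0<..<1}" using s by auto
   have "continuous_on {0<..<1} (%x. T x / eps)" using epspos by (intro continuous_intros c) auto
   then have "((%x. T x / eps) \<longlongrightarrow> T s / eps) (at s)"
    using s' at_within_open[OF s'] unfolding continuous_on_def by fastforce
   moreover have "eventually (%x. T x / eps = iota x) (at s)"
   proof -
    have "eventually (%x. x : {0<..<1}) (at s)" using eventually_at_in_open'[of "{0<..<1}" s] s' by simp
    then show ?thesis by eventually_elim (simp add: iota_def)
   qed
   ultimately have "(iota \<longlongrightarrow> T s / eps) (at s)" by (rule Lim_transform_eventually)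
   moreover have "T s / eps = iota s" using False by (simp add: iota_def)
   ultimately have "(iota \<longlongrightarrow> iota s) (at s)" by simp
   then show ?thesis by (rule tendsto_within_subset) simp
  qed
 qed
 ultimately show thesis using that[of eps \<sigma> iota] epspos epsle \<sigma> \<sigma>0 iota iota\<sigma> \<sigma>iota by blast
qed

text \<open>The open half chart is connected and covered by maximal strips, which are open and
  pairwise disjoint.\<close>

lemma (in cut_strip_family) half_chart_in_arc:
 assumes c: "continuous_map (top_of_set half_square) X b0"
  and leaf: "b0 ` half_square_pos <= \<Union>\<L>"
  and cover: "!!L. L : \<L> ==> EX B. strip_arc B & L <= B"
 obtains B where "maximal_arc B" "b0 ` half_square_pos <= B"
proof -
 have m: "(0, 1/2) : half_square_pos" by simp
 then obtain L where L: "L : \<L>" "b0 (0, 1/2) : L" using leaf by blast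
 obtain B0 where B0: "strip_arc B0" "L <= B0" using cover[OF L(1)] by blast
 obtain B where B: "maximal_arc B" "B0 <= B" using maximal_arc_exists[OF B0(1)] .
 have op: "openin X B'" if "maximal_arc B'" for B' using that strip_arc_openin by (simp add: maximal_arc_def)
 let ?R = "\<Union>{B'. maximal_arc B' & B' ~= B}"
 have oR: "openin X ?R" using op by (intro openin_Union) auto
 have "connectedin (top_of_set half_square) half_square_pos"
  unfolding connectedin_subtopology by (auto intro!: connected_Times)
 then have con: "connectedin X (b0 ` half_square_pos)" by (rule connectedin_continuous_map_image[OF c])
 have cov: "b0 ` half_square_pos <= B Un ?R"
 proof
  fix z assume "z : b0 ` half_square_pos"
  then obtain L' where L': "L' : \<L>" "z : L'" using leaf by blast
  obtain B1 where B1: "strip_arc B1" "L' <= B1" using cover[OF L'(1)] by blast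
  obtain B2 where "maximal_arc B2" "B1 <= B2" using maximal_arc_exists[OF B1(1)] .
  then show "z : B Un ?R" using B1 L' by (cases "B2 = B") auto
 qed
 have "B Int B' = {}" if "maximal_arc B'" "B' ~= B" for B' using maximal_arc_disjoint[OF B(1) that(1)] that(2) by blast
 then have "B Int ?R Int b0 ` half_square_pos = {}" by blast
 moreover have "B Int b0 ` half_square_pos ~= {}" using m L B0 B by blast
 ultimately have "?R Int b0 ` half_square_pos = {}" using connectedinD[OF con op[OF B(1)] oR cov] by blast
 then show thesis using that[OF B(1)] cov by blast
qed

text \<open>Horizontal segments lie in leaves, so in strip coordinates the height depends on
  \<open>s\<close> alone. The base point lies on no line of the family, so the height tends to an
  end \<open>e\<close> and \<open>\<sigma>\<close> makes it linear. The direction along the lines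
  cannot change with \<open>s\<close> and is corrected by the sign \<open>rho\<close>.\<close>

lemma (in strip_family) half_chart_normal_form:
 fixes b0 :: "real \<times> real => 'a"
 assumes h: "pstrip 0 1 h" and c: "continuous_map (top_of_set half_square) X b0" and i: "inj_on b0 half_square"
  and sub: "b0 ` half_square_pos <= h ` (band {0<..<1})"
  and leaf: "!!s. s : {0<..<1} ==> EX L:\<L>. b0 ` ({-1<..<1} \<times> {s}) <= L"
  and base: "b0 (0, 0) ~: \<Union>\<L>"
 shows "EX rho \<sigma> iota xi e eps. (rho = 1 \<or> rho = -1) & (e = 0 \<or> e = 1) & 0 < eps & eps <= 1 &
   \<sigma> 0 = 0 & iota 0 = 0 & continuous_on {0..<1} \<sigma> & continuous_on {0..<1} iota &
   (ALL s:{0<..<1}. \<sigma> s : {0<..<1}) & (ALL s:{0<..<1}. iota s : {0<..<1}) &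
   (ALL s:{0..<1}. iota (\<sigma> s) = s) & (ALL s:{0..<1}. \<sigma> (iota s) = s) &
   continuous_on half_square_pos (%(x, s). xi x s) &
   (ALL s:{0<..<1}. ALL x x'. -1 < x --> x < x' --> x' < 1 --> xi x s < xi x' s) &
   (ALL x:{-1<..<1}. ALL s:{0<..<1}. b0 (rho * x, \<sigma> s) = h (xi x s :: real, e + (1 - 2 * e) * eps * s :: real))"
proof -
 let ?A = "band {0<..<1} :: (real \<times> real) set"
 have hi: "inj_on h ?A" and hL: "!!t. t : {0<..<1} ==> h ` (band {t}) : \<L>"
  and hK: "!!K. compact K ==> K <= {0<..<1} ==> closedin X (h ` (band K))"
  using h by (auto simp: proper_strip_def)
 define kb where "kb = inv_into ?A h \<circ> b0"
 have kbA: "kb p : ?A" "h (kb p) = b0 p" if p: "p : half_square_pos" for p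
 proof -
  have z: "b0 p : h ` ?A" using sub p by blast
  show "kb p : ?A" unfolding kb_def o_def by (rule inv_into_into[OF z])
  show "h (kb p) = b0 p" unfolding kb_def o_def by (rule f_inv_into_f[OF z])
 qed
 have kbc: "continuous_on half_square_pos kb"
 proof -
  have "half_square_pos <= half_square" by auto
  then have "continuous_map (top_of_set half_square_pos) (subtopology X (h ` ?A)) b0"
   using continuous_map_from_subtopology_mono[OF c] sub by (auto simp: continuous_map_in_subtopology)
  moreover have "continuous_map (subtopology X (h ` ?A)) (top_of_set ?A) (inv_into ?A h)"
   using h by (intro surface_open_embedding_inverse[OF surf]) (auto simp: proper_strip_def open_Times)
  ultimately have "continuous_map (top_of_set half_square_pos) (top_of_set ?A) kb"
   unfolding kb_def by (rule continuous_map_compose)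
  then show ?thesis by (simp add: continuous_map_in_subtopology)
 qed
 have kbi: "inj_on kb half_square_pos"
 proof (rule inj_onI)
  fix p p' assume p: "p : half_square_pos" "p' : half_square_pos" "kb p = kb p'"
  then have "b0 p = b0 p'" using kbA(2) by metis
  then show "p = p'" using inj_onD[OF i] p by auto
 qed
 define xi0 where "xi0 x s = fst (kb (x, s))" for x s
 define T where "T s = snd (kb (0, s))" for s
 have T01: "T s : {0<..<1}" if "s : {0<..<1}" for s
  using kbA(1)[of "(0, s)"] that by (auto simp: T_def mem_Times_iff)
 have snd_kb: "snd (kb (x, s)) = T s" if x: "x : {-1<..<1}" and s: "s : {0<..<1}" for x s
 proof -
  have p: "(x, s) : half_square_pos" "(0, s) : half_square_pos" using x s by auto
  obtain L where L: "L : \<L>" "b0 ` ({-1<..<1} \<times> {s}) <= L" using leaf[OF s] by blast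
  have "b0 (0, s) = h (fst (kb (0, s)), T s)" using kbA(2)[OF p(2)] by (simp add: T_def)
  then have "b0 (0, s) : h ` (band {T s})" by blast
  moreover have "b0 (0, s) : L" "b0 (x, s) : L" using L(2) x by auto
  ultimately have "L = h ` (band {T s})" using leaf_disjoint[OF L(1) hL[OF T01[OF s]]] by blast
  then obtain y where y: "b0 (x, s) = h (y, T s)" using \<open>b0 (x, s) : L\<close> by auto
  have "kb (x, s) = (y, T s)"
   by (rule inj_onD[OF hi]) (use y kbA[OF p(1)] T01[OF s] in auto)
  then show ?thesis by simp
 qed
 have kb_eq: "kb (x, s) = (xi0 x s, T s)" if "x : {-1<..<1}" "s : {0<..<1}" for x s
  using snd_kb[OF that] by (simp add: xi0_def prod_eq_iff)
 have Tc: "continuous_on {0<..<1} T"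
  unfolding T_def by (intro continuous_on_snd continuous_on_compose2[OF kbc] continuous_intros) auto
 \<comment> \<open>The coordinate change is open by invariance of domain and projections are open,
   so \<open>T\<close> is an open map; this is what prevents it from turning back.\<close>
 have Ti: "inj_on T {0<..<1}"
 proof (rule open_map_imp_inj[OF Tc])
  fix V :: "real set" assume V: "open V" "V <= {0<..<1}"
  have s: "{-1<..<1} \<times> V <= half_square_pos" using V by auto
  have "open (kb ` ({-1<..<1} \<times> V))"
   using continuous_on_subset[OF kbc s] inj_on_subset[OF kbi s] V(1) by (intro invariance_of_domain open_Times) auto
  then have "open (snd ` kb ` ({-1<..<1} \<times> V))" by (rule open_image_snd)
  moreover have "snd ` kb ` ({-1<..<1} \<times> V) = T ` V"
  proof (intro equalityI subsetI)
   fix v assume "v : snd ` kb ` ({-1<..<1} \<times> V)"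
   then obtain x s where "x : {-1<..<1}" "s : V" "v = snd (kb (x, s))" by auto
   then show "v : T ` V" using snd_kb[of x s] V(2) by auto
  next
   fix v assume "v : T ` V"
   then obtain s where s: "s : V" "v = snd (kb (0, s))" by (auto simp: T_def)
   then have "(0::real, s) : {-1<..<1} \<times> V" by simp
   then show "v : snd ` kb ` ({-1<..<1} \<times> V)" using s(2) by blast
  qed
  ultimately show "open (T ` V)" by simp
 qed
 have "(ALL c<1. EX s':{0<..1/2}. ALL s:{0<..s'}. c < T s) \<or> (ALL c>0. EX s':{0<..1/2}. ALL s:{0<..s'}. T s < c)"
 proof (rule end_limit_right)
  show "continuous_on {0<..1/2} T" by (rule continuous_on_subset[OF Tc]) auto
  fix u v :: real assume uv: "0 < u" "u <= v" "v < 1"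
  then have "closedin X (h ` (band {u..v}))" by (intro hK) auto
  then have o: "openin X (topspace X - h ` (band {u..v}))" by blast
  have "h ` (band {u..v}) <= \<Union>\<L>"
  proof clarify
   fix x t :: real assume "t : {u..v}"
   then have "t : {0<..<1}" using uv by auto
   from hL[OF this] show "h (x, t) : \<Union>\<L>" by blast
  qed
  moreover have "b0 (0, 0) : topspace X"
   using continuous_map_image_subset_topspace[OF c] by (auto simp: image_subset_iff)
  ultimately have b00: "b0 (0, 0) : topspace X - h ` (band {u..v})" using base by blast
  have z0: "(0::real) : {-1<..<1}" by simp
  obtain delta where delta: "delta > 0" "hbox 0 delta <= half_square" "b0 ` hbox 0 delta <= topspace X - h ` (band {u..v})"
   using hbox_in_preimage[OF c o b00 z0] .
  have "T s ~: {u..v}" if s: "s : {0<..<delta}" "s <= 1/2" for s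
  proof
   assume "T s : {u..v}"
   moreover have "(0, s) : half_square_pos" using s by auto
   then have "b0 (0, s) = h (fst (kb (0, s)), T s)" using kbA(2) by (simp add: T_def)
   ultimately have "b0 (0, s) : h ` (band {u..v})" by blast
   moreover have "(0, s) : hbox 0 delta" using s by (auto simp: hbox_def)
   ultimately show False using delta(3) by blast
  qed
  then show "EX s'>0. ALL s:{0<..<s'}. s <= 1/2 --> T s ~: {u..v}" using delta(1) by blast
 qed simp
 \<comment> \<open>For \<open>e = 1\<close> the expression is \<open>1 - T s\<close>, so both cases
   become convergence to 0.\<close>
 then obtain e :: real where e: "e = 0 \<or> e = 1"
  and elim: "!!c. c > 0 ==> EX s':{0<..<1}. ALL s:{0<..s'}. e + (1 - 2 * e) * T s < c"
 proof
  assume hi1: "ALL c<1. EX s':{0<..1/2}. ALL s:{0<..s'}. c < T s"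
  show thesis
  proof (rule that[of 1])
   fix c :: real assume "c > 0"
   then have "1 - c < 1" by simp
   then obtain s' where s': "s' : {0<..1/2}" "ALL s:{0<..s'}. 1 - c < T s" using hi1 by blast
   then show "EX s':{0<..<1}. ALL s:{0<..s'}. 1 + (1 - 2 * 1) * T s < c" by (intro bexI[of _ s']) force+
  qed simp
 next
  assume lo: "ALL c>0. EX s':{0<..1/2}. ALL s:{0<..s'}. T s < c"
  show thesis
  proof (rule that[of 0])
   fix c :: real assume "c > 0"
   then obtain s' where s': "s' : {0<..1/2}" "ALL s:{0<..s'}. T s < c" using lo by blast
   then show "EX s':{0<..<1}. ALL s:{0<..s'}. 0 + (1 - 2 * 0) * T s < c" by (intro bexI[of _ s']) force+
  qed simp
 qed
 have T'c: "continuous_on {0<..<1} (%s. e + (1 - 2 * e) * T s)" by (intro continuous_intros Tc)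
 have T'i: "inj_on (%s. e + (1 - 2 * e) * T s) {0<..<1}" using e inj_onD[OF Ti] by (auto intro!: inj_onI)
 have T'im: "(%s. e + (1 - 2 * e) * T s) ` {0<..<1} <= {0<..<1}" using e T01 by fastforce
 obtain eps \<sigma> iota where eps: "0 < eps" "eps <= 1"
  and \<sigma>: "!!s. s : {0<..<1} ==> \<sigma> s : {0<..<1} & e + (1 - 2 * e) * T (\<sigma> s) = eps * s" "\<sigma> 0 = 0"
  and c\<sigma>: "continuous_on {0..<1} \<sigma>" "continuous_on {0..<1} iota" "iota 0 = 0"
  and iota: "!!s. s : {0<..<1} ==> iota s : {0<..<1}" "!!s. s : {0..<1} ==> iota (\<sigma> s) = s" "!!s. s : {0..<1} ==> \<sigma> (iota s) = s"
  by (rule end_reparametrization[OF T'c T'i T'im elim]) blast+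
 have T\<sigma>: "T (\<sigma> s) = e + (1 - 2 * e) * eps * s" if s: "s : {0<..<1}" for s
  using \<sigma>(1)[OF s] e by auto
 have xi0c: "continuous_on half_square_pos (%p. xi0 (fst p) (snd p))"
  unfolding xi0_def using continuous_on_fst[OF kbc] by simp
 have xi0c1: "continuous_on {-1<..<1} (%x. xi0 x s)" if s: "s : {0<..<1}" for s
  unfolding xi0_def using s by (intro continuous_on_fst continuous_on_compose2[OF kbc] continuous_intros) auto
 have xi0c2: "continuous_on {0<..<1} (%s. xi0 x s)" if x: "x : {-1<..<1}" for x
  unfolding xi0_def using x by (intro continuous_on_fst continuous_on_compose2[OF kbc] continuous_intros) auto
 have xi0i: "inj_on (%x. xi0 x s) {-1<..<1}" if s: "s : {0<..<1}" for s
 proof (rule inj_onI)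
  fix x x' assume x: "x : {-1<..<1}" "x' : {-1<..<1}" "xi0 x s = xi0 x' s"
  then have "kb (x, s) = kb (x', s)" using kb_eq s by simp
  then have "(x, s) = (x', s)" by (rule inj_onD[OF kbi]) (use x s in auto)
  then show "x = x'" by simp
 qed
 \<comment> \<open>The sign of \<open>D\<close> tells in which direction the lines are traversed; it
   never vanishes, so it is constant in \<open>s\<close>.\<close>
 define D where "D s = xi0 (1/2) s - xi0 (-1/2) s" for s
 have mono: "strict_mono_on {-1<..<1} (%x. xi0 x s) \<or> strict_antimono_on {-1<..<1} (%x. xi0 x s)" if s: "s : {0<..<1}" for s
  using injective_eq_monotone_map[OF _ xi0c1[OF s]] xi0i[OF s] is_interval_oo by blast
 have Dpos: "strict_mono_on {-1<..<1} (%x. xi0 x s)" if s: "s : {0<..<1}" and "D s > 0" for s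
 proof -
  have "\<not> strict_antimono_on {-1<..<1} (%x. xi0 x s)"
  proof
   assume "strict_antimono_on {-1<..<1} (%x. xi0 x s)"
   then have "xi0 (1/2) s < xi0 (-1/2) s" by (auto simp: monotone_on_def)
   then show False using that(2) by (simp add: D_def)
  qed
  then show ?thesis using mono[OF s] by blast
 qed
 have Dneg: "strict_antimono_on {-1<..<1} (%x. xi0 x s)" if s: "s : {0<..<1}" and "D s < 0" for s
 proof -
  have "\<not> strict_mono_on {-1<..<1} (%x. xi0 x s)"
  proof
   assume "strict_mono_on {-1<..<1} (%x. xi0 x s)"
   then have "xi0 (-1/2) s < xi0 (1/2) s" by (auto simp: monotone_on_def)
   then show False using that(2) by (simp add: D_def)
  qed
  then show ?thesis using mono[OF s] by blast
 qed
 have D0: "D s ~= 0" if s: "s : {0<..<1}" for s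
  using inj_onD[OF xi0i[OF s], of "1/2" "-1/2"] by (auto simp: D_def)
 have "connected (D ` {0<..<1})"
  unfolding D_def by (intro connected_continuous_image continuous_intros xi0c2) auto
 then have Dsign: "(ALL s:{0<..<1}. D s > 0) \<or> (ALL s:{0<..<1}. D s < 0)"
 proof -
  assume con: "connected (D ` {0<..<1})"
  show ?thesis
  proof (rule ccontr)
   assume "\<not> ?thesis"
   then obtain s s' where ss: "s : {0<..<1}" "s' : {0<..<1}" "D s <= 0" "0 <= D s'" by (meson not_less)
   have "0 : D ` {0<..<1}" by (rule connectedD_interval[OF con, of "D s" "D s'"]) (use ss in auto)
   then show False using D0 by force
  qed
 qed
 define rho :: real where "rho = (if ALL s:{0<..<1}. D s > 0 then 1 else -1)"
 have rho: "rho = 1 \<or> rho = -1" by (simp add: rho_def)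
 define xi where "xi x s = xi0 (rho * x) (\<sigma> s)" for x s
 have rhox: "rho * x : {-1<..<1}" if "x : {-1<..<1}" for x using rho that by auto
 have xic: "continuous_on half_square_pos (%(x, s). xi x s)"
 proof -
  have "continuous_on half_square_pos (%p. (rho * fst p, \<sigma> (snd p)))"
   by (intro continuous_on_Pair continuous_intros continuous_on_compose2[OF c\<sigma>(1)]) auto
  moreover have "(%p. (rho * fst p, \<sigma> (snd p))) ` half_square_pos <= half_square_pos"
  proof (rule image_subsetI)
   fix p assume p: "p : half_square_pos"
   then have "fst p : {-1<..<1}" "snd p : {0<..<1}" by auto
   then show "(rho * fst p, \<sigma> (snd p)) : half_square_pos" using rhox \<sigma>(1) by blast
  qed
  ultimately have "continuous_on half_square_pos (%p. xi0 (fst (rho * fst p, \<sigma> (snd p))) (snd (rho * fst p, \<sigma> (snd p))))"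
   by (rule continuous_on_compose2[OF xi0c])
  then show ?thesis by (simp add: xi_def case_prod_unfold)
 qed
 have xim: "xi x s < xi x' s" if s: "s : {0<..<1}" and x: "-1 < x" "x < x'" "x' < 1" for s x x'
 proof (cases "ALL s:{0<..<1}. D s > 0")
  case True
  then have "strict_mono_on {-1<..<1} (%x. xi0 x (\<sigma> s))" using Dpos \<sigma>(1)[OF s] by blast
  then show ?thesis using True x by (simp add: xi_def rho_def monotone_on_def)
 next
  case False
  then have "strict_antimono_on {-1<..<1} (%x. xi0 x (\<sigma> s))" using Dneg Dsign \<sigma>(1)[OF s] by blast
  moreover have "rho = -1" using False by (simp add: rho_def)
  ultimately show ?thesis using x by (simp add: xi_def monotone_on_def)
 qed
 have co: "b0 (rho * x, \<sigma> s) = h (xi x s, e + (1 - 2 * e) * eps * s)" if x: "x : {-1<..<1}" and s: "s : {0<..<1}" for x s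
 proof -
  have "(rho * x, \<sigma> s) : half_square_pos" using rhox[OF x] \<sigma>(1)[OF s] by blast
  then have "b0 (rho * x, \<sigma> s) = h (kb (rho * x, \<sigma> s))" using kbA(2) by simp
  also have "kb (rho * x, \<sigma> s) = (xi0 (rho * x) (\<sigma> s), T (\<sigma> s))" using rhox[OF x] \<sigma>(1)[OF s] by (intro kb_eq) auto
  finally show ?thesis using T\<sigma>[OF s] by (simp add: xi_def)
 qed
 show ?thesis
  by (rule exI[of _ rho], rule exI[of _ \<sigma>], rule exI[of _ iota], rule exI[of _ xi], rule exI[of _ e], rule exI[of _ eps])
   (intro conjI ballI allI impI rho e eps \<sigma>(2) c\<sigma> iota xic xim co; use \<sigma>(1) in blast)
qed

section \<open>Charts centred on a cut leaf\<close>

definition centred_box :: "bool => (real \<times> real) set" where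
 "centred_box full = {-1<..<1} \<times> (if full then {-1<..<1} else {0..<1})"

text \<open>A path component of the leaf in the chart is mapped onto a full horizontal segment, and
  the segment through the given point can only be the one at its own height.\<close>

lemma plaque_in_leaf:
 fixes Y :: "real set" and g :: "real \<times> real => 'a"
 assumes fol: "\<Union>\<Delta> = topspace X" and U: "openin X U"
  and gm: "homeomorphic_maps (subtopology X U) (top_of_set ({-1<..<1} \<times> Y)) phi g"
  and pl: "ALL L:\<Delta>. ALL C:path_components_of (subtopology X (L Int U)). EX t. phi ` C = {-1<..<1} \<times> {t}"
  and y: "y : Y"
 shows "EX L:\<Delta>. g ` ({-1<..<1} \<times> {y}) <= L"
proof -
 let ?B = "{-1<..<1::real} \<times> Y"
 have UX: "topspace (subtopology X U) = U" using openin_subset[OF U] by (simp add: Int_absorb1)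
 have gU: "g p : U" and phig: "phi (g p) = p" if "p : ?B" for p
 proof -
  have "g ` ?B <= U"
   using gm continuous_map_image_subset_topspace[of "top_of_set ?B" "subtopology X U" g] UX
   by (simp add: homeomorphic_maps_def)
  then show "g p : U" using that by blast
  show "phi (g p) = p" using gm that by (auto simp: homeomorphic_maps_def)
 qed
 have gphi: "g (phi w) = w" if "w : U" for w using gm that UX by (simp add: homeomorphic_maps_def)
 have p: "(0, y) : ?B" using y by simp
 have "g (0, y) : \<Union>\<Delta>" using gU[OF p] openin_subset[OF U] fol by blast
 then obtain L where L: "L : \<Delta>" "g (0, y) : L" by blast
 have top: "topspace (subtopology X (L Int U)) = L Int U" using openin_subset[OF U] by auto
 define C where "C = Collect (path_component_of (subtopology X (L Int U)) (g (0, y)))"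
 have "g (0, y) : topspace (subtopology X (L Int U))" using L(2) gU[OF p] top by simp
 then have C: "C : path_components_of (subtopology X (L Int U))" "g (0, y) : C"
  unfolding C_def path_components_of_def by (auto simp: path_component_of_refl)
 then obtain t where t: "phi ` C = {-1<..<1} \<times> {t}" using pl L(1) by blast
 have "phi (g (0, y)) : phi ` C" using C(2) by blast
 then have "t = y" using t phig[OF p] by auto
 have CL: "C <= L Int U" using path_components_of_subset[OF C(1)] top by simp
 have "g ` ({-1<..<1} \<times> {y}) <= L"
 proof (rule image_subsetI)
  fix q assume "q : {-1<..<1::real} \<times> {y}"
  then have "q : phi ` C" using t \<open>t = y\<close> by simp
  then obtain w where w: "w : C" "q = phi w" by blast
  then have "w : L" "w : U" using CL by blast+
  then show "g q : L" using gphi[of w] w(2) by simp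
 qed
 then show ?thesis using L(1) by blast
qed

text \<open>As a subspace the leaf is a line, so invariance of domain in dimension one applies.
  Consequently some open set meets the leaf in this plaque only: the leaf does not return
  arbitrarily close to itself.\<close>

lemma plaque_open_in_leaf:
 fixes f :: "real => 'a"
 assumes line: "subtopology X L homeomorphic_space euclideanreal" and c: "continuous_map (top_of_set {a<..<b}) X f"
  and i: "inj_on f {a<..<b}" and s: "f ` {a<..<b} <= L"
 shows "openin (subtopology X L) (f ` {a<..<b})"
proof -
 obtain kappa kappa' where k: "homeomorphic_maps (subtopology X L) euclideanreal kappa kappa'"
  using line by (auto simp: homeomorphic_space_def)
 have kc: "continuous_map (subtopology X L) euclideanreal kappa" "continuous_map euclideanreal (subtopology X L) kappa'"
  and k1: "!!w. w : topspace (subtopology X L) ==> kappa' (kappa w) = w" and k2: "!!t. kappa (kappa' t) = t"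
  using k by (auto simp: homeomorphic_maps_def)
 have fL: "continuous_map (top_of_set {a<..<b}) (subtopology X L) f" using c s by (auto simp: continuous_map_in_subtopology)
 then have fT: "f x : topspace (subtopology X L)" if "x : {a<..<b}" for x
  using that continuous_map_image_subset_topspace[OF fL] by auto
 have "continuous_map (top_of_set {a<..<b}) euclideanreal (kappa \<circ> f)" by (rule continuous_map_compose[OF fL kc(1)])
 then have cf: "continuous_on {a<..<b} (kappa \<circ> f)" by simp
 have "inj_on (kappa \<circ> f) {a<..<b}"
 proof (rule inj_onI)
  fix x y assume xy: "x : {a<..<b}" "y : {a<..<b}" "(kappa \<circ> f) x = (kappa \<circ> f) y"
  then have "kappa' (kappa (f x)) = kappa' (kappa (f y))" by simp
  then have "f x = f y" by (simp only: k1[OF fT[OF xy(1)]] k1[OF fT[OF xy(2)]])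
  then show "x = y" using inj_onD[OF i] xy by blast
 qed
 then have "open ((kappa \<circ> f) ` {a<..<b})"
  by (intro invariance_of_domain cf) auto
 moreover have "f ` {a<..<b} = {w : topspace (subtopology X L). kappa w : (kappa \<circ> f) ` {a<..<b}}"
 proof (intro equalityI subsetI)
  fix w assume "w : f ` {a<..<b}"
  then show "w : {w : topspace (subtopology X L). kappa w : (kappa \<circ> f) ` {a<..<b}}" using fT by auto
 next
  fix w assume "w : {w : topspace (subtopology X L). kappa w : (kappa \<circ> f) ` {a<..<b}}"
  then obtain x where x: "x : {a<..<b}" "w : topspace (subtopology X L)" "kappa w = kappa (f x)" by auto
  then have "kappa' (kappa w) = kappa' (kappa (f x))" by simp
  then have "w = f x" by (simp only: k1[OF x(2)] k1[OF fT[OF x(1)]])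
  then show "w : f ` {a<..<b}" using x by blast
 qed
 ultimately show ?thesis using openin_continuous_map_preimage[OF kc(1)] by simp
qed

text \<open>The chart meets the cut leaves exactly in its axis \<open>y = 0\<close>. In the
  construction below it is one-sided when the axis lies on the edge of a half square.\<close>

definition centred_chart :: "'a topology => 'a set set => 'a set => bool => (real \<times> real => 'a) => bool" where
 "centred_chart X \<Delta> W full f \<longleftrightarrow>
   continuous_map (top_of_set (centred_box full)) X f & inj_on f (centred_box full) &
   (ALL V. openin (top_of_set (centred_box full)) V --> openin X (f ` V)) &
   (ALL x y. (x, y) : centred_box full --> (f (x, y) : W \<longleftrightarrow> y = 0)) &
   (ALL y. (0, y) : centred_box full --> (EX L:\<Delta>. f ` ({-1<..<1} \<times> {y}) <= L))"

lemma isolating_neighbourhood: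
 assumes cl: "!!L. L : Sg ==> closedin X L" and lf: "locally_finite_in X Sg"
  and omega: "omega : Sg" "z : omega" and dis: "!!L. L : Sg ==> L ~= omega ==> z ~: L"
 obtains N where "openin X N" "z : N" "N Int \<Union>Sg <= omega"
proof -
 have "z : topspace X" using lf omega by (auto simp: locally_finite_in_def)
 then obtain V where V: "openin X V" "z : V" "finite {L : Sg. L Int V ~= {}}"
  using lf unfolding locally_finite_in_def by blast
 let ?F = "{L : Sg. L Int V ~= {}} - {omega}"
 have "closedin X (\<Union>?F)" using V(3) cl by (intro closedin_Union) auto
 then have "openin X (V - \<Union>?F)" by (rule openin_diff[OF V(1)])
 moreover have "z : V - \<Union>?F" using V(2) dis by blast
 moreover have "(V - \<Union>?F) Int \<Union>Sg <= omega" by blast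
 ultimately show thesis by (rule that)
qed

lemma foliation1_charts:
 assumes fol: "foliation1 X \<Delta>" and x: "x : topspace X"
 obtains U and Y :: "real set" and phi g where "openin X U" "x : U" "Y = {-1<..<1} \<or> Y = {0..<1}"
  "homeomorphic_maps (subtopology X U) (top_of_set ({-1<..<1::real} \<times> Y)) phi g"
  "ALL y:Y. EX L:\<Delta>. g ` ({-1<..<1} \<times> {y}) <= L"
proof -
 have "EX U B phi. openin X U & x : U & foliation_chart_domain B &
    homeomorphic_map (subtopology X U) (subtopology euclidean B) phi &
    (ALL L:\<Delta>. ALL C:path_components_of (subtopology X (L Int U)). EX t. phi ` C = {-1<..<1} \<times> {t})"
  using fol x unfolding foliation1_def by simp
 then obtain U B phi where U: "openin X U" "x : U" and B: "foliation_chart_domain B"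
  and phi: "homeomorphic_map (subtopology X U) (top_of_set B) phi"
  and pl: "ALL L:\<Delta>. ALL C:path_components_of (subtopology X (L Int U)). EX t. phi ` C = {-1<..<1} \<times> {t}" by blast
 obtain Y where Y: "Y = {-1<..<1} \<or> Y = {0..<1}" and BY: "B = {-1<..<1} \<times> Y"
  using B unfolding foliation_chart_domain_def by blast
 obtain g where gm: "homeomorphic_maps (subtopology X U) (top_of_set ({-1<..<1} \<times> Y)) phi g"
  using phi homeomorphic_map_maps BY by blast
 have cov: "\<Union>\<Delta> = topspace X" using fol by (simp add: foliation1_def)
 show thesis using plaque_in_leaf[OF cov U(1) gm pl] by (intro that[OF U Y gm] ballI)
qed

text \<open>Two things must be kept away by shrinking a foliated chart: other cut leaves, which
  local finiteness keeps at a distance, and further plaques of the same leaf, which are excluded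
  because the plaque is open in the leaf.\<close>

lemma centred_chart_exists:
 assumes fol: "foliation1 X \<Delta>" and line: "!!L. L : \<Delta> ==> subtopology X L homeomorphic_space euclideanreal"
  and cl: "!!L. L : \<Delta> ==> closedin X L" and Sg: "Sg <= \<Delta>" and lf: "locally_finite_in X Sg"
  and z: "z : \<Union>Sg"
 shows "EX full f. centred_chart X \<Delta> (\<Union>Sg) full f & f (0, 0) = z"
proof -
 have cov: "\<Union>\<Delta> = topspace X" and dj: "ALL L:\<Delta>. ALL L':\<Delta>. L ~= L' --> L Int L' = {}"
  using fol unfolding foliation1_def by simp_all
 have disj: "L = L'" if "L : \<Delta>" "L' : \<Delta>" "L Int L' ~= {}" for L L' using dj that by blast
 obtain omega where omega: "omega : Sg" "z : omega" using z by blast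
 have zX: "z : topspace X" using omega Sg cov by blast
 obtain U Y phi g where U: "openin X U" "z : U" and Y: "Y = {-1<..<1::real} \<or> Y = {0..<1}"
  and gmY: "homeomorphic_maps (subtopology X U) (top_of_set ({-1<..<1::real} \<times> Y)) phi g"
  and plY: "ALL y:Y. EX L:\<Delta>. g ` ({-1<..<1} \<times> {y}) <= L" using foliation1_charts[OF fol zX] .
 define B where BY: "B = {-1<..<1::real} \<times> Y"
 have gm: "homeomorphic_maps (subtopology X U) (top_of_set B) phi g" using gmY by (simp only: BY)
 have UX: "topspace (subtopology X U) = U" using openin_subset[OF U(1)] by (simp add: Int_absorb1)
 have gc: "continuous_map (top_of_set B) (subtopology X U) g" using gm by (simp add: homeomorphic_maps_def)
 have phic: "continuous_map (subtopology X U) (top_of_set B) phi" using gm by (simp add: homeomorphic_maps_def)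
 have phig: "phi (g p) = p" if "p : B" for p using gm that by (simp add: homeomorphic_maps_def)
 have gphi: "g (phi w) = w" if "w : U" for w using gm that UX by (simp add: homeomorphic_maps_def)
 have gi: "inj_on g B" by (rule inj_on_inverseI[of _ phi]) (rule phig)
 have gcX: "continuous_map (top_of_set B) X g" using gc by (simp add: continuous_map_in_subtopology)
 have go: "openin X (g ` V)" if V: "openin (top_of_set B) V" for V
 proof -
  have "homeomorphic_map (top_of_set B) (subtopology X U) g"
   using gm homeomorphic_maps_sym homeomorphic_maps_map by blast
  then have "openin (subtopology X U) (g ` V)"
   using homeomorphic_map_openness_eq V openin_subset by blast
  then show ?thesis using U(1) by (rule openin_trans_full)
 qed
 define x0 y0 where "x0 = fst (phi z)" and "y0 = snd (phi z)"
 have zB: "phi z : B" using continuous_map_image_subset_topspace[OF phic] UX U(2) by auto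
 then have xy0: "x0 : {-1<..<1}" "y0 : Y" "(x0, y0) : B" by (auto simp: x0_def y0_def BY)
 have gz: "g (x0, y0) = z" using gphi[OF U(2)] by (simp add: x0_def y0_def)
 have plq: "EX L:\<Delta>. g ` ({-1<..<1} \<times> {y}) <= L" if "y : Y" for y
  using plY that by blast
 have C0: "g ` ({-1<..<1} \<times> {y0}) <= omega"
 proof -
  obtain L where L: "L : \<Delta>" "g ` ({-1<..<1} \<times> {y0}) <= L" using plq[OF xy0(2)] by blast
  have "z : g ` ({-1<..<1} \<times> {y0})" using gz xy0(1) by force
  then have "L = omega" using L omega Sg by (intro disj) auto
  then show ?thesis using L by simp
 qed
 have "openin (subtopology X omega) ((%x. g (x, y0)) ` {-1<..<1})"
 proof (rule plaque_open_in_leaf)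
  show "subtopology X omega homeomorphic_space euclideanreal" using line omega Sg by blast
  have "continuous_on {-1<..<1} (%x. (x, y0))" by (intro continuous_intros)
  then show "continuous_map (top_of_set {-1<..<1}) X (%x. g (x, y0))"
   using xy0(2) by (intro continuous_map_top_of_set_o[OF gcX]) (auto simp: BY)
  show "inj_on (%x. g (x, y0)) {-1<..<1}"
   using inj_onD[OF gi] xy0(2) by (intro inj_onI) (auto simp: BY)
  show "(%x. g (x, y0)) ` {-1<..<1} <= omega" using C0 by auto
 qed
 then obtain Q where Q: "openin X Q" "(%x. g (x, y0)) ` {-1<..<1} = Q Int omega"
  unfolding openin_subtopology by blast
 have zQ: "z : Q"
 proof -
  have "z : (%x. g (x, y0)) ` {-1<..<1}" using gz xy0(1) by force
  then show ?thesis using Q(2) by blast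
 qed
 obtain N where N: "openin X N" "z : N" "N Int \<Union>Sg <= omega"
 proof (rule isolating_neighbourhood[OF _ lf omega])
  show "closedin X L" if "L : Sg" for L using cl Sg that by blast
  show "z ~: L" if L: "L : Sg" "L ~= omega" for L using disj[of L omega] L omega Sg by blast
 qed
 have "openin (top_of_set B) {p : topspace (top_of_set B). g p : N Int Q}"
  using openin_continuous_map_preimage[OF gcX] N(1) Q(1) by blast
 then obtain M where M: "open M" "{p : B. g p : N Int Q} = B Int M"
  by (auto simp: openin_open)
 have "(x0, y0) : M" using M(2) xy0(3) gz N(2) zQ by blast
 then obtain d where d: "d > 0" "ball (x0, y0) d <= M" using M(1) open_contains_ball by blast
 define full where "full = (\<not> (Y = {0..<1} & y0 = 0))"
 obtain c where c: "c > 0" "2 * c <= d" "c < 1 - x0" "c < 1 + x0" "c < 1 - y0" "full ==> {y0 - c<..<y0 + c} <= Y"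
 proof -
  \<comment> \<open>The distance of \<open>y0\<close> from the lower edge of \<open>Y\<close>; the
    value 1 stands in when \<open>y0\<close> lies on the edge of a half square, where the chart
    becomes one-sided.\<close>
  define m where "m = (if Y = {0..<1} then (if y0 = 0 then 1 else y0) else 1 + y0)"
  have m: "m > 0" using xy0(2) Y by (auto simp: m_def)
  define c where "c = Min {d, 1 - x0, 1 + x0, 1 - y0, m} / 2"
  have p: "Min {d, 1 - x0, 1 + x0, 1 - y0, m} > 0" using d(1) xy0 Y m by auto
  have l: "Min {d, 1 - x0, 1 + x0, 1 - y0, m} <= w" if "w : {d, 1 - x0, 1 + x0, 1 - y0, m}" for w
   using that by (intro Min_le) auto
  have cl: "2 * c <= w" if "w : {d, 1 - x0, 1 + x0, 1 - y0, m}" for w using l[OF that] by (simp add: c_def)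
  have cp: "c > 0" using p by (simp add: c_def)
  have cs: "2 * c <= d" "2 * c <= 1 - x0" "2 * c <= 1 + x0" "2 * c <= 1 - y0" "2 * c <= m" using cl by blast+
  show thesis
  proof (rule that[OF cp cs(1)])
   show "{y0 - c<..<y0 + c} <= Y" if "full"
   proof (cases "Y = {0..<1}")
    case True
    then have "m = y0" using that by (simp add: m_def full_def)
    then show ?thesis using cs(4,5) cp True by auto
   next
    case False
    then have "m = 1 + y0" "Y = {-1<..<1}" using Y by (auto simp: m_def)
    then show ?thesis using cs(4,5) cp by auto
   qed
  qed (use cs cp in linarith)+
 qed
 define A where "A p = (x0 + c * fst p, y0 + c * snd p)" for p :: "real \<times> real"
 let ?D = "centred_box full"
 have AB: "A ` ?D = B Int ({x0 - c<..<x0 + c} \<times> {y0 - c<..<y0 + c})"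
 proof (intro equalityI subsetI)
  fix p assume "p : A ` ?D"
  then obtain x y where xy: "(x, y) : ?D" "p = (x0 + c * x, y0 + c * y)" by (auto simp: A_def)
  have "-1 < x" "x < 1" "-1 < y" "y < 1" using xy(1) by (auto simp: centred_box_def split: if_splits)
  then have b: "- c < c * x" "c * x < c" "- c < c * y" "c * y < c"
   using c(1) mult_strict_left_mono[of "-1" x c] mult_strict_left_mono[of "-1" y c] by auto
  have "y0 + c * y : Y"
  proof (cases full)
   case True
   then show ?thesis using c(6) b by auto
  next
   case False
   then have "0 <= y" "y0 = 0" "Y = {0..<1}" using xy(1) by (auto simp: centred_box_def full_def)
   moreover from this have "c * y < 1" using b(4) c(5) by linarith
   ultimately show ?thesis using c(1) by simp
  qed
  moreover have "-1 < x0 + c * x" "x0 + c * x < 1" "x0 - c < x0 + c * x" "x0 + c * x < x0 + c"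
   "y0 - c < y0 + c * y" "y0 + c * y < y0 + c" using b c(3,4) by linarith+
  ultimately show "p : B Int ({x0 - c<..<x0 + c} \<times> {y0 - c<..<y0 + c})"
   unfolding xy(2) BY Int_iff mem_Times_iff greaterThanLessThan_iff fst_conv snd_conv by blast
 next
  fix p assume p: "p : B Int ({x0 - c<..<x0 + c} \<times> {y0 - c<..<y0 + c})"
  obtain u v where uv: "p = (u, v)" by (cases p)
  have "((u - x0) / c, (v - y0) / c) : ?D"
  proof -
   have "-1 < (u - x0) / c" "(u - x0) / c < 1" "-1 < (v - y0) / c" "(v - y0) / c < 1"
    using p c(1) by (auto simp: uv pos_less_divide_eq pos_divide_less_eq)
   moreover have "0 <= (v - y0) / c" if "\<not> full" using that p c(1) by (auto simp: uv BY full_def)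
   ultimately show ?thesis by (simp add: centred_box_def)
  qed
  moreover have "A ((u - x0) / c, (v - y0) / c) = p" using c(1) by (simp add: A_def uv)
  ultimately show "p : A ` ?D" by (metis imageI)
 qed
 have Ao: "openin (top_of_set B) (A ` V)" if V: "openin (top_of_set ?D) V" for V
 proof -
  obtain V' where V': "open V'" "V = ?D Int V'" using V by (auto simp: openin_open)
  have Ai: "inj A" using c(1) by (auto simp: A_def inj_on_def prod_eq_iff)
  have Ac: "continuous_on UNIV A" unfolding A_def by (intro continuous_intros)
  have "open (A ` V')"
   using continuous_on_subset[OF Ac] inj_on_subset[OF Ai] V'(1) by (intro invariance_of_domain) auto
  moreover have "A ` V = B Int (({x0 - c<..<x0 + c} \<times> {y0 - c<..<y0 + c}) Int A ` V')"
   using image_Int[OF Ai, of ?D V'] AB V'(2) by blast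
  ultimately show ?thesis by (simp add: openin_open_Int open_Int open_Times)
 qed
 have A0: "A (0, 0) = (x0, y0)" by (simp add: A_def)
 have "(0, 0) : ?D" by (simp add: centred_box_def)
 have AM: "A ` ?D <= M"
 proof
  fix p assume "p : A ` ?D"
  then have p: "\<bar>fst p - x0\<bar> < c" "\<bar>snd p - y0\<bar> < c" using AB by auto
  have "dist (x0, y0) p <= \<bar>fst p - x0\<bar> + \<bar>snd p - y0\<bar>"
   using sqrt_sum_squares_le_sum_abs[of "fst p - x0" "snd p - y0"]
   by (cases p) (simp add: dist_Pair_Pair dist_real_def abs_minus_commute power2_commute)
  then have "p : ball (x0, y0) d" using p c(2) by simp
  then show "p : M" using d(2) by blast
 qed
 define f where "f = g \<circ> A"
 have fN: "f p : N Int Q" if "p : ?D" for p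
 proof -
  have "A p : B Int M" using AB AM that by blast
  then show ?thesis using M(2) by (auto simp: f_def)
 qed
 have AB': "A p : B" if "p : ?D" for p using AB that by blast
 have "centred_chart X \<Delta> (\<Union>Sg) full f"
  unfolding centred_chart_def
 proof (intro conjI allI impI)
  have "continuous_on ?D A" unfolding A_def by (intro continuous_intros)
  then show "continuous_map (top_of_set ?D) X f"
   unfolding f_def o_def using AB' by (intro continuous_map_top_of_set_o[OF gcX]) auto
  show "inj_on f ?D"
  proof (rule inj_onI)
   fix p p' assume p: "p : ?D" "p' : ?D" "f p = f p'"
   then have "A p = A p'" using inj_onD[OF gi] AB' by (simp add: f_def)
   then show "p = p'" using c(1) by (simp add: A_def prod_eq_iff)
  qed
  show "openin X (f ` V)" if V: "openin (top_of_set ?D) V" for V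
   using go[OF Ao[OF V]] by (simp add: f_def image_comp)
 next
  fix x y assume xy: "(x, y) : ?D"
  have Axy: "A (x, y) = (x0 + c * x, y0 + c * y)" by (simp add: A_def)
  show "f (x, y) : \<Union>Sg \<longleftrightarrow> y = 0"
  proof
   assume "f (x, y) : \<Union>Sg"
   then have "f (x, y) : Q Int omega" using fN[OF xy] N(3) by blast
   then obtain x' where x': "x' : {-1<..<1}" "f (x, y) = g (x', y0)" using Q(2) by blast
   have "A (x, y) = (x', y0)" by (rule inj_onD[OF gi]) (use x' AB'[OF xy] xy0(2) in \<open>auto simp: f_def BY\<close>)
   then show "y = 0" using Axy c(1) by simp
  next
   assume "y = 0"
   then have "A (x, y) : {-1<..<1} \<times> {y0}" using AB'[OF xy] Axy by (auto simp: BY)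
   then have "f (x, y) : g ` ({-1<..<1} \<times> {y0})" unfolding f_def o_def by (rule imageI)
   then show "f (x, y) : \<Union>Sg" using C0 omega(1) by blast
  qed
 next
  fix y assume y: "(0, y) : ?D"
  have "y0 + c * y : Y" using AB'[OF y] by (simp add: A_def BY)
  then obtain L where L: "L : \<Delta>" "g ` ({-1<..<1} \<times> {y0 + c * y}) <= L" using plq by blast
  have "f ` ({-1<..<1} \<times> {y}) <= L"
  proof (rule image_subsetI)
   fix p assume p: "p : {-1<..<1::real} \<times> {y}"
   then have "p : ?D" using y by (auto simp: centred_box_def)
   then have "A p : {-1<..<1} \<times> {y0 + c * y}" using AB' p by (auto simp: BY A_def)
   then have "g (A p) : L" by (rule subsetD[OF L(2) imageI])
   then show "f p : L" by (simp add: f_def)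
  qed
  then show "EX L:\<Delta>. f ` ({-1<..<1} \<times> {y}) <= L" using L(1) by blast
 qed
 moreover have "f (0, 0) = z" using A0 gz by (simp add: f_def)
 ultimately show ?thesis by blast
qed

section \<open>The two halves of a centred chart\<close>

definition half_map :: "(real \<times> real => 'a) => real => real => (real => real) => real \<times> real => 'a" where
 "half_map f d rho \<sigma> = (%(x, s). f (rho * x, d * \<sigma> s))"

text \<open>The sign \<open>d\<close> selects the upper or the lower half and is -1 only for a
  two-sided chart. With trivial \<open>rho\<close>, \<open>\<sigma>\<close> and \<open>iota\<close>
  this describes a raw half chart, otherwise its normal form; the same facts serve both.\<close>

locale half_chart =
 fixes X :: "'a topology" and \<Delta> :: "'a set set" and W :: "'a set" and full :: bool and f :: "real \<times> real => 'a"
  and d rho :: real and \<sigma> iota :: "real => real"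
 assumes chart: "centred_chart X \<Delta> W full f"
  and d: "d = 1 \<or> d = -1 & full" and rho: "rho = 1 \<or> rho = -1"
  and \<sigma>0: "\<sigma> 0 = 0" and iota0: "iota 0 = 0"
  and \<sigma>_cont: "continuous_on {0..<1} \<sigma>" and iota_cont: "continuous_on {0..<1} iota"
  and \<sigma>_in: "!!s. s : {0<..<1} ==> \<sigma> s : {0<..<1}" and iota_in: "!!s. s : {0<..<1} ==> iota s : {0<..<1}"
  and iota\<sigma>: "!!s. s : {0..<1} ==> iota (\<sigma> s) = s" and \<sigma>iota: "!!s. s : {0..<1} ==> \<sigma> (iota s) = s"
begin

abbreviation D :: "(real \<times> real) set" where "D \<equiv> centred_box full"
abbreviation m :: "real \<times> real => real \<times> real" where "m p \<equiv> (rho * fst p, d * \<sigma> (snd p))"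
abbreviation m' :: "real \<times> real => real \<times> real" where "m' p \<equiv> (rho * fst p, iota (d * snd p))"
abbreviation b :: "real \<times> real => 'a" where "b \<equiv> half_map f d rho \<sigma>"

lemma f_cont: "continuous_map (top_of_set D) X f" and f_inj: "inj_on f D"
 and f_open: "!!V. openin (top_of_set D) V ==> openin X (f ` V)"
 and f_W: "!!x y. (x, y) : D ==> f (x, y) : W \<longleftrightarrow> y = 0"
 using chart unfolding centred_chart_def by auto

lemma b_m: "b p = f (m p)" by (simp add: half_map_def case_prod_unfold)

lemma dd: "d * (d * y) = y" and rhorho: "rho * (rho * x) = x" and rho_in: "rho * x : {-1<..<1} \<longleftrightarrow> x : {-1<..<1}"
 using d rho by auto

definition H :: "(real \<times> real) set" where "H = {p. fst p : {-1<..<1} & d * snd p : {0..<1}}"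
definition Hp :: "(real \<times> real) set" where "Hp = {p. fst p : {-1<..<1} & d * snd p : {0<..<1}}"

lemma H_D: "H <= D" and Hp_H: "Hp <= H" using d by (auto simp: H_def Hp_def centred_box_def)

lemma \<sigma>_in0: "s : {0..<1} ==> \<sigma> s : {0..<1}" using \<sigma>_in[of s] \<sigma>0 by (cases "s = 0") auto
lemma iota_in0: "s : {0..<1} ==> iota s : {0..<1}" using iota_in[of s] iota0 by (cases "s = 0") auto

lemma m_in: "p : half_square ==> m p : H" "p : half_square_pos ==> m p : Hp"
 and m'_in: "p : H ==> m' p : half_square" "p : Hp ==> m' p : half_square_pos"
 and m'm: "p : half_square ==> m' (m p) = p" and mm': "p : H ==> m (m' p) = p"
proof -
 have hs: "fst p : {-1<..<1}" "snd p : {0..<1}" if "p : half_square" for p using that by auto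
 have hp: "fst p : {-1<..<1}" "snd p : {0<..<1}" if "p : half_square_pos" for p using that by auto
 show "m p : H" if p: "p : half_square"
  unfolding H_def mem_Collect_eq fst_conv snd_conv dd using hs[OF p] rho_in \<sigma>_in0 by blast
 show "m p : Hp" if p: "p : half_square_pos"
  unfolding Hp_def mem_Collect_eq fst_conv snd_conv dd using hp[OF p] rho_in \<sigma>_in by blast
 show "m' p : half_square" if p: "p : H"
  unfolding mem_Times_iff fst_conv snd_conv using p[unfolded H_def mem_Collect_eq] rho_in iota_in0 by blast
 show "m' p : half_square_pos" if p: "p : Hp"
  unfolding mem_Times_iff fst_conv snd_conv using p[unfolded Hp_def mem_Collect_eq] rho_in iota_in by blast
 show "m' (m p) = p" if p: "p : half_square"
  using iota\<sigma>[OF hs(2)[OF p]] by (simp only: fst_conv snd_conv dd rhorho prod.collapse)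
 show "m (m' p) = p" if p: "p : H"
 proof -
  have "d * snd p : {0..<1}" using p by (simp add: H_def)
  then show ?thesis by (simp only: fst_conv snd_conv dd rhorho prod.collapse \<sigma>iota)
 qed
qed

lemma b_m': "p : H ==> f p = b (m' p)" using mm'[of p] by (simp add: b_m)

lemma m_continuous: "continuous_on half_square m"
 by (intro continuous_on_Pair continuous_intros continuous_on_compose2[OF \<sigma>_cont]) auto

lemma m'_continuous: "continuous_on H m'"
 by (intro continuous_on_Pair continuous_intros continuous_on_compose2[OF iota_cont]) (auto simp: H_def)

lemma b_continuous: "continuous_map (top_of_set half_square) X b"
proof -
 have "continuous_map (top_of_set half_square) X (%p. f (m p))"
  using m_in(1) H_D by (intro continuous_map_top_of_set_o[OF f_cont m_continuous]) blast
 then show ?thesis by (simp add: b_m[abs_def])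
qed

lemma b_inj: "inj_on b half_square"
proof (rule inj_onI)
 fix p p' assume p: "p : half_square" "p' : half_square" "b p = b p'"
 have "m p = m p'" by (rule inj_onD[OF f_inj]) (use p m_in(1) H_D b_m in auto)
 then have "m' (m p) = m' (m p')" by (rule arg_cong)
 then show "p = p'" by (simp only: m'm[OF p(1)] m'm[OF p(2)])
qed

lemma b_image: "b ` half_square = f ` H" and b_image_pos: "b ` half_square_pos = f ` Hp"
proof -
 show "b ` half_square = f ` H"
 proof (intro equalityI image_subsetI)
  fix p assume "p : half_square" then show "b p : f ` H" using m_in(1) b_m by blast
 next
  fix p assume "p : H" then show "f p : b ` half_square" using m'_in(1) b_m' by blast
 qed
 show "b ` half_square_pos = f ` Hp"
 proof (intro equalityI image_subsetI)
  fix p assume "p : half_square_pos" then show "b p : f ` Hp" using m_in(2) b_m by blast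
 next
  fix p assume "p : Hp" then show "f p : b ` half_square_pos" using m'_in(2) b_m' Hp_H by blast
 qed
qed

lemma b_image_base: "b ` ({-1<..<1} \<times> {0}) = f ` ({-1<..<1} \<times> {0})"
proof (intro equalityI image_subsetI)
 fix p assume "p : {-1<..<1::real} \<times> {0::real}"
 then have "fst p : {-1<..<1}" "snd p = 0" by auto
 then have "m p : {-1<..<1} \<times> {0}" by (simp only: mem_Times_iff fst_conv snd_conv \<sigma>0 mult_zero_right rho_in singleton_iff)
 then show "b p : f ` ({-1<..<1} \<times> {0})" using b_m by blast
next
 fix p assume p: "p : {-1<..<1::real} \<times> {0::real}"
 then have p': "fst p : {-1<..<1}" "snd p = 0" by auto
 then have "m' p : {-1<..<1} \<times> {0}" by (simp only: mem_Times_iff fst_conv snd_conv iota0 mult_zero_right rho_in singleton_iff)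
 moreover have "p : H" using p' by (auto simp: H_def)
 ultimately show "f p : b ` ({-1<..<1} \<times> {0})" using b_m' by blast
qed

text \<open>The half with its base is not open in a two-sided chart, so openness is shown relative
  to the image: an open set pulled back along \<open>m'\<close> is the trace of an open set of the
  centred chart.\<close>

lemma b_homeo: "homeomorphic_map (top_of_set half_square) (subtopology X (b ` half_square)) b"
proof (rule bijective_open_imp_homeomorphic_map)
 show "continuous_map (top_of_set half_square) (subtopology X (b ` half_square)) b"
  using b_continuous by (auto simp: continuous_map_in_subtopology)
 have "b ` half_square <= topspace X" using continuous_map_image_subset_topspace[OF b_continuous] by simp
 then show "b ` topspace (top_of_set half_square) = topspace (subtopology X (b ` half_square))" by auto
 show "inj_on b (topspace (top_of_set half_square))" using b_inj by simp
 show "open_map (top_of_set half_square) (subtopology X (b ` half_square)) b"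
  unfolding open_map_def
 proof (intro allI impI)
  fix V assume "openin (top_of_set half_square) V"
  then obtain V' where V': "open V'" "V = half_square Int V'" by (auto simp: openin_open)
  obtain Q where Q: "open Q" "H Int m' -` V' = H Int Q"
   using continuous_openin_preimage_gen[OF m'_continuous V'(1)] by (auto simp: openin_open)
  have "b ` V = f ` (D Int Q) Int b ` half_square"
  proof (intro equalityI subsetI)
   fix z assume "z : b ` V"
   then obtain p where p: "p : half_square" "p : V'" "z = b p" using V'(2) by blast
   have "m p : H Int m' -` V'" using m_in(1)[OF p(1)] m'm[OF p(1)] p(2) by simp
   then have "m p : D Int Q" using Q(2) H_D by blast
   then show "z : f ` (D Int Q) Int b ` half_square" using p b_m by blast
  next
   fix z assume "z : f ` (D Int Q) Int b ` half_square"
   then obtain w p where w: "w : D" "w : Q" "z = f w" and p: "p : half_square" "z = b p" by blast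
   have "w = m p" by (rule inj_onD[OF f_inj]) (use w p b_m m_in(1) H_D in auto)
   then have "m p : H Int m' -` V'" using Q(2) w(2) m_in(1)[OF p(1)] by blast
   then have "p : V" using m'm[OF p(1)] p(1) V'(2) by simp
   then show "z : b ` V" using p(2) by blast
  qed
  moreover have "openin X (f ` (D Int Q))" using Q(1) by (intro f_open) (simp add: openin_open_Int)
  ultimately show "openin (subtopology X (b ` half_square)) (b ` V)" unfolding openin_subtopology by blast
 qed
qed

lemma f_open_Int: "open V ==> openin X (f ` (D Int V))" by (intro f_open) (simp add: openin_open_Int)

lemma U_open: "openin X (f ` D)" using f_open_Int[of UNIV] by simp

lemma b_open: "openin X (b ` half_square_pos)"
proof -
 have "open (fst -` {-1<..<1} Int snd -` {y. d * y : {0<..<1}} :: (real \<times> real) set)"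
 proof (intro open_Int open_vimage_fst open_vimage_snd)
  have "{y. d * y : {0<..<1}} = (%y. d * y) -` {0<..<1}" by auto
  then show "open {y. d * y : {0<..<1}}" by (auto intro!: open_vimage continuous_intros)
 qed auto
 moreover have "Hp = D Int (fst -` {-1<..<1} Int snd -` {y. d * y : {0<..<1}})" using Hp_H H_D by (auto simp: Hp_def)
 ultimately show ?thesis using f_open_Int b_image_pos by simp
qed

lemma b_U: "b ` half_square <= f ` D" using b_image H_D by blast

lemma U_W: "f ` D Int W = b ` ({-1<..<1} \<times> {0})"
proof -
 have "f ` D Int W = f ` ({-1<..<1} \<times> {0})"
 proof (intro equalityI subsetI)
  fix z assume "z : f ` D Int W"
  then obtain x y where "(x, y) : D" "z = f (x, y)" "f (x, y) : W" by auto
  then show "z : f ` ({-1<..<1} \<times> {0})" using f_W[of x y] by (auto simp: centred_box_def)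
 next
  fix z assume "z : f ` ({-1<..<1} \<times> {0})"
  then obtain x where x: "x : {-1<..<1}" "z = f (x, 0)" by auto
  then have "(x, 0) : D" by (auto simp: centred_box_def)
  then show "z : f ` D Int W" using f_W[of x 0] x(2) by blast
 qed
 then show ?thesis using b_image_base by simp
qed

lemma b_W: "b ` half_square_pos Int W = {}"
proof -
 have "f p ~: W" if p: "p : Hp" for p
  using f_W[of "fst p" "snd p"] p Hp_H H_D by (auto simp: Hp_def)
 then show ?thesis unfolding b_image_pos by blast
qed

lemma U_minus_W: "f ` D - W = f ` (D Int {p. snd p ~= 0})"
proof (intro equalityI subsetI)
 fix z assume "z : f ` D - W"
 then obtain x y where "(x, y) : D" "z = f (x, y)" "f (x, y) ~: W" by auto
 then show "z : f ` (D Int {p. snd p ~= 0})" using f_W[of x y] by force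
next
 fix z assume "z : f ` (D Int {p. snd p ~= 0})"
 then obtain x y where "(x, y) : D" "z = f (x, y)" "y ~= 0" by auto
 then show "z : f ` D - W" using f_W[of x y] by blast
qed

lemma rest_open: "openin X (f ` D - W - b ` half_square_pos)"
proof -
 have "f ` D - W - b ` half_square_pos = f ` (D Int {p. d * snd p < 0})"
 proof (intro equalityI subsetI)
  fix z assume "z : f ` D - W - b ` half_square_pos"
  then obtain p where p: "p : D" "snd p ~= 0" "z = f p" "f p ~: f ` Hp" unfolding U_minus_W b_image_pos by blast
  then have "p ~: Hp" by blast
  then have "d * snd p < 0" using p d by (auto simp: Hp_def centred_box_def split: if_splits)
  then show "z : f ` (D Int {p. d * snd p < 0})" using p by blast
 next
  fix z assume "z : f ` (D Int {p. d * snd p < 0})"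
  then obtain p where p: "p : D" "d * snd p < 0" "z = f p" by blast
  have "f p ~: f ` Hp"
  proof
   assume "f p : f ` Hp"
   then obtain w where w: "w : Hp" "f p = f w" by blast
   have "p = w" by (rule inj_onD[OF f_inj w(2)]) (use p w Hp_H H_D in auto)
   then show False using w p(2) by (simp add: Hp_def)
  qed
  moreover have "z : f ` D - W" using U_minus_W p by force
  ultimately show "z : f ` D - W - b ` half_square_pos" unfolding b_image_pos using p(3) by simp
 qed
 moreover have "open {p. d * snd p < (0::real)}"
  by (intro open_Collect_less continuous_intros)
 ultimately show ?thesis using f_open_Int by simp
qed

text \<open>Small heights in the centred chart have small levels in the half chart; this is needed
  when half boxes of both sides are fitted together.\<close>

lemma iota_small: "delta > 0 ==> EX eta>0. ALL s:{0..<eta}. s < 1 --> iota s < delta"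
proof -
 assume delta: "delta > 0"
 have "0 : {0..<1::real}" by simp
 then obtain eta where eta: "eta > 0" "ALL s:{0..<1}. dist s 0 < eta --> dist (iota s) (iota 0) < delta"
  using iota_cont delta unfolding continuous_on_iff by blast
 show ?thesis
 proof (intro exI[of _ eta] conjI ballI impI eta(1))
  fix s assume "s : {0..<eta}" "s < 1"
  then have "dist (iota s) (iota 0) < delta" using eta(2) by auto
  then show "iota s < delta" by (simp add: iota0 dist_real_def)
 qed
qed

end

section \<open>Assembling the data for the gluing\<close>

text \<open>The union of the cut leaves is second countable, so countably many cores cover it. The
  sequence may repeat charts; this does no harm, since each leaf is later represented by its least
  chart.\<close>

lemma centred_charts_cover:
 assumes surf: "surface_with_boundary X" and fol: "foliation1 X \<Delta>"
  and line: "!!L. L : \<Delta> ==> subtopology X L homeomorphic_space euclideanreal"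
  and cl: "!!L. L : \<Delta> ==> closedin X L" and Sg: "Sg <= \<Delta>" and lf: "locally_finite_in X Sg" and ne: "\<Union>Sg ~= {}"
 obtains F f where "!!n::nat. centred_chart X \<Delta> (\<Union>Sg) (F n) (f n)" "!!z. z : \<Union>Sg ==> EX n. EX x:core. z = f n (x, 0)"
proof -
 have "ALL z:\<Union>Sg. EX p. centred_chart X \<Delta> (\<Union>Sg) (fst p) (snd p) & snd p (0, 0) = z"
 proof
  fix z assume "z : \<Union>Sg"
  from centred_chart_exists[OF fol line cl Sg lf this]
  obtain full f where "centred_chart X \<Delta> (\<Union>Sg) full f & f (0, 0) = z" by blast
  then show "EX p. centred_chart X \<Delta> (\<Union>Sg) (fst p) (snd p) & snd p (0, 0) = z" by (intro exI[of _ "(full, f)"]) simp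
 qed
 from bchoice[OF this] obtain P where P: "ALL z:\<Union>Sg. centred_chart X \<Delta> (\<Union>Sg) (fst (P z)) (snd (P z)) & snd (P z) (0, 0) = z" ..
 define G where "G z = snd (P z) ` (centred_box (fst (P z)) Int (core \<times> UNIV))" for z
 have G: "openin X (G z)" "z : G z" if z: "z : \<Union>Sg" for z
 proof -
  have c: "centred_chart X \<Delta> (\<Union>Sg) (fst (P z)) (snd (P z))" "snd (P z) (0, 0) = z" using bspec[OF P z] by simp_all
  have "open (core \<times> (UNIV::real set))" by (intro open_Times) auto
  then have "openin (top_of_set (centred_box (fst (P z)))) (centred_box (fst (P z)) Int (core \<times> UNIV))" by (rule openin_open_Int)
  then show "openin X (G z)" using c(1) unfolding centred_chart_def G_def by simp
  have "(0, 0) : centred_box (fst (P z)) Int (core \<times> UNIV)" by (simp add: centred_box_def)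
  then have "snd (P z) (0, 0) : G z" unfolding G_def by (rule imageI)
  then show "z : G z" using c(2) by simp
 qed
 have WX: "\<Union>Sg <= topspace X" using lf by (simp add: locally_finite_in_def)
 let ?Y = "subtopology X (\<Union>Sg)"
 have "second_countable ?Y" using surf by (simp add: surface_with_boundary_def second_countable_subtopology)
 then have lin: "Lindelof_space ?Y" by (rule second_countable_imp_Lindelof_space)
 have "EX \<V>. countable \<V> & \<V> <= (%z. \<Union>Sg Int G z) ` \<Union>Sg & \<Union>\<V> = topspace ?Y"
 proof (rule Lindelof_spaceD[OF lin])
  show "openin ?Y V" if V: "V : (%z. \<Union>Sg Int G z) ` \<Union>Sg" for V
  proof -
   obtain z where z: "z : \<Union>Sg" "V = \<Union>Sg Int G z" using V by blast
   show ?thesis using openin_subtopology_Int2[OF G(1)[OF z(1)]] z(2) by simp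
  qed
  show "\<Union>((%z. \<Union>Sg Int G z) ` \<Union>Sg) = topspace ?Y" using G(2) WX by auto
 qed
 then obtain \<V> where \<V>: "countable \<V>" "\<V> <= (%z. \<Union>Sg Int G z) ` \<Union>Sg" "\<Union>\<V> = \<Union>Sg" using WX by (auto simp: Int_absorb1)
 obtain Z where Z: "countable Z" "Z <= \<Union>Sg" "\<V> = (%z. \<Union>Sg Int G z) ` Z"
  using \<V>(1,2) countable_subset_image[of \<V> "%z. \<Union>Sg Int G z" "\<Union>Sg"] by blast
 have Zne: "Z ~= {}" using ne \<V>(3) Z(3) by auto
 have nZ: "from_nat_into Z n : \<Union>Sg" for n using from_nat_into[OF Zne] Z(2) by blast
 show thesis
 proof (rule that[of "%n. fst (P (from_nat_into Z n))" "%n. snd (P (from_nat_into Z n))"])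
  show "centred_chart X \<Delta> (\<Union>Sg) (fst (P (from_nat_into Z n))) (snd (P (from_nat_into Z n)))" for n
   using bspec[OF P nZ] by simp
 next
  fix z assume z: "z : \<Union>Sg"
  then obtain w where w: "w : Z" "z : G w" using \<V>(3) Z(3) by blast
  obtain n where n: "from_nat_into Z n = w" using from_nat_into_surj[OF Z(1) w(1)] by blast
  obtain x y where xy: "(x, y) : centred_box (fst (P w))" "x : core" "z = snd (P w) (x, y)" using w(2) by (auto simp: G_def)
  have "centred_chart X \<Delta> (\<Union>Sg) (fst (P w)) (snd (P w))" using bspec[OF P nZ[of n]] n by simp
  then have "snd (P w) (x, y) : \<Union>Sg \<longleftrightarrow> y = 0" using xy(1) unfolding centred_chart_def by simp
  then have "y = 0" using z xy(3) by simp
  then show "EX n. EX x:core. z = snd (P (from_nat_into Z n)) (x, 0)" using xy n by blast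
 qed
qed

definition end_normal_form ::
 "(real \<times> real => 'a) => (real \<times> real => 'a) => real => (real => real) => (real => real) => (real => real => real) => real => real => bool" where
 "end_normal_form h b0 rho \<sigma> iota xi e eps \<longleftrightarrow> (rho = 1 \<or> rho = -1) & (e = 0 \<or> e = 1) & 0 < eps & eps <= 1 &
   \<sigma> 0 = 0 & iota 0 = 0 & continuous_on {0..<1} \<sigma> & continuous_on {0..<1} iota &
   (ALL s:{0<..<1}. \<sigma> s : {0<..<1}) & (ALL s:{0<..<1}. iota s : {0<..<1}) &
   (ALL s:{0..<1}. iota (\<sigma> s) = s) & (ALL s:{0..<1}. \<sigma> (iota s) = s) &
   continuous_on half_square_pos (%(x, s). xi x s) &
   (ALL s:{0<..<1}. ALL x x'. -1 < x --> x < x' --> x' < 1 --> xi x s < xi x' s) &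
   (ALL x:{-1<..<1}. ALL s:{0<..<1}. b0 (rho * x, \<sigma> s) = h (xi x s, e + (1 - 2 * e) * eps * s))"

text \<open>Settles the case in which there is no leaf to cut and hence no sequence of charts to
  start from.\<close>

lemma empty_surface_admits_striped_atlas:
 assumes "topspace X = {}" "\<Union>\<Delta> = topspace X" "{} ~: \<Delta>"
 shows "admits_striped_atlas X \<Delta>"
proof -
 have "\<Delta> = {}" using assms by auto
 then have "striped_atlas X {} S u v q {} Xg Yg & atlas_canonical_foliation {} S u v q = \<Delta>" for S u v q Xg Yg
  using assms(1) by (simp add: striped_atlas_def atlas_canonical_foliation_def)
 then show ?thesis unfolding admits_striped_atlas_def by blast
qed

lemma (in cut_strip_family) countable_maximal_arcs: "countable (Collect maximal_arc)"
proof -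
 let ?B = "Collect maximal_arc"
 have op: "openin X B" "B ~= {}" if "B : ?B" for B
  using that strip_arc_openin strip_arc_nonempty by (simp_all add: maximal_arc_def)
 let ?Y = "subtopology X (\<Union>?B)"
 have "second_countable ?Y" using surf by (simp add: surface_with_boundary_def second_countable_subtopology)
 then have lin: "Lindelof_space ?Y" by (rule second_countable_imp_Lindelof_space)
 have sub: "\<Union>?B <= topspace X" using op(1) openin_subset by blast
 have "EX \<V>. countable \<V> & \<V> <= ?B & \<Union>\<V> = topspace ?Y"
 proof (rule Lindelof_spaceD[OF lin])
  show "openin ?Y V" if V: "V : ?B" for V
   unfolding openin_subtopology using op(1)[OF V] V by (intro exI[of _ V]) auto
  show "\<Union>?B = topspace ?Y" using sub by auto
 qed
 then obtain \<V> where \<V>: "countable \<V>" "\<V> <= ?B" "\<Union>\<V> = \<Union>?B" using sub by (auto simp: Int_absorb1)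
 have "?B <= \<V>"
 proof
  fix B assume B: "B : ?B"
  obtain z where z: "z : B" using op(2)[OF B] by blast
  then have "z : \<Union>\<V>" using \<V>(3) B by blast
  then obtain V where V: "V : \<V>" "z : V" by blast
  then have "maximal_arc V" using \<V>(2) by blast
  then have "B = V" using maximal_arc_disjoint[of B V] B z V(2) by blast
  then show "B : \<V>" using V by simp
 qed
 then show ?thesis using \<V>(1) countable_subset by blast
qed

text \<open>The levels on the two sides are distorted independently, so the extents
  \<open>eta\<close> above and \<open>eta'\<close> below the axis are chosen separately.\<close>

lemma two_sided_neighbourhood:
 fixes f :: "real \<times> real => 'a"
 assumes p: "half_chart X \<Delta> W full f 1 rho \<sigma> iota" and m: "full ==> half_chart X \<Delta> W full f (-1) rho' \<sigma>' iota'"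
  and x: "x : core" and delta: "delta > 0"
 shows "EX V. openin X V & half_map f 1 rho \<sigma> (x, 0) : V &
   V <= half_map f 1 rho \<sigma> ` (hbox x delta Int half_square) Un
    (if full then half_map f (-1) rho' \<sigma>' ` (hbox (rho * rho' * x) delta Int half_square) else {})"
proof -
 interpret p: half_chart X \<Delta> W full f 1 rho \<sigma> iota by (rule p)
 obtain eta where eta: "eta > 0" "ALL s:{0..<eta}. s < 1 --> iota s < delta" using p.iota_small[OF delta] by blast
 obtain eta' where eta': "eta' > 0" "full --> (ALL s:{0..<eta'}. s < 1 --> iota' s < delta)"
 proof (cases full)
  case True
  then show thesis using that half_chart.iota_small[OF m[OF True] delta] by blast
 next
  case False
  then show thesis using that[of 1] by simp
 qed
 define V where "V = p.D Int ({rho * x - delta<..<rho * x + delta} \<times> {-eta'<..<eta})"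
 have xx: "rho * x : {-1<..<1}" using p.rho x by auto
 have "openin X (f ` V)" unfolding V_def by (intro p.f_open_Int open_Times) auto
 moreover have "(rho * x, 0) : V" using xx eta(1) eta'(1) delta by (auto simp: V_def centred_box_def)
 then have "half_map f 1 rho \<sigma> (x, 0) : f ` V" by (simp add: half_map_def p.\<sigma>0)
 moreover have "f w : half_map f 1 rho \<sigma> ` (hbox x delta Int half_square) Un
    (if full then half_map f (-1) rho' \<sigma>' ` (hbox (rho * rho' * x) delta Int half_square) else {})" if w: "w : V" for w
 proof -
  obtain u y where uy: "w = (u, y)" by (cases w)
  have u: "u : {-1<..<1}" "\<bar>u - rho * x\<bar> < delta" "-eta' < y" "y < eta" "y < 1" "\<not> full ==> 0 <= y" "-1 < y"
   using w by (auto simp: V_def uy centred_box_def split: if_splits)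
  show ?thesis
  proof (cases "y \<ge> 0")
   case True
   then have H: "w : p.H" using u by (auto simp: p.H_def uy)
   have "\<bar>rho * u - x\<bar> < delta" using p.rho u(2) by auto
   moreover have "iota y < delta" using eta(2) True u by simp
   moreover have "0 <= iota y" using p.iota_in0[of y] True u(5) by auto
   ultimately have "(rho * u, iota (1 * y)) : hbox x delta" by (auto simp: hbox_def)
   moreover have "(rho * u, iota (1 * y)) : half_square" using p.m'_in(1)[OF H] by (simp add: uy)
   moreover have "f w = half_map f 1 rho \<sigma> (rho * u, iota (1 * y))" using p.b_m'[OF H] by (simp add: uy)
   ultimately show ?thesis by blast
  next
   case False
   then have full: full using u(6) by blast
   interpret m: half_chart X \<Delta> W full f "-1" rho' \<sigma>' iota' by (rule m[OF full])
   have H: "w : m.H" using u False by (auto simp: m.H_def uy)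
   have "\<bar>rho' * u - rho * rho' * x\<bar> < delta" using m.rho p.rho u(2) by auto
   moreover have "iota' (-y) < delta" using eta'(2) full False u by simp
   moreover have "0 <= iota' (-y)" using m.iota_in0[of "-y"] False u(7) by auto
   ultimately have "(rho' * u, iota' (-1 * y)) : hbox (rho * rho' * x) delta" by (auto simp: hbox_def)
   moreover have "(rho' * u, iota' (-1 * y)) : half_square" using m.m'_in(1)[OF H] by (simp add: uy)
   moreover have "f w = half_map f (-1) rho' \<sigma>' (rho' * u, iota' (-1 * y))" using m.b_m'[OF H] by (simp add: uy)
   ultimately show ?thesis using full by auto
  qed
 qed
 ultimately show ?thesis by (intro exI[of _ "f ` V"]) blast
qed

text \<open>Half charts occur twice. The raw halves \<open>c\<close> serve to find the maximal strip
  on each side; only relative to that strip can the normal form \<open>b\<close> be chosen.\<close>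

lemma locally_finite_cut_admits_striped_atlas:
 assumes surf: "surface_with_boundary X" and fol: "foliation1 X \<Delta>"
  and line: "!!L. L : \<Delta> ==> subtopology X L homeomorphic_space euclideanreal"
  and cl: "!!L. L : \<Delta> ==> closedin X L" and Sg: "Sg <= \<Delta>" and lf: "locally_finite_in X Sg"
  and fam: "cut_strip_family X (\<Delta> - Sg)"
  and cover: "!!L. L : \<Delta> - Sg ==> EX B. strip_family.strip_arc X (\<Delta> - Sg) B & L <= B"
 shows "admits_striped_atlas X \<Delta>"
proof (cases "topspace X = {}")
 case True
 then show ?thesis using fol by (intro empty_surface_admits_striped_atlas) (simp_all add: foliation1_def)
next
 case False
 interpret cut_strip_family X "\<Delta> - Sg" by (rule fam)
 have covX: "\<Union>\<Delta> = topspace X" and dj: "ALL L:\<Delta>. ALL L':\<Delta>. L ~= L' --> L Int L' = {}" and ne: "{} ~: \<Delta>"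
  using fol unfolding foliation1_def by simp_all
 have disj: "L = L'" if "L : \<Delta>" "L' : \<Delta>" "L Int L' ~= {}" for L L' using dj that by blast
 define W where "W = \<Union>Sg"
 have LW: "\<Union>(\<Delta> - Sg) = topspace X - W"
 proof (intro equalityI subsetI)
  fix z assume "z : \<Union>(\<Delta> - Sg)"
  then obtain L where L: "L : \<Delta>" "L ~: Sg" "z : L" by blast
  have "z ~: L'" if L': "L' : Sg" for L' using disj[of L L'] L L' Sg by blast
  then show "z : topspace X - W" using L covX W_def by blast
 next
  fix z assume "z : topspace X - W"
  then show "z : \<Union>(\<Delta> - Sg)" using covX W_def by blast
 qed
 \<comment> \<open>If nothing were cut, the whole surface would be open, closed and made of uncut
   leaves.\<close>
 have W_ne: "W ~= {}"
 proof
  assume "W = {}"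
  then have "topspace X = {}" using LW by (intro no_clopen) auto
  then show False using False by simp
 qed
 obtain F f where ch: "!!n::nat. centred_chart X \<Delta> W (F n) (f n)"
  and cov: "!!z. z : W ==> EX n. EX x:core. z = f n (x, 0)"
 proof (rule centred_charts_cover[OF surf fol line cl Sg lf W_ne[unfolded W_def], folded W_def])
  fix F f assume a: "!!n::nat. centred_chart X \<Delta> W (F n) (f n)" "!!z. z : W ==> EX n. EX x:core. z = f n (x, 0)"
  show thesis by (rule that[OF a])
 qed
 define I where "I = {k. even k \<or> F (k div 2)}"
 define d :: "nat => real" where "d k = (if even k then 1 else -1)" for k
 define c where "c k = half_map (f (k div 2)) (d k) 1 (%s. s)" for k
 have raw: "half_chart X \<Delta> W (F (k div 2)) (f (k div 2)) (d k) 1 (%s. s) (%s. s)" if k: "k : I" for k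
  by unfold_locales (use ch[of "k div 2"] k in \<open>auto simp: I_def d_def\<close>)
 have ck: "c k (x, s) = f (k div 2) (x, d k * s)" for k x s by (simp add: c_def half_map_def)
 have lines: "EX L:\<Delta> - Sg. c k ` ({-1<..<1} \<times> {s}) <= L" if k: "k : I" and s: "s : {0<..<1}" for k s
 proof -
  have y: "(0, d k * s) : centred_box (F (k div 2))" using k s by (auto simp: centred_box_def I_def d_def)
  then obtain L where L: "L : \<Delta>" "f (k div 2) ` ({-1<..<1} \<times> {d k * s}) <= L"
   using ch[of "k div 2"] unfolding centred_chart_def by blast
  have "f (k div 2) (0, d k * s) ~: W" using half_chart.f_W[OF raw[OF k] y] s by (auto simp: d_def)
  moreover have "f (k div 2) (0, d k * s) : L" using L(2) by auto
  ultimately have "L ~: Sg" using W_def by blast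
  moreover have "c k ` ({-1<..<1} \<times> {s}) <= L" using L(2) by (auto simp: ck)
  ultimately show ?thesis using L(1) by blast
 qed
 have pos: "c k ` half_square_pos <= \<Union>(\<Delta> - Sg)" if k: "k : I" for k
 proof (rule image_subsetI)
  fix p assume p: "p : half_square_pos"
  then have "snd p : {0<..<1}" by auto
  from lines[OF k this] obtain L where L: "L : \<Delta> - Sg" "c k ` ({-1<..<1} \<times> {snd p}) <= L" ..
  have "p : {-1<..<1} \<times> {snd p}" using p by auto
  then have "c k p : L" by (rule subsetD[OF L(2) imageI])
  then show "c k p : \<Union>(\<Delta> - Sg)" using L(1) by blast
 qed
 have base: "c k (0, 0) ~: \<Union>(\<Delta> - Sg)" if k: "k : I" for k
 proof -
  have "(0, 0) : centred_box (F (k div 2))" by (simp add: centred_box_def)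
  then have "c k (0, 0) : W" using half_chart.f_W[OF raw[OF k]] by (simp add: ck)
  then show ?thesis using LW by blast
 qed
 have ccont: "continuous_map (top_of_set half_square) X (c k)" and cinj: "inj_on (c k) half_square" if k: "k : I" for k
  using half_chart.b_continuous[OF raw[OF k]] half_chart.b_inj[OF raw[OF k]] by (simp_all add: c_def)
 have "ALL k:I. EX B. maximal_arc B & c k ` half_square_pos <= B"
 proof
  fix k assume k: "k : I"
  obtain B where "maximal_arc B" "c k ` half_square_pos <= B" by (rule half_chart_in_arc[OF ccont[OF k] pos[OF k] cover])
  then show "EX B. maximal_arc B & c k ` half_square_pos <= B" by blast
 qed
 from bchoice[OF this] obtain Bk where Bk: "ALL k:I. maximal_arc (Bk k) & c k ` half_square_pos <= Bk k" ..
 define BB where "BB = Collect maximal_arc"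
 have cBB: "countable BB" unfolding BB_def by (rule countable_maximal_arcs)
 have "ALL B:BB. EX h. pstrip 0 1 h & B = h ` (band {0<..<1})" by (simp add: BB_def maximal_arc_def strip_arc_def)
 from bchoice[OF this] obtain hB where hB: "ALL B:BB. pstrip 0 1 (hB B) & B = hB B ` (band {0<..<1})" ..
 define \<Lambda> where "\<Lambda> = to_nat_on BB ` BB"
 define h where "h l = hB (from_nat_into BB l)" for l
 define a where "a k = to_nat_on BB (Bk k)" for k
 have fl: "from_nat_into BB l : BB" "to_nat_on BB (from_nat_into BB l) = l" if l: "l : \<Lambda>" for l
  using l cBB by (auto simp: \<Lambda>_def)
 have hl: "pstrip 0 1 (h l)" "h l ` (band {0<..<1}) = from_nat_into BB l" if l: "l : \<Lambda>" for l
  using bspec[OF hB fl(1)[OF l]] by (simp_all add: h_def)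
 have aL: "a k : \<Lambda>" "h (a k) ` (band {0<..<1}) = Bk k" if k: "k : I" for k
 proof -
  have B: "Bk k : BB" using Bk k by (simp add: BB_def)
  then show "a k : \<Lambda>" by (simp add: a_def \<Lambda>_def)
  then show "h (a k) ` (band {0<..<1}) = Bk k" using hl(2)[of "a k"] B cBB by (simp add: a_def)
 qed
 have "EX rho \<sigma> iota xi e eps. end_normal_form (h (a k)) (c k) rho \<sigma> iota xi e eps" if k: "k : I" for k
  unfolding end_normal_form_def
 proof (rule half_chart_normal_form[OF hl(1)[OF aL(1)[OF k]] ccont[OF k] cinj[OF k] _ lines[OF k] base[OF k]])
  show "c k ` half_square_pos <= h (a k) ` (band {0<..<1})" using aL(2)[OF k] Bk k by simp
 qed
 then obtain rho \<sigma> iota xi e eps where nf: "!!k. k : I ==> end_normal_form (h (a k)) (c k) (rho k) (\<sigma> k) (iota k) (xi k) (e k) (eps k)"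
  by metis
 have hc: "half_chart X \<Delta> W (F (k div 2)) (f (k div 2)) (d k) (rho k) (\<sigma> k) (iota k)" if k: "k : I" for k
  by unfold_locales (use ch[of "k div 2"] k nf[OF k] in \<open>auto simp: I_def d_def end_normal_form_def\<close>)
 define b where "b k = half_map (f (k div 2)) (d k) (rho k) (\<sigma> k)" for k
 define U where "U n = f n ` centred_box (F n)" for n
 have hcb: "continuous_map (top_of_set half_square) X (b k)" "inj_on (b k) half_square"
  "homeomorphic_map (top_of_set half_square) (subtopology X (b k ` half_square)) (b k)"
  "openin X (U (k div 2))" "b k ` half_square <= U (k div 2)" "U (k div 2) Int W = b k ` ({-1<..<1} \<times> {0})"
  "b k ` half_square_pos Int W = {}" "openin X (b k ` half_square_pos)"
  "openin X (U (k div 2) - W - b k ` half_square_pos)" if k: "k : I" for k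
 proof -
  interpret half_chart X \<Delta> W "F (k div 2)" "f (k div 2)" "d k" "rho k" "\<sigma> k" "iota k" by (rule hc[OF k])
  show "continuous_map (top_of_set half_square) X (b k)" "inj_on (b k) half_square"
  "homeomorphic_map (top_of_set half_square) (subtopology X (b k ` half_square)) (b k)"
  "openin X (U (k div 2))" "b k ` half_square <= U (k div 2)" "U (k div 2) Int W = b k ` ({-1<..<1} \<times> {0})"
  "b k ` half_square_pos Int W = {}" "openin X (b k ` half_square_pos)"
  "openin X (U (k div 2) - W - b k ` half_square_pos)"
   unfolding b_def U_def by (rule b_continuous b_inj b_homeo U_open b_U U_W b_W b_open rest_open)+
 qed
 have coords: "b k (x, s) = h (a k) (xi k x s, e k + (1 - 2 * e k) * eps k * s)"
  if k: "k : I" and x: "x : {-1<..<1}" and s: "s : {0<..<1}" for k x s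
 proof -
  have "b k (x, s) = c k (rho k * x, \<sigma> k s)" by (simp add: b_def half_map_def ck)
  then show ?thesis using nf[OF k] x s unfolding end_normal_form_def by simp
 qed
 have "EX S q En. strip_completion X (h l) {k : I. a k = l} b S q En" if l: "l : \<Lambda>" for l
 proof -
  interpret E: arc_ends X W "h l" "{k : I. a k = l}" b "%k. U (k div 2)" xi e eps
  proof
   show "Hausdorff_space X" using surf by (simp add: surface_with_boundary_def)
   show "inj_on (h l) (band {0<..<1})" using hl(1)[OF l] by (simp add: proper_strip_def)
   fix j assume "j : {k : I. a k = l}"
   then have j: "j : I" "a j = l" by auto
   note hcb[OF j(1)]
   then show "homeomorphic_map (top_of_set half_square) (subtopology X (b j ` half_square)) (b j)"
    "continuous_map (top_of_set half_square) X (b j)" "openin X (U (j div 2))" "b j ` half_square <= U (j div 2)"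
    "U (j div 2) Int W = b j ` ({-1<..<1} \<times> {0})" "b j ` half_square_pos Int W = {}" "openin X (b j ` half_square_pos)"
    "openin X (U (j div 2) - W - b j ` half_square_pos)" by simp_all
   show "continuous_on half_square_pos (%(x, s). xi j x s)" "e j = 0 \<or> e j = 1" "0 < eps j" "eps j <= 1"
    using nf[OF j(1)] by (simp_all add: end_normal_form_def)
   fix x x' s :: real
   show "xi j x s < xi j x' s" if "s : {0<..<1}" "-1 < x" "x < x'" "x' < 1"
    using nf[OF j(1)] that by (simp add: end_normal_form_def)
   show "b j (x, s) = h l (xi j x s, e j + (1 - 2 * e j) * eps j * s)" if "x : {-1<..<1}" "s : {0<..<1}"
    using coords[OF j(1) that] j(2) by simp
  qed
  have "continuous_map (top_of_set (band {0<..<1})) X (h l)" using hl(1)[OF l] by (simp add: proper_strip_def)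
  from E.strip_completion_exists[OF this] show ?thesis by blast
 qed
 then obtain S q En where comp: "!!l. l : \<Lambda> ==> strip_completion X (h l) {k : I. a k = l} b (S l) (q l) (En l)" by metis
 \<comment> \<open>Since \<open>\<sigma>\<close> vanishes at 0, the two sides differ on the axis
   only by their signs, and the product is their relative direction.\<close>
 define r where "r n = (if F n then rho (2 * n) * rho (2 * n + 1) else 1)" for n
 have ev: "2 * n : I" for n by (simp add: I_def)
 have od: "2 * n + 1 : I" if "F n" for n using that by (simp add: I_def)
 have hce: "half_chart X \<Delta> W (F n) (f n) 1 (rho (2 * n)) (\<sigma> (2 * n)) (iota (2 * n))" for n using hc[OF ev[of n]] by (simp add: d_def)
 have hco: "half_chart X \<Delta> W (F n) (f n) (-1) (rho (2 * n + 1)) (\<sigma> (2 * n + 1)) (iota (2 * n + 1))" if "F n" for n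
  using hc[OF od[OF that]] by (simp add: d_def)
 have be: "b (2 * n) = half_map (f n) 1 (rho (2 * n)) (\<sigma> (2 * n))" for n by (simp add: b_def d_def)
 have bo: "b (2 * n + 1) = half_map (f n) (-1) (rho (2 * n + 1)) (\<sigma> (2 * n + 1))" for n by (simp add: b_def d_def)
 have rho1: "rho k = 1 \<or> rho k = -1" if "k : I" for k using nf[OF that] by (simp add: end_normal_form_def)
 have be0: "b (2 * n) (x, 0) = f n (rho (2 * n) * x, 0)" for n x
  using half_chart.\<sigma>0[OF hce[of n]] by (simp add: be half_map_def)
 have rel: "EX L:Sg. b (2 * n) ` ({-1<..<1} \<times> {0}) <= L" for n
 proof -
  have z0: "(0, 0) : centred_box (F n)" by (simp add: centred_box_def)
  then obtain L where L: "L : \<Delta>" "f n ` ({-1<..<1} \<times> {0}) <= L" using ch[of n] unfolding centred_chart_def by blast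
  have "f n (0, 0) : W" using half_chart.f_W[OF hce z0] by simp
  then obtain L' where L': "L' : Sg" "f n (0, 0) : L'" using W_def by blast
  have "f n (0, 0) : L" using L(2) by auto
  then have "L = L'" using L L' Sg by (intro disj) auto
  moreover have "b (2 * n) ` ({-1<..<1} \<times> {0}) = f n ` ({-1<..<1} \<times> {0})" unfolding be by (rule half_chart.b_image_base[OF hce])
  ultimately show ?thesis using L L' by auto
 qed
 have "strip_gluing X \<Delta> Sg \<Lambda> h F U a b r S q En"
 proof (unfold_locales, fold W_def I_def)
  show "surface_with_boundary X" by (rule surf)
  show "L = L'" if "L : \<Delta>" "L' : \<Delta>" "L Int L' ~= {}" for L L' by (rule disj[OF that])
  show "{} ~: \<Delta>" by (rule ne)
  show "\<Union>\<Delta> = topspace X" by (rule covX)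
  show "closedin X L" if "L : \<Delta>" for L by (rule cl[OF that])
  show "subtopology X L homeomorphic_space euclideanreal" if "L : \<Delta>" for L by (rule line[OF that])
  show "Sg <= \<Delta>" by (rule Sg)
  show "locally_finite_in X Sg" by (rule lf)
  show "strip_completion X (h l) {k : I. a k = l} b (S l) (q l) (En l)" if "l : \<Lambda>" for l by (rule comp[OF that])
  show "h l ` (band {t}) : \<Delta> - Sg" if l: "l : \<Lambda>" and t: "t : {0<..<1}" for l t
   using hl(1)[OF l] t unfolding proper_strip_def by blast
  show "l = l'" if l: "l : \<Lambda>" "l' : \<Lambda>" "h l ` (band {0<..<1}) Int h l' ` (band {0<..<1}) ~= {}" for l l'
  proof -
   have "from_nat_into BB l = from_nat_into BB l'"
    using l(3) fl(1)[OF l(1)] fl(1)[OF l(2)] unfolding hl(2)[OF l(1)] hl(2)[OF l(2)] BB_def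
    by (intro maximal_arc_disjoint) simp_all
   then have "to_nat_on BB (from_nat_into BB l) = to_nat_on BB (from_nat_into BB l')" by simp
   then show ?thesis unfolding fl(2)[OF l(1)] fl(2)[OF l(2)] .
  qed
  show "(\<Union>l\<in>\<Lambda>. h l ` (band {0<..<1})) = topspace X - W"
  proof (intro equalityI subsetI)
   fix z assume "z : (\<Union>l\<in>\<Lambda>. h l ` (band {0<..<1}))"
   then obtain l x t where l: "l : \<Lambda>" "t : {0<..<1}" "z = h l (x, t)" by auto
   then have "h l ` (band {t}) : \<Delta> - Sg" using hl(1)[OF l(1)] unfolding proper_strip_def by blast
   then have "z : \<Union>(\<Delta> - Sg)" using l(3) by blast
   then show "z : topspace X - W" using LW by simp
  next
   fix z assume "z : topspace X - W"
   then obtain L where L: "L : \<Delta> - Sg" "z : L" using LW by blast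
   obtain B0 where B0: "strip_arc B0" "L <= B0" using cover[OF L(1)] by blast
   obtain B where B: "maximal_arc B" "B0 <= B" by (rule maximal_arc_exists[OF B0(1)])
   have BB: "B : BB" using B by (simp add: BB_def)
   then have "to_nat_on BB B : \<Lambda>" "from_nat_into BB (to_nat_on BB B) = B" using cBB by (simp_all add: \<Lambda>_def)
   then have "z : h (to_nat_on BB B) ` (band {0<..<1})" using hl(2)[of "to_nat_on BB B"] L B B0 by auto
   then show "z : (\<Union>l\<in>\<Lambda>. h l ` (band {0<..<1}))" using \<open>to_nat_on BB B : \<Lambda>\<close> by blast
  qed
  show "openin X (U n)" for n using hcb(4)[OF ev[of n]] by simp
  show "EX n. EX x:core. z = b (2 * n) (x, 0)" if z: "z : W" for z
  proof -
   obtain n x where n: "x : core" "z = f n (x, 0)" using cov[OF z] by blast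
   have "rho (2 * n) * x : core" "rho (2 * n) * (rho (2 * n) * x) = x" using rho1[OF ev[of n]] n(1) by auto
   moreover from this(2) have "z = b (2 * n) (rho (2 * n) * x, 0)" unfolding be0 n(2) by (simp only:)
   ultimately show ?thesis by blast
  qed
  show "EX L:Sg. b (2 * n) ` ({-1<..<1} \<times> {0}) <= L" for n by (rule rel)
  show "r n = 1 \<or> r n = -1" for n using rho1[OF ev[of n]] rho1[OF od[of n]] by (auto simp: r_def)
  show "b (2 * n + 1) (x, 0) = b (2 * n) (r n * x, 0)" if n: "F n" "x : {-1<..<1}" for n x
  proof -
   have "b (2 * n + 1) (x, 0) = f n (rho (2 * n + 1) * x, 0)"
    using half_chart.\<sigma>0[OF hco[OF n(1)]] by (simp add: bo[simplified] half_map_def)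
   moreover have "rho (2 * n) * (r n * x) = rho (2 * n + 1) * x" using rho1[OF ev[of n]] n(1) by (auto simp: r_def)
   ultimately show ?thesis unfolding be0 by (simp only:)
  qed
  show "U n - W <= b (2 * n) ` half_square_pos Un (if F n then b (2 * n + 1) ` half_square_pos else {})" for n
  proof
   fix z assume z: "z : U n - W"
   then obtain p where p: "p : centred_box (F n)" "snd p ~= 0" "z = f n p"
    using half_chart.U_minus_W[OF hce[of n]] unfolding U_def by blast
   show "z : b (2 * n) ` half_square_pos Un (if F n then b (2 * n + 1) ` half_square_pos else {})"
   proof (cases "snd p > 0")
    case True
    then have "p : half_chart.Hp 1" using p by (auto simp: half_chart.Hp_def[OF hce[of n]] centred_box_def split: if_splits)
    then have "z : b (2 * n) ` half_square_pos" using half_chart.b_image_pos[OF hce[of n]] p(3) unfolding be by blast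
    then show ?thesis by blast
   next
    case neg: False
    then have F: "F n" using p by (auto simp: centred_box_def split: if_splits)
    have "p : half_chart.Hp (-1)" using p neg F by (auto simp: half_chart.Hp_def[OF hco[OF F]] centred_box_def)
    then have "z : b (2 * n + 1) ` half_square_pos" using half_chart.b_image_pos[OF hco[OF F]] p(3) unfolding bo by blast
    then show ?thesis using F by simp
   qed
  qed
  show "b (2 * n) ` half_square_pos Int b (2 * n + 1) ` half_square_pos = {}" if F: "F n" for n
  proof -
   interpret p: half_chart X \<Delta> W "F n" "f n" 1 "rho (2 * n)" "\<sigma> (2 * n)" "iota (2 * n)" by (rule hce)
   interpret m: half_chart X \<Delta> W "F n" "f n" "-1" "rho (2 * n + 1)" "\<sigma> (2 * n + 1)" "iota (2 * n + 1)" by (rule hco[OF F])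
   have "f n ` p.Hp Int f n ` m.Hp = f n ` (p.Hp Int m.Hp)"
    using p.Hp_H p.H_D m.Hp_H m.H_D by (intro inj_on_image_Int[OF p.f_inj, symmetric]) blast+
   moreover have "p.Hp Int m.Hp = {}" by (auto simp: p.Hp_def m.Hp_def)
   ultimately show ?thesis unfolding be bo p.b_image_pos m.b_image_pos by simp
  qed
  show "EX V. openin X V & b (2 * n) (x, 0) : V & V <= b (2 * n) ` (hbox x delta Int half_square) Un
    (if F n then b (2 * n + 1) ` (hbox (r n * x) delta Int half_square) else {})" if x: "x : core" and delta: "delta > 0" for n x delta
  proof -
   have r: "r n = rho (2 * n) * rho (2 * n + 1)" if "F n" using that by (simp add: r_def)
   show ?thesis using two_sided_neighbourhood[OF hce[of n] hco x delta] r unfolding be bo by (cases "F n") simp_all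
  qed
  fix k assume k: "k : I"
  show "a k : \<Lambda>" by (rule aL(1)[OF k])
  show "continuous_map (top_of_set half_square) X (b k)" "inj_on (b k) half_square"
   "openin X (b k ` half_square_pos)" "b k ` half_square <= U (k div 2)" by (rule hcb[OF k])+
  show "b k ` half_square_pos <= h (a k) ` (band {0<..<1})"
  proof (rule image_subsetI)
   fix p assume p: "p : half_square_pos"
   have "\<sigma> k (snd p) : {0<..<1}" "rho k * fst p : {-1<..<1}"
    using p nf[OF k] rho1[OF k] unfolding end_normal_form_def by auto
   then have "c k (rho k * fst p, \<sigma> k (snd p)) : c k ` half_square_pos" by blast
   moreover have "b k p = c k (rho k * fst p, \<sigma> k (snd p))" by (cases p) (simp add: b_def half_map_def ck)
   ultimately show "b k p : h (a k) ` (band {0<..<1})" using aL(2)[OF k] Bk k by auto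
  qed
 qed
 then show ?thesis by (rule strip_gluing.gluing_admits_striped_atlas)
qed

section \<open>Regular leaves and cut families\<close>

text \<open>The model is given on the closure of \<open>U\<close>. A band over a compact set is
  closed in the model, so its image is closed in that closure and hence in the surface; this is how
  regularity yields properness.\<close>

lemma regular_leaf_proper_strip:
 assumes mod: "foliated_model_nbhd X \<Delta> omega U {-1..1} {-1<..<1}"
 obtains g where "proper_strip X \<Delta> (-1) 1 g" "g ` (band {0}) = omega"
proof -
 let ?C = "X closure_of U" and ?T = "band {-1..1} :: (real \<times> real) set"
 obtain V h where U: "U <= topspace X" and V: "omega <= V" "V <= U"
  and h: "homeomorphic_map (subtopology X ?C) (top_of_set ?T) h" and homega: "h ` omega = band {0}"
  and hL: "{h ` L | L. L : \<Delta> & L <= ?C} = {band {t} | t. t : {-1..1}}"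
  using mod unfolding foliated_model_nbhd_def by (elim conjE exE)
 have top: "topspace (subtopology X ?C) = ?C" by (simp add: closure_of_subset_topspace Int_absorb1)
 obtain g where gm: "homeomorphic_maps (subtopology X ?C) (top_of_set ?T) h g" using h homeomorphic_map_maps by blast
 have gh: "g (h w) = w" if "w : ?C" for w using gm that top by (simp add: homeomorphic_maps_def)
 have hg: "h (g p) = p" if "p : ?T" for p using gm that by (auto simp: homeomorphic_maps_def)
 have gc: "continuous_map (top_of_set ?T) X g" using gm by (simp add: homeomorphic_maps_def continuous_map_in_subtopology)
 have gmap: "homeomorphic_map (top_of_set ?T) (subtopology X ?C) g"
  using gm homeomorphic_maps_sym homeomorphic_maps_map by blast
 have ghL: "g ` h ` L = L" if "L <= ?C" for L using gh that by (force simp: image_image)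
 have sub: "band {-1<..<1} <= ?T" by auto
 have "proper_strip X \<Delta> (-1) 1 g"
  unfolding proper_strip_def
 proof (intro conjI ballI allI impI)
  show "continuous_map (top_of_set (band {-1<..<1})) X g" by (rule continuous_map_from_subtopology_mono[OF gc sub])
  have "inj_on g ?T" by (rule inj_on_inverseI[of _ h]) (rule hg)
  then show "inj_on g (band {-1<..<1})" using sub by (rule inj_on_subset)
  fix t :: real assume t: "t : {-1<..<1}"
  then have "t : {-1..1}" by auto
  then have "band {t} : {h ` L | L. L : \<Delta> & L <= ?C}" unfolding hL by blast
  then obtain L where L: "band {t} = h ` L" "L : \<Delta>" "L <= ?C" by blast
  show "g ` (band {t}) : \<Delta>" unfolding L(1) ghL[OF L(3)] by (rule L(2))
 next
  fix K :: "real set" assume K: "compact K & K <= {-1<..<1}"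
  then have "closed (UNIV \<times> K :: (real \<times> real) set)" using closed_Times[OF closed_UNIV compact_imp_closed] by blast
  moreover have "UNIV \<times> K <= ?T" using K by auto
  ultimately have "closedin (top_of_set ?T) (band K)" by (simp add: closed_subset)
  then have "closedin (subtopology X ?C) (g ` (band K))"
   using homeomorphic_map_closedness_eq[OF gmap] closedin_subset by blast
  then show "closedin X (g ` (band K))" by (rule closedin_trans_full) (rule closedin_closure_of)
 qed simp
 moreover have "omega <= ?C" using V closure_of_subset[OF U] by blast
 then have "g ` (band {0}) = omega" unfolding homega[symmetric] by (rule ghL)
 ultimately show thesis by (rule that)
qed

lemma locally_finite_in_Un:
 assumes "locally_finite_in X \<A>" "locally_finite_in X \<B>"
 shows "locally_finite_in X (\<A> Un \<B>)"
 unfolding locally_finite_in_def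
proof (intro conjI ballI)
 show "\<Union>(\<A> Un \<B>) <= topspace X" using assms by (simp add: locally_finite_in_def)
 fix x assume x: "x : topspace X"
 obtain V where V: "openin X V" "x : V" "finite {U : \<A>. U Int V ~= {}}" using assms(1) x unfolding locally_finite_in_def by blast
 obtain V' where V': "openin X V'" "x : V'" "finite {U : \<B>. U Int V' ~= {}}" using assms(2) x unfolding locally_finite_in_def by blast
 have "{U : \<A> Un \<B>. U Int (V Int V') ~= {}} <= {U : \<A>. U Int V ~= {}} Un {U : \<B>. U Int V' ~= {}}" by blast
 then have "finite {U : \<A> Un \<B>. U Int (V Int V') ~= {}}" using V(3) V'(3) finite_subset by blast
 then show "EX N. openin X N & x : N & finite {U : \<A> Un \<B>. U Int N ~= {}}"
  using V(1,2) V'(1,2) by (intro exI[of _ "V Int V'"]) (simp add: openin_Int)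
qed

text \<open>Inside a chart a boundary point can only lie on the edge of a half square, as all other
  points have planar neighbourhoods. The edge belongs to a single leaf, so a chart meets at most one
  boundary leaf.\<close>

lemma boundary_leaves_locally_finite:
 assumes fol: "foliation1 X \<Delta>"
 shows "locally_finite_in X {omega : \<Delta>. omega <= mboundary X}"
 unfolding locally_finite_in_def
proof (intro conjI ballI)
 show "\<Union>{omega : \<Delta>. omega <= mboundary X} <= topspace X" by (auto simp: mboundary_def)
 have dj: "ALL L:\<Delta>. ALL L':\<Delta>. L ~= L' --> L Int L' = {}" using fol unfolding foliation1_def by simp
 have disj: "L = L'" if "L : \<Delta>" "L' : \<Delta>" "L Int L' ~= {}" for L L' using dj that by blast
 fix x assume x: "x : topspace X"
 obtain U Y phi g where U: "openin X U" "x : U" and Y: "Y = {-1<..<1::real} \<or> Y = {0..<1}"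
  and gm: "homeomorphic_maps (subtopology X U) (top_of_set ({-1<..<1::real} \<times> Y)) phi g"
  and pl: "ALL y:Y. EX L:\<Delta>. g ` ({-1<..<1} \<times> {y}) <= L" using foliation1_charts[OF fol x] .
 let ?B = "{-1<..<1::real} \<times> Y"
 have UX: "topspace (subtopology X U) = U" using openin_subset[OF U(1)] by (simp add: Int_absorb1)
 have phic: "continuous_map (subtopology X U) (top_of_set ?B) phi" using gm by (simp add: homeomorphic_maps_def)
 have phiB: "phi z : ?B" if "z : U" for z using continuous_map_image_subset_topspace[OF phic] UX that by auto
 have gphi: "g (phi w) = w" if "w : U" for w using gm that UX by (simp add: homeomorphic_maps_def)
 define P where "P = {-1<..<1::real} \<times> (Y - {0})"
 have oP: "open P" if "Y = {0..<1}"
 proof -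
  have "Y - {0} = {0<..<1}" using that by auto
  then show ?thesis by (simp add: P_def open_Times)
 qed
 have only0: "Y = {0..<1} & snd (phi z) = 0" if z: "z : U" "z : mboundary X" for z
 proof (rule ccontr)
  assume a: "\<not> (Y = {0..<1} & snd (phi z) = 0)"
  have "EX U W. openin X U & z : U & open (W :: (real \<times> real) set) & subtopology X U homeomorphic_space top_of_set W"
  proof (cases "Y = {0..<1}")
   case True
   define V where "V = {w : U. phi w : P}"
   have PB: "P <= ?B" by (auto simp: P_def)
   have "openin (top_of_set ?B) P" using oP[OF True] PB by (intro open_subset)
   then have oV: "openin (subtopology X U) V" using openin_continuous_map_preimage[OF phic] unfolding V_def UX by blast
   have hm: "homeomorphic_map (subtopology X U) (top_of_set ?B) phi" using gm homeomorphic_maps_map by blast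
   have im: "phi ` V = P"
   proof (intro equalityI subsetI)
    fix p assume p: "p : P"
    have "g ` ?B <= U" using gm continuous_map_image_subset_topspace[of "top_of_set ?B" "subtopology X U" g] UX
     by (simp add: homeomorphic_maps_def)
    then have "g p : U" using p PB by blast
    moreover have "phi (g p) = p" using gm p PB by (auto simp: homeomorphic_maps_def)
    ultimately show "p : phi ` V" unfolding V_def using p by force
   qed (auto simp: V_def)
   have VP: "U Int V = V" "?B Int P = P" using PB by (auto simp: V_def)
   have "homeomorphic_map (subtopology (subtopology X U) V) (subtopology (top_of_set ?B) P) phi"
    by (rule homeomorphic_map_subtopologies[OF hm]) (simp only: UX topspace_euclidean_subtopology VP im)
   moreover have "subtopology (subtopology X U) V = subtopology X V" "subtopology (top_of_set ?B) P = top_of_set P"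
    by (simp_all only: subtopology_subtopology VP)
   ultimately have "subtopology X V homeomorphic_space top_of_set P" using homeomorphic_map_imp_homeomorphic_space by metis
   moreover have "z : V" using a True z(1) phiB[OF z(1)] by (auto simp: V_def P_def mem_Times_iff)
   moreover have "openin X V" using oV U(1) by (rule openin_trans_full)
   ultimately show ?thesis using oP[OF True] by blast
  next
   case False
   then have "open ?B" using Y by (auto intro: open_Times)
   moreover have "subtopology X U homeomorphic_space top_of_set ?B" using gm homeomorphic_space_def by blast
   ultimately show ?thesis using U(1) z(1) by blast
  qed
  then show False using z(2) unfolding mboundary_def by blast
 qed
 have "omega = omega'" if w: "omega : \<Delta>" "omega <= mboundary X" "omega Int U ~= {}" "omega' : \<Delta>" "omega' <= mboundary X" "omega' Int U ~= {}" for omega omega'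
 proof -
  obtain z z' where z: "z : omega" "z : U" "z' : omega'" "z' : U" using w(3,6) by blast
  have o: "Y = {0..<1}" "snd (phi z) = 0" "snd (phi z') = 0" using only0[of z] only0[of z'] z w(2,5) by auto
  then obtain L where L: "L : \<Delta>" "g ` ({-1<..<1} \<times> {0}) <= L" using bspec[OF pl, of 0] by auto
  have phiz: "phi z : {-1<..<1} \<times> {0}" "phi z' : {-1<..<1} \<times> {0}"
   using phiB[OF z(2)] phiB[OF z(4)] o by (auto simp: mem_Times_iff)
  have "z : L" "z' : L"
   using subsetD[OF L(2) imageI[OF phiz(1)]] subsetD[OF L(2) imageI[OF phiz(2)]] gphi[OF z(2)] gphi[OF z(4)] by simp_all
  then have "omega = L" "omega' = L" using disj[of omega L] disj[of omega' L] w L z by blast+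
  then show ?thesis by simp
 qed
 then have one: "omega = omega'" if "omega : {omega : {omega : \<Delta>. omega <= mboundary X}. omega Int U ~= {}}"
  "omega' : {omega : {omega : \<Delta>. omega <= mboundary X}. omega Int U ~= {}}" for omega omega' using that by simp
 have "finite {omega : {omega : \<Delta>. omega <= mboundary X}. omega Int U ~= {}}" (is "finite ?F")
 proof (cases "?F = {}")
  case False
  then obtain omega0 where omega0: "omega0 : ?F" by blast
  have "?F <= {omega0}" using one[OF _ omega0] by blast
  then show ?thesis by (rule finite_subset) simp
 next
  case True
  show ?thesis unfolding True by (rule finite.emptyI)
 qed
 then show "EX V. openin X V & x : V & finite {omega : {omega : \<Delta>. omega <= mboundary X}. omega Int V ~= {}}" using U by blast
qed

text \<open>A chart is connected, hence meets at most one of the selected leaves. A nonempty open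
  and closed set contains a whole component and with it the leaf selected there.\<close>

lemma leaf_per_component:
 assumes fol: "foliation1 X \<Delta>"
 obtains Sg where "Sg <= \<Delta>" "locally_finite_in X Sg"
  "!!C. openin X C ==> closedin X C ==> C Int \<Union>Sg = {} ==> C = {}"
proof -
 have cov: "\<Union>\<Delta> = topspace X" and ne: "{} ~: \<Delta>" and pc: "ALL L:\<Delta>. path_connectedin X L"
  using fol unfolding foliation1_def by simp_all
 let ?K = "connected_component_of_set X"
 \<comment> \<open>The choice is made from the component, so all of its points select the same
   leaf.\<close>
 define l where "l K = (SOME L. L : \<Delta> & L <= K)" for K
 have l: "l (?K x) : \<Delta>" "l (?K x) <= ?K x" if x: "x : topspace X" for x
 proof -
  obtain L where L: "L : \<Delta>" "x : L" using x cov by blast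
  have "connectedin X L" using pc L(1) path_connectedin_imp_connectedin by blast
  then have "L <= ?K x" using L(2) by (rule connected_component_of_maximal)
  then have "EX L. L : \<Delta> & L <= ?K x" using L(1) by blast
  from someI_ex[OF this] show "l (?K x) : \<Delta>" "l (?K x) <= ?K x" by (simp_all add: l_def)
 qed
 define Sg where "Sg = (%x. l (?K x)) ` topspace X"
 have sub: "Sg <= \<Delta>" using l(1) by (auto simp: Sg_def)
 moreover have "locally_finite_in X Sg"
  unfolding locally_finite_in_def
 proof (intro conjI ballI)
  show "\<Union>Sg <= topspace X" using sub cov by blast
  fix x assume x: "x : topspace X"
  obtain U Y phi g where U: "openin X U" "x : U" and Y: "Y = {-1<..<1::real} \<or> Y = {0..<1}"
   and gm: "homeomorphic_maps (subtopology X U) (top_of_set ({-1<..<1::real} \<times> Y)) phi g" using foliation1_charts[OF fol x] .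
  have "connected ({-1<..<1::real} \<times> Y)" using Y by (auto intro: connected_Times)
  then have "connected_space (top_of_set ({-1<..<1::real} \<times> Y))" by (simp only: connectedin_iff_connected[symmetric] connectedin_def)
  moreover have "subtopology X U homeomorphic_space top_of_set ({-1<..<1::real} \<times> Y)" using gm homeomorphic_space_def by blast
  ultimately have "connected_space (subtopology X U)" using homeomorphic_connected_space by blast
  then have "connectedin X U" using openin_subset[OF U(1)] by (simp add: connectedin_def)
  then have UK: "U <= ?K x" using U(2) by (rule connected_component_of_maximal)
  have "{L : Sg. L Int U ~= {}} <= {l (?K x)}"
  proof
   fix L assume "L : {L : Sg. L Int U ~= {}}"
   then obtain w z where w: "w : topspace X" "L = l (?K w)" "z : L" "z : U" by (auto simp: Sg_def)
   have "z : ?K w" "z : ?K x" using l(2)[OF w(1)] w UK by blast+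
   then have "connected_component_of X w z" "connected_component_of X x z" by simp_all
   then have "?K w = ?K z" "?K x = ?K z" by (simp_all add: connected_component_of_equiv)
   then show "L : {l (?K x)}" using w(2) by simp
  qed
  then have "finite {L : Sg. L Int U ~= {}}" by (rule finite_subset) simp
  then show "EX V. openin X V & x : V & finite {L : Sg. L Int V ~= {}}" using U by blast
 qed
 moreover have "C = {}" if C: "openin X C" "closedin X C" "C Int \<Union>Sg = {}" for C
 proof (rule ccontr)
  assume "C ~= {}"
  then obtain x where x: "x : C" by blast
  then have xX: "x : topspace X" using openin_subset[OF C(1)] by blast
  have "?K x <= C \<or> disjnt (?K x) C"
   by (rule connectedin_clopen_cases[OF connectedin_connected_component_of C(2,1)])
  moreover have "x : ?K x" using xX by (simp add: connected_component_of_refl)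
  ultimately have "?K x <= C" using x by (auto simp: disjnt_def)
  then have "l (?K x) <= C" using l(2)[OF xX] by blast
  moreover have "l (?K x) : Sg" using xX by (auto simp: Sg_def)
  ultimately have "l (?K x) = {}" using C(3) by blast
  then show False using l(1)[OF xX] ne by simp
 qed
 ultimately show thesis by (rule that)
qed

text \<open>The union of the cut leaves is closed, so a short piece of the transversal avoids it,
  and the lines through this piece are uncut.\<close>

lemma strip_avoiding_closed:
 assumes g: "proper_strip X \<Delta> (-1) 1 g" and cl: "closedin X (\<Union>Sg)" and 0: "g (0, 0) ~: \<Union>Sg"
 obtains eta where "0 < eta" "proper_strip X (\<Delta> - Sg) (-eta) eta g"
proof -
 have gc: "continuous_map (top_of_set (band {-1<..<1})) X g" and gi: "inj_on g (band {-1<..<1})"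
  and gL: "ALL t:{-1<..<1}. g ` (band {t}) : \<Delta>"
  and gK: "ALL K. compact K & K <= {-1<..<1} --> closedin X (g ` (band K))"
  using g unfolding proper_strip_def by simp_all
 have "continuous_on {-1<..<1} (%t. (0::real, t::real))" by (intro continuous_intros)
 then have c: "continuous_map (top_of_set {-1<..<1}) X (%t. g (0, t))" by (intro continuous_map_top_of_set_o[OF gc]) auto
 have "openin X (topspace X - \<Union>Sg)" using cl by blast
 from openin_continuous_map_preimage[OF c this]
 have "openin (top_of_set {-1<..<1}) {t : {-1<..<1}. g (0, t) : topspace X - \<Union>Sg}" by simp
 then have "open {t : {-1<..<1}. g (0, t) : topspace X - \<Union>Sg}" by (rule openin_open_trans) simp
 moreover have "g (0, 0) : topspace X" using continuous_map_image_subset_topspace[OF c] by auto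
 then have "0 : {t : {-1<..<1}. g (0, t) : topspace X - \<Union>Sg}" using 0 by simp
 ultimately obtain eta where eta: "eta > 0" "ball 0 eta <= {t : {-1<..<1}. g (0, t) : topspace X - \<Union>Sg}"
  using open_contains_ball by blast
 have sub: "{-eta<..<eta} <= {-1<..<1}" and av: "!!t. t : {-eta<..<eta} ==> g (0, t) ~: \<Union>Sg"
  using eta(2) by (auto simp: ball_eq_greaterThanLessThan)
 have sub2: "band {-eta<..<eta} <= band {-1<..<1}" using sub by blast
 have "proper_strip X (\<Delta> - Sg) (-eta) eta g"
  unfolding proper_strip_def
 proof (intro conjI ballI allI impI)
  show "-eta < eta" using eta(1) by simp
  show "continuous_map (top_of_set (band {-eta<..<eta})) X g" by (rule continuous_map_from_subtopology_mono[OF gc sub2])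
  show "inj_on g (band {-eta<..<eta})" by (rule inj_on_subset[OF gi sub2])
  show "g ` (band {t}) : \<Delta> - Sg" if t: "t : {-eta<..<eta}" for t
  proof
   show "g ` (band {t}) : \<Delta>" using gL sub t by blast
   show "g ` (band {t}) ~: Sg" using av[OF t] by blast
  qed
  show "closedin X (g ` (band K))" if "compact K & K <= {-eta<..<eta}" for K using gK sub that by blast
 qed
 with eta(1) show thesis by (rule that)
qed

theorem locally_finite_singular_leaves_imp_striped_atlas:
 assumes surf: "surface_with_boundary X" and fol: "foliation1 X \<Delta>"
  and line: "!!L. L : \<Delta> ==> subtopology X L homeomorphic_space euclideanreal"
  and cl: "!!L. L : \<Delta> ==> closedin X L"
  and sing: "locally_finite_in X (singular_leaves X \<Delta>)"
 shows "admits_striped_atlas X \<Delta>"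
proof -
 have cov: "\<Union>\<Delta> = topspace X" and dj: "ALL L:\<Delta>. ALL L':\<Delta>. L ~= L' --> L Int L' = {}"
  using fol unfolding foliation1_def by simp_all
 have disj: "L = L'" if "L : \<Delta>" "L' : \<Delta>" "L Int L' ~= {}" for L L' using dj that by blast
 \<comment> \<open>A boundary leaf may be regular by a one-sided model and still belong here; the
   local finiteness of such leaves comes from the charts.\<close>
 define Sg0 where "Sg0 = {omega : \<Delta>. \<nexists>U. foliated_model_nbhd X \<Delta> omega U {-1..1} {-1<..<1}}"
 obtain Sg1 where Sg1: "Sg1 <= \<Delta>" "locally_finite_in X Sg1"
  "!!C. openin X C ==> closedin X C ==> C Int \<Union>Sg1 = {} ==> C = {}"
 proof (rule leaf_per_component[OF fol])
  fix Sg assume a: "Sg <= \<Delta>" "locally_finite_in X Sg" "!!C. openin X C ==> closedin X C ==> C Int \<Union>Sg = {} ==> C = {}"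
  show thesis by (rule that[OF a])
 qed
 define Sg where "Sg = Sg0 Un Sg1"
 have "Sg0 <= singular_leaves X \<Delta> Un {omega : \<Delta>. omega <= mboundary X}"
  by (auto simp: Sg0_def singular_leaves_def regular_leaf_def)
 then have "locally_finite_in X Sg0"
  using locally_finite_in_Un[OF sing boundary_leaves_locally_finite[OF fol]] locally_finite_in_subset by blast
 then have lf: "locally_finite_in X Sg" unfolding Sg_def using Sg1(2) by (rule locally_finite_in_Un)
 have Sg: "Sg <= \<Delta>" using Sg1(1) by (auto simp: Sg_def Sg0_def)
 have clS: "closedin X (\<Union>Sg)" using lf cl Sg by (intro closedin_locally_finite_Union) auto
 have dS: "L Int \<Union>Sg = {}" if L: "L : \<Delta> - Sg" for L
 proof -
  have "L Int L' = {}" if "L' : Sg" for L' using disj[of L L'] L that Sg by blast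
  then show ?thesis by blast
 qed
 have fam: "cut_strip_family X (\<Delta> - Sg)"
 proof
  show "surface_with_boundary X" by (rule surf)
  show "L = L'" if "L : \<Delta> - Sg" "L' : \<Delta> - Sg" "L Int L' ~= {}" for L L' using disj that by blast
  fix C assume C: "openin X C" "closedin X C" "C <= \<Union>(\<Delta> - Sg)"
  have "C Int \<Union>Sg = {}" using C(3) dS by blast
  then have "C Int \<Union>Sg1 = {}" unfolding Sg_def by blast
  then show "C = {}" by (rule Sg1(3)[OF C(1,2)])
 qed
 interpret cut_strip_family X "\<Delta> - Sg" by (rule fam)
 have arcs: "EX B. strip_arc B & L <= B" if L: "L : \<Delta> - Sg" for L
 proof -
  obtain U where U: "foliated_model_nbhd X \<Delta> L U {-1..1} {-1<..<1}" using L by (auto simp: Sg_def Sg0_def)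
  obtain g where g: "proper_strip X \<Delta> (-1) 1 g" "g ` (band {0}) = L" using regular_leaf_proper_strip[OF U] .
  have "g (0, 0) : L" using g(2) by blast
  then have g0: "g (0, 0) ~: \<Union>Sg" using dS[OF L] by blast
  obtain eta where eta: "0 < eta" "proper_strip X (\<Delta> - Sg) (-eta) eta g" using strip_avoiding_closed[OF g(1) clS g0] .
  have "band {0} <= band {-eta<..<eta}" using eta(1) by auto
  then have "L <= g ` (band {-eta<..<eta})" using g(2) by blast
  then show ?thesis using strip_arcI[OF eta(2)] by blast
 qed
 show ?thesis by (rule locally_finite_cut_admits_striped_atlas[OF surf fol line cl Sg lf fam arcs])
qed

section \<open>Striped atlases have locally finite singular leaves\<close>

locale atlas_surface =
 fixes X :: "'a topology" and \<Delta> :: "'a set set" and \<Lambda> :: "nat set" and S :: "nat => (real \<times> real) set"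
  and u v :: "nat => real" and q :: "nat \<times> (real \<times> real) => 'a" and \<Gamma> :: "nat set"
  and Xg Yg :: "nat => nat \<times> (real \<times> real) set"
 assumes surf: "surface_with_boundary X" and atlas: "striped_atlas X \<Lambda> S u v q \<Gamma> Xg Yg"
  and canonical: "atlas_canonical_foliation \<Lambda> S u v q = \<Delta>"
  and leaf_nonempty: "{} ~: \<Delta>"
  and leaf_disjoint: "!!L L'. L : \<Delta> ==> L' : \<Delta> ==> L Int L' ~= {} ==> L = L'"
begin

abbreviation inner :: "nat => (real \<times> real) set" where "inner l \<equiv> band {u l<..<v l}"
abbreviation bd :: "nat => (real \<times> real) set" where "bd l \<equiv> strip_boundary (S l) (u l) (v l)"
abbreviation bints :: "nat => (real \<times> real) set set" where "bints l \<equiv> boundary_intervals (S l) (u l) (v l)"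
definition glued :: "(nat \<times> (real \<times> real)) set" where "glued = (\<Union>gamma\<in>\<Gamma>. sheet (Xg gamma) Un sheet (Yg gamma))"
text \<open>The inward vertical direction at a boundary point: upwards from the lower edge,
  downwards from the upper one.\<close>

definition side :: "nat => real \<times> real => real" where "side l w = (if snd w = u l then 1 else -1)"

lemma strip:
 assumes "l : \<Lambda>"
 shows "u l < v l" "inner l <= S l" "S l <= band {u l..v l}" "openin (top_of_set (band {u l..v l})) (S l)"
 using atlas assms unfolding striped_atlas_def is_strip_def by auto

lemma q_cont: "l : \<Lambda> ==> continuous_map (top_of_set (S l)) X (%p. q (l, p))"
 using atlas unfolding striped_atlas_def by simp

lemma q_openin:
 assumes "A <= topspace X" "!!l. l : \<Lambda> ==> openin (top_of_set (S l)) {p : S l. q (l, p) : A}"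
 shows "openin X A"
 using atlas assms unfolding striped_atlas_def by simp

lemma q_in: "l : \<Lambda> ==> p : S l ==> q (l, p) : topspace X"
 using continuous_map_image_subset_topspace[OF q_cont] by (auto simp: image_subset_iff)

lemma q_inj: "inj_on q (Sigma \<Lambda> S - glued)" using atlas unfolding striped_atlas_def glued_def by simp

lemma bint_subset: "J : bints l ==> J <= bd l"
 using connected_components_of_subset[of J "top_of_set (bd l)"] by (simp add: boundary_intervals_def)

lemma bint_eq: "J : bints l ==> J' : bints l ==> w : J ==> w : J' ==> J = J'"
 using connected_components_of_disjoint[of J "top_of_set (bd l)" J'] by (auto simp: boundary_intervals_def disjnt_def)

lemma bint_exists: "w : bd l ==> EX J:bints l. w : J"
 using Union_connected_components_of[of "top_of_set (bd l)"] unfolding boundary_intervals_def by auto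

lemma bd_S: "bd l <= S l" by (auto simp: strip_boundary_def)

lemma bd_level: "w : bd l ==> snd w = u l \<or> snd w = v l" by (auto simp: strip_boundary_def)

lemma bd_inner: "w : bd l ==> w ~: inner l" by (auto simp: strip_boundary_def)

lemma S_cases: "l : \<Lambda> ==> p : S l ==> p : inner l \<or> p : bd l"
 using strip(3)[of l] by (cases p) (auto simp: strip_boundary_def)

text \<open>On the boundary the height takes only the values \<open>u l\<close> and
  \<open>v l\<close>; a connected set with both would also have a point at their mean.\<close>

lemma bint_level:
 assumes J: "J : bints l" and w: "w : J" "w' : J"
 shows "snd w = snd w'"
proof (rule ccontr)
 assume ne: "snd w ~= snd w'"
 have "connectedin (top_of_set (bd l)) J" using J by (simp add: boundary_intervals_def connectedin_connected_components_of)
 then have "connected J" by (simp add: connectedin_subtopology)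
 then have con: "connected (snd ` J)" by (intro connected_continuous_image continuous_intros)
 have lv: "t = u l \<or> t = v l" if "t : snd ` J" for t using that bint_subset[OF J] bd_level by blast
 define a b where "a = min (snd w) (snd w')" and "b = max (snd w) (snd w')"
 have ab: "a : snd ` J" "b : snd ` J" "a < b" using w ne by (auto simp: a_def b_def min_def max_def)
 then have "(a + b) / 2 : snd ` J" by (intro connectedD_interval[OF con ab(1,2)]) auto
 then show False using lv[OF ab(1)] lv[OF ab(2)] lv[of "(a + b) / 2"] ab(3) by auto
qed

lemma glued_cases:
 assumes "(l, w) : glued"
 obtains gamma where "gamma : \<Gamma>" "l : \<Lambda>" "w : bd l" "(l, w) : sheet (Xg gamma) Un sheet (Yg gamma)"
  "q (l, w) : q ` sheet (Xg gamma)"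
proof -
 obtain gamma where gamma: "gamma : \<Gamma>" "(l, w) : sheet (Xg gamma) Un sheet (Yg gamma)" using assms unfolding glued_def by blast
 have g: "is_bint \<Lambda> S u v (Xg gamma)" "is_bint \<Lambda> S u v (Yg gamma)" "q ` sheet (Xg gamma) = q ` sheet (Yg gamma)"
  using atlas gamma(1) unfolding striped_atlas_def by simp_all
 have "l : \<Lambda> & w : bd l"
 proof (cases "(l, w) : sheet (Xg gamma)")
  case True
  then show ?thesis using g(1) bint_subset by (auto simp: sheet_def is_bint_def)
 next
  case False
  then have "(l, w) : sheet (Yg gamma)" using gamma(2) by blast
  then show ?thesis using g(2) bint_subset by (auto simp: sheet_def is_bint_def)
 qed
 moreover have "q (l, w) : q ` sheet (Xg gamma)" using gamma(2) g(3) by blast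
 ultimately show thesis using that gamma by blast
qed

lemma q_inj_inner:
 assumes "l : \<Lambda>" "l' : \<Lambda>" "p : inner l" "p' : S l'" "(l', p') ~: glued" "q (l, p) = q (l', p')"
 shows "l = l' & p = p'"
proof -
 have "(l, p) ~: glued"
 proof
  assume "(l, p) : glued"
  then have "p : bd l" by (rule glued_cases)
  then show False using bd_inner assms(3) by blast
 qed
 then have "(l, p) = (l', p')" using assms strip(2)[OF assms(1)] by (intro inj_onD[OF q_inj]) auto
 then show ?thesis by simp
qed

lemma q_inner:
 assumes l: "l : \<Lambda>"
 shows "continuous_map (top_of_set (inner l)) X (%p. q (l, p))" "inj_on (%p. q (l, p)) (inner l)"
proof -
 show "continuous_map (top_of_set (inner l)) X (%p. q (l, p))"
  by (rule continuous_map_from_subtopology_mono[OF q_cont[OF l] strip(2)[OF l]])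
 show "inj_on (%p. q (l, p)) (inner l)"
 proof (rule inj_onI)
  fix p p' assume p: "p : inner l" "p' : inner l" "q (l, p) = q (l, p')"
  have "(l, p') ~: glued"
  proof
   assume "(l, p') : glued"
   then have "p' : bd l" by (rule glued_cases)
   then show False using bd_inner p(2) by blast
  qed
  then show "p = p'" using q_inj_inner[OF l l p(1) _ _ p(3)] strip(2)[OF l] p(2) by blast
 qed
qed

lemma q_open_inner:
 assumes l: "l : \<Lambda>" and V: "open V" "V <= inner l"
 shows "openin X ((%p. q (l, p)) ` V)"
 by (rule surface_invariance_of_domain[OF surf V(1) continuous_map_from_subtopology_mono[OF q_inner(1)[OF l] V(2)] inj_on_subset[OF q_inner(2)[OF l] V(2)]])

lemma side_cases: "side l w = 1 \<or> side l w = -1" by (simp add: side_def)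

lemma half_box:
 assumes l: "l : \<Lambda>" and w: "w : bd l"
 obtains eta where "eta > 0" "eta < v l - u l"
  "!!x s. \<bar>x - fst w\<bar> <= eta ==> 0 <= s ==> s <= eta ==> (x, snd w + side l w * s) : S l"
  "!!x s. \<bar>x - fst w\<bar> <= eta ==> 0 < s ==> s <= eta ==> (x, snd w + side l w * s) : inner l"
proof -
 obtain T where T: "open T" "S l = (band {u l..v l}) Int T" using strip(4)[OF l] by (auto simp: openin_open)
 have "w : T" using w bd_S T(2) by blast
 then obtain r where r: "r > 0" "ball w r <= T" using T(1) open_contains_ball by blast
 define eta where "eta = min (r / 3) ((v l - u l) / 2)"
 have eta: "eta > 0" "eta <= r / 3" "eta < v l - u l" using r(1) strip(1)[OF l] by (auto simp: eta_def min_def)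
 have lv: "snd w = u l & side l w = 1 \<or> snd w = v l & side l w = -1"
  using bd_level[OF w] strip(1)[OF l] by (auto simp: side_def)
 show thesis
 proof (rule that[OF eta(1,3)])
  fix x s assume x: "\<bar>x - fst w\<bar> <= eta" and s: "0 <= s" "s <= eta"
  have "dist w (x, snd w + side l w * s) <= \<bar>x - fst w\<bar> + \<bar>side l w * s\<bar>"
   using sqrt_sum_squares_le_sum_abs[of "fst w - x" "- (side l w * s)"]
   by (cases w) (simp add: dist_Pair_Pair dist_real_def abs_minus_commute)
  also have "\<bar>side l w * s\<bar> = s" using s side_cases[of l w] by auto
  finally have "(x, snd w + side l w * s) : T" using x s eta(2) r by (intro subsetD[OF r(2)]) simp
  moreover have "snd w + side l w * s : {u l..v l}" using lv s eta(3) strip(1)[OF l] by auto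
  ultimately show "(x, snd w + side l w * s) : S l" using T(2) by simp
 next
  fix x s assume x: "\<bar>x - fst w\<bar> <= eta" and s: "0 < s" "s <= eta"
  show "(x, snd w + side l w * s) : inner l" using lv s eta(3) strip(1)[OF l] by auto
 qed
qed

lemma base_segment:
 assumes l: "l : \<Lambda>" and J: "J : bints l" "w : J"
  and eta: "!!x s. \<bar>x - fst w\<bar> <= eta ==> 0 <= s ==> s <= eta ==> (x, snd w + side l w * s) : S l"
  and x: "\<bar>x - fst w\<bar> <= eta"
 shows "(x, snd w) : J"
proof -
 let ?A = "{fst w - eta..fst w + eta} \<times> {snd w}"
 have eta0: "0 <= eta" using x by linarith
 have wb: "w : bd l" using J bint_subset by blast
 have "?A <= bd l"
 proof
  fix p assume "p : ?A"
  then have p: "\<bar>fst p - fst w\<bar> <= eta" "snd p = snd w" by auto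
  have "(fst p, snd w) : S l" using eta[OF p(1) order_refl eta0] by simp
  moreover have "(fst p, snd w) = p" using p(2) by (simp add: prod_eq_iff)
  ultimately show "p : bd l" using p(2) bd_level[OF wb] by (simp add: strip_boundary_def mem_Times_iff)
 qed
 moreover have "connected ?A" by (intro connected_Times) auto
 ultimately have "connectedin (top_of_set (bd l)) ?A" by (simp add: connectedin_subtopology)
 moreover have "\<not> disjnt J ?A"
 proof -
  have "w : ?A" using eta0 by (cases w) auto
  then show ?thesis using J(2) by (auto simp: disjnt_def)
 qed
 ultimately have "?A <= J" using J(1) connected_components_of_maximal[of J "top_of_set (bd l)" ?A]
  by (simp add: boundary_intervals_def)
 moreover have "(x, snd w) : ?A" using x by (auto simp: abs_le_iff)
 ultimately show ?thesis by blast
qed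

text \<open>Moving inwards vertically from a boundary point stays in the open strip and, for short
  distances, in the preimage of the neighbourhood.\<close>

lemma inner_approach:
 assumes l: "l : \<Lambda>" and w: "w : bd l" and N: "openin X N" "q (l, w) : N" and delta: "delta > 0"
 obtains w' where "w' : inner l" "dist w' w < delta" "q (l, w') : N"
proof -
 have "openin (top_of_set (S l)) {p : S l. q (l, p) : N}"
  using openin_continuous_map_preimage[OF q_cont[OF l] N(1)] by simp
 then obtain T where T: "open T" "{p : S l. q (l, p) : N} = S l Int T" by (auto simp: openin_open)
 have "w : T" using T(2) w bd_S N(2) by blast
 then obtain r where r: "r > 0" "ball w r <= T" using T(1) open_contains_ball by blast
 obtain eta where eta: "eta > 0" "!!x s. \<bar>x - fst w\<bar> <= eta ==> 0 < s ==> s <= eta ==> (x, snd w + side l w * s) : inner l"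
  using half_box[OF l w] by metis
 define s where "s = min eta (min (r / 2) (delta / 2))"
 have s: "0 < s" "s <= eta" "s < r" "s < delta" using eta(1) r(1) delta by (auto simp: s_def)
 let ?w = "(fst w, snd w + side l w * s)"
 have d: "dist ?w w = s" using s(1) side_cases[of l w] by (cases w) (auto simp: dist_Pair_Pair dist_real_def)
 have w': "?w : inner l" using eta(1) s by (intro eta(2)) auto
 have "?w : T" using r(2) d s(3) by (auto simp: dist_commute)
 then have "q (l, ?w) : N" using T(2) w' strip(2)[OF l] by blast
 then show thesis using that[OF w'] d s(4) by simp
qed

text \<open>The atlas gives injectivity only off the glued sheets. If \<open>p'\<close> is a
  boundary point, it is approached by inner points whose images enter a small open neighbourhood of
  \<open>q (l, p)\<close>. Injectivity on inner points then puts them near \<open>p\<close>,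
  although they are near \<open>p'\<close>.\<close>

lemma inner_unique:
 assumes l: "l : \<Lambda>" "l' : \<Lambda>" and p: "p : inner l" "p' : S l'" and eq: "q (l, p) = q (l', p')"
 shows "l = l' & p = p'"
proof (cases "p' : inner l'")
 case True
 have "(l', p') ~: glued" using glued_cases bd_inner True by metis
 then show ?thesis using q_inj_inner[OF l p _ eq] by blast
next
 case False
 then have b: "p' : bd l'" using S_cases[OF l(2) p(2)] by blast
 have "p ~= p'" if "l = l'" using False p(1) that by blast
 \<comment> \<open>Half of this distance keeps the neighbourhoods of the two points apart; for
   different strips any positive number will do.\<close>
 define d where "d = (if l = l' then dist p p' else 1)"
 have d: "d > 0" using \<open>l = l' ==> p ~= p'\<close> by (simp add: d_def)
 let ?V = "inner l Int ball p (d / 2)"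
 have "open ?V" by (intro open_Int open_Times open_ball open_UNIV open_greaterThanLessThan)
 then have oV: "openin X ((%p. q (l, p)) ` ?V)" by (rule q_open_inner[OF l(1)]) blast
 have "p : ?V" using p(1) d by simp
 then have "q (l, p) : (%p. q (l, p)) ` ?V" by (rule imageI)
 then have qV: "q (l', p') : (%p. q (l, p)) ` ?V" using eq by simp
 have d2: "d / 2 > 0" using d by simp
 obtain w where w: "w : inner l'" "dist w p' < d / 2" "q (l', w) : (%p. q (l, p)) ` ?V"
  using inner_approach[OF l(2) b oV qV d2] .
 obtain w1 where w1: "w1 : inner l" "dist p w1 < d / 2" "q (l', w) = q (l, w1)" using w(3) by auto
 have "(l, w1) ~: glued" using glued_cases bd_inner w1(1) by metis
 then have "l' = l & w = w1" using q_inj_inner[OF l(2,1) w(1) _ _ w1(3)] strip(2)[OF l(1)] w1(1) by blast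
 then have "d = dist p p'" "dist p p' < d" using w(2) w1(2) dist_triangle[of p p' w1] by (auto simp: d_def)
 then show ?thesis by simp
qed

lemma dist_box:
 assumes "\<bar>x - fst w\<bar> <= mu" "\<bar>y - snd w\<bar> <= mu"
 shows "dist (x, y) (w :: real \<times> real) <= 2 * mu"
 using sqrt_sum_squares_le_sum_abs[of "x - fst w" "y - snd w"] assms
 by (cases w) (simp add: dist_Pair_Pair dist_real_def)

text \<open>Two half boxes, one at each glued sheet, are joined along the identified segment to an
  injective map \<open>F\<close> of a square, whose image is open by invariance of domain. A
  boundary point mapped into this image is a limit of inner points mapped into it, and these lie in
  two closed half boxes; hence the point lies on one of the two sheets.\<close>

lemma glued_neighbourhood:
 assumes gamma: "gamma : \<Gamma>" and y: "y : q ` sheet (Xg gamma)"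
 shows "EX N. openin X N & y : N & (ALL l:\<Lambda>. ALL w:bd l. q (l, w) : N --> (l, w) : sheet (Xg gamma) Un sheet (Yg gamma))"
proof -
 define l1 J1 l2 J2 where "l1 = fst (Xg gamma)" and "J1 = snd (Xg gamma)" and "l2 = fst (Yg gamma)" and "J2 = snd (Yg gamma)"
 have sh: "sheet (Xg gamma) = {l1} \<times> J1" "sheet (Yg gamma) = {l2} \<times> J2" by (simp_all add: sheet_def l1_def J1_def l2_def J2_def)
 have "is_bint \<Lambda> S u v (Xg gamma)" "is_bint \<Lambda> S u v (Yg gamma)" and qeq: "q ` sheet (Xg gamma) = q ` sheet (Yg gamma)"
  and emb1: "embedding_map (top_of_set J1) X (%p. q (l1, p))" and emb2: "embedding_map (top_of_set J2) X (%p. q (l2, p))"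
  using atlas gamma unfolding striped_atlas_def l1_def J1_def l2_def J2_def by simp_all
 then have l: "l1 : \<Lambda>" "l2 : \<Lambda>" and J: "J1 : bints l1" "J2 : bints l2"
  by (simp_all add: is_bint_def l1_def J1_def l2_def J2_def)
 have XY: "Xg gamma ~= Yg gamma" using atlas gamma unfolding striped_atlas_def by blast
 obtain w1 where w1: "w1 : J1" "y = q (l1, w1)" using y sh by auto
 have "y : q ` sheet (Yg gamma)" using y qeq by simp
 then obtain w2 where w2: "w2 : J2" "y = q (l2, w2)" using sh by auto
 have wb: "w1 : bd l1" "w2 : bd l2" using w1 w2 J bint_subset by blast+
 have ne: "w1 ~= w2" if "l1 = l2"
 proof
  assume "w1 = w2"
  then have "J1 = J2" using bint_eq[of J1 l1 J2 w1] J w1 w2 that by simp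
  then show False using XY that by (simp add: l1_def J1_def l2_def J2_def prod_eq_iff)
 qed
 define e1 e2 where "e1 = side l1 w1" and "e2 = side l2 w2"
 have e: "e1 = 1 \<or> e1 = -1" "e2 = 1 \<or> e2 = -1" using side_cases by (simp_all add: e1_def e2_def)
 obtain eta1 where eta1: "eta1 > 0" "eta1 < v l1 - u l1"
  and b1: "!!x s. \<bar>x - fst w1\<bar> <= eta1 ==> 0 <= s ==> s <= eta1 ==> (x, snd w1 + e1 * s) : S l1"
  and i1: "!!x s. \<bar>x - fst w1\<bar> <= eta1 ==> 0 < s ==> s <= eta1 ==> (x, snd w1 + e1 * s) : inner l1"
 proof (rule half_box[OF l(1) wb(1)])
  fix eta assume a: "eta > 0" "eta < v l1 - u l1"
   "!!x s. \<bar>x - fst w1\<bar> <= eta ==> 0 <= s ==> s <= eta ==> (x, snd w1 + side l1 w1 * s) : S l1"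
   "!!x s. \<bar>x - fst w1\<bar> <= eta ==> 0 < s ==> s <= eta ==> (x, snd w1 + side l1 w1 * s) : inner l1"
  show thesis by (rule that[OF a[folded e1_def]])
 qed
 obtain eta2 where eta2: "eta2 > 0" "eta2 < v l2 - u l2"
  and b2: "!!x s. \<bar>x - fst w2\<bar> <= eta2 ==> 0 <= s ==> s <= eta2 ==> (x, snd w2 + e2 * s) : S l2"
  and i2: "!!x s. \<bar>x - fst w2\<bar> <= eta2 ==> 0 < s ==> s <= eta2 ==> (x, snd w2 + e2 * s) : inner l2"
 proof (rule half_box[OF l(2) wb(2)])
  fix eta assume a: "eta > 0" "eta < v l2 - u l2"
   "!!x s. \<bar>x - fst w2\<bar> <= eta ==> 0 <= s ==> s <= eta ==> (x, snd w2 + side l2 w2 * s) : S l2"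
   "!!x s. \<bar>x - fst w2\<bar> <= eta ==> 0 < s ==> s <= eta ==> (x, snd w2 + side l2 w2 * s) : inner l2"
  show thesis by (rule that[OF a[folded e2_def]])
 qed
 have s1: "(x, snd w1) : J1" if "\<bar>x - fst w1\<bar> <= eta1" for x
  by (rule base_segment[OF l(1) J(1) w1(1) b1[unfolded e1_def] that])
 have s2: "(x, snd w2) : J2" if "\<bar>x - fst w2\<bar> <= eta2" for x
  by (rule base_segment[OF l(2) J(2) w2(1) b2[unfolded e2_def] that])
 \<comment> \<open>If both sheets bound the same strip, the half boxes stay within
   \<open>2 * mu\<close> of \<open>w1\<close> and \<open>w2\<close>; a fifth of the distance makes
   them disjoint.\<close>
 define mu where "mu = (if l1 = l2 then dist w1 w2 / 5 else 1)"
 have mu: "mu > 0" using ne by (simp add: mu_def)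
 have i1': "inj_on (%p. q (l1, p)) J1" using emb1 by (auto simp: embedding_map_def homeomorphic_map_def intro: homeomorphic_imp_injective_map[of "top_of_set J1", simplified])
 have J2X: "(%p. q (l2, p)) ` J2 <= topspace X" using q_in[OF l(2)] bint_subset[OF J(2)] bd_S by blast
 obtain k where k: "homeomorphic_maps (top_of_set J2) (subtopology X ((%p. q (l2, p)) ` J2)) (%p. q (l2, p)) k"
  using emb2 homeomorphic_map_maps unfolding embedding_map_def by fastforce
 have kc: "continuous_map (subtopology X ((%p. q (l2, p)) ` J2)) (top_of_set J2) k"
  and k1: "!!p. p : J2 ==> k (q (l2, p)) = p" and k2: "!!z. z : (%p. q (l2, p)) ` J2 ==> q (l2, k z) = z"
  using k J2X by (auto simp: homeomorphic_maps_def)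
 define R where "R = {-eta1..eta1}"
 define beta where "beta x = q (l1, (fst w1 + x, snd w1))" for x
 have betaJ: "(fst w1 + x, snd w1) : J1" if "x : R" for x using that by (intro s1) (auto simp: R_def)
 have betaY: "beta x : (%p. q (l2, p)) ` J2" if x: "x : R" for x
 proof -
  have "beta x : q ` sheet (Xg gamma)" using betaJ[OF x] unfolding beta_def sh by blast
  then have "beta x : q ` ({l2} \<times> J2)" unfolding qeq sh(2) .
  then show ?thesis by blast
 qed
 have "continuous_map (top_of_set R) X beta"
  unfolding beta_def
 proof (rule continuous_map_top_of_set_o[OF q_cont[OF l(1)]])
  show "continuous_on R (%x. (fst w1 + x, snd w1))" by (intro continuous_intros)
  show "(%x. (fst w1 + x, snd w1)) ` R <= S l1" using betaJ bint_subset[OF J(1)] bd_S by blast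
 qed
 then have betac: "continuous_map (top_of_set R) (subtopology X ((%p. q (l2, p)) ` J2)) beta"
  using betaY by (auto simp: continuous_map_in_subtopology)
 \<comment> \<open>The identification of the two sheets: the point at offset \<open>x\<close> on the
   first is glued to \<open>kappa x\<close> on the second.\<close>
 define kappa where "kappa x = k (beta x)" for x
 have "continuous_map (top_of_set R) (top_of_set J2) (k \<circ> beta)" by (rule continuous_map_compose[OF betac kc])
 then have kappac: "continuous_on R kappa" and kappaJ: "!!x. x : R ==> kappa x : J2"
  by (auto simp: continuous_map_in_subtopology kappa_def[abs_def] o_def)
 have qkappa: "q (l2, kappa x) = beta x" if "x : R" for x unfolding kappa_def by (rule k2[OF betaY[OF that]])
 have beta0: "beta 0 = y" using w1(2) by (simp add: beta_def)
 have kappa0: "kappa 0 = w2" using k1[OF w2(1)] w2(2) beta0 by (simp add: kappa_def)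
 have betainj: "x = x'" if x: "x : R" "x' : R" "beta x = beta x'" for x x'
 proof -
  have "(fst w1 + x, snd w1) = (fst w1 + x', snd w1)"
   by (rule inj_onD[OF i1' _ betaJ[OF x(1)] betaJ[OF x(2)]]) (use x(3) in \<open>simp add: beta_def\<close>)
  then show ?thesis by simp
 qed
 define tau where "tau x = fst (kappa x)" for x
 have kappatau: "kappa x = (tau x, snd w2)" if "x : R" for x
  using bint_level[OF J(2) kappaJ[OF that] w2(1)] by (simp add: tau_def prod_eq_iff)
 have tauc: "continuous_on R tau" unfolding tau_def by (intro continuous_on_fst kappac)
 have tauinj: "x = x'" if x: "x : R" "x' : R" "tau x = tau x'" for x x'
 proof -
  have "kappa x = kappa x'" using kappatau x by simp
  then have "beta x = beta x'" using qkappa[OF x(1)] qkappa[OF x(2)] by simp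
  then show ?thesis by (rule betainj[OF x(1,2)])
 qed
 define nu where "nu = min eta2 mu"
 have nu: "nu > 0" "nu <= eta2" "nu <= mu" using eta2(1) mu by (auto simp: nu_def)
 have "0 : R" using eta1(1) by (simp add: R_def)
 then obtain d where d: "d > 0" "ALL x:R. dist x 0 < d --> dist (tau x) (tau 0) < nu"
  using tauc nu(1) unfolding continuous_on_iff by blast
 define eta where "eta = min (min eta1 d) nu"
 have eta: "eta > 0" "eta <= eta1" "eta <= d" "eta <= nu" using eta1(1) d(1) nu(1) by (auto simp: eta_def)
 have taunear: "\<bar>tau x - fst w2\<bar> <= nu" and xR: "x : R" if x: "\<bar>x\<bar> < eta" for x
 proof -
  show xR: "x : R" using x eta(2) by (auto simp: R_def)
  have "dist x 0 < d" using x eta(3) by (simp add: dist_real_def)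
  then have "dist (tau x) (tau 0) < nu" using d(2) xR by blast
  moreover have "tau 0 = fst w2" by (simp add: tau_def kappa0)
  ultimately show "\<bar>tau x - fst w2\<bar> <= nu" by (simp add: dist_real_def)
 qed
 define D where "D = {-eta<..<eta} \<times> {-eta<..<eta}"
 define P1 where "P1 p = (fst w1 + fst p, snd w1 + e1 * snd p)" for p :: "real \<times> real"
 \<comment> \<open>The lower half of the square runs into the second strip, whence the sign of
   \<open>snd p\<close>.\<close>
 define P2 where "P2 p = (tau (fst p), snd w2 + e2 * (- snd p))" for p :: "real \<times> real"
 define F where "F p = (if 0 <= snd p then q (l1, P1 p) else q (l2, P2 p))" for p
 have D: "\<bar>fst p\<bar> < eta" "\<bar>snd p\<bar> < eta" if "p : D" for p using that by (auto simp: D_def)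
 have P1S: "P1 p : S l1" if p: "p : D" "0 <= snd p" for p unfolding P1_def using D[OF p(1)] p(2) eta(2) by (intro b1) auto
 have P1I: "P1 p : inner l1" if p: "p : D" "0 < snd p" for p unfolding P1_def using D[OF p(1)] p(2) eta(2) by (intro i1) auto
 have P2S: "P2 p : S l2" if p: "p : D" "snd p <= 0" for p
  unfolding P2_def using D[OF p(1)] taunear[OF D(1)[OF p(1)]] p(2) eta(4) nu(2) by (intro b2) auto
 have P2I: "P2 p : inner l2" if p: "p : D" "snd p < 0" for p
  unfolding P2_def using D[OF p(1)] taunear[OF D(1)[OF p(1)]] p(2) eta(4) nu(2) by (intro i2) auto
 have agree: "q (l1, P1 p) = q (l2, P2 p)" if p: "p : D" "snd p = 0" for p
 proof -
  have xr: "fst p : R" by (rule xR[OF D(1)[OF p(1)]])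
  have "q (l1, P1 p) = beta (fst p)" using p(2) by (simp add: P1_def beta_def)
  also have "\<dots> = q (l2, kappa (fst p))" using qkappa[OF xr] by simp
  also have "kappa (fst p) = P2 p" using kappatau[OF xr] p(2) by (simp add: P2_def)
  finally show ?thesis .
 qed
 have Fc: "continuous_map (top_of_set D) X F"
  unfolding F_def
 proof (rule continuous_map_cases_le)
  show "continuous_map (top_of_set D) euclideanreal (%x. 0)" by simp
  show "continuous_map (top_of_set D) euclideanreal snd" by (simp add: continuous_on_snd)
  show "q (l1, P1 p) = q (l2, P2 p)" if "p : topspace (top_of_set D)" "0 = snd p" for p using agree that by simp
  have "continuous_map (top_of_set {p : D. 0 <= snd p}) X (%p. q (l1, P1 p))"
  proof (rule continuous_map_top_of_set_o[OF q_cont[OF l(1)]])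
   show "continuous_on {p : D. 0 <= snd p} P1" unfolding P1_def by (intro continuous_intros)
  qed (use P1S in blast)
  moreover have "D Int {p : D. 0 <= snd p} = {p : D. 0 <= snd p}" by blast
  ultimately show "continuous_map (subtopology (top_of_set D) {p : topspace (top_of_set D). 0 <= snd p}) X (%p. q (l1, P1 p))"
   by (simp add: subtopology_subtopology)
  have "continuous_map (top_of_set {p : D. snd p <= 0}) X (%p. q (l2, P2 p))"
  proof (rule continuous_map_top_of_set_o[OF q_cont[OF l(2)]])
   show "continuous_on {p : D. snd p <= 0} P2"
    unfolding P2_def by (intro continuous_on_Pair continuous_intros continuous_on_compose2[OF tauc]) (use xR D(1) in blast)
  qed (use P2S in blast)
  moreover have "D Int {p : D. snd p <= 0} = {p : D. snd p <= 0}" by blast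
  ultimately show "continuous_map (subtopology (top_of_set D) {p : topspace (top_of_set D). snd p <= 0}) X (%p. q (l2, P2 p))"
   by (simp add: subtopology_subtopology)
 qed
 have apart: False if p: "p : D" "p' : D" "0 <= snd p'" "snd p < 0" and eq: "q (l2, P2 p) = q (l1, P1 p')" for p p'
 proof -
  have ll: "l2 = l1" "P2 p = P1 p'" using inner_unique[OF l(2,1) P2I[OF p(1,4)] P1S[OF p(2,3)] eq] by simp_all
  have "\<bar>e1 * snd p'\<bar> <= mu" "\<bar>e2 * - snd p\<bar> <= mu" using e D[OF p(1)] D[OF p(2)] eta(4) nu(3) by auto
  moreover have "\<bar>fst p'\<bar> <= mu" "\<bar>tau (fst p) - fst w2\<bar> <= mu"
   using D(1)[OF p(2)] taunear[OF D(1)[OF p(1)]] eta(4) nu(3) by linarith+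
  ultimately have "dist (fst w1 + fst p', snd w1 + e1 * snd p') w1 <= 2 * mu" "dist (tau (fst p), snd w2 + e2 * - snd p) w2 <= 2 * mu"
   by (intro dist_box; simp)+
  then have "dist (P1 p') w1 <= 2 * mu" "dist (P2 p) w2 <= 2 * mu" by (simp_all only: P1_def P2_def)
  then have "dist w1 w2 <= 4 * mu" using dist_triangle2[of w1 w2 "P1 p'"] ll(2) by (simp add: dist_commute)
  moreover have "dist w1 w2 = 5 * mu" using ll by (simp add: mu_def)
  ultimately show False using mu by simp
 qed
 have P1_eq: "p = p'" if "P1 p = P1 p'" for p p'
  using that e by (auto simp: P1_def prod_eq_iff)
 have P2_eq: "tau (fst p) = tau (fst p') & snd p = snd p'" if "P2 p = P2 p'" for p p'
  using that e by (auto simp: P2_def)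
 have Fi': "p = p'" if p: "p : D" "p' : D" "snd p <= snd p'" and eq: "F p = F p'" for p p'
 proof (cases "snd p < 0")
  case True
  then have Fp: "F p = q (l2, P2 p)" by (simp add: F_def)
  show ?thesis
  proof (cases "0 <= snd p'")
   case True
   then show ?thesis using apart[OF p(1,2) True \<open>snd p < 0\<close>] eq Fp by (simp add: F_def)
  next
   case False
   then have "q (l2, P2 p) = q (l2, P2 p')" using eq Fp by (simp add: F_def)
   then have "P2 p = P2 p'" using inner_unique[OF l(2,2) P2I[OF p(1) True] P2S[OF p(2)]] False by simp
   then have "tau (fst p) = tau (fst p')" "snd p = snd p'" using P2_eq by blast+
   then show ?thesis using tauinj[OF xR[OF D(1)[OF p(1)]] xR[OF D(1)[OF p(2)]]] by (simp add: prod_eq_iff)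
  qed
 next
  case False
  then have s: "0 <= snd p" "0 <= snd p'" using p(3) by auto
  then have eq1: "q (l1, P1 p') = q (l1, P1 p)" using eq by (simp add: F_def)
  show ?thesis
  proof (cases "snd p' = 0")
   case True
   then have "snd p = 0" using s p(3) by simp
   then have "beta (fst p) = beta (fst p')" using eq1 True by (simp add: P1_def beta_def)
   then show ?thesis using betainj[OF xR[OF D(1)[OF p(1)]] xR[OF D(1)[OF p(2)]]] True \<open>snd p = 0\<close> by (simp add: prod_eq_iff)
  next
   case False
   then have "P1 p' = P1 p" using inner_unique[OF l(1,1) P1I[OF p(2)] P1S[OF p(1) s(1)] eq1] s by simp
   then show ?thesis by (rule P1_eq[symmetric])
  qed
 qed
 have Fi: "inj_on F D"
 proof (rule inj_onI)
  fix p p' assume p: "p : D" "p' : D" "F p = F p'"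
  show "p = p'" using Fi'[OF p(1,2) _ p(3)] Fi'[OF p(2,1) _ p(3)[symmetric]] by (cases "snd p <= snd p'") auto
 qed
 have "open D" by (simp add: D_def open_Times)
 then have oN: "openin X (F ` D)" by (rule surface_invariance_of_domain[OF surf _ Fc Fi])
 have "(0, 0) : D" using eta(1) by (simp add: D_def)
 then have "F (0, 0) : F ` D" by (rule imageI)
 moreover have "F (0, 0) = y" using w1(2) by (simp add: F_def P1_def)
 ultimately have yN: "y : F ` D" by simp
 \<comment> \<open>Closed half boxes that contain the inner points mapped into the image of
   \<open>F\<close>; being closed, they also contain the boundary points approached by
   these.\<close>
 define K1 where "K1 = {w. \<bar>fst w - fst w1\<bar> <= eta1 & 0 <= e1 * (snd w - snd w1) & e1 * (snd w - snd w1) <= eta1}"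
 define K2 where "K2 = {w. \<bar>fst w - fst w2\<bar> <= eta2 & 0 <= e2 * (snd w - snd w2) & e2 * (snd w - snd w2) <= eta2}"
 have cK: "closed K1" "closed K2" unfolding K1_def K2_def
  by (intro closed_Collect_conj closed_Collect_le continuous_intros)+
 have "(l, w) : sheet (Xg gamma) Un sheet (Yg gamma)" if lw: "l : \<Lambda>" "w : bd l" "q (l, w) : F ` D" for l w
 proof -
  define K where "K = (if l = l1 then K1 else {}) Un (if l = l2 then K2 else {})"
  have "closed K" using cK by (auto simp: K_def)
  moreover have "w : closure K"
   unfolding closure_approachable
  proof (intro allI impI)
   fix delta :: real assume "delta > 0"
   then obtain w' where w': "w' : inner l" "dist w' w < delta" "q (l, w') : F ` D" using inner_approach[OF lw(1,2) oN lw(3)] by metis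
   obtain p where p: "p : D" "q (l, w') = F p" using w'(3) by blast
   have "w' : K"
   proof (cases "0 <= snd p")
    case True
    then have "l = l1 & w' = P1 p" using inner_unique[OF lw(1) \<open>l1 : \<Lambda>\<close> w'(1) P1S[OF p(1) True]] p(2) by (simp add: F_def)
    then show ?thesis using D[OF p(1)] True e eta(2) by (auto simp: K_def K1_def P1_def)
   next
    case False
    then have "snd p <= 0" by simp
    then have "l = l2 & w' = P2 p" using inner_unique[OF lw(1) \<open>l2 : \<Lambda>\<close> w'(1) P2S[OF p(1)]] p(2) False by (simp add: F_def)
    moreover have "P2 p : K2" using D[OF p(1)] taunear[OF D(1)[OF p(1)]] False e eta(4) nu(2) by (auto simp: K2_def P2_def)
    ultimately show ?thesis by (simp add: K_def)
   qed
   then show "EX w':K. dist w' w < delta" using w'(2) by blast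
  qed
  ultimately have "w : K" by simp
  then consider "l = l1" "w : K1" | "l = l2" "w : K2" by (auto simp: K_def split: if_splits)
  then show ?thesis
  proof cases
   case 1
   have "snd w = snd w1" using 1(2) bd_level[OF lw(2)] bd_level[OF wb(1)] eta1(2) e strip(1)[OF l(1)] 1(1)
    by (auto simp: K1_def)
   moreover have "(fst w, snd w1) : J1" using 1(2) by (intro s1) (simp add: K1_def)
   ultimately have "w : J1" by (metis prod.collapse)
   then show ?thesis using 1(1) sh by simp
  next
   case 2
   have "snd w = snd w2" using 2(2) bd_level[OF lw(2)] bd_level[OF wb(2)] eta2(2) e strip(1)[OF l(2)] 2(1)
    by (auto simp: K2_def)
   moreover have "(fst w, snd w2) : J2" using 2(2) by (intro s2) (simp add: K2_def)
   ultimately have "w : J2" by (metis prod.collapse)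
   then show ?thesis using 2(1) sh by simp
  qed
 qed
 then show ?thesis using oN yN by (intro exI[of _ "F ` D"]) blast
qed

text \<open>The image of a half box is open by the quotient property as soon as its preimage is the
  box alone. A glued point with the same image is impossible, because around its image only the two
  glued sheets contribute boundary points.\<close>

lemma unglued_neighbourhood:
 assumes l: "l : \<Lambda>" and w: "w : bd l" and ng: "(l, w) ~: glued" and J: "J : bints l" "w : J"
 shows "EX N. openin X N & q (l, w) : N & (ALL l':\<Lambda>. ALL w':bd l'. q (l', w') : N --> l' = l & w' : J)"
proof -
 obtain eta where eta: "eta > 0" "eta < v l - u l"
  and b: "!!x s. \<bar>x - fst w\<bar> <= eta ==> 0 <= s ==> s <= eta ==> (x, snd w + side l w * s) : S l"
  using half_box[OF l w] by metis
 have seg: "(x, snd w) : J" if "\<bar>x - fst w\<bar> <= eta" for x by (rule base_segment[OF l J b that])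
 define B where "B = S l Int {p. \<bar>fst p - fst w\<bar> < eta & side l w * (snd p - snd w) < eta}"
 have oB: "openin (top_of_set (S l)) B"
  unfolding B_def by (intro openin_open_Int open_Collect_conj open_Collect_less continuous_intros)
 have wB: "w : B" using w bd_S eta(1) by (auto simp: B_def)
 have BJ: "p : J" if p: "p : B" "p : bd l" for p
 proof -
  have "snd p = snd w" using p(1) bd_level[OF p(2)] bd_level[OF w] eta(2) strip(1)[OF l] by (auto simp: B_def side_def split: if_splits)
  moreover have "(fst p, snd w) : J" using p(1) by (intro seg) (simp add: B_def)
  ultimately show ?thesis by (metis prod.collapse)
 qed
 have Jng: "(l, p) ~: glued" if p: "p : J" for p
 proof
  assume "(l, p) : glued"
  then obtain gamma where gamma: "gamma : \<Gamma>" "(l, p) : sheet (Xg gamma) Un sheet (Yg gamma)" by (rule glued_cases)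
  have g: "is_bint \<Lambda> S u v (Xg gamma)" "is_bint \<Lambda> S u v (Yg gamma)" using atlas gamma(1) unfolding striped_atlas_def by simp_all
  have "(l, w) : sheet (Xg gamma) Un sheet (Yg gamma)"
  proof (cases "(l, p) : sheet (Xg gamma)")
   case True
   then have "l = fst (Xg gamma)" "p : snd (Xg gamma)" by (auto simp: sheet_def)
   then show ?thesis using bint_eq[OF J(1) _ p] g(1) J(2) by (auto simp: is_bint_def sheet_def)
  next
   case False
   then have "l = fst (Yg gamma)" "p : snd (Yg gamma)" using gamma(2) by (auto simp: sheet_def)
   then show ?thesis using bint_eq[OF J(1) _ p] g(2) J(2) by (auto simp: is_bint_def sheet_def)
  qed
  then show False using ng gamma(1) unfolding glued_def by blast
 qed
 define N where "N = (%p. q (l, p)) ` B"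
 have pre: "l' = l & p' : B" if p': "l' : \<Lambda>" "p' : S l'" "q (l', p') : N" for l' p'
 proof -
  obtain p where p: "p : B" "q (l, p) = q (l', p')" using p'(3) by (auto simp: N_def)
  have pS: "p : S l" using p(1) by (simp add: B_def)
  have "l = l' & p = p'"
  proof (cases "p : inner l")
   case True
   then show ?thesis by (rule inner_unique[OF l p'(1) _ p'(2) p(2)])
  next
   case False
   then have pb: "p : bd l" using S_cases[OF l pS] by blast
   then have png: "(l, p) ~: glued" using BJ[OF p(1)] Jng by blast
   have "(l', p') ~: glued"
   proof
    assume "(l', p') : glued"
    then obtain gamma where gamma: "gamma : \<Gamma>" "q (l', p') : q ` sheet (Xg gamma)" by (rule glued_cases)
    obtain N' where "q (l', p') : N'" "ALL l:\<Lambda>. ALL w:bd l. q (l, w) : N' --> (l, w) : sheet (Xg gamma) Un sheet (Yg gamma)"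
     using glued_neighbourhood[OF gamma] by blast
    then have "(l, p) : sheet (Xg gamma) Un sheet (Yg gamma)" using l pb p(2) by simp
    then show False using png gamma(1) unfolding glued_def by blast
   qed
   then have "(l, p) = (l', p')" using png p(2) l p'(1,2) pS by (intro inj_onD[OF q_inj]) auto
   then show ?thesis by simp
  qed
  then show ?thesis using p(1) by blast
 qed
 have "openin X N"
 proof (rule q_openin)
  show "N <= topspace X" using q_in[OF l] by (auto simp: N_def B_def)
  fix l' assume l': "l' : \<Lambda>"
  show "openin (top_of_set (S l')) {p : S l'. q (l', p) : N}"
  proof (cases "l' = l")
   case True
   have "{p : S l. q (l, p) : N} = B" using pre[OF l] by (auto simp: N_def B_def)
   then show ?thesis using oB True by simp
  next
   case False
   then have "{p : S l'. q (l', p) : N} = {}" using pre[OF l'] by blast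
   then show ?thesis by (simp only: openin_empty)
  qed
 qed
 moreover have "q (l, w) : N" using wB by (auto simp: N_def)
 moreover have "l' = l & w' : J" if "l' : \<Lambda>" "w' : bd l'" "q (l', w') : N" for l' w'
  using pre[of l' w'] that bd_S BJ by blast
 ultimately show ?thesis by (intro exI[of _ N]) blast
qed

text \<open>Images of inner points, glued points and unglued boundary points have neighbourhoods
  that are reached from none, at most two, and at most one of the boundary intervals.\<close>

lemma boundary_leaves_locally_finite:
 "locally_finite_in X {q ` ({l} \<times> J) | l J. l : \<Lambda> & J : bints l}"
 unfolding locally_finite_in_def
proof (intro conjI ballI)
 let ?J = "{q ` ({l} \<times> J) | l J. l : \<Lambda> & J : bints l}"
 show "\<Union>?J <= topspace X"
 proof
  fix z assume "z : \<Union>?J"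
  then obtain l J p where z: "l : \<Lambda>" "J : bints l" "p : J" "z = q (l, p)" by blast
  then have "p : S l" using bint_subset bd_S by blast
  then show "z : topspace X" using q_in z by simp
 qed
 fix y assume y: "y : topspace X"
 have "q ` Sigma \<Lambda> S = topspace X" using atlas unfolding striped_atlas_def by simp
 then obtain l p where lp: "l : \<Lambda>" "p : S l" "y = q (l, p)" using y by blast
 have fin: "EX V. openin X V & y : V & finite {L : ?J. L Int V ~= {}}"
  if N: "openin X N" "y : N" and T: "finite T" and sub: "!!l J w. l : \<Lambda> ==> J : bints l ==> w : J ==> q (l, w) : N ==> (l, J) : T" for N T
 proof -
  have "{L : ?J. L Int N ~= {}} <= (%(l, J). q ` ({l} \<times> J)) ` T"
  proof
   fix L assume "L : {L : ?J. L Int N ~= {}}"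
   then have "L : ?J" and LN: "L Int N ~= {}" by simp_all
   then obtain l J where L: "l : \<Lambda>" "J : bints l" "L = q ` ({l} \<times> J)" by blast
   obtain w where "w : J" "q (l, w) : N" using LN unfolding L(3) by blast
   then have "(l, J) : T" by (rule sub[OF L(1,2)])
   then show "L : (%(l, J). q ` ({l} \<times> J)) ` T" using L(3) by force
  qed
  then have "finite {L : ?J. L Int N ~= {}}" by (rule finite_surj[OF T])
  then show ?thesis using N by (intro exI[of _ N] conjI)
 qed
 show "EX V. openin X V & y : V & finite {L : ?J. L Int V ~= {}}"
 proof (cases "p : inner l")
  case True
  show ?thesis
  proof (rule fin[of _ "{}"])
   show "openin X ((%p. q (l, p)) ` inner l)" by (rule q_open_inner[OF lp(1)]) (auto intro: open_Times)
   show "y : (%p. q (l, p)) ` inner l" using True lp(3) by blast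
   fix l' J w assume a: "l' : \<Lambda>" "J : bints l'" "w : J" "q (l', w) : (%p. q (l, p)) ` inner l"
   then obtain p' where p': "p' : inner l" "q (l, p') = q (l', w)" by auto
   have wb: "w : bd l'" using a bint_subset by blast
   then have "l = l' & p' = w" using inner_unique[OF lp(1) a(1) p'(1) _ p'(2)] bd_S by blast
   then show "(l', J) : {}" using p'(1) wb bd_inner by blast
  qed simp
 next
  case False
  then have pb: "p : bd l" using S_cases[OF lp(1,2)] by blast
  show ?thesis
  proof (cases "(l, p) : glued")
   case True
   then obtain gamma where gamma: "gamma : \<Gamma>" "q (l, p) : q ` sheet (Xg gamma)" by (rule glued_cases)
   have g: "is_bint \<Lambda> S u v (Xg gamma)" "is_bint \<Lambda> S u v (Yg gamma)" using atlas gamma(1) unfolding striped_atlas_def by simp_all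
   obtain N where N: "openin X N" "q (l, p) : N"
    and sub: "ALL l:\<Lambda>. ALL w:bd l. q (l, w) : N --> (l, w) : sheet (Xg gamma) Un sheet (Yg gamma)"
    using glued_neighbourhood[OF gamma] by blast
   show ?thesis
   proof (rule fin[OF N(1), of "{Xg gamma, Yg gamma}"])
    fix l' J w assume a: "l' : \<Lambda>" "J : bints l'" "w : J" "q (l', w) : N"
    then have "(l', w) : sheet (Xg gamma) Un sheet (Yg gamma)" using sub bint_subset by blast
    then consider "l' = fst (Xg gamma)" "w : snd (Xg gamma)" | "l' = fst (Yg gamma)" "w : snd (Yg gamma)" by (auto simp: sheet_def)
    then show "(l', J) : {Xg gamma, Yg gamma}"
    proof cases
     case 1
     then have "J = snd (Xg gamma)" using bint_eq[OF a(2) _ a(3)] g(1) by (auto simp: is_bint_def)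
     then show ?thesis using 1 by simp
    next
     case 2
     then have "J = snd (Yg gamma)" using bint_eq[OF a(2) _ a(3)] g(2) by (auto simp: is_bint_def)
     then show ?thesis using 2 by simp
    qed
   qed (use N lp in auto)
  next
   case False
   obtain J where J: "J : bints l" "p : J" using bint_exists[OF pb] by blast
   obtain N where N: "openin X N" "q (l, p) : N" and sub: "ALL l':\<Lambda>. ALL w':bd l'. q (l', w') : N --> l' = l & w' : J"
    using unglued_neighbourhood[OF lp(1) pb False J] by blast
   show ?thesis
   proof (rule fin[OF N(1), of "{(l, J)}"])
    fix l' J' w assume a: "l' : \<Lambda>" "J' : bints l'" "w : J'" "q (l', w) : N"
    then have "l' = l" "w : J" using sub bint_subset by blast+
    then show "(l', J') : {(l, J)}" using bint_eq[of J' l J w] a J by simp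
   qed (use N lp in auto)
  qed
 qed
qed

text \<open>No other point is identified with one of an inner line, so a narrow closed band is its
  own preimage and closed in the surface. It is therefore the closure of the open band, and an
  affine change of height gives the model.\<close>

lemma inner_line_regular:
 assumes l: "l : \<Lambda>" and t: "t : {u l<..<v l}"
 shows "regular_leaf X \<Delta> (q ` ({l} \<times> (band {t})))"
proof -
 let ?q = "%p. q (l, p)" and ?omega = "q ` ({l} \<times> (band {t}))"
 have im: "q ` ({l} \<times> A) = ?q ` A" for A by auto
 \<comment> \<open>Half the distance to the edges keeps the closed band inside the open
   strip.\<close>
 define eps where "eps = min (t - u l) (v l - t) / 2"
 have eps: "eps > 0" "u l < t - eps" "t + eps < v l" using t by (auto simp: eps_def min_def field_simps)
 define U where "U = ?q ` (band {t - eps<..<t + eps})"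
 define C where "C = ?q ` (band {t - eps..t + eps})"
 have sub: "band {t - eps..t + eps} <= inner l" "band {t - eps<..<t + eps} <= inner l" using eps by auto
 have lines: "?q ` (band {t'}) : \<Delta>" if "t' : {u l<..<v l}" for t'
 proof -
  have "(UNIV::real set) \<times> {t'} : strip_canonical_foliation (S l) (u l) (v l)" using that unfolding strip_canonical_foliation_def by blast
  then have "q ` ({l} \<times> (band {t'})) : \<Delta>" using l unfolding canonical[symmetric] atlas_canonical_foliation_def by blast
  then show ?thesis by (simp only: im)
 qed
 have leaf: "L = ?q ` (band {t'})" if L: "L : \<Delta>" "?q (x, t') : L" "t' : {u l<..<v l}" for L x t'
  by (rule leaf_disjoint[OF L(1) lines[OF L(3)]]) (use L(2) in blast)
 have oU: "openin X U" unfolding U_def by (rule q_open_inner[OF l _ sub(2)]) (intro open_Times open_UNIV open_greaterThanLessThan)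
 have UX: "U <= topspace X" by (rule openin_subset[OF oU])
 have CX: "C <= topspace X" unfolding C_def using q_in[OF l] sub(1) strip(2)[OF l] by blast
 have clC: "closedin X C"
 proof -
  have "openin X (topspace X - C)"
  proof (rule q_openin)
   fix l' assume l': "l' : \<Lambda>"
   have "openin (top_of_set (S l')) (S l' Int (if l' = l then - (band {t - eps..t + eps}) else UNIV))"
   proof (rule openin_open_Int)
    have "open (- ((UNIV::real set) \<times> {t - eps..t + eps}))" by (intro open_Compl closed_Times closed_UNIV closed_atLeastAtMost)
    then show "open (if l' = l then - ((UNIV::real set) \<times> {t - eps..t + eps}) else UNIV)"
     by (cases "l' = l") (simp_all only: if_True if_False open_UNIV simp_thms)
   qed
   moreover have "{p : S l'. q (l', p) : topspace X - C} = S l' Int (if l' = l then - (band {t - eps..t + eps}) else UNIV)"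
   proof (intro equalityI subsetI)
    fix p assume "p : {p : S l'. q (l', p) : topspace X - C}"
    then have p: "p : S l'" "q (l', p) ~: C" by simp_all
    have "p ~: band {t - eps..t + eps}" if "l' = l"
    proof
     assume "p : band {t - eps..t + eps}"
     then have "q (l, p) : C" unfolding C_def by (rule imageI)
     then show False using p(2) that by simp
    qed
    then show "p : S l' Int (if l' = l then - (band {t - eps..t + eps}) else UNIV)"
     using p(1) by (cases "l' = l") (simp_all only: if_True if_False simp_thms Int_iff Compl_iff UNIV_I not_False_eq_True)
   next
    fix p assume p: "p : S l' Int (if l' = l then - (band {t - eps..t + eps}) else UNIV)"
    have "q (l', p) ~: C"
    proof
     assume "q (l', p) : C"
     then obtain p' where p': "p' : band {t - eps..t + eps}" "q (l, p') = q (l', p)" by (auto simp: C_def)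
     then have ll: "l' = l" "p' = p" using inner_unique[OF l l' _ _ p'(2)] sub(1) p by blast+
     have "p : - (band {t - eps..t + eps})" using p unfolding ll(1) by (simp only: simp_thms if_True Int_iff)
     then show False using p'(1) unfolding ll(2) by blast
    qed
    then show "p : {p : S l'. q (l', p) : topspace X - C}" using p q_in[OF l'] by blast
   qed
   ultimately show "openin (top_of_set (S l')) {p : S l'. q (l', p) : topspace X - C}" by simp
  qed blast
  then show ?thesis using CX by (simp add: closedin_def)
 qed
 have clU: "X closure_of U = C"
 proof (rule equalityI)
  show "X closure_of U <= C" by (rule closure_of_minimal[OF _ clC]) (auto simp: U_def C_def)
  have "band {t - eps..t + eps} <= closure ((UNIV::real set) \<times> {t - eps<..<t + eps})" using eps(1) by (simp add: closure_Times)
  then have "band {t - eps..t + eps} <= top_of_set (inner l) closure_of (band {t - eps<..<t + eps})"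
   using sub by (auto simp: closure_of_subtopology Int_absorb1)
  then have "C <= ?q ` (top_of_set (inner l) closure_of (band {t - eps<..<t + eps}))" unfolding C_def by (rule image_mono)
  also have "\<dots> <= X closure_of U" unfolding U_def by (rule continuous_map_image_closure_subset[OF q_inner(1)[OF l]])
  finally show "C <= X closure_of U" .
 qed
 define k where "k = inv_into (inner l) ?q"
 have kq: "k (?q p) = p" if "p : inner l" for p unfolding k_def by (rule inv_into_f_f[OF q_inner(2)[OF l] that])
 have kc: "continuous_map (subtopology X (?q ` inner l)) (top_of_set (inner l)) k"
  unfolding k_def by (rule surface_open_embedding_inverse[OF surf _ q_inner[OF l]]) (auto intro: open_Times)
 define h where "h z = (fst (k z), (snd (k z) - t) / eps)" for z
 define m where "m p = ?q (fst p, t + eps * snd p)" for p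
 have hq: "h (?q (x, t')) = (x, (t' - t) / eps)" if "t' : {u l<..<v l}" for x t' using kq[of "(x, t')"] that by (simp add: h_def)
 have epss: "t + eps * s : {t - eps..t + eps}" if "s : {-1..1}" for s
 proof -
  have "- eps <= eps * s" "eps * s <= eps" using that eps(1) mult_left_mono[of "-1" s eps] mult_left_mono[of s 1 eps] by auto
  then show ?thesis by auto
 qed
 have epsu: "t + eps * s : {u l<..<v l}" if "s : {-1..1}" for s
  using epss[OF that] eps unfolding atLeastAtMost_iff greaterThanLessThan_iff by linarith
 have "homeomorphic_maps (subtopology X C) (top_of_set (band {-1..1})) h m"
  unfolding homeomorphic_maps_def
 proof (intro conjI ballI)
  have Csub: "C <= ?q ` inner l" unfolding C_def by (rule image_mono[OF sub(1)])
  have "continuous_map (subtopology X C) (top_of_set (inner l)) k" by (rule continuous_map_from_subtopology_mono[OF kc Csub])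
  then have "continuous_map (subtopology X C) euclidean k" by (simp add: continuous_map_in_subtopology)
  then have "continuous_map (subtopology X C) euclidean ((%p. (fst p, (snd p - t) / eps)) \<circ> k)"
  proof (rule continuous_map_compose)
   have "continuous_on UNIV (%p::real \<times> real. (fst p, (snd p - t) / eps))" using eps(1) by (intro continuous_intros) auto
   then show "continuous_map euclidean euclidean (%p::real \<times> real. (fst p, (snd p - t) / eps))" by simp
  qed
  then have hc: "continuous_map (subtopology X C) euclidean h" by (simp add: h_def[abs_def] o_def)
  have "h z : band {-1..1}" if z: "z : C" for z
  proof -
   obtain x t' where z': "t' : {t - eps..t + eps}" "z = ?q (x, t')" using z by (auto simp: C_def)
   then have "t' : {u l<..<v l}" using eps by auto
   then have "h z = (x, (t' - t) / eps)" using hq z'(2) by simp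
   moreover have "-1 <= (t' - t) / eps" "(t' - t) / eps <= 1" using z'(1) eps(1) by (simp_all add: pos_le_divide_eq pos_divide_le_eq)
   ultimately show ?thesis by simp
  qed
  then show "continuous_map (subtopology X C) (top_of_set (band {-1..1})) h"
   using hc by (simp add: continuous_map_in_subtopology image_subset_iff Pi_iff)
  have mS: "(fst p, t + eps * snd p) : band {t - eps..t + eps}" if "p : band {-1..1}" for p :: "real \<times> real"
   using epss[of "snd p"] that by auto
  have "continuous_map (top_of_set (band {-1..1})) X m"
   unfolding m_def
  proof (rule continuous_map_top_of_set_o[OF q_inner(1)[OF l]])
   show "continuous_on (band {-1..1}) (%p::real \<times> real. (fst p, t + eps * snd p))" by (intro continuous_intros)
   show "(%p. (fst p, t + eps * snd p)) ` (band {-1..1}) <= inner l" using mS sub(1) by blast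
  qed
  moreover have "m p : C" if "p : band {-1..1}" for p unfolding m_def C_def by (rule imageI[OF mS[OF that]])
  ultimately show "continuous_map (top_of_set (band {-1..1})) (subtopology X C) m"
   by (simp add: continuous_map_in_subtopology image_subset_iff Pi_iff)
  fix z assume "z : topspace (subtopology X C)"
  then obtain x t' where z: "t' : {t - eps..t + eps}" "z = ?q (x, t')" by (auto simp: C_def)
  then have "t' : {u l<..<v l}" using eps by auto
  then show "m (h z) = z" using hq z(2) eps(1) by (simp add: m_def)
 next
  fix p assume "p : topspace (top_of_set ((UNIV::real set) \<times> {-1..1::real}))"
  then have "snd p : {-1..1}" by auto
  from epsu[OF this] show "h (m p) = p" using hq eps(1) by (simp add: m_def)
 qed
 then have hmap: "homeomorphic_map (subtopology X C) (top_of_set (band {-1..1})) h" using homeomorphic_maps_map by blast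
 have hline: "h ` ?q ` (band {t'}) = band {(t' - t) / eps}" if "t' : {u l<..<v l}" for t'
  using hq[OF that] by (force simp: image_iff)
 have model: "foliated_model_nbhd X \<Delta> ?omega U {-1..1} {-1<..<1}"
  unfolding foliated_model_nbhd_def clU
 proof (intro conjI exI[of _ h] exI[of _ U] hmap UX oU order_refl)
  show "saturated \<Delta> U"
   unfolding saturated_def
  proof (intro ballI impI)
   fix L assume L: "L : \<Delta>" "L Int U ~= {}"
   then obtain z where "z : L" "z : U" by blast
   then obtain x t' where z: "t' : {t - eps<..<t + eps}" "?q (x, t') : L" unfolding U_def by blast
   then have "t' : {u l<..<v l}" using eps by auto
   then have "L = ?q ` (band {t'})" by (rule leaf[OF L(1) z(2)])
   then show "L <= U" using z(1) by (auto simp: U_def)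
  qed
  show "?omega <= U" using eps(1) by (auto simp: U_def)
  show "h ` U = band {-1<..<1}"
  proof (intro equalityI subsetI)
   fix z assume "z : h ` U"
   then obtain x t' where z: "t' : {t - eps<..<t + eps}" "z = h (?q (x, t'))" by (auto simp: U_def)
   then have "t' : {u l<..<v l}" using eps by auto
   then have "z = (x, (t' - t) / eps)" using hq z(2) by simp
   then show "z : band {-1<..<1}" using z(1) eps(1) by (simp add: pos_less_divide_eq pos_divide_less_eq)
  next
   fix z :: "real \<times> real" assume z: "z : band {-1<..<1}"
   have "- eps < eps * snd z" "eps * snd z < eps"
    using z eps(1) mult_strict_left_mono[of "-1" "snd z" eps] mult_strict_left_mono[of "snd z" 1 eps] by auto
   then have a: "t + eps * snd z : {t - eps<..<t + eps}" unfolding greaterThanLessThan_iff by linarith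
   have "snd z : {-1..1}" using z by auto
   from epsu[OF this] have "h (?q (fst z, t + eps * snd z)) = z" using hq eps(1) by simp
   moreover have "?q (fst z, t + eps * snd z) : U" using a by (auto simp: U_def)
   ultimately show "z : h ` U" by (metis imageI)
  qed
  show "h ` ?omega = band {0}" using hline[OF t] by (simp add: im)
  show "{h ` L | L. L : \<Delta> & L <= C} = {band {s} | s. s : {-1..1}}"
  proof (intro equalityI subsetI)
   fix A assume "A : {h ` L | L. L : \<Delta> & L <= C}"
   then obtain L where L: "A = h ` L" "L : \<Delta>" "L <= C" by blast
   obtain z where "z : L" using leaf_nonempty L(2) by (metis ex_in_conv)
   then obtain x t' where z: "t' : {t - eps..t + eps}" "?q (x, t') : L" using L(3) unfolding C_def by blast
   then have t': "t' : {u l<..<v l}" using eps by auto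
   then have "A = band {(t' - t) / eps}" using leaf[OF L(2) z(2)] L(1) hline by simp
   moreover have "-1 <= (t' - t) / eps" "(t' - t) / eps <= 1" using z(1) eps(1) by (simp_all add: pos_le_divide_eq pos_divide_le_eq)
   ultimately show "A : {band {s} | s. s : {-1..1}}" by auto
  next
   fix A assume "A : {(UNIV::real set) \<times> {s} | s. s : {-1..1::real}}"
   then obtain s where s: "A = band {s}" "s : {-1..1}" by blast
   let ?L = "?q ` (band {t + eps * s})"
   have t': "t + eps * s : {u l<..<v l}" by (rule epsu[OF s(2)])
   have "h ` ?L = A" using hline[OF t'] s(1) eps(1) by simp
   moreover have "?L <= C" using epss[OF s(2)] unfolding C_def by blast
   ultimately show "A : {h ` L | L. L : \<Delta> & L <= C}" using lines[OF t'] by blast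
  qed
 qed
 have "?omega <= minterior X"
 proof
  fix z assume "z : ?omega"
  then have z: "z : ?q ` inner l" using t by auto
  have o: "openin X (?q ` inner l)" by (rule q_open_inner[OF l]) (auto intro: open_Times)
  have "homeomorphic_map (top_of_set (inner l)) (subtopology X (?q ` inner l)) ?q"
   by (rule surface_open_embedding[OF surf _ q_inner[OF l]]) (auto intro: open_Times)
  then have "subtopology X (?q ` inner l) homeomorphic_space top_of_set (inner l)"
   using homeomorphic_map_imp_homeomorphic_space homeomorphic_space_sym by blast
  moreover have "open (inner l)" by (auto intro: open_Times)
  ultimately show "z : minterior X" using z o openin_subset[OF o] unfolding minterior_def mboundary_def by blast
 qed
 then show ?thesis using model unfolding regular_leaf_def by blast
qed

text \<open>Inner lines are regular, so a singular leaf can only come from a boundary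
  interval.\<close>

theorem singular_leaves_locally_finite: "locally_finite_in X (singular_leaves X \<Delta>)"
proof (rule locally_finite_in_subset[OF boundary_leaves_locally_finite])
 show "singular_leaves X \<Delta> <= {q ` ({l} \<times> J) | l J. l : \<Lambda> & J : bints l}"
 proof
  fix L assume L: "L : singular_leaves X \<Delta>"
  then have "L : atlas_canonical_foliation \<Lambda> S u v q" using canonical by (simp add: singular_leaves_def)
  then obtain l A where A: "l : \<Lambda>" "A : strip_canonical_foliation (S l) (u l) (v l)" "L = q ` ({l} \<times> A)"
   unfolding atlas_canonical_foliation_def by blast
  have "A : bints l"
  proof (rule ccontr)
   assume "A ~: bints l"
   then obtain t where "t : {u l<..<v l}" "A = band {t}" using A(2) unfolding strip_canonical_foliation_def by blast
   then have "regular_leaf X \<Delta> L" using inner_line_regular[OF A(1)] A(3) by simp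
   then show False using L by (simp add: singular_leaves_def)
  qed
  then show "L : {q ` ({l} \<times> J) | l J. l : \<Lambda> & J : bints l}" using A by blast
 qed
qed

end

theorem theorem4p4:
  fixes X :: "'a topology" and \<Delta> :: "'a set set"
  assumes "surface_with_boundary X"
    and "foliation1 X \<Delta>"
    and "\<forall>C\<in>connected_components_of (subtopology X (mboundary X)). C \<in> \<Delta>"
    and "\<forall>L\<in>\<Delta>. subtopology X L homeomorphic_space (euclideanreal) \<and> closedin X L"
  shows "admits_striped_atlas X \<Delta> \<longleftrightarrow> locally_finite_in X (singular_leaves X \<Delta>)"
proof
  assume "admits_striped_atlas X \<Delta>"
  then obtain \<Lambda> S u v q \<Gamma> Xg Yg where atlas: "striped_atlas X \<Lambda> S u v q \<Gamma> Xg Yg"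
    "atlas_canonical_foliation \<Lambda> S u v q = \<Delta>" unfolding admits_striped_atlas_def by blast
  have leaves: "{} \<notin> \<Delta>" "\<forall>L\<in>\<Delta>. \<forall>L'\<in>\<Delta>. L \<noteq> L' \<longrightarrow> L \<inter> L' = {}"
    using assms(2) unfolding foliation1_def by simp_all
  have "atlas_surface X \<Delta> \<Lambda> S u v q \<Gamma> Xg Yg"
  proof
    show "L = L'" if "L \<in> \<Delta>" "L' \<in> \<Delta>" "L \<inter> L' \<noteq> {}" for L L' using leaves(2) that by blast
  qed (rule assms(1) atlas leaves(1))+
  then show "locally_finite_in X (singular_leaves X \<Delta>)" by (rule atlas_surface.singular_leaves_locally_finite)
next
  assume sing: "locally_finite_in X (singular_leaves X \<Delta>)"
  show "admits_striped_atlas X \<Delta>"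
    by (rule locally_finite_singular_leaves_imp_striped_atlas[OF assms(1,2) _ _ sing]) (use assms(4) in blast)+
qed

end
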